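(* Let $G$ be a countable group. Suppose $A\subset G$ is $\mathcal{FS}$-large and $B\subset G$ is strongly non-paradoxical. Then there exist an open set $U\subset bG$ with $$s_{bG}(U)\le \Big\lfloor \frac{1}{d^*_{\mathcal{FS}}(A)\cdot d^*_{np}(B)}\Big\rfloor$$ and a right thick set $T\subset G$ such that $$AB\supset \iota_o^{-1}(U)\cap T.$$ In particular, if $G$ is amenable and $A\subset G$ is $\mathcal{FS}$-large, then $AB$ is a right piecewise Bohr set for every $\mathcal{L}_G$-large set $B\subset G$.
   Context: A mean on $G$ is a positive linear functional of norm one on $\ell^\infty(G)$; $\mathcal{M}(G)$ is the set of all means, and $\lambda'(C)=\lambda(\chi_C)$ for $C\subset G$. For $\mathcal{C}\subset\mathcal{M}(G)$, put $d^*_{\mathcal{C}}(C)=\sup_{\lambda\in\mathcal{C}}\lambda'(C)$; $C$ is $\mathcal{C}$-large if $d^*_{\mathcal{C}}(C)>0$. The left regular representation is $(\rho(g)\varphi)(x)=\varphi(g^{-1}x)$, and $\mathcal{L}_G$ is the set of left $G$-invariant means on $G$. The Fourier-Stiltjes algebra $\mathrm{B}(G)\subset\ell^\infty(G)$ is the set of all matrix coefficients $g\mapsto\langle y,\pi(g)x\rangle$ of unitary representations $\pi$ of $G$ on Hilbert spaces. There is a unique left invariant mean $\lambda_o$ on $\mathrm{B}(G)$ (Ryll-Nardzewski), and $\mathcal{FS}=\{\lambda\in\mathcal{M}(G):\lambda|_{\mathrm{B}(G)}=\lambda_o\}$. For $B\subset G$, the Bebutov algebra $\mathcal{B}_B$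 is the smallest left $G$-invariant sub-C*-algebra of $\ell^\infty(G)$ containing the constants and $\chi_B$. The set $B$ is strongly non-paradoxical if there is a left $G$-invariant mean $\eta$ on $\mathcal{B}_B$ with $\eta(\chi_B)>0$. Let $\mathcal{L}_B$ be the set of all means on $G$ whose restrictions to $\mathcal{B}_B$ are left $G$-invariant; $d^*_{np}(B)=\sup_{\lambda\in\mathcal{L}_B}\lambda'(B)$. The Bohr compactification $(bG,\iota_o)$ of $G$ is a compact Hausdorff group $bG$ with a homomorphism $\iota_o:G\to bG$ with dense image such that for every compact Hausdorff group $K$ and homomorphism $\iota:G\to K$ with dense image there is a continuous surjective homomorphism $\iota_K:bG\to K$ with $\iota_K\circ\iota_o=\iota$. For a compact Hausdorff group $K$ and nonempty open $U\subset K$, the syndeticity index is $s_K(U)=\min\{|F|: F\subset K,\ FU=K\}$; in particular the asserted bound includes that $U$ is nonempty. A set $T\subset G$ is right thick if for every finite $F\subset G$ there is $g\in G$ with $Fg\subset T$. A set $C\subset G$ is Bohr if there are a compact Hausdorff group $K$, a homomorphism $\tau:G\to K$ with dense image and a nonempty open $V\subset K$ with $C\supset\tau^{-1}(V)$. A set is right piecewise Bohr if it is of the form $C\cap T$ with $C$ Bohr and $T$ right thick (equivalently, contains such a set). *)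

theory Defs
  imports "HOL-Analysis.Analysis" "HOL-Algebra.Coset" "HOL-Algebra.Module"
begin

section \<open>Bounded functions, means, densities\<close>

text \<open>A function on the group \<open>G\<close> is encoded as a function on the whole type that vanishes
  outside \<open>carrier G\<close>.  Pointwise operations then stay inside the encoding, the characteristic
  function of \<open>C \<subseteq> carrier G\<close> is the library's \<open>indicator C\<close>, the constant \<open>c\<close>
  is \<open>\<lambda>x. c * indicator (carrier G) x\<close>, and uniform convergence on \<open>G\<close> is uniform
  convergence on \<open>UNIV\<close>.\<close>

definition linf :: "('a, 'm) monoid_scheme \<Rightarrow> ('a \<Rightarrow> complex) set" where
  "linf G = {\<phi>. (\<forall>x. x \<notin> carrier G \<longrightarrow> \<phi> x = 0) \<and> bounded (range \<phi>)}"

definition ltrans :: "('a, 'm) monoid_scheme \<Rightarrow> 'a \<Rightarrow> ('a \<Rightarrow> complex) \<Rightarrow> 'a \<Rightarrow> complex" where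
  "ltrans G g \<phi> = (\<lambda>x. if x \<in> carrier G then \<phi> (inv\<^bsub>G\<^esub> g \<otimes>\<^bsub>G\<^esub> x) else 0)"

text \<open>Positive linear functionals of norm one on a linear subspace \<open>V\<close> of the bounded functions.
  The operator norm is taken in the extended reals, where the supremum always makes sense.\<close>

definition mean_on :: "('a \<Rightarrow> complex) set \<Rightarrow> (('a \<Rightarrow> complex) \<Rightarrow> complex) \<Rightarrow> bool" where
  "mean_on V \<mu> \<longleftrightarrow>
     (\<forall>\<phi>\<in>V. \<forall>\<psi>\<in>V. \<mu> (\<lambda>x. \<phi> x + \<psi> x) = \<mu> \<phi> + \<mu> \<psi>) \<and>
     (\<forall>c. \<forall>\<phi>\<in>V. \<mu> (\<lambda>x. c * \<phi> x) = c * \<mu> \<phi>) \<and>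
     (\<forall>\<phi>\<in>V. (\<forall>x. \<phi> x \<in> \<real>\<^sub>\<ge>\<^sub>0) \<longrightarrow> \<mu> \<phi> \<in> \<real>\<^sub>\<ge>\<^sub>0) \<and>
     (SUP \<phi>\<in>{\<phi> \<in> V. \<forall>x. cmod (\<phi> x) \<le> 1}. ereal (cmod (\<mu> \<phi>))) = 1"

definition means :: "('a, 'm) monoid_scheme \<Rightarrow> (('a \<Rightarrow> complex) \<Rightarrow> complex) set" where
  "means G = {\<mu>. mean_on (linf G) \<mu>}"

definition left_invariant_on ::
  "('a, 'm) monoid_scheme \<Rightarrow> ('a \<Rightarrow> complex) set \<Rightarrow> (('a \<Rightarrow> complex) \<Rightarrow> complex) \<Rightarrow> bool" where
  "left_invariant_on G V \<mu> \<longleftrightarrow> (\<forall>g\<in>carrier G. \<forall>\<phi>\<in>V. \<mu> (ltrans G g \<phi>) = \<mu> \<phi>)"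

definition left_invariant_means :: "('a, 'm) monoid_scheme \<Rightarrow> (('a \<Rightarrow> complex) \<Rightarrow> complex) set" where
  "left_invariant_means G = {\<mu> \<in> means G. left_invariant_on G (linf G) \<mu>}"

definition amenable :: "('a, 'm) monoid_scheme \<Rightarrow> bool" where
  "amenable G \<longleftrightarrow> left_invariant_means G \<noteq> {}"

text \<open>The values of a mean at characteristic functions are real and lie in \<open>[0, 1]\<close>, so that
  \<open>Re\<close> only changes the type.\<close>

definition upper_density :: "(('a \<Rightarrow> complex) \<Rightarrow> complex) set \<Rightarrow> 'a set \<Rightarrow> real" where
  "upper_density \<C> C = (SUP \<mu>\<in>\<C>. Re (\<mu> (indicator C)))"

definition large :: "(('a \<Rightarrow> complex) \<Rightarrow> complex) set \<Rightarrow> 'a set \<Rightarrow> bool" where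
  "large \<C> C \<longleftrightarrow> upper_density \<C> C > 0"


section \<open>The Bebutov algebra\<close>

definition invariant_cstar_subalgebra ::
  "('a, 'm) monoid_scheme \<Rightarrow> ('a \<Rightarrow> complex) set \<Rightarrow> bool" where
  "invariant_cstar_subalgebra G V \<longleftrightarrow>
     V \<subseteq> linf G \<and>
     (\<lambda>x. 0) \<in> V \<and>
     (\<forall>\<phi>\<in>V. \<forall>\<psi>\<in>V. (\<lambda>x. \<phi> x + \<psi> x) \<in> V) \<and>
     (\<forall>c. \<forall>\<phi>\<in>V. (\<lambda>x. c * \<phi> x) \<in> V) \<and>
     (\<forall>\<phi>\<in>V. \<forall>\<psi>\<in>V. (\<lambda>x. \<phi> x * \<psi> x) \<in> V) \<and>
     (\<forall>\<phi>\<in>V. (\<lambda>x. cnj (\<phi> x)) \<in> V) \<and>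
     (\<forall>\<phi> \<psi>. (\<forall>n. \<phi> n \<in> V) \<and> uniform_limit UNIV \<phi> \<psi> sequentially \<longrightarrow> \<psi> \<in> V) \<and>
     (\<forall>g\<in>carrier G. \<forall>\<phi>\<in>V. ltrans G g \<phi> \<in> V)"

definition bebutov :: "('a, 'm) monoid_scheme \<Rightarrow> 'a set \<Rightarrow> ('a \<Rightarrow> complex) set" where
  "bebutov G B = \<Inter> {V. invariant_cstar_subalgebra G V \<and>
     (\<forall>c. (\<lambda>x. c * indicator (carrier G) x) \<in> V) \<and> indicator B \<in> V}"

definition strongly_non_paradoxical :: "('a, 'm) monoid_scheme \<Rightarrow> 'a set \<Rightarrow> bool" where
  "strongly_non_paradoxical G B \<longleftrightarrow>
     (\<exists>\<eta>. mean_on (bebutov G B) \<eta> \<and> left_invariant_on G (bebutov G B) \<eta> \<and>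
          Re (\<eta> (indicator B)) > 0)"

definition bebutov_means ::
  "('a, 'm) monoid_scheme \<Rightarrow> 'a set \<Rightarrow> (('a \<Rightarrow> complex) \<Rightarrow> complex) set" where
  "bebutov_means G B = {\<mu> \<in> means G. left_invariant_on G (bebutov G B) \<mu>}"

definition np_density :: "('a, 'm) monoid_scheme \<Rightarrow> 'a set \<Rightarrow> real" where
  "np_density G B = upper_density (bebutov_means G B) B"


section \<open>Unitary representations and the Fourier-Stieltjes algebra\<close>

definition complex_ring :: "complex ring" where
  "complex_ring = \<lparr>carrier = UNIV, mult = (*), one = 1, zero = 0, add = (+)\<rparr>"

text \<open>As in the library's modules, the fields \<open>mult\<close> and \<open>one\<close> that \<open>module\<close>
  inherits from \<open>ring\<close> are not used.  The inner product is linear in the second argument.\<close>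

record 'h inner_module = "(complex, 'h) module" +
  hinner :: "'h \<Rightarrow> 'h \<Rightarrow> complex"

definition hnorm :: "('h, 'm) inner_module_scheme \<Rightarrow> 'h \<Rightarrow> real" where
  "hnorm H x = sqrt (Re (hinner H x x))"

locale complex_hilbert = module complex_ring H for H :: "('h, 'm) inner_module_scheme" (structure) +
  assumes hinner_add: "\<lbrakk>x \<in> carrier H; y \<in> carrier H; z \<in> carrier H\<rbrakk> \<Longrightarrow>
      hinner H x (y \<oplus> z) = hinner H x y + hinner H x z"
    and hinner_smult: "\<lbrakk>x \<in> carrier H; y \<in> carrier H\<rbrakk> \<Longrightarrow>
      hinner H x (c \<odot> y) = c * hinner H x y"
    and hinner_cnj: "\<lbrakk>x \<in> carrier H; y \<in> carrier H\<rbrakk> \<Longrightarrow> hinner H y x = cnj (hinner H x y)"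
    and hinner_nonneg: "x \<in> carrier H \<Longrightarrow> 0 \<le> Re (hinner H x x)"
    and hinner_definite: "\<lbrakk>x \<in> carrier H; hinner H x x = 0\<rbrakk> \<Longrightarrow> x = \<zero>"
    and hcomplete: "\<lbrakk>\<And>n. s n \<in> carrier H;
      \<And>e. e > 0 \<Longrightarrow> \<exists>N::nat. \<forall>m\<ge>N. \<forall>n\<ge>N. hnorm H (s m \<ominus> s n) < e\<rbrakk> \<Longrightarrow>
      \<exists>l\<in>carrier H. (\<lambda>n. hnorm H (s n \<ominus> l)) \<longlonglongrightarrow> 0"

text \<open>\<open>\<pi> g\<close> is only considered for \<open>g\<close> in \<open>G\<close> and as a map on the carrier
  of \<open>H\<close>; \<open>\<pi> \<one> = id\<close> follows from bijectivity and multiplicativity.\<close>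

definition unitary_rep ::
  "('a, 'm) monoid_scheme \<Rightarrow> ('h, 'n) inner_module_scheme \<Rightarrow> ('a \<Rightarrow> 'h \<Rightarrow> 'h) \<Rightarrow> bool" where
  "unitary_rep G H \<pi> \<longleftrightarrow>
     (\<forall>g\<in>carrier G.
        bij_betw (\<pi> g) (carrier H) (carrier H) \<and>
        (\<forall>x\<in>carrier H. \<forall>y\<in>carrier H. \<pi> g (x \<oplus>\<^bsub>H\<^esub> y) = \<pi> g x \<oplus>\<^bsub>H\<^esub> \<pi> g y) \<and>
        (\<forall>c. \<forall>x\<in>carrier H. \<pi> g (c \<odot>\<^bsub>H\<^esub> x) = c \<odot>\<^bsub>H\<^esub> \<pi> g x) \<and>
        (\<forall>x\<in>carrier H. \<forall>y\<in>carrier H. hinner H (\<pi> g x) (\<pi> g y) = hinner H x y)) \<and>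
     (\<forall>g\<in>carrier G. \<forall>h\<in>carrier G. \<forall>x\<in>carrier H. \<pi> (g \<otimes>\<^bsub>G\<^esub> h) x = \<pi> g (\<pi> h x))"

definition matrix_coeff :: "('a, 'm) monoid_scheme \<Rightarrow> ('h, 'n) inner_module_scheme \<Rightarrow>
    ('a \<Rightarrow> 'h \<Rightarrow> 'h) \<Rightarrow> 'h \<Rightarrow> 'h \<Rightarrow> 'a \<Rightarrow> complex" where
  "matrix_coeff G H \<pi> y x = (\<lambda>g. if g \<in> carrier G then hinner H y (\<pi> g x) else 0)"

text \<open>The Hilbert spaces range over carriers inside the type \<open>'a \<Rightarrow> complex\<close>.  This is no
  restriction: by \<open>fourier_stieltjesI\<close> below, the matrix coefficients of unitary representations
  on Hilbert spaces over any type whatsoever belong to this set.\<close>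

definition fourier_stieltjes :: "('a, 'm) monoid_scheme \<Rightarrow> ('a \<Rightarrow> complex) set" where
  "fourier_stieltjes G =
     {\<phi>. \<exists>(H :: ('a \<Rightarrow> complex) inner_module) \<pi> x y.
        complex_hilbert H \<and> unitary_rep G H \<pi> \<and> x \<in> carrier H \<and> y \<in> carrier H \<and>
        \<phi> = matrix_coeff G H \<pi> y x}"

text \<open>Uniqueness of the left invariant mean on the Fourier-Stieltjes algebra holds up to values
  outside of the algebra, which extensionality pins down.\<close>

definition fs_mean :: "('a, 'm) monoid_scheme \<Rightarrow> ('a \<Rightarrow> complex) \<Rightarrow> complex" where
  "fs_mean G = (THE \<mu>. \<mu> \<in> extensional (fourier_stieltjes G) \<and>
     mean_on (fourier_stieltjes G) \<mu> \<and> left_invariant_on G (fourier_stieltjes G) \<mu>)"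

definition FS :: "('a, 'm) monoid_scheme \<Rightarrow> (('a \<Rightarrow> complex) \<Rightarrow> complex) set" where
  "FS G = {\<mu> \<in> means G. restrict \<mu> (fourier_stieltjes G) = fs_mean G}"


section \<open>Compact groups, the Bohr compactification, Bohr sets\<close>

definition compact_hausdorff_group :: "('k, 'm) monoid_scheme \<Rightarrow> 'k topology \<Rightarrow> bool" where
  "compact_hausdorff_group K X \<longleftrightarrow>
     group K \<and> topspace X = carrier K \<and>
     continuous_map (prod_topology X X) X (\<lambda>(x, y). x \<otimes>\<^bsub>K\<^esub> y) \<and>
     continuous_map X X (\<lambda>x. inv\<^bsub>K\<^esub> x) \<and>
     compact_space X \<and> Hausdorff_space X"

definition dense_hom ::
  "('a, 'm) monoid_scheme \<Rightarrow> ('k, 'n) monoid_scheme \<Rightarrow> 'k topology \<Rightarrow> ('a \<Rightarrow> 'k) \<Rightarrow> bool" where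
  "dense_hom G K X \<tau> \<longleftrightarrow> \<tau> \<in> hom G K \<and> X closure_of (\<tau> ` carrier G) = topspace X"

text \<open>The compact groups in the universal property and in the definition of Bohr sets have
  carriers inside the type \<open>'a set set\<close>.  Again this is no restriction: see
  \<open>bohr_compactification_universal\<close> and \<open>bohr_setI\<close> below.\<close>

definition bohr_compactification ::
  "('a, 'm) monoid_scheme \<Rightarrow> ('b, 'n) monoid_scheme \<Rightarrow> 'b topology \<Rightarrow> ('a \<Rightarrow> 'b) \<Rightarrow> bool" where
  "bohr_compactification G bG X \<iota>\<^sub>o \<longleftrightarrow>
     compact_hausdorff_group bG X \<and> dense_hom G bG X \<iota>\<^sub>o \<and>
     (\<forall>(K :: 'a set set monoid) Y \<iota>. compact_hausdorff_group K Y \<and> dense_hom G K Y \<iota> \<longrightarrow>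
        (\<exists>\<kappa>. \<kappa> \<in> hom bG K \<and> continuous_map X Y \<kappa> \<and> \<kappa> ` carrier bG = carrier K \<and>
             (\<forall>g\<in>carrier G. \<kappa> (\<iota>\<^sub>o g) = \<iota> g)))"

text \<open>Only meant for nonempty open \<open>U\<close> in a compact group, where such finite sets \<open>F\<close>
  exist.\<close>

definition syndeticity_index :: "('k, 'm) monoid_scheme \<Rightarrow> 'k set \<Rightarrow> nat" where
  "syndeticity_index K U =
     (LEAST n. \<exists>F. F \<subseteq> carrier K \<and> finite F \<and> card F = n \<and> F <#>\<^bsub>K\<^esub> U = carrier K)"

definition right_thick :: "('a, 'm) monoid_scheme \<Rightarrow> 'a set \<Rightarrow> bool" where
  "right_thick G T \<longleftrightarrow> T \<subseteq> carrier G \<and>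
     (\<forall>F. finite F \<and> F \<subseteq> carrier G \<longrightarrow> (\<exists>g\<in>carrier G. F #>\<^bsub>G\<^esub> g \<subseteq> T))"

definition bohr_set :: "('a, 'm) monoid_scheme \<Rightarrow> 'a set \<Rightarrow> bool" where
  "bohr_set G C \<longleftrightarrow> C \<subseteq> carrier G \<and>
     (\<exists>(K :: 'a set set monoid) X \<tau> V. compact_hausdorff_group K X \<and> dense_hom G K X \<tau> \<and>
        openin X V \<and> V \<noteq> {} \<and> \<tau> -` V \<inter> carrier G \<subseteq> C)"

definition right_piecewise_bohr :: "('a, 'm) monoid_scheme \<Rightarrow> 'a set \<Rightarrow> bool" where
  "right_piecewise_bohr G S \<longleftrightarrow> (\<exists>C T. bohr_set G C \<and> right_thick G T \<and> S = C \<inter> T)"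


section \<open>The choice of carrier types is immaterial\<close>

lemma compact_group_transfer:
  fixes K :: "('k, 'n) monoid_scheme" and f :: "'k \<Rightarrow> 'l"
  assumes K: "compact_hausdorff_group K X" and f: "inj_on f (carrier K)"
  obtains K' :: "'l monoid" and X' where
    "compact_hausdorff_group K' X'" "f \<in> iso K K'" "homeomorphic_map X X' f"
proof -
  interpret group K using K by (simp add: compact_hausdorff_group_def)
  have top: "topspace X = carrier K"
    and cm: "continuous_map (prod_topology X X) X (\<lambda>(x, y). x \<otimes>\<^bsub>K\<^esub> y)"
    and ci: "continuous_map X X (\<lambda>x. inv\<^bsub>K\<^esub> x)"
    and cs: "compact_space X" and hs: "Hausdorff_space X"
    using K by (auto simp: compact_hausdorff_group_def)
  define h where "h = inv_into (carrier K) f"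
  have hf [simp]: "h (f x) = x" if "x \<in> carrier K" for x
    using f that by (simp add: h_def)
  define K' :: "'l monoid" where
    "K' = \<lparr>carrier = f ` carrier K, mult = (\<lambda>p q. f (h p \<otimes>\<^bsub>K\<^esub> h q)), one = f \<one>\<^bsub>K\<^esub>\<rparr>"
  define X' where "X' = pullback_topology (f ` carrier K) h X"
  have gK': "group K'"
  proof (rule groupI)
    fix x assume "x \<in> carrier K'"
    then obtain a where a: "a \<in> carrier K" "x = f a" by (auto simp: K'_def)
    then show "\<exists>y\<in>carrier K'. y \<otimes>\<^bsub>K'\<^esub> x = \<one>\<^bsub>K'\<^esub>"
      by (intro bexI[of _ "f (inv\<^bsub>K\<^esub> a)"]) (auto simp: K'_def)
  qed (auto simp: K'_def m_assoc)
  have iso: "f \<in> iso K K'"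
    using f by (auto simp: iso_def hom_def K'_def bij_betw_def)
  have top': "topspace X' = f ` carrier K"
    by (auto simp: X'_def topspace_pullback_topology top)
  have ch: "continuous_map X' X h"
    unfolding X'_def using continuous_map_pullback[of X X id "f ` carrier K" h] by simp
  have cf: "continuous_map X X' f"
    unfolding X'_def
  proof (rule continuous_map_pullback')
    show "continuous_map X X (h \<circ> f)"
      using continuous_map_eq[of X X id "h \<circ> f"] top by simp
    show "topspace X \<subseteq> f -` f ` carrier K" by (auto simp: top)
  qed
  have hm: "homeomorphic_maps X X' f h"
    using cf ch by (auto simp: homeomorphic_maps_def top top')
  then have hmf: "homeomorphic_map X X' f" and hs': "X homeomorphic_space X'"
    by (auto simp: homeomorphic_maps_map homeomorphic_space_def)
  have inv': "inv\<^bsub>K'\<^esub> x = f (inv\<^bsub>K\<^esub> (h x))" if "x \<in> carrier K'" for x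
    using that by (intro group.inv_equality[OF gK']) (auto simp: K'_def)
  have "continuous_map (prod_topology X' X') X (\<lambda>z. (h (fst z)) \<otimes>\<^bsub>K\<^esub> (h (snd z)))"
    using continuous_map_compose[of "prod_topology X' X'" "prod_topology X X"
        "\<lambda>z. (h (fst z), h (snd z))" X "\<lambda>(x, y). x \<otimes>\<^bsub>K\<^esub> y"] cm ch
    by (simp add: continuous_map_paired continuous_map_compose[unfolded o_def, of _ X' _ X h]
        continuous_map_fst continuous_map_snd o_def)
  then have "continuous_map (prod_topology X' X') X' (\<lambda>z. f ((h (fst z)) \<otimes>\<^bsub>K\<^esub> (h (snd z))))"
    using continuous_map_compose[OF _ cf] by (simp add: o_def)
  then have cm': "continuous_map (prod_topology X' X') X' (\<lambda>(x, y). x \<otimes>\<^bsub>K'\<^esub> y)"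
    by (simp add: K'_def case_prod_unfold)
  have "continuous_map X' X' (f \<circ> (\<lambda>x. inv\<^bsub>K\<^esub> x) \<circ> h)"
    using ch ci cf by (intro continuous_map_compose)
  then have ci': "continuous_map X' X' (\<lambda>x. inv\<^bsub>K'\<^esub> x)"
    by (rule continuous_map_eq) (use top' inv' in \<open>auto simp: K'_def\<close>)
  have "compact_hausdorff_group K' X'"
    unfolding compact_hausdorff_group_def
    using gK' top' cm' ci' cs hs homeomorphic_compact_space[OF hs']
      homeomorphic_Hausdorff_space[OF hs'] by (simp add: K'_def)
  from that[OF this iso hmf] show ?thesis .
qed

lemma dense_hom_small:
  fixes G :: "('a, 'm) monoid_scheme" and K :: "('k, 'n) monoid_scheme"
  assumes K: "compact_hausdorff_group K X" and \<tau>: "dense_hom G K X \<tau>"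
  obtains K' :: "'a set set monoid" and X' f where
    "compact_hausdorff_group K' X'" "dense_hom G K' X' (f \<circ> \<tau>)"
    "f \<in> iso K K'" "homeomorphic_map X X' f"
proof -
  have top: "topspace X = carrier K" and hs: "Hausdorff_space X"
    using K by (auto simp: compact_hausdorff_group_def)
  have dense: "X closure_of (\<tau> ` carrier G) = topspace X" and hom: "\<tau> \<in> hom G K"
    using \<tau> by (auto simp: dense_hom_def)
  define f where "f x = {S. S \<subseteq> carrier G \<and> x \<in> X closure_of (\<tau> ` S)}" for x
  have "inj_on f (carrier K)"
  proof (rule inj_onI, rule ccontr)
    fix x y assume xy: "x \<in> carrier K" "y \<in> carrier K" "f x = f y" "x \<noteq> y"
    then obtain U V where UV: "openin X U" "openin X V" "x \<in> U" "y \<in> V" "disjnt U V"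
      using hs top unfolding Hausdorff_space_def by metis
    define S where "S = {g \<in> carrier G. \<tau> g \<in> U}"
    have "x \<in> X closure_of (\<tau> ` S)"
      unfolding in_closure_of
    proof (intro conjI allI impI)
      show "x \<in> topspace X" using xy top by simp
      fix W assume W: "x \<in> W \<and> openin X W"
      then have "openin X (U \<inter> W)" "x \<in> U \<inter> W" using UV by auto
      moreover have "x \<in> X closure_of (\<tau> ` carrier G)" using dense xy top by simp
      ultimately obtain g where "g \<in> carrier G" "\<tau> g \<in> U \<inter> W"
        unfolding in_closure_of by blast
      then show "\<exists>z. z \<in> \<tau> ` S \<and> z \<in> W" by (auto simp: S_def)
    qed
    then have "S \<in> f y" using xy(3) by (auto simp: f_def S_def)
    then have "y \<in> X closure_of (\<tau> ` S)" by (simp add: f_def)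
    then obtain z where "z \<in> \<tau> ` S" "z \<in> V" using UV unfolding in_closure_of by blast
    then show False using UV by (auto simp: S_def disjnt_def)
  qed
  then obtain K' :: "'a set set monoid" and X' where
    K': "compact_hausdorff_group K' X'" "f \<in> iso K K'" "homeomorphic_map X X' f"
    using compact_group_transfer[OF K] by blast
  have "f \<circ> \<tau> \<in> hom G K'"
    using hom K'(2) hom_compose[of \<tau> G K f K'] by (auto simp: iso_def)
  moreover have "X' closure_of ((f \<circ> \<tau>) ` carrier G) = topspace X'"
  proof -
    have "\<tau> ` carrier G \<subseteq> topspace X" using hom top by (auto simp: hom_def)
    then have "X' closure_of (f ` (\<tau> ` carrier G)) = f ` (X closure_of (\<tau> ` carrier G))"
      using K'(3) by (simp add: homeomorphic_map_closure_of)
    then show ?thesis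
      using dense K'(3) by (simp add: image_comp homeomorphic_imp_surjective_map)
  qed
  ultimately show ?thesis using that K' by (simp add: dense_hom_def)
qed

lemma bohr_compactification_universal:
  fixes G :: "('a, 'm) monoid_scheme" and K :: "('k, 'n) monoid_scheme"
  assumes bG: "bohr_compactification G bG X \<iota>\<^sub>o"
    and K: "compact_hausdorff_group K Y" "dense_hom G K Y \<iota>"
  shows "\<exists>\<kappa>. \<kappa> \<in> hom bG K \<and> continuous_map X Y \<kappa> \<and> \<kappa> ` carrier bG = carrier K \<and>
             (\<forall>g\<in>carrier G. \<kappa> (\<iota>\<^sub>o g) = \<iota> g)"
proof -
  obtain K' :: "'a set set monoid" and Y' f where K':
    "compact_hausdorff_group K' Y'" "dense_hom G K' Y' (f \<circ> \<iota>)"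
    "f \<in> iso K K'" "homeomorphic_map Y Y' f"
    using dense_hom_small[OF K] .
  have "\<exists>\<kappa>. \<kappa> \<in> hom bG K' \<and> continuous_map X Y' \<kappa> \<and> \<kappa> ` carrier bG = carrier K' \<and>
             (\<forall>g\<in>carrier G. \<kappa> (\<iota>\<^sub>o g) = (f \<circ> \<iota>) g)"
    using bG[unfolded bohr_compactification_def, THEN conjunct2, THEN conjunct2, rule_format,
        OF conjI[OF K'(1,2)]] .
  then obtain \<kappa> where \<kappa>: "\<kappa> \<in> hom bG K'" "continuous_map X Y' \<kappa>"
      "\<kappa> ` carrier bG = carrier K'" "\<forall>g\<in>carrier G. \<kappa> (\<iota>\<^sub>o g) = f (\<iota> g)"
    unfolding o_def by (elim exE conjE)
  have top: "topspace Y = carrier K" "topspace Y' = carrier K'" and gr: "group K"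
    using K(1) K'(1) by (auto simp: compact_hausdorff_group_def)
  obtain h where h: "homeomorphic_maps Y Y' f h"
    using K'(4) homeomorphic_map_maps by blast
  then have hf: "h (f x) = x" if "x \<in> carrier K" for x
    using that by (simp add: homeomorphic_maps_def top)
  have bij: "bij_betw f (carrier K) (carrier K')" using K'(3) by (simp add: iso_def)
  have hinv: "h p = inv_into (carrier K) f p" if "p \<in> carrier K'" for p
    using that bij hf by (metis bij_betw_imp_surj_on f_inv_into_f inv_into_into)
  have hhom: "h \<in> hom K' K"
  proof -
    have "inv_into (carrier K) f \<in> hom K' K"
      using group.iso_set_sym[OF gr K'(3)] by (simp add: iso_def)
    moreover have "group K'" using K'(1) by (simp add: compact_hausdorff_group_def)
    ultimately show ?thesis
      using hinv by (auto simp: hom_def Pi_def group.is_monoid monoid.m_closed)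
  qed
  have himg: "h ` carrier K' = carrier K"
  proof -
    have "h ` f ` carrier K = (\<lambda>x. x) ` carrier K"
      unfolding image_image by (rule image_cong) (simp_all add: hf)
    then show ?thesis using bij_betw_imp_surj_on[OF bij] by simp
  qed
  show ?thesis
  proof (intro exI conjI)
    show "h \<circ> \<kappa> \<in> hom bG K" using \<kappa>(1) hhom by (rule hom_compose)
    show "continuous_map X Y (h \<circ> \<kappa>)"
      using \<kappa>(2) h by (intro continuous_map_compose) (auto simp: homeomorphic_maps_def)
    show "(h \<circ> \<kappa>) ` carrier bG = carrier K" using \<kappa>(3) himg by (metis image_comp)
    show "\<forall>g\<in>carrier G. (h \<circ> \<kappa>) (\<iota>\<^sub>o g) = \<iota> g"
      using \<kappa>(4) K(2) hf by (auto simp: dense_hom_def hom_def)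
  qed
qed

lemma bohr_setI:
  fixes G :: "('a, 'm) monoid_scheme" and K :: "('k, 'n) monoid_scheme"
  assumes K: "compact_hausdorff_group K X" "dense_hom G K X \<tau>"
    and V: "openin X V" "V \<noteq> {}" and C: "\<tau> -` V \<inter> carrier G \<subseteq> C" "C \<subseteq> carrier G"
  shows "bohr_set G C"
proof -
  obtain K' :: "'a set set monoid" and X' f where K':
    "compact_hausdorff_group K' X'" "dense_hom G K' X' (f \<circ> \<tau>)"
    "f \<in> iso K K'" "homeomorphic_map X X' f"
    using dense_hom_small[OF K] .
  have top: "topspace X = carrier K" using K by (auto simp: compact_hausdorff_group_def)
  have sub: "V \<subseteq> carrier K" using openin_subset[OF V(1)] top by simp
  have inj: "inj_on f (carrier K)" using K'(3) by (simp add: iso_def bij_betw_def)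
  have op: "openin X' (f ` V)"
    using K'(4) V sub top by (simp add: homeomorphic_map_openness_eq)
  have "(f \<circ> \<tau>) -` (f ` V) \<inter> carrier G \<subseteq> C"
  proof
    fix g assume g: "g \<in> (f \<circ> \<tau>) -` (f ` V) \<inter> carrier G"
    then obtain v where v: "v \<in> V" "f (\<tau> g) = f v" by auto
    moreover have "\<tau> g \<in> carrier K" using g K(2) by (auto simp: dense_hom_def hom_def)
    ultimately have "\<tau> g = v" using inj sub by (meson inj_onD subsetD)
    then show "g \<in> C" using v g C by auto
  qed
  with op V(2) K'(1,2) have "compact_hausdorff_group K' X' \<and> dense_hom G K' X' (f \<circ> \<tau>) \<and>
        openin X' (f ` V) \<and> f ` V \<noteq> {} \<and> (f \<circ> \<tau>) -` (f ` V) \<inter> carrier G \<subseteq> C"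
    by simp
  with C(2) show ?thesis unfolding bohr_set_def
    by - (rule conjI, assumption, (rule exI)+, assumption)
qed

lemma complex_ring_simps [simp]:
  "carrier complex_ring = UNIV" "a \<oplus>\<^bsub>complex_ring\<^esub> b = a + b"
  "a \<otimes>\<^bsub>complex_ring\<^esub> b = a * b" "\<one>\<^bsub>complex_ring\<^esub> = 1" "\<zero>\<^bsub>complex_ring\<^esub> = 0"
  by (simp_all add: complex_ring_def)

lemma cring_complex_ring: "cring complex_ring"
proof (rule cringI)
  show "abelian_group complex_ring"
    by (rule abelian_groupI) (auto simp: algebra_simps intro: exI[of _ "- _"])
  show "comm_monoid complex_ring"
    by (rule comm_monoidI) (auto simp: algebra_simps)
qed (auto simp: algebra_simps)

context complex_hilbert
begin

lemma minus_eq_smult: "x \<in> carrier H \<Longrightarrow> \<ominus> x = (-1) \<odot> x"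
proof -
  assume x: "x \<in> carrier H"
  have "(-1) \<odot> x \<oplus> x = (-1) \<odot> x \<oplus> 1 \<odot> x" using x smult_one[of x] by simp
  also have "\<dots> = (-1 + 1) \<odot> x" using x smult_l_distr[of "-1" 1 x] by simp
  also have "\<dots> = \<zero>" using smult_l_null[of x] x by simp
  finally show ?thesis using x smult_closed[of "-1" x] by (intro minus_equality) auto
qed

lemma smult_in: "x \<in> carrier H \<Longrightarrow> c \<odot> x \<in> carrier H"
  by (rule smult_closed) simp

lemma hinner_zero: "x \<in> carrier H \<Longrightarrow> hinner H x \<zero> = 0"
  using hinner_smult[of x x 0] smult_l_null[of x] by simp

lemma hinner_zero_left: "x \<in> carrier H \<Longrightarrow> hinner H \<zero> x = 0"
  using hinner_zero[of x] hinner_cnj[of x "\<zero>"] by simp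

lemma hinner_diff: "\<lbrakk>x \<in> carrier H; y \<in> carrier H; z \<in> carrier H\<rbrakk> \<Longrightarrow>
    hinner H x (y \<ominus> z) = hinner H x y - hinner H x z"
  using smult_in[of z "-1"]
  by (simp add: a_minus_def minus_eq_smult hinner_add hinner_smult)

lemma Cauchy_Schwarz:
  assumes x: "x \<in> carrier H" and y: "y \<in> carrier H"
  shows "cmod (hinner H x y) \<le> hnorm H x * hnorm H y"
proof (cases "hinner H x x = 0")
  case True
  then have "hinner H x y = 0" using x y hinner_definite hinner_zero_left by metis
  then show ?thesis using x y by (simp add: hnorm_def hinner_nonneg)
next
  case False
  define a where "a = Re (hinner H x x)"
  have im: "hinner H x x = of_real a"
    using hinner_cnj[of x x] x by (simp add: a_def complex_eq_iff)
  have a: "a > 0" proof -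
    have "a \<noteq> 0" using False unfolding im by simp
    moreover have "a \<ge> 0" using hinner_nonneg[OF x] by (simp only: a_def)
    ultimately show ?thesis by simp
  qed
  define p where "p = hinner H x y"
  have p': "hinner H y x = cnj p" using hinner_cnj[OF x y] by (simp add: p_def)
  define c where "c = - p / of_real a"
  define z where "z = y \<oplus> c \<odot> x"
  have cx: "c \<odot> x \<in> carrier H" and z: "z \<in> carrier H" using smult_in[OF x] y by (auto simp: z_def)
  have zx: "hinner H x z = 0"
    unfolding z_def using x y cx a by (simp add: hinner_add hinner_smult im c_def flip: p_def)
  then have xz: "hinner H z x = 0" using hinner_cnj[OF x z] by simp
  have yz: "hinner H y z = hinner H y y + c * cnj p"
    unfolding z_def using x y cx by (simp add: hinner_add hinner_smult p')
  have "hinner H z z = hinner H z y + c * hinner H z x"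
    by (subst (2) z_def) (use x y z cx in \<open>simp add: hinner_add hinner_smult\<close>)
  also have "\<dots> = cnj (hinner H y z)" using xz hinner_cnj[OF y z] by simp
  finally have "0 \<le> Re (hinner H y z)" using hinner_nonneg[OF z] by simp
  also have "Re (hinner H y z) = Re (hinner H y y) - (cmod p)\<^sup>2 / a"
    unfolding yz c_def cmod_power2 by (simp add: power2_eq_square add_divide_distrib)
  finally have "(cmod p)\<^sup>2 \<le> a * Re (hinner H y y)"
    using a by (simp add: field_simps)
  then have "cmod p \<le> sqrt (a * Re (hinner H y y))" by (rule real_le_rsqrt)
  then show ?thesis by (simp add: p_def hnorm_def a_def real_sqrt_mult)
qed

lemma hinner_limit_zero:
  assumes w: "w \<in> carrier H" and s: "\<And>n. s n \<in> carrier H" and l: "l \<in> carrier H"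
    and lim: "(\<lambda>n::nat. hnorm H (s n \<ominus> l)) \<longlonglongrightarrow> 0" and z: "\<And>n. hinner H w (s n) = 0"
  shows "hinner H w l = 0"
proof -
  have "cmod (hinner H w l) \<le> hnorm H w * hnorm H (s n \<ominus> l)" for n
    using Cauchy_Schwarz[OF w, of "s n \<ominus> l"] s l hinner_diff[OF w s l] z by (simp)
  moreover have "(\<lambda>n. hnorm H w * hnorm H (s n \<ominus> l)) \<longlonglongrightarrow> 0"
    using tendsto_mult_right_zero[OF lim] by simp
  ultimately have "cmod (hinner H w l) \<le> 0"
    by (intro LIMSEQ_le_const) auto
  then show ?thesis by simp
qed

end

definition hilbert_image ::
  "('h, 'm) inner_module_scheme \<Rightarrow> 'h set \<Rightarrow> ('h \<Rightarrow> 'l) \<Rightarrow> 'l inner_module" where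
  "hilbert_image H M J = (let h = inv_into M J in
     \<lparr>carrier = J ` M, mult = undefined, one = undefined, zero = J \<zero>\<^bsub>H\<^esub>,
      add = (\<lambda>p q. J (h p \<oplus>\<^bsub>H\<^esub> h q)), smult = (\<lambda>c p. J (c \<odot>\<^bsub>H\<^esub> h p)),
      hinner = (\<lambda>p q. hinner H (h p) (h q))\<rparr>)"

lemma hilbert_image_simps:
  assumes "inj_on J M"
  shows "carrier (hilbert_image H M J) = J ` M" "\<zero>\<^bsub>hilbert_image H M J\<^esub> = J \<zero>\<^bsub>H\<^esub>"
    "\<lbrakk>x \<in> M; y \<in> M\<rbrakk> \<Longrightarrow> J x \<oplus>\<^bsub>hilbert_image H M J\<^esub> J y = J (x \<oplus>\<^bsub>H\<^esub> y)"
    "x \<in> M \<Longrightarrow> c \<odot>\<^bsub>hilbert_image H M J\<^esub> J x = J (c \<odot>\<^bsub>H\<^esub> x)"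
    "\<lbrakk>x \<in> M; y \<in> M\<rbrakk> \<Longrightarrow> hinner (hilbert_image H M J) (J x) (J y) = hinner H x y"
  using assms by (simp_all add: hilbert_image_def Let_def)

lemma complex_hilbert_image:
  fixes H :: "('h, 'n) inner_module_scheme" (structure)
  assumes H: "complex_hilbert H" and M: "M \<subseteq> carrier H" "\<zero>\<^bsub>H\<^esub> \<in> M"
    and add: "\<And>x y. \<lbrakk>x \<in> M; y \<in> M\<rbrakk> \<Longrightarrow> x \<oplus>\<^bsub>H\<^esub> y \<in> M"
    and smult: "\<And>c x. x \<in> M \<Longrightarrow> c \<odot>\<^bsub>H\<^esub> x \<in> M"
    and closed: "\<And>s l. \<lbrakk>\<And>n::nat. s n \<in> M; l \<in> carrier H;
        (\<lambda>n. hnorm H (s n \<ominus>\<^bsub>H\<^esub> l)) \<longlonglongrightarrow> 0\<rbrakk> \<Longrightarrow> l \<in> M"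
    and J: "inj_on J M"
  shows "complex_hilbert (hilbert_image H M J)" (is "complex_hilbert ?H'")
proof -
  interpret complex_hilbert H by (rule H)
  note [simp] = hilbert_image_simps[OF J] and [intro] = add smult
  have MH [intro]: "x \<in> carrier H" if "x \<in> M" for x using that M by auto
  have ag: "abelian_group ?H'"
  proof (rule abelian_groupI)
    fix p assume "p \<in> carrier ?H'"
    then obtain x where x: "x \<in> M" "p = J x" by auto
    then have "\<ominus> x \<in> M" using smult[of x "-1"] by (simp add: minus_eq_smult MH)
    with x show "\<exists>q\<in>carrier ?H'. q \<oplus>\<^bsub>?H'\<^esub> p = \<zero>\<^bsub>?H'\<^esub>"
      by (intro bexI[of _ "J (\<ominus> x)"]) (auto simp: l_neg MH)
  qed (auto simp: M add MH a_assoc intro!: arg_cong[of _ _ J] a_comm)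
  have m: "module complex_ring ?H'"
  proof (rule moduleI[OF cring_complex_ring ag])
  qed (auto simp: smult add MH intro!: arg_cong[of _ _ J]
        smult_l_distr[simplified] smult_r_distr[simplified] smult_assoc1[simplified]
        smult_one[simplified])
  have minus: "J x \<ominus>\<^bsub>?H'\<^esub> J y = J (x \<ominus> y)" "x \<ominus> y \<in> M" if xy: "x \<in> M" "y \<in> M" for x y
  proof -
    have my: "\<ominus> y \<in> M" using smult[of y "-1"] xy by (simp add: minus_eq_smult MH)
    then have "\<ominus>\<^bsub>?H'\<^esub> J y = J (\<ominus> y)"
      using xy by (intro abelian_group.minus_equality[OF ag]) (auto simp: l_neg MH)
    then show "J x \<ominus>\<^bsub>?H'\<^esub> J y = J (x \<ominus> y)" "x \<ominus> y \<in> M"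
      using xy my by (simp_all add: a_minus_def add)
  qed
  have norm: "hnorm ?H' (J x) = hnorm H x" if "x \<in> M" for x
    using that by (simp add: hnorm_def)
  show ?thesis
  proof (rule complex_hilbert.intro[OF m], unfold_locales)
    fix s assume s: "\<And>n. s n \<in> carrier ?H'"
      and cau: "\<And>e. e > 0 \<Longrightarrow> \<exists>N::nat. \<forall>m\<ge>N. \<forall>n\<ge>N. hnorm ?H' (s m \<ominus>\<^bsub>?H'\<^esub> s n) < e"
    have "\<forall>n. \<exists>t. t \<in> M \<and> s n = J t" using s by auto
    then obtain t where t: "\<And>n. t n \<in> M" "\<And>n. s n = J (t n)" by metis
    have "\<exists>N. \<forall>m\<ge>N. \<forall>n\<ge>N. hnorm H (t m \<ominus> t n) < e" if "e > 0" for e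
      using cau[OF that] by (simp add: t minus norm)
    then obtain l where l: "l \<in> carrier H" "(\<lambda>n. hnorm H (t n \<ominus> l)) \<longlonglongrightarrow> 0"
      using hcomplete[of t] t(1) by blast
    then have lM: "l \<in> M" using closed[of t l] t(1) by blast
    then show "\<exists>l\<in>carrier ?H'. (\<lambda>n. hnorm ?H' (s n \<ominus>\<^bsub>?H'\<^esub> l)) \<longlonglongrightarrow> 0"
      using l(2) by (intro bexI[of _ "J l"]) (auto simp: t minus norm)
  next
    fix p q assume "p \<in> carrier ?H'" "q \<in> carrier ?H'"
    then obtain u v where "u \<in> M" "p = J u" "v \<in> M" "q = J v" by auto
    then show "hinner ?H' q p = cnj (hinner ?H' p q)" using hinner_cnj[of u v] by (simp add: MH)
  next
    fix p assume "p \<in> carrier ?H'" "hinner ?H' p p = 0"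
    then obtain v where "v \<in> M" "p = J v" "hinner H v v = 0" by auto
    then show "p = \<zero>\<^bsub>?H'\<^esub>" using hinner_definite[of v] by (simp add: MH)
  qed (auto simp: add smult MH hinner_add hinner_smult hinner_nonneg)
qed

lemma ex_inj_complex_pair: "\<exists>e :: complex \<times> complex \<Rightarrow> complex. inj e"
proof -
  obtain r :: "nat set \<Rightarrow> real" where r: "bij_betw r UNIV UNIV"
    using nat_sets_eqpoll_reals by (auto simp: eqpoll_def)
  define d where "d = inv_into UNIV r"
  have d: "inj d" using r by (metis d_def bij_betw_inv_into bij_betw_imp_inj_on)
  define pr :: "real \<times> real \<Rightarrow> real" where
    "pr = (\<lambda>z. r ((\<lambda>n. 2 * n) ` d (fst z) \<union> (\<lambda>n. 2 * n + 1) ` d (snd z)))"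
  have "inj pr"
  proof (rule injI)
    fix z w assume "pr z = pr w"
    then have eq: "(\<lambda>n. 2 * n) ` d (fst z) \<union> (\<lambda>n. 2 * n + 1) ` d (snd z) =
        (\<lambda>n. 2 * n) ` d (fst w) \<union> (\<lambda>n. 2 * n + 1) ` d (snd w)" (is "?L = ?R")
      using r by (auto simp: pr_def bij_def inj_def)
    have "n \<in> d (fst z) \<longleftrightarrow> n \<in> d (fst w)" for n
    proof -
      have "n \<in> d (fst z) \<longleftrightarrow> 2 * n \<in> ?L" "n \<in> d (fst w) \<longleftrightarrow> 2 * n \<in> ?R"
        by (auto; presburger)+
      then show ?thesis unfolding eq by (rule trans[OF _ sym])
    qed
    moreover have "n \<in> d (snd z) \<longleftrightarrow> n \<in> d (snd w)" for n
    proof -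
      have "n \<in> d (snd z) \<longleftrightarrow> 2 * n + 1 \<in> ?L" "n \<in> d (snd w) \<longleftrightarrow> 2 * n + 1 \<in> ?R"
        by (auto; presburger)+
      then show ?thesis unfolding eq by (rule trans[OF _ sym])
    qed
    ultimately have "d (fst z) = d (fst w)" "d (snd z) = d (snd w)" by auto
    then show "z = w" using d by (auto simp: inj_def prod_eq_iff)
  qed
  then have pr: "pr p = pr q \<longleftrightarrow> p = q" for p q by (rule inj_eq)
  have "inj (\<lambda>z :: complex \<times> complex.
      Complex (pr (Re (fst z), Im (fst z))) (pr (Re (snd z), Im (snd z))))"
    by (rule injI) (simp only: complex.sel pr fst_conv snd_conv complex_eq_iff prod_eq_iff)
  then show ?thesis by (rule exI[where P = inj])
qed

lemma fourier_stieltjesI: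
  fixes G :: "('a, 'm) monoid_scheme" and H :: "('h, 'n) inner_module_scheme" (structure)
  assumes G: "group G" and H: "complex_hilbert H" and \<pi>: "unitary_rep G H \<pi>"
    and x: "x \<in> carrier H" and y: "y \<in> carrier H"
  shows "matrix_coeff G H \<pi> y x \<in> fourier_stieltjes G"
proof -
  interpret G: group G by (rule G)
  interpret complex_hilbert H by (rule H)
  have bij: "bij_betw (\<pi> g) (carrier H) (carrier H)"
    and \<pi>_add: "\<And>u v. \<lbrakk>u \<in> carrier H; v \<in> carrier H\<rbrakk> \<Longrightarrow> \<pi> g (u \<oplus> v) = \<pi> g u \<oplus> \<pi> g v"
    and \<pi>_smult: "\<And>c u. u \<in> carrier H \<Longrightarrow> \<pi> g (c \<odot> u) = c \<odot> \<pi> g u"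
    and \<pi>_inner: "\<And>u v. \<lbrakk>u \<in> carrier H; v \<in> carrier H\<rbrakk> \<Longrightarrow>
        hinner H (\<pi> g u) (\<pi> g v) = hinner H u v"
    if "g \<in> carrier G" for g
    using \<pi> that by (auto simp: unitary_rep_def)
  have \<pi>_mult: "\<pi> (g \<otimes>\<^bsub>G\<^esub> k) u = \<pi> g (\<pi> k u)"
    if "g \<in> carrier G" "k \<in> carrier G" "u \<in> carrier H" for g k u
    using \<pi> that by (auto simp: unitary_rep_def)
  have \<pi>_in: "\<pi> g u \<in> carrier H" if "g \<in> carrier G" "u \<in> carrier H" for g u
    using bij[OF that(1)] that(2) by (auto simp: bij_betw_def)
  have \<pi>_one: "\<pi> \<one>\<^bsub>G\<^esub> u = u" if u: "u \<in> carrier H" for u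
  proof -
    have "\<pi> \<one>\<^bsub>G\<^esub> (\<pi> \<one>\<^bsub>G\<^esub> u) = \<pi> \<one>\<^bsub>G\<^esub> u"
      using \<pi>_mult[of "\<one>\<^bsub>G\<^esub>" "\<one>\<^bsub>G\<^esub>" u] u by simp
    then show ?thesis
      using bij[OF G.one_closed] u \<pi>_in[OF G.one_closed u]
      by (meson bij_betw_imp_inj_on inj_onD)
  qed
  have \<pi>_inv: "\<pi> g (\<pi> (inv\<^bsub>G\<^esub> g) u) = u" if "g \<in> carrier G" "u \<in> carrier H" for g u
    using \<pi>_mult[of g "inv\<^bsub>G\<^esub> g" u] that \<pi>_one by simp
  \<comment> \<open>\<open>M\<close> is the closed invariant subspace generated by \<open>x\<close> and \<open>y\<close>.\<close>
  define N where "N = {w \<in> carrier H. \<forall>g\<in>carrier G.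
      hinner H (\<pi> g x) w = 0 \<and> hinner H (\<pi> g y) w = 0}"
  define M where "M = {v \<in> carrier H. \<forall>w\<in>N. hinner H w v = 0}"
  have NH: "w \<in> carrier H" if "w \<in> N" for w using that by (simp add: N_def)
  have MH: "v \<in> carrier H" if "v \<in> M" for v using that by (simp add: M_def)
  have N_inv: "\<pi> g w \<in> N" if g: "g \<in> carrier G" and w: "w \<in> N" for g w
  proof -
    have *: "hinner H (\<pi> k z) (\<pi> g w) = hinner H (\<pi> (inv\<^bsub>G\<^esub> g \<otimes>\<^bsub>G\<^esub> k) z) w"
      if "k \<in> carrier G" "z \<in> carrier H" for k z
    proof -
      have "\<pi> g (\<pi> (inv\<^bsub>G\<^esub> g \<otimes>\<^bsub>G\<^esub> k) z) = \<pi> k z"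
        using \<pi>_mult[of "inv\<^bsub>G\<^esub> g" k z] \<pi>_inv[of g "\<pi> k z"] that g \<pi>_in by simp
      then show ?thesis
        using \<pi>_inner[OF g, of "\<pi> (inv\<^bsub>G\<^esub> g \<otimes>\<^bsub>G\<^esub> k) z" w] \<pi>_in that g NH[OF w] by simp
    qed
    show ?thesis using w g x y by (auto simp: N_def * \<pi>_in)
  qed
  have M_inv: "\<pi> g v \<in> M" if g: "g \<in> carrier G" and v: "v \<in> M" for g v
  proof -
    have "hinner H w (\<pi> g v) = 0" if w: "w \<in> N" for w
    proof -
      have "hinner H w (\<pi> g v) = hinner H (\<pi> (inv\<^bsub>G\<^esub> g) w) v"
        using \<pi>_inner[OF g, of "\<pi> (inv\<^bsub>G\<^esub> g) w" v] \<pi>_inv[OF g NH[OF w]]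
          \<pi>_in[OF G.inv_closed[OF g] NH[OF w]] MH[OF v] by simp
      then show ?thesis using N_inv[OF G.inv_closed[OF g] w] v by (simp add: M_def)
    qed
    then show ?thesis using \<pi>_in[OF g MH[OF v]] by (simp add: M_def)
  qed
  have swap: "hinner H u v = 0 \<longleftrightarrow> hinner H v u = 0" if "u \<in> carrier H" "v \<in> carrier H" for u v
    using hinner_cnj[OF that] by simp
  have xM: "x \<in> M" and yM: "y \<in> M"
    using x y \<pi>_one by (auto simp: M_def N_def swap intro: bspec[OF _ G.one_closed] dest!: bspec[OF _ G.one_closed])
  have minus_M: "u \<ominus> v \<in> M" if "u \<in> M" "v \<in> M" for u v
    using that NH by (auto simp: M_def hinner_diff)
  obtain e :: "complex \<times> complex \<Rightarrow> complex" where e: "inj e"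
    using ex_inj_complex_pair by blast
  define J where "J v = (\<lambda>g. if g \<in> carrier G
      then e (hinner H (\<pi> g x) v, hinner H (\<pi> g y) v) else 0)" for v
  have J: "inj_on J M"
  proof (rule inj_onI)
    fix u v assume u: "u \<in> M" and v: "v \<in> M" and eq: "J u = J v"
    have "hinner H (\<pi> g x) u = hinner H (\<pi> g x) v \<and> hinner H (\<pi> g y) u = hinner H (\<pi> g y) v"
      if "g \<in> carrier G" for g
      using fun_cong[OF eq, of g] that e by (simp add: J_def inj_eq)
    then have "u \<ominus> v \<in> N"
      using MH[OF u] MH[OF v] \<pi>_in x y by (simp add: N_def hinner_diff)
    then have "hinner H (u \<ominus> v) (u \<ominus> v) = 0" using minus_M[OF u v] by (simp add: M_def)
    then have "u \<ominus> v = \<zero>" using MH[OF minus_M[OF u v]] by (intro hinner_definite)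
    then show "u = v"
      using MH[OF u] MH[OF v] by (metis a_minus_def a_inv_closed minus_equality minus_minus)
  qed
  let ?H' = "hilbert_image H M J"
  note simps = hilbert_image_simps[OF J, where H = H]
  have addM: "u \<oplus> v \<in> M" if "u \<in> M" "v \<in> M" for u v
    using that NH by (auto simp: M_def hinner_add)
  have smultM: "c \<odot> u \<in> M" if "u \<in> M" for c u
    using that NH smult_in by (auto simp: M_def hinner_smult)
  have H': "complex_hilbert ?H'"
  proof (rule complex_hilbert_image[OF H _ _ addM smultM _ J])
    fix s l assume s: "\<And>n::nat. s n \<in> M" and l: "l \<in> carrier H"
      and lim: "(\<lambda>n. hnorm H (s n \<ominus> l)) \<longlonglongrightarrow> 0"
    then show "l \<in> M"
      using hinner_limit_zero[OF NH MH[OF s] l lim] by (auto simp: M_def)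
  qed (use NH in \<open>auto simp: M_def hinner_zero\<close>)
  define h where "h = inv_into M J"
  have hJ: "h (J v) = v" if "v \<in> M" for v using J that by (simp add: h_def)
  define \<pi>' where "\<pi>' g p = J (\<pi> g (h p))" for g p
  have \<pi>'J: "\<pi>' g (J v) = J (\<pi> g v)" if "v \<in> M" for g v using that by (simp add: \<pi>'_def hJ)
  have "unitary_rep G ?H' \<pi>'"
    unfolding unitary_rep_def
  proof (intro conjI ballI allI)
    fix g assume g: "g \<in> carrier G"
    have "\<pi> g ` M = M"
    proof
      show "M \<subseteq> \<pi> g ` M"
      proof
        fix v assume v: "v \<in> M"
        show "v \<in> \<pi> g ` M"
          using \<pi>_inv[OF g MH[OF v]] M_inv[OF G.inv_closed[OF g] v] by (metis imageI)
      qed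
    qed (use M_inv[OF g] in auto)
    moreover have "\<pi>' g ` J ` M = J ` \<pi> g ` M"
      unfolding image_image by (rule image_cong) (simp_all add: \<pi>'J)
    ultimately have "\<pi>' g ` J ` M = J ` M" by simp
    moreover have "inj_on (\<pi>' g) (J ` M)"
    proof (rule inj_onI)
      fix p q assume "p \<in> J ` M" "q \<in> J ` M" and eq: "\<pi>' g p = \<pi>' g q"
      then obtain u v where uv: "u \<in> M" "v \<in> M" "p = J u" "q = J v" by auto
      then have "\<pi> g u = \<pi> g v"
        using eq inj_onD[OF J, of "\<pi> g u" "\<pi> g v"] by (simp add: \<pi>'J M_inv[OF g])
      then have "u = v"
        using inj_onD[OF bij_betw_imp_inj_on[OF bij[OF g]], of u v] uv by (simp add: MH)
      then show "p = q" using uv by simp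
    qed
    ultimately show "bij_betw (\<pi>' g) (carrier ?H') (carrier ?H')"
      by (simp add: bij_betw_def simps)
  qed (auto simp: simps \<pi>'J addM smultM M_inv MH \<pi>_add \<pi>_smult \<pi>_inner \<pi>_mult)
  moreover have "matrix_coeff G H \<pi> y x = matrix_coeff G ?H' \<pi>' (J y) (J x)"
    using xM yM by (auto simp: matrix_coeff_def simps \<pi>'J M_inv)
  moreover have "J x \<in> carrier ?H'" "J y \<in> carrier ?H'" using xM yM by (auto simp: simps)
  ultimately have "complex_hilbert ?H' \<and> unitary_rep G ?H' \<pi>' \<and> J x \<in> carrier ?H' \<and>
      J y \<in> carrier ?H' \<and> matrix_coeff G H \<pi> y x = matrix_coeff G ?H' \<pi>' (J y) (J x)"
    using H' by simp
  then show ?thesis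
    unfolding fourier_stieltjes_def by - (rule CollectI, (rule exI)+, assumption)
qed

end

theory Submission
  imports Defs
begin

text \<open>Let the means \<open>\<Lambda>\<close> and \<open>\<eta>\<close> nearly realise the densities of \<open>A = {a\<^sub>0, a\<^sub>1, \<dots>}\<close> and \<open>B\<close>, and let
  \<open>D\<^sub>n\<close> be the complement of \<open>a\<^sub>0 B \<union> \<dots> \<union> a\<^sub>n\<^sub>-\<^sub>1 B\<close>.  The function \<open>\<phi> g = lim \<eta> (D\<^sub>n \<inter> g B)\<close> is an entry of
  an invariant positive semidefinite kernel, hence belongs to the Fourier-Stieltjes algebra, and it
  vanishes on \<open>A\<close>.  Projecting to the compact vectors of the representation, one splits
  \<open>\<phi> = \<psi> + \<phi>\<^sub>0\<close> with \<open>\<psi>\<close> almost periodic and \<open>\<Lambda> (\<bar>\<phi>\<^sub>0\<bar>\<^sup>2) = 0\<close>.  For \<open>f\<^sub>k = (1 - \<bar>\<psi>\<bar>\<^sup>2 / K\<^sup>2)\<^sup>k\<close> this gives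
  \<open>\<Lambda> f\<^sub>k \<ge> \<Lambda> A\<close>, because \<open>\<phi> = 0\<close> on \<open>A\<close>, and \<open>\<Lambda> (f\<^sub>k \<phi>) \<rightarrow> 0\<close>.

  Given a finite set \<open>F\<close>, choose a finite family \<open>(s\<^sub>i)\<close> whose averages approximate \<open>\<Lambda>\<close> and then a point
  \<open>h\<close> such that, for \<open>g \<in> F\<close>, the average \<open>u g\<close> of \<open>f\<^sub>k (g s\<^sub>i) 1\<^sub>B (s\<^sub>i\<^sup>-\<^sup>1 h)\<close> can only be large if \<open>g h \<in> A B\<close>.  Smoothing
  by an approximate identity turns \<open>u\<close> into a correlation of almost periodic functions, and a maximal
  family of translates with small pairwise correlation shows that few translates of \<open>{u > \<epsilon>}\<close>, at most
  \<open>1 / (\<Lambda> A \<cdot> \<eta> B)\<close>, cover \<open>G\<close>.  All \<open>u\<close> are Lipschitz for one totally bounded bi-invariant pseudometric.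
  By the pigeonhole principle, the sets \<open>{u > \<epsilon>}\<close> agree up to a small error along an exhaustion of \<open>G\<close> by
  finite sets, which produces the thick set; the completion of the pseudometric is a compact group
  onto which \<open>bG\<close> maps, and there the sets become open.\<close>

text \<open>Two invariances are at hand, each on a small algebra: \<open>\<Lambda>\<close> is
  prescribed only on the Fourier-Stieltjes algebra, and \<open>\<eta>\<close> is invariant only on
  the Bebutov algebra of \<open>B\<close>. The complement of \<open>A B\<close> need not lie in the
  latter when \<open>A\<close> is infinite, whereas every \<open>D\<^sub>n\<close> does; hence
  \<open>\<phi>\<close> is a limit. Likewise \<open>\<Lambda>\<close> is of no direct use on the
  indicator of \<open>A\<close>, so \<open>f\<^sub>k\<close> takes its place, and only high powers
  make \<open>\<Lambda> (f\<^sub>k \<phi>)\<close> small while \<open>\<Lambda> f\<^sub>k\<close>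
  stays above the density of \<open>A\<close>. On the Fourier-Stieltjes algebra the mean is a limit
  of averages over finite families, uniformly under translation. The families come from minimising
  the norm over the convex hull of an orbit in Hilbert space, and the uniformity lets one family
  serve several functions and all translates at once. The integer part leaves room for every
  approximation: with \<open>N\<close> the asserted bound,
  \<open>1 / (\<alpha> \<beta>) < N + 1\<close> is strict, so means slightly below the densities
  still exclude \<open>N + 1\<close> translates. The function, the smoothing and the radius are
  fixed before the finite set \<open>F\<close>; only the point, the translates and the centres
  depend on it, and these can be rounded to a finite net.\<close>

section \<open>Positive semidefinite kernels and their Hilbert spaces\<close>

text \<open>A list of pairs (coefficient, index) stands for a formal linear combination.\<close>

definition kip :: "('i \<Rightarrow> 'i \<Rightarrow> complex) \<Rightarrow> (complex \<times> 'i) list \<Rightarrow> (complex \<times> 'i) list \<Rightarrow> complex" where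
  "kip k xs ys = (\<Sum>p\<leftarrow>xs. \<Sum>q\<leftarrow>ys. cnj (fst p) * fst q * k (snd p) (snd q))"

definition lscale :: "complex \<Rightarrow> (complex \<times> 'i) list \<Rightarrow> (complex \<times> 'i) list" where
  "lscale c xs = map (\<lambda>p. (c * fst p, snd p)) xs"

definition ldiff :: "(complex \<times> 'i) list \<Rightarrow> (complex \<times> 'i) list \<Rightarrow> (complex \<times> 'i) list" where
  "ldiff xs ys = xs @ lscale (-1) ys"

lemma sum_list_cnj: "cnj (sum_list xs) = (\<Sum>x\<leftarrow>xs. cnj x)"
  by (induction xs) auto

lemma kip_Nil [simp]: "kip k [] ys = 0" "kip k xs [] = 0"
  by (simp_all add: kip_def)

lemma kip_Cons_left: "kip k (p # xs) ys = kip k [p] ys + kip k xs ys"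
  by (simp add: kip_def)

lemma kip_append [simp]:
  "kip k (xs @ xs') ys = kip k xs ys + kip k xs' ys"
  "kip k xs (ys @ ys') = kip k xs ys + kip k xs ys'"
  by (simp_all add: kip_def sum_list_addf)

lemma kip_Cons_right: "kip k xs (p # ys) = kip k xs [p] + kip k xs ys"
  using kip_append(2)[of k xs "[p]" ys] by simp

lemma kip_lscale [simp]:
  "kip k (lscale c xs) ys = cnj c * kip k xs ys"
  "kip k xs (lscale c ys) = c * kip k xs ys"
proof -
  have "kip k (lscale c xs) ys = (\<Sum>p\<leftarrow>xs. cnj c * (\<Sum>q\<leftarrow>ys. cnj (fst p) * fst q * k (snd p) (snd q)))"
    by (simp add: kip_def lscale_def o_def mult.assoc flip: sum_list_const_mult)
  then show "kip k (lscale c xs) ys = cnj c * kip k xs ys"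
    by (simp only: kip_def sum_list_const_mult)
  have "kip k xs (lscale c ys) = (\<Sum>p\<leftarrow>xs. c * (\<Sum>q\<leftarrow>ys. cnj (fst p) * fst q * k (snd p) (snd q)))"
    by (simp add: kip_def lscale_def o_def mult.assoc mult.left_commute[of _ c] flip: sum_list_const_mult)
  then show "kip k xs (lscale c ys) = c * kip k xs ys"
    by (simp only: kip_def sum_list_const_mult)
qed

lemma kip_ldiff [simp]:
  "kip k (ldiff xs xs') ys = kip k xs ys - kip k xs' ys"
  "kip k xs (ldiff ys ys') = kip k xs ys - kip k xs ys'"
  by (simp_all add: ldiff_def)

lemma set_lscale: "set xs \<subseteq> UNIV \<times> I \<Longrightarrow> set (lscale c xs) \<subseteq> UNIV \<times> I"
  by (auto simp: lscale_def)

lemma set_ldiff: "\<lbrakk>set xs \<subseteq> UNIV \<times> I; set ys \<subseteq> UNIV \<times> I\<rbrakk> \<Longrightarrow> set (ldiff xs ys) \<subseteq> UNIV \<times> I"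
  by (auto simp: ldiff_def lscale_def)

lemma kip_cong:
  assumes "\<And>i j. \<lbrakk>i \<in> snd ` set xs; j \<in> snd ` set ys\<rbrakk> \<Longrightarrow> k i j = k' i j"
  shows "kip k xs ys = kip k' xs ys"
  unfolding kip_def by (intro arg_cong[of _ _ sum_list] map_cong refl) (simp add: assms)

section \<open>Seminorm and Cauchy-Schwarz inequality of a kernel\<close>

locale psd_kernel =
  fixes I :: "'i set" and k :: "'i \<Rightarrow> 'i \<Rightarrow> complex"
  assumes herm: "\<lbrakk>i \<in> I; j \<in> I\<rbrakk> \<Longrightarrow> k j i = cnj (k i j)"
    and pos: "set xs \<subseteq> UNIV \<times> I \<Longrightarrow> 0 \<le> Re (kip k xs xs)"
begin

abbreviation valid :: "(complex \<times> 'i) list \<Rightarrow> bool" where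
  "valid xs \<equiv> set xs \<subseteq> UNIV \<times> I"

definition knorm :: "(complex \<times> 'i) list \<Rightarrow> real" where
  "knorm xs = sqrt (Re (kip k xs xs))"

lemma kip_sym:
  assumes "valid xs" "valid ys"
  shows "kip k ys xs = cnj (kip k xs ys)"
proof -
  have single: "kip k [q] [p] = cnj (kip k [p] [q])" if "p \<in> UNIV \<times> I" "q \<in> UNIV \<times> I" for p q
    using that herm[of "snd p" "snd q"] by (simp add: kip_def mem_Times_iff)
  have one: "kip k [q] xs = cnj (kip k xs [q])" if "q \<in> UNIV \<times> I" for q
    using assms(1)
  proof (induction xs)
    case (Cons p xs)
    then show ?case using single[of p q] that
      by (simp add: kip_Cons_left[of _ p xs] kip_Cons_right[of _ _ p xs])
  qed simp
  show ?thesis using assms(2)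
  proof (induction ys)
    case (Cons q ys)
    then show ?case using one[of q]
      by (simp add: kip_Cons_left[of _ q ys] kip_Cons_right[of _ _ q ys])
  qed simp
qed

lemma kip_self: "valid xs \<Longrightarrow> kip k xs xs = of_real ((knorm xs)\<^sup>2)"
  using kip_sym[of xs xs] pos[of xs] by (simp add: knorm_def complex_eq_iff)

lemma knorm_nonneg [simp]: "valid xs \<Longrightarrow> 0 \<le> knorm xs"
  using pos by (simp add: knorm_def)

text \<open>Expanding the squared seminorm of \<open>ys - t p xs\<close> for real \<open>t\<close>
  gives a real quadratic in \<open>t\<close>, the phase of \<open>p\<close> being absorbed in the
  coefficient. The seminorm may be degenerate, so \<open>X = 0\<close> is handled by a large
  \<open>t\<close> and \<open>X > 0\<close> by the minimiser \<open>t = 1 / X\<close>.\<close>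

lemma kip_CS:
  assumes "valid xs" "valid ys"
  shows "cmod (kip k xs ys) \<le> knorm xs * knorm ys"
proof -
  define p where "p = kip k xs ys"
  define X where "X = (knorm xs)\<^sup>2"
  define Y where "Y = (knorm ys)\<^sup>2"
  have X: "kip k xs xs = of_real X" and Y: "kip k ys ys = of_real Y"
    using kip_self assms by (auto simp: X_def Y_def)
  have sym: "kip k ys xs = cnj p" unfolding p_def using assms by (rule kip_sym)
  have key: "0 \<le> Y - 2 * t * (cmod p)\<^sup>2 + t\<^sup>2 * (cmod p)\<^sup>2 * X" for t :: real
  proof -
    define c where "c = - (of_real t * p)"
    have "0 \<le> Re (kip k (ys @ lscale (cnj (-(of_real t * cnj p))) xs) (ys @ lscale (cnj (-(of_real t * cnj p))) xs))"
      using assms by (intro pos) (auto simp: lscale_def)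
    also have "\<dots> = Y - 2 * t * (cmod p)\<^sup>2 + t\<^sup>2 * (cmod p)\<^sup>2 * X"
      by (simp add: X Y sym cmod_power2 flip: p_def)
         (simp add: power2_eq_square algebra_simps)
    finally show ?thesis .
  qed
  have X0: "X \<ge> 0" "Y \<ge> 0" by (auto simp: X_def Y_def)
  have "(cmod p)\<^sup>2 \<le> X * Y"
  proof (cases "X = 0")
    case True
    have "cmod p = 0"
    proof (rule ccontr)
      assume "cmod p \<noteq> 0"
      then have "2 * ((Y + 1) / (cmod p)\<^sup>2) * (cmod p)\<^sup>2 = 2 * (Y + 1)" by simp
      with key[of "(Y + 1) / (cmod p)\<^sup>2"] X0 True show False by simp
    qed
    then show ?thesis using X0 by simp
  next
    case False
    then show ?thesis using key[of "1 / X"] X0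
      by (simp add: field_simps power2_eq_square)
  qed
  then have "cmod p \<le> sqrt (X * Y)" by (rule real_le_rsqrt)
  then show ?thesis using assms by (simp add: p_def X_def Y_def real_sqrt_mult)
qed

lemma knorm_sq: "valid xs \<Longrightarrow> (knorm xs)\<^sup>2 = Re (kip k xs xs)"
  using pos by (simp add: knorm_def)

lemma knorm_append:
  assumes "valid xs" "valid ys"
  shows "knorm (xs @ ys) \<le> knorm xs + knorm ys"
proof (rule power2_le_imp_le)
  have "(knorm (xs @ ys))\<^sup>2 = Re (kip k (xs @ ys) (xs @ ys))"
    by (rule knorm_sq) (use assms in auto)
  also have "\<dots> = (knorm xs)\<^sup>2 + 2 * Re (kip k xs ys) + (knorm ys)\<^sup>2"
    using assms by (simp add: kip_sym[of xs ys] knorm_sq)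
  also have "\<dots> \<le> (knorm xs + knorm ys)\<^sup>2"
    using kip_CS[OF assms] complex_Re_le_cmod[of "kip k xs ys"]
    by (simp add: power2_sum)
  finally show "(knorm (xs @ ys))\<^sup>2 \<le> (knorm xs + knorm ys)\<^sup>2" .
qed (use assms in auto)

lemma knorm_lscale: "valid xs \<Longrightarrow> knorm (lscale c xs) = cmod c * knorm xs"
proof -
  assume xs: "valid xs"
  have "Re (kip k (lscale c xs) (lscale c xs)) = Re ((cnj c * c) * of_real ((knorm xs)\<^sup>2))"
    by (simp only: kip_lscale kip_self[OF xs] mult.assoc mult.left_commute)
  also have "\<dots> = (cmod c * knorm xs)\<^sup>2"
    by (simp add: power_mult_distrib cmod_power2 distrib_right flip: power2_eq_square)
  finally show ?thesis using xs by (simp add: knorm_def[of "lscale c xs"])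
qed

lemma knorm_triangle:
  assumes "valid xs" "valid ys" "valid zs"
  shows "knorm (ldiff xs zs) \<le> knorm (ldiff xs ys) + knorm (ldiff ys zs)"
proof -
  have "Re (kip k (ldiff xs zs) (ldiff xs zs)) =
      Re (kip k (ldiff xs ys @ ldiff ys zs) (ldiff xs ys @ ldiff ys zs))"
    by simp
  then have "knorm (ldiff xs zs) = knorm (ldiff xs ys @ ldiff ys zs)"
    by (simp only: knorm_def)
  then show ?thesis using knorm_append[of "ldiff xs ys" "ldiff ys zs"] assms by (simp add: set_ldiff)
qed

lemma knorm_ldiff_commute: "knorm (ldiff xs ys) = knorm (ldiff ys xs)"
  by (simp add: knorm_def)

lemma knorm_diff_le:
  assumes "valid xs" "valid ys"
  shows "\<bar>knorm xs - knorm ys\<bar> \<le> knorm (ldiff xs ys)"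
proof -
  have *: "knorm (ldiff zs []) = knorm zs" for zs by (simp add: knorm_def)
  show ?thesis
    using knorm_triangle[of xs ys "[]"] knorm_triangle[of ys xs "[]"] assms *
      knorm_ldiff_commute[of xs ys] by auto
qed

text \<open>This is the Gram kernel after projecting all generators off the \<open>i\<close>-th one.
  Its positivity is the Cauchy-Schwarz inequality against that generator.\<close>

lemma psd_schur_complement:
  assumes i: "i \<in> I" "k i i \<noteq> 0"
  shows "psd_kernel I (\<lambda>j l. k j l - k j i * k i l / k i i)"
proof
  have im: "cnj (k i i) = k i i" using herm[of i i] i by simp
  show "k l j - k l i * k i j / k i i = cnj (k j l - k j i * k i l / k i i)" if "j \<in> I" "l \<in> I" for j l
    using that i herm[of j l] herm[of i j] herm[of l i] by (simp add: im mult.commute)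
  fix xs assume xs: "valid xs"
  define e where "e = [(1::complex, i)]"
  have e: "valid e" using i by (simp add: e_def)
  have ki: "k i i = of_real ((knorm e)\<^sup>2)" using kip_self[OF e] by (simp add: e_def kip_def)
  then have ne: "knorm e \<noteq> 0" using i by auto
  have split: "kip (\<lambda>j l. k j l - k j i * k i l / k i i) us vs =
      kip k us vs - kip k us e * kip k e vs / k i i" for us vs
  proof (induction us)
    case (Cons p us)
    have "kip (\<lambda>j l. k j l - k j i * k i l / k i i) [p] vs =
        kip k [p] vs - kip k [p] e * kip k e vs / k i i"
    proof (induction vs)
      case (Cons q vs)
      then show ?case
        unfolding kip_Cons_right[of _ _ q vs]
        by (simp add: kip_def e_def algebra_simps diff_divide_distrib add_divide_distrib)
    qed simp
    then show ?case using Cons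
      unfolding kip_Cons_left[of _ p us] by (simp add: algebra_simps add_divide_distrib)
  qed simp
  have "Re (kip (\<lambda>j l. k j l - k j i * k i l / k i i) xs xs) = (knorm xs)\<^sup>2 - (cmod (kip k e xs))\<^sup>2 / (knorm e)\<^sup>2"
  proof -
    have "kip (\<lambda>j l. k j l - k j i * k i l / k i i) xs xs =
        of_real ((knorm xs)\<^sup>2) - cnj (kip k e xs) * kip k e xs / of_real ((knorm e)\<^sup>2)"
      by (simp only: split kip_self[OF xs] kip_sym[OF e xs]) (simp only: ki)
    also have "cnj (kip k e xs) * kip k e xs = of_real ((cmod (kip k e xs))\<^sup>2)"
      by (simp add: complex_norm_square[symmetric] mult.commute del: of_real_power)
    finally show ?thesis by (simp flip: of_real_divide of_real_diff of_real_power)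
  qed
  moreover have "(cmod (kip k e xs))\<^sup>2 \<le> (knorm e)\<^sup>2 * (knorm xs)\<^sup>2"
    using power_mono[OF kip_CS[OF e xs], of 2] by (simp add: power_mult_distrib)
  ultimately show "0 \<le> Re (kip (\<lambda>j l. k j l - k j i * k i l / k i i) xs xs)"
    using ne by (simp add: divide_le_eq mult.commute)
qed

end

section \<open>The Schur product theorem\<close>

lemma psd_kernel_comap:
  fixes f :: "'b \<Rightarrow> 'i"
  assumes "psd_kernel I k" and f: "\<And>j. j \<in> J \<Longrightarrow> f j \<in> I"
  shows "psd_kernel J (\<lambda>i j. k (f i) (f j))"
proof -
  interpret psd_kernel I k by fact
  show ?thesis
  proof
    fix xs :: "(complex \<times> 'b) list" assume "set xs \<subseteq> UNIV \<times> J"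
    then have "valid (map (\<lambda>p. (fst p, f (snd p))) xs)" using f by auto
    from pos[OF this] show "0 \<le> Re (kip (\<lambda>i j. k (f i) (f j)) xs xs)"
      by (simp add: kip_def o_def)
  qed (use f in \<open>blast intro: herm\<close>)
qed

lemma (in psd_kernel) diag_zero:
  assumes "i \<in> I" "j \<in> I" "k i i = 0"
  shows "k i j = 0" "k j i = 0"
proof -
  have "cmod (kip k [(1, i)] [(1, j)]) \<le> knorm [(1, i)] * knorm [(1, j)]"
    by (rule kip_CS) (use assms in auto)
  moreover have "knorm [(1, i)] = 0" using assms by (simp add: knorm_def kip_def)
  ultimately show "k i j = 0" by (simp add: kip_def)
  then show "k j i = 0" using herm[OF assms(1,2)] by simp
qed

text \<open>Gaussian elimination: at the first index, \<open>k\<close> splits into a rank one kernel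
  and a Schur complement. The rank one part times \<open>k'\<close> is the form of \<open>k'\<close>
  at reweighted coefficients, and the complement does not see the first entry, which shortens the
  list. The kernel changes on the way, so the induction keeps it arbitrary.\<close>

lemma psd_kernel_mult:
  assumes "psd_kernel I k" "psd_kernel I k'"
  shows "psd_kernel I (\<lambda>i j. k i j * k' i j)"
proof -
  interpret k': psd_kernel I k' by fact
  have "0 \<le> Re (kip (\<lambda>i j. k i j * k' i j) xs xs)"
    if "set xs \<subseteq> UNIV \<times> I" "psd_kernel I k" for xs k
    using that
  proof (induction xs arbitrary: k)
    case (Cons p xs)
    interpret psd_kernel I k by fact
    obtain a i where p: "p = (a, i)" by (cases p)
    have i: "i \<in> I" and xs: "valid xs" using Cons.prems p by auto
    \<comment> \<open>A kernel with vanishing \<open>i\<close>-th row and column does not see \<open>p\<close>.\<close>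
    have drop: "kip (\<lambda>i j. h i j * k' i j) (p # xs) (p # xs) = kip (\<lambda>i j. h i j * k' i j) xs xs"
      if h: "\<And>j. j \<in> I \<Longrightarrow> h i j = 0" "\<And>j. j \<in> I \<Longrightarrow> h j i = 0" for h
    proof -
      have 1: "kip (\<lambda>i j. h i j * k' i j) [p] ys = 0" if "valid ys" for ys
        using that by (induction ys) (auto simp: kip_def p h)
      have 2: "kip (\<lambda>i j. h i j * k' i j) ys [p] = 0" if "valid ys" for ys
        using that by (induction ys) (auto simp: kip_def p h)
      have "valid (p # xs)" using i xs p by simp
      then show ?thesis
        unfolding kip_Cons_left[of _ p xs] kip_Cons_right[of _ xs p xs] using 1 2 xs by simp
    qed
    show ?case
    proof (cases "k i i = 0")
      case True
      have "kip (\<lambda>i j. k i j * k' i j) (p # xs) (p # xs) = kip (\<lambda>i j. k i j * k' i j) xs xs"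
        by (rule drop) (use diag_zero[OF i _ True] in auto)
      then show ?thesis using Cons.IH[OF xs Cons.prems(2)] by simp
    next
      case False
      define h where "h = (\<lambda>j l. k j l - k j i * k i l / k i i)"
      have h: "psd_kernel I h" unfolding h_def by (rule psd_schur_complement[OF i False])
      have h0: "h i j = 0" "h j i = 0" for j using False by (auto simp: h_def)
      \<comment> \<open>The rank one factor \<open>k j i * k i l\<close> moves into the
        coefficients; it fits the conjugation in \<open>kip\<close> because
        \<open>k j i = cnj (k i j)\<close>.\<close>
      define ys where "ys = map (\<lambda>q. (fst q * k i (snd q), snd q)) (p # xs)"
      have ys: "valid ys" using xs i p by (auto simp: ys_def)
      have kii: "k i i = of_real (Re (k i i))" using herm[OF i i] by (simp add: complex_eq_iff)
      have Rk: "Re (k i i) \<ge> 0" using pos[of "[(1, i)]"] i by (simp add: kip_def)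
      have "kip (\<lambda>j l. k j i * k i l * k' j l) us vs =
          kip k' (map (\<lambda>q. (fst q * k i (snd q), snd q)) us) (map (\<lambda>q. (fst q * k i (snd q), snd q)) vs)"
        if "valid us" for us vs
        unfolding kip_def using that
        by (auto simp: o_def herm[OF i] mult_ac intro!: arg_cong[of _ _ sum_list] map_cong)
      then have 1: "kip (\<lambda>j l. k j i * k i l * k' j l) (p # xs) (p # xs) = kip k' ys ys"
        using xs i p by (simp add: ys_def)
      have 2: "(\<lambda>j l. k j l * k' j l) = (\<lambda>j l. h j l * k' j l + k j i * k i l * k' j l / k i i)"
        by (auto simp: h_def algebra_simps fun_eq_iff)
      have "kip (\<lambda>j l. k j l * k' j l) us us =
         kip (\<lambda>j l. h j l * k' j l) us us + kip (\<lambda>j l. k j i * k i l * k' j l) us us / k i i" for us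
        unfolding 2 kip_def distrib_left sum_list_addf
        by (simp add: divide_inverse sum_list_mult_const flip: mult.assoc)
      then have "kip (\<lambda>j l. k j l * k' j l) (p # xs) (p # xs) =
          kip (\<lambda>j l. h j l * k' j l) xs xs + kip k' ys ys / of_real (Re (k i i))"
        by (simp only: drop[of h, OF h0] 1 flip: kii)
      moreover have "0 \<le> Re (kip k' ys ys / of_real (Re (k i i)))"
        using k'.pos[OF ys] Rk by (simp only: Re_divide_of_real) simp
      ultimately show ?thesis using Cons.IH[OF xs h] by simp
    qed
  qed simp
  moreover have "k j i * k' j i = cnj (k i j * k' i j)" if "i \<in> I" "j \<in> I" for i j
    using psd_kernel.herm[OF assms(1) that] k'.herm[OF that] by simp
  ultimately show ?thesis using assms(1) by (simp add: psd_kernel.intro)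
qed

section \<open>The Hilbert space completion of a kernel\<close>

context psd_kernel
begin

definition cauchy_seq :: "(nat \<Rightarrow> (complex \<times> 'i) list) \<Rightarrow> bool" where
  "cauchy_seq X \<longleftrightarrow> (\<forall>n. valid (X n)) \<and>
     (\<forall>e>0. \<exists>N. \<forall>m\<ge>N. \<forall>n\<ge>N. knorm (ldiff (X m) (X n)) < e)"

text \<open>A point of the completion is a function on \<open>I\<close>: the inner products of the generators with a
  Cauchy sequence of formal linear combinations.\<close>

definition repr :: "('i \<Rightarrow> complex) \<Rightarrow> (nat \<Rightarrow> (complex \<times> 'i) list) \<Rightarrow> bool" where
  "repr F X \<longleftrightarrow> cauchy_seq X \<and> (\<forall>i\<in>I. (\<lambda>n. kip k [(1, i)] (X n)) \<longlonglongrightarrow> F i) \<and> (\<forall>i. i \<notin> I \<longrightarrow> F i = 0)"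

text \<open>One choice of representing sequences is fixed here; \<open>hip_lim\<close> shows that
  every other choice gives the same value.\<close>

definition hip :: "('i \<Rightarrow> complex) \<Rightarrow> ('i \<Rightarrow> complex) \<Rightarrow> complex" where
  "hip F F' = lim (\<lambda>n. kip k ((SOME X. repr F X) n) ((SOME X. repr F' X) n))"

definition embed :: "(complex \<times> 'i) list \<Rightarrow> 'i \<Rightarrow> complex" where
  "embed xs = (\<lambda>i. if i \<in> I then kip k [(1, i)] xs else 0)"

lemma cauchy_seq_valid: "cauchy_seq X \<Longrightarrow> valid (X n)"
  by (simp add: cauchy_seq_def)

lemma repr_valid: "repr F X \<Longrightarrow> valid (X n)"
  by (simp add: cauchy_seq_def repr_def)

lemma ldiff_append_knorm:
  assumes "valid a" "valid b" "valid c" "valid d"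
  shows "knorm (ldiff (a @ b) (c @ d)) \<le> knorm (ldiff a c) + knorm (ldiff b d)"
proof -
  have "knorm (ldiff (a @ b) (c @ d)) = knorm (ldiff a c @ ldiff b d)"
    by (simp add: knorm_def algebra_simps)
  then show ?thesis using knorm_append[of "ldiff a c" "ldiff b d"] assms by (simp add: set_ldiff)
qed

lemma cauchy_seq_append:
  assumes "cauchy_seq X" "cauchy_seq Y"
  shows "cauchy_seq (\<lambda>n. X n @ Y n)"
  unfolding cauchy_seq_def
proof (intro conjI allI impI)
  fix e :: real assume "e > 0"
  then obtain N M where N: "\<And>m n. m \<ge> N \<Longrightarrow> n \<ge> N \<Longrightarrow> knorm (ldiff (X m) (X n)) < e / 2"
    and M: "\<And>m n. m \<ge> M \<Longrightarrow> n \<ge> M \<Longrightarrow> knorm (ldiff (Y m) (Y n)) < e / 2"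
    using assms unfolding cauchy_seq_def by (metis half_gt_zero)
  have "knorm (ldiff (X m @ Y m) (X n @ Y n)) < e" if "m \<ge> max N M" "n \<ge> max N M" for m n
    using N[of m n] M[of m n] that
      ldiff_append_knorm[of "X m" "Y m" "X n" "Y n"] assms[THEN cauchy_seq_valid] by fastforce
  then show "\<exists>N. \<forall>m\<ge>N. \<forall>n\<ge>N. knorm (ldiff (X m @ Y m) (X n @ Y n)) < e" by blast
qed (use assms[THEN cauchy_seq_valid] in simp)

lemma cauchy_seq_lscale:
  assumes "cauchy_seq X"
  shows "cauchy_seq (\<lambda>n. lscale c (X n))"
  unfolding cauchy_seq_def
proof (intro conjI allI impI)
  have v: "valid (X n)" for n using assms by (rule cauchy_seq_valid)
  fix e :: real assume "e > 0"
  then have "e / (cmod c + 1) > 0" by (simp add: add_nonneg_pos)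
  then obtain N where N: "\<And>m n. m \<ge> N \<Longrightarrow> n \<ge> N \<Longrightarrow> knorm (ldiff (X m) (X n)) < e / (cmod c + 1)"
    using assms unfolding cauchy_seq_def by metis
  have "knorm (ldiff (lscale c (X m)) (lscale c (X n))) < e" if "m \<ge> N" "n \<ge> N" for m n
  proof -
    have "knorm (ldiff (lscale c (X m)) (lscale c (X n))) = knorm (lscale c (ldiff (X m) (X n)))"
      by (simp add: knorm_def algebra_simps)
    also have "\<dots> = cmod c * knorm (ldiff (X m) (X n))"
      using v by (simp add: knorm_lscale set_ldiff)
    also have "\<dots> \<le> (cmod c + 1) * knorm (ldiff (X m) (X n))"
      using v by (intro mult_right_mono) (simp_all add: set_ldiff)
    also have "\<dots> < e"
      using N[OF that] pos_less_divide_eq[of "cmod c + 1"] by (simp add: add_nonneg_pos mult.commute)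
    finally show ?thesis .
  qed
  then show "\<exists>N. \<forall>m\<ge>N. \<forall>n\<ge>N. knorm (ldiff (lscale c (X m)) (lscale c (X n))) < e" by blast
qed (use assms[THEN cauchy_seq_valid] in \<open>simp add: set_lscale\<close>)

lemma repr_add: "\<lbrakk>repr F X; repr F' Y\<rbrakk> \<Longrightarrow> repr (\<lambda>i. F i + F' i) (\<lambda>n. X n @ Y n)"
  by (auto simp: repr_def cauchy_seq_append intro!: tendsto_add)

lemma repr_scale: "repr F X \<Longrightarrow> repr (\<lambda>i. c * F i) (\<lambda>n. lscale c (X n))"
  by (auto simp: repr_def cauchy_seq_lscale intro!: tendsto_mult_left)

lemma repr_diff: "\<lbrakk>repr F X; repr F' Y\<rbrakk> \<Longrightarrow> repr (\<lambda>i. F i - F' i) (\<lambda>n. ldiff (X n) (Y n))"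
  using repr_add[OF _ repr_scale[of F' Y "-1"], of F X] by (simp add: ldiff_def)

lemma knorm_self_diff [simp]: "knorm (ldiff xs xs) = 0"
  by (simp add: knorm_def)

lemma repr_embed: "valid xs \<Longrightarrow> repr (embed xs) (\<lambda>n. xs)"
  by (auto simp: repr_def cauchy_seq_def embed_def)

lemma cauchy_seq_bounded:
  assumes "cauchy_seq X"
  shows "\<exists>B>0. \<forall>n. knorm (X n) \<le> B"
proof -
  obtain N where N: "\<And>m n. m \<ge> N \<Longrightarrow> n \<ge> N \<Longrightarrow> knorm (ldiff (X m) (X n)) < 1"
    using assms unfolding cauchy_seq_def by (metis zero_less_one)
  define B where "B = 1 + (\<Sum>n\<le>N. knorm (X n))"
  have v: "valid (X n)" for n using assms by (rule cauchy_seq_valid)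
  have *: "knorm (X n) \<le> (\<Sum>n\<le>N. knorm (X n))" if "n \<le> N" for n
    using that v by (intro member_le_sum) auto
  have "knorm (X n) \<le> B" for n
  proof (cases "n \<le> N")
    case False
    then show ?thesis using N[of n N] knorm_diff_le[OF v v, of n N] *[of N] by (simp add: B_def)
  qed (use * in \<open>fastforce simp: B_def\<close>)
  moreover have "B > 0" unfolding B_def using v by (intro add_pos_nonneg sum_nonneg) auto
  ultimately show ?thesis by blast
qed

lemma kip_Cauchy:
  assumes X: "cauchy_seq X" and Y: "cauchy_seq Y"
  shows "convergent (\<lambda>n. kip k (X n) (Y n))"
proof -
  obtain B C where B: "B > 0" "\<And>n. knorm (X n) \<le> B" and C: "C > 0" "\<And>n. knorm (Y n) \<le> C"
    using cauchy_seq_bounded[OF X] cauchy_seq_bounded[OF Y] by auto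
  have v: "valid (X n)" "valid (Y n)" for n using assms by (auto dest: cauchy_seq_valid)
  have "Cauchy (\<lambda>n. kip k (X n) (Y n))"
  proof (rule metric_CauchyI)
    fix e :: real assume e: "e > 0"
    then have "e / (2 * C) > 0" "e / (2 * B) > 0" using B C by auto
    then obtain N M where
      N: "\<And>m n. m \<ge> N \<Longrightarrow> n \<ge> N \<Longrightarrow> knorm (ldiff (X m) (X n)) < e / (2 * C)" and
      M: "\<And>m n. m \<ge> M \<Longrightarrow> n \<ge> M \<Longrightarrow> knorm (ldiff (Y m) (Y n)) < e / (2 * B)"
      using X Y unfolding cauchy_seq_def by metis
    have "dist (kip k (X m) (Y m)) (kip k (X n) (Y n)) < e" if "m \<ge> max N M" "n \<ge> max N M" for m n
    proof -
      have "kip k (X m) (Y m) - kip k (X n) (Y n) =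
          kip k (ldiff (X m) (X n)) (Y m) + kip k (X n) (ldiff (Y m) (Y n))" by simp
      also have "cmod \<dots> \<le> knorm (ldiff (X m) (X n)) * knorm (Y m) + knorm (X n) * knorm (ldiff (Y m) (Y n))"
        using v by (intro norm_triangle_mono kip_CS) (auto simp: set_ldiff)
      also have "\<dots> \<le> knorm (ldiff (X m) (X n)) * C + B * knorm (ldiff (Y m) (Y n))"
        using v B C by (intro add_mono mult_left_mono mult_right_mono) (auto simp: set_ldiff)
      also have "\<dots> < e / 2 + e / 2"
        using N[of m n] M[of m n] that B C by (intro add_strict_mono) (auto simp: field_simps)
      finally show ?thesis by (simp add: dist_norm)
    qed
    then show "\<exists>M. \<forall>m\<ge>M. \<forall>n\<ge>M. dist (kip k (X m) (Y m)) (kip k (X n) (Y n)) < e" by blast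
  qed
  then show ?thesis by (simp add: Cauchy_convergent_iff)
qed

lemma repr_null_pair:
  assumes Z: "repr (\<lambda>_. 0) Z" and xs: "valid xs"
  shows "(\<lambda>n. kip k xs (Z n)) \<longlonglongrightarrow> 0"
  using xs
proof (induction xs)
  case (Cons p xs)
  have "[p] = lscale (fst p) [(1, snd p)]" by (simp add: lscale_def)
  then have "kip k (p # xs) (Z n) = cnj (fst p) * kip k [(1, snd p)] (Z n) + kip k xs (Z n)" for n
    by (metis kip_Cons_left kip_lscale(1))
  moreover have "(\<lambda>n. cnj (fst p) * kip k [(1, snd p)] (Z n) + kip k xs (Z n)) \<longlonglongrightarrow> cnj (fst p) * 0 + 0"
    using Cons Z by (intro tendsto_intros) (auto simp: repr_def)
  ultimately show ?case by simp
qed simp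

text \<open>Both arguments vary with \<open>n\<close>. Freezing \<open>Y\<close> at a late index
  costs little because \<open>Z\<close> is bounded, and against a fixed combination the pairing
  tends to \<open>0\<close>. This is why elements of the completion can be functions instead of
  equivalence classes: two sequences with the same coordinates differ by one that is negligible in
  every inner product.\<close>

lemma repr_null:
  assumes Z: "repr (\<lambda>_. 0) Z" and Y: "cauchy_seq Y"
  shows "(\<lambda>n. kip k (Y n) (Z n)) \<longlonglongrightarrow> 0"
proof (rule LIMSEQ_I)
  fix e :: real assume e: "e > 0"
  have v: "valid (Z n)" "valid (Y n)" for n
    using Z Y by (auto dest: repr_valid cauchy_seq_valid)
  obtain B where B: "B > 0" "\<And>n. knorm (Z n) \<le> B"
    using cauchy_seq_bounded[of Z] Z by (auto simp: repr_def)
  have "e / (2 * B) > 0" using e B by simp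
  then obtain N where N: "\<And>m n. m \<ge> N \<Longrightarrow> n \<ge> N \<Longrightarrow> knorm (ldiff (Y m) (Y n)) < e / (2 * B)"
    using Y unfolding cauchy_seq_def by metis
  obtain M where M: "\<And>n. n \<ge> M \<Longrightarrow> cmod (kip k (Y N) (Z n)) < e / 2"
    using LIMSEQ_D[OF repr_null_pair[OF Z v(2)[of N]], of "e / 2"] e by auto
  have "cmod (kip k (Y n) (Z n)) < e" if n: "n \<ge> max N M" for n
  proof -
    have "kip k (Y n) (Z n) = kip k (Y N) (Z n) + kip k (ldiff (Y n) (Y N)) (Z n)" by simp
    also have "cmod \<dots> \<le> cmod (kip k (Y N) (Z n)) + knorm (ldiff (Y n) (Y N)) * knorm (Z n)"
      using v by (intro norm_triangle_mono kip_CS order_refl) (auto simp: set_ldiff)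
    also have "\<dots> \<le> cmod (kip k (Y N) (Z n)) + knorm (ldiff (Y n) (Y N)) * B"
      using v B by (intro add_left_mono mult_left_mono) (auto simp: set_ldiff)
    also have "\<dots> < e / 2 + e / 2"
      using M[of n] N[of n N] n B by (intro add_strict_mono) (auto simp: field_simps)
    finally show ?thesis by simp
  qed
  then show "\<exists>no. \<forall>n\<ge>no. norm (kip k (Y n) (Z n) - 0) < e"
    by (metis diff_zero)
qed

lemma hip_lim:
  assumes X: "repr F X" and Y: "repr F' Y"
  shows "(\<lambda>n. kip k (X n) (Y n)) \<longlonglongrightarrow> hip F F'"
proof -
  define X' where "X' = (SOME X. repr F X)"
  define Y' where "Y' = (SOME X. repr F' X)"
  have X': "repr F X'" unfolding X'_def using X by (rule someI[of "repr F"])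
  have Y': "repr F' Y'" unfolding Y'_def using Y by (rule someI[of "repr F'"])
  have c: "cauchy_seq X" "cauchy_seq Y" "cauchy_seq X'" "cauchy_seq Y'"
    using X Y X' Y' by (auto simp: repr_def)
  have v: "valid (X n)" "valid (X' n)" "valid (Y n)" "valid (Y' n)" for n
    using X Y X' Y' by (auto dest: repr_valid)
  have 1: "(\<lambda>n. kip k (X' n) (Y' n)) \<longlonglongrightarrow> hip F F'"
    using kip_Cauchy[OF c(3,4)] unfolding hip_def X'_def[symmetric] Y'_def[symmetric]
    by (simp add: convergent_LIMSEQ_iff)
  have "repr (\<lambda>_. 0) (\<lambda>n. ldiff (X n) (X' n))" "repr (\<lambda>_. 0) (\<lambda>n. ldiff (Y n) (Y' n))"
    using repr_diff[OF X X'] repr_diff[OF Y Y'] by simp_all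
  then have 2: "(\<lambda>n. kip k (X' n) (ldiff (Y n) (Y' n))) \<longlonglongrightarrow> 0"
    "(\<lambda>n. kip k (Y n) (ldiff (X n) (X' n))) \<longlonglongrightarrow> 0"
    by - (rule repr_null; simp only: c)+
  have "(\<lambda>n. kip k (X' n) (Y' n) + kip k (X' n) (ldiff (Y n) (Y' n)) + cnj (kip k (Y n) (ldiff (X n) (X' n))))
      \<longlonglongrightarrow> hip F F' + 0 + cnj 0"
    by (intro tendsto_add 1 2 tendsto_cnj)
  moreover have "cnj (kip k (Y n) (ldiff (X n) (X' n))) = kip k (ldiff (X n) (X' n)) (Y n)" for n
    using v by (intro kip_sym[symmetric]) (auto simp: set_ldiff)
  ultimately show ?thesis by simp
qed

definition completion :: "('i \<Rightarrow> complex) inner_module" where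
  "completion = \<lparr>carrier = {F. \<exists>X. repr F X}, mult = undefined, one = undefined, zero = (\<lambda>_. 0),
     add = (\<lambda>F F' i. F i + F' i), smult = (\<lambda>c F i. c * F i), hinner = hip\<rparr>"

lemma completion_simps [simp]:
  "carrier completion = {F. \<exists>X. repr F X}" "\<zero>\<^bsub>completion\<^esub> = (\<lambda>_. 0)"
  "F \<oplus>\<^bsub>completion\<^esub> F' = (\<lambda>i. F i + F' i)" "c \<odot>\<^bsub>completion\<^esub> F = (\<lambda>i. c * F i)"
  "hinner completion = hip"
  by (simp_all add: completion_def)

lemma repr_zero: "repr (\<lambda>_. 0) (\<lambda>_. [])"
  by (auto simp: repr_def cauchy_seq_def)

lemma module_completion: "module complex_ring completion"
proof (rule moduleI[OF cring_complex_ring])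
  show "abelian_group completion"
  proof (rule abelian_groupI)
    fix F assume "F \<in> carrier completion"
    then obtain X where "repr F X" by auto
    from repr_scale[OF this, of "-1"]
    show "\<exists>F'\<in>carrier completion. F' \<oplus>\<^bsub>completion\<^esub> F = \<zero>\<^bsub>completion\<^esub>"
      by (intro bexI[of _ "\<lambda>i. -1 * F i"]) auto
  qed (auto intro: repr_add repr_zero simp: add_ac)
qed (auto intro: repr_scale simp: algebra_simps)

lemma completion_minus:
  assumes "F \<in> carrier completion" "F' \<in> carrier completion"
  shows "F \<ominus>\<^bsub>completion\<^esub> F' = (\<lambda>i. F i - F' i)"
proof -
  interpret module complex_ring completion by (rule module_completion)
  have "(\<lambda>i. - F' i) \<in> carrier completion"
    using assms repr_scale[of F' _ "-1"] by auto
  then have "\<ominus>\<^bsub>completion\<^esub> F' = (\<lambda>i. - F' i)"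
    using assms by (intro minus_equality) auto
  then show ?thesis by (simp add: a_minus_def)
qed

lemma hnorm_completion:
  assumes "repr F X"
  shows "(\<lambda>n. knorm (X n)) \<longlonglongrightarrow> hnorm completion F"
  using hip_lim[OF assms assms] unfolding knorm_def hnorm_def
  by (intro tendsto_real_sqrt tendsto_Re) simp

lemma hnorm_completion_triangle:
  assumes "F \<in> carrier completion" "F' \<in> carrier completion" "F'' \<in> carrier completion"
  shows "hnorm completion (\<lambda>i. F i - F'' i) \<le>
    hnorm completion (\<lambda>i. F i - F' i) + hnorm completion (\<lambda>i. F' i - F'' i)"
proof -
  obtain X Y Z where XYZ: "repr F X" "repr F' Y" "repr F'' Z" using assms by auto
  have "knorm (ldiff (X n) (Z n)) \<le> knorm (ldiff (X n) (Y n)) + knorm (ldiff (Y n) (Z n))" for n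
    using XYZ by (intro knorm_triangle repr_valid)
  then show ?thesis
    by (intro tendsto_le[OF _ tendsto_add[OF hnorm_completion[OF repr_diff[OF XYZ(1,2)]]
      hnorm_completion[OF repr_diff[OF XYZ(2,3)]]] hnorm_completion[OF repr_diff[OF XYZ(1,3)]]]) auto
qed

lemma hnorm_completion_commute:
  assumes "F \<in> carrier completion" "F' \<in> carrier completion"
  shows "hnorm completion (\<lambda>i. F i - F' i) = hnorm completion (\<lambda>i. F' i - F i)"
proof -
  obtain X Y where XY: "repr F X" "repr F' Y" using assms by auto
  show ?thesis
    using hnorm_completion[OF repr_diff[OF XY]] hnorm_completion[OF repr_diff[OF XY(2,1)]]
    by (simp add: knorm_ldiff_commute[of "Y _"] LIMSEQ_unique)
qed

lemma embed_approx:
  assumes X: "repr F X" and e: "e > 0"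
  shows "\<exists>N. \<forall>m\<ge>N. hnorm completion (\<lambda>i. F i - embed (X m) i) \<le> e"
proof -
  obtain N where N: "\<And>m n. m \<ge> N \<Longrightarrow> n \<ge> N \<Longrightarrow> knorm (ldiff (X m) (X n)) < e"
    using X e unfolding repr_def cauchy_seq_def by metis
  have "hnorm completion (\<lambda>i. F i - embed (X m) i) \<le> e" if "m \<ge> N" for m
  proof (rule LIMSEQ_le_const2)
    show "(\<lambda>n. knorm (ldiff (X n) (X m))) \<longlonglongrightarrow> hnorm completion (\<lambda>i. F i - embed (X m) i)"
      by (intro hnorm_completion repr_diff X repr_embed repr_valid[OF X])
    show "\<exists>M. \<forall>n\<ge>M. knorm (ldiff (X n) (X m)) \<le> e" using N[OF _ that] less_imp_le by blast
  qed
  then show ?thesis by blast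
qed

text \<open>Every \<open>s n\<close> is replaced by an embedded finite combination
  \<open>x n\<close> at distance at most \<open>1 / (n + 1)\<close>. The sequence \<open>x\<close>
  is Cauchy in the seminorm, so it represents an element of the completion, and that element is the
  limit.\<close>

lemma complete_completion:
  assumes s: "\<And>n. s n \<in> carrier completion"
    and cau: "\<And>e. e > 0 \<Longrightarrow> \<exists>N::nat. \<forall>m\<ge>N. \<forall>n\<ge>N. hnorm completion (\<lambda>i. s m i - s n i) < e"
  shows "\<exists>L\<in>carrier completion. (\<lambda>n. hnorm completion (\<lambda>i. s n i - L i)) \<longlonglongrightarrow> 0"
proof -
  have "\<exists>x. valid x \<and> hnorm completion (\<lambda>i. s n i - embed x i) \<le> 1 / real (Suc n)" for n
  proof -
    obtain X where X: "repr (s n) X" using s[of n] by auto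
    then obtain N where "hnorm completion (\<lambda>i. s n i - embed (X N) i) \<le> 1 / real (Suc n)"
      using embed_approx[of "s n" X "1 / real (Suc n)"] by auto
    then show ?thesis using repr_valid[OF X, of N] by blast
  qed
  then obtain x where x: "\<And>n. valid (x n)"
    "\<And>n. hnorm completion (\<lambda>i. s n i - embed (x n) i) \<le> 1 / real (Suc n)" by metis
  have ex: "embed (x n) \<in> carrier completion" for n using repr_embed[OF x(1)] by auto
  have diff: "hnorm completion (\<lambda>i. embed (x m) i - embed (x n) i) = knorm (ldiff (x m) (x n))" for m n
    using hnorm_completion[OF repr_diff[OF repr_embed[OF x(1)[of m]] repr_embed[OF x(1)[of n]]]]
    by (simp add: LIMSEQ_const_iff)
  have small: "\<exists>N. \<forall>n\<ge>N. 1 / real (Suc n) < e" if e: "e > 0" for e :: real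
  proof -
    obtain N where "inverse (real (Suc N)) < e" using reals_Archimedean[OF e] by auto
    moreover have "1 / real (Suc n) \<le> inverse (real (Suc N))" if "n \<ge> N" for n
      using that by (simp add: divide_simps)
    ultimately show ?thesis by (meson order_le_less_trans)
  qed
  have cx: "cauchy_seq x"
    unfolding cauchy_seq_def
  proof (intro conjI allI impI x)
    fix e :: real assume e: "e > 0"
    then obtain N where N: "\<And>n. n \<ge> N \<Longrightarrow> 1 / real (Suc n) < e / 3" using small[of "e / 3"] by auto
    obtain M where M: "\<And>m n. m \<ge> M \<Longrightarrow> n \<ge> M \<Longrightarrow> hnorm completion (\<lambda>i. s m i - s n i) < e / 3"
      using cau[of "e / 3"] e by auto
    have "knorm (ldiff (x m) (x n)) < e" if mn: "m \<ge> max N M" "n \<ge> max N M" for m n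
    proof -
      have "hnorm completion (\<lambda>i. embed (x m) i - embed (x n) i) \<le>
         hnorm completion (\<lambda>i. s m i - embed (x m) i) + (hnorm completion (\<lambda>i. s m i - s n i)
         + hnorm completion (\<lambda>i. s n i - embed (x n) i))"
        using hnorm_completion_triangle[OF ex[of m] s[of m] ex[of n]]
          hnorm_completion_triangle[OF s[of m] s[of n] ex[of n]]
          hnorm_completion_commute[OF ex[of m] s[of m]] by linarith
      then show ?thesis using x(2)[of m] x(2)[of n] N[of m] N[of n] M[of m n] mn
        unfolding diff by simp
    qed
    then show "\<exists>N. \<forall>m\<ge>N. \<forall>n\<ge>N. knorm (ldiff (x m) (x n)) < e" by blast
  qed
  define L where "L i = (if i \<in> I then lim (\<lambda>n. kip k [(1, i)] (x n)) else 0)" for i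
  have "repr L x"
    unfolding repr_def
  proof (intro conjI ballI cx)
    fix i assume i: "i \<in> I"
    have "cauchy_seq (\<lambda>n. [(1, i)])" using i by (simp add: cauchy_seq_def)
    from kip_Cauchy[OF this cx] show "(\<lambda>n. kip k [(1, i)] (x n)) \<longlonglongrightarrow> L i"
      using i by (simp add: L_def convergent_LIMSEQ_iff)
  qed (simp add: L_def)
  then have L: "L \<in> carrier completion" by auto
  have "(\<lambda>n. hnorm completion (\<lambda>i. s n i - L i)) \<longlonglongrightarrow> 0"
  proof (rule LIMSEQ_I)
    fix e :: real assume e: "e > 0"
    obtain N where N: "\<And>n. n \<ge> N \<Longrightarrow> 1 / real (Suc n) < e / 2" using small[of "e / 2"] e by auto
    obtain M where M: "\<And>n. n \<ge> M \<Longrightarrow> hnorm completion (\<lambda>i. L i - embed (x n) i) \<le> e / 3"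
      using embed_approx[OF \<open>repr L x\<close>, of "e / 3"] e by auto
    have "norm (hnorm completion (\<lambda>i. s n i - L i) - 0) < e" if n: "n \<ge> max N M" for n
    proof -
      have "hnorm completion (\<lambda>i. s n i - L i) \<le>
        hnorm completion (\<lambda>i. s n i - embed (x n) i) + hnorm completion (\<lambda>i. L i - embed (x n) i)"
        using hnorm_completion_triangle[OF s[of n] ex[of n] L] hnorm_completion_commute[OF L ex[of n]]
        by simp
      moreover have "0 \<le> hnorm completion (\<lambda>i. s n i - L i)"
      proof -
        obtain X where X: "repr (\<lambda>i. s n i - L i) X"
          using s[of n] repr_diff[OF _ \<open>repr L x\<close>] by auto
        show ?thesis
          by (rule LIMSEQ_le_const[OF hnorm_completion[OF X]]) (use repr_valid[OF X] in auto)
      qed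
      ultimately show ?thesis using x(2)[of n] N[of n] M[of n] n e by simp
    qed
    then show "\<exists>no. \<forall>n\<ge>no. norm (hnorm completion (\<lambda>i. s n i - L i) - 0) < e" by blast
  qed
  then show ?thesis using L by blast
qed

lemma complex_hilbert_completion: "complex_hilbert completion"
proof (rule complex_hilbert.intro[OF module_completion], unfold_locales)
  fix F F' F'' :: "'i \<Rightarrow> complex" and c :: complex
  assume "F \<in> carrier completion" "F' \<in> carrier completion"
  then obtain X Y where XY: "repr F X" "repr F' Y" by auto
  show "hinner completion F (c \<odot>\<^bsub>completion\<^esub> F') = c * hinner completion F F'"
    using LIMSEQ_unique[OF hip_lim[OF XY(1) repr_scale[OF XY(2), of c]]]
      tendsto_mult_left[OF hip_lim[OF XY], of c] by simp
  show "hinner completion F' F = cnj (hinner completion F F')"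
  proof (rule LIMSEQ_unique)
    show "(\<lambda>n. cnj (kip k (X n) (Y n))) \<longlonglongrightarrow> cnj (hinner completion F F')"
      using hip_lim[OF XY] by (simp add: tendsto_cnj)
    show "(\<lambda>n. cnj (kip k (X n) (Y n))) \<longlonglongrightarrow> hinner completion F' F"
      using hip_lim[OF XY(2,1)] kip_sym[OF repr_valid[OF XY(1)] repr_valid[OF XY(2)]] by simp
  qed
  assume "F'' \<in> carrier completion"
  then obtain Z where Z: "repr F'' Z" by auto
  show "hinner completion F (F' \<oplus>\<^bsub>completion\<^esub> F'') = hinner completion F F' + hinner completion F F''"
    using LIMSEQ_unique[OF hip_lim[OF XY(1) repr_add[OF XY(2) Z]]]
      tendsto_add[OF hip_lim[OF XY] hip_lim[OF XY(1) Z]] by simp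
next
  fix F assume "F \<in> carrier completion"
  then obtain X where X: "repr F X" by auto
  show "0 \<le> Re (hinner completion F F)"
    using pos[OF repr_valid[OF X]]
    by (intro LIMSEQ_le_const[OF tendsto_Re[OF hip_lim[OF X X, folded completion_simps]]]) auto
  assume 0: "hinner completion F F = 0"
  \<comment> \<open>Definiteness holds because an element is the family of its coordinates: if the
    seminorms of a representing sequence tend to \<open>0\<close>, so do the coordinates, by
    Cauchy-Schwarz.\<close>
  have "F i = 0" if i: "i \<in> I" for i
  proof -
    have "(\<lambda>n. knorm (X n)) \<longlonglongrightarrow> 0"
      using hnorm_completion[OF X] 0 by (simp add: hnorm_def)
    from tendsto_mult_left[OF this, of "knorm [(1, i)]"]
    have "(\<lambda>n. knorm [(1, i)] * knorm (X n)) \<longlonglongrightarrow> 0" by simp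
    moreover have "cmod (kip k [(1, i)] (X n)) \<le> knorm [(1, i)] * knorm (X n)" for n
      using i repr_valid[OF X] by (intro kip_CS) auto
    ultimately have "(\<lambda>n. kip k [(1, i)] (X n)) \<longlonglongrightarrow> 0"
      by (intro Lim_null_comparison[of "\<lambda>n. kip k [(1, i)] (X n)"]) (auto intro: always_eventually)
    moreover have "(\<lambda>n. kip k [(1, i)] (X n)) \<longlonglongrightarrow> F i" using X i by (simp add: repr_def)
    ultimately show ?thesis using LIMSEQ_unique by blast
  qed
  moreover have "F i = 0" if "i \<notin> I" for i using X that by (simp add: repr_def)
  ultimately show "F = \<zero>\<^bsub>completion\<^esub>" by auto
next
  fix s assume s: "\<And>n. s n \<in> carrier completion"
    and cau: "\<And>e. e > 0 \<Longrightarrow> \<exists>N::nat. \<forall>m\<ge>N. \<forall>n\<ge>N. hnorm completion (s m \<ominus>\<^bsub>completion\<^esub> s n) < e"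
  then obtain L where "L \<in> carrier completion" "(\<lambda>n. hnorm completion (\<lambda>i. s n i - L i)) \<longlonglongrightarrow> 0"
    using complete_completion[of s] s by (auto simp: completion_minus[OF s s] simp del: completion_simps)
  then show "\<exists>l\<in>carrier completion. (\<lambda>n. hnorm completion (s n \<ominus>\<^bsub>completion\<^esub> l)) \<longlonglongrightarrow> 0"
    using completion_minus[OF s] by (intro bexI[of _ L]) (auto simp del: completion_simps)
qed

end

section \<open>Sums and conjugates of kernels; the inner product as a kernel\<close>

lemma psd_kernel_add:
  assumes "psd_kernel I k" "psd_kernel I k'"
  shows "psd_kernel I (\<lambda>i j. k i j + k' i j)"
proof
  fix xs :: "(complex \<times> 'a) list" assume xs: "set xs \<subseteq> UNIV \<times> I"
  have "kip (\<lambda>i j. k i j + k' i j) xs xs = kip k xs xs + kip k' xs xs"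
    by (simp add: kip_def distrib_left sum_list_addf)
  then show "0 \<le> Re (kip (\<lambda>i j. k i j + k' i j) xs xs)"
    using psd_kernel.pos[OF assms(1) xs] psd_kernel.pos[OF assms(2) xs] by simp
next
  fix i j assume "i \<in> I" "j \<in> I"
  then show "k j i + k' j i = cnj (k i j + k' i j)"
    using psd_kernel.herm[OF assms(1), of i j] psd_kernel.herm[OF assms(2), of i j] by simp
qed

lemma psd_kernel_cnj:
  assumes "psd_kernel I k"
  shows "psd_kernel I (\<lambda>i j. cnj (k i j))"
proof
  fix xs :: "(complex \<times> 'a) list" assume "set xs \<subseteq> UNIV \<times> I"
  then have v: "set (map (\<lambda>p. (cnj (fst p), snd p)) xs) \<subseteq> UNIV \<times> I" by auto
  have "kip (\<lambda>i j. cnj (k i j)) xs xs =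
      cnj (kip k (map (\<lambda>p. (cnj (fst p), snd p)) xs) (map (\<lambda>p. (cnj (fst p), snd p)) xs))"
    by (simp add: kip_def o_def sum_list_cnj)
  then show "0 \<le> Re (kip (\<lambda>i j. cnj (k i j)) xs xs)"
    using psd_kernel.pos[OF assms v] by simp
next
  fix i j assume "i \<in> I" "j \<in> I"
  then show "cnj (k j i) = cnj (cnj (k i j))"
    using psd_kernel.herm[OF assms, of i j] by simp
qed

lemma psd_kernel_one: "psd_kernel I (\<lambda>_ _. 1)"
proof
  fix xs :: "(complex \<times> 'a) list"
  have "kip (\<lambda>_ _. 1) xs xs = cnj (\<Sum>p\<leftarrow>xs. fst p) * (\<Sum>p\<leftarrow>xs. fst p)"
    by (simp add: kip_def sum_list_const_mult sum_list_mult_const sum_list_cnj o_def)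
  then show "0 \<le> Re (kip (\<lambda>_ _. 1) xs xs)" by simp
qed simp

context complex_hilbert
begin

primrec lincomb :: "(complex \<times> 'h) list \<Rightarrow> 'h" where
  "lincomb [] = \<zero>"
| "lincomb (p # xs) = fst p \<odot> snd p \<oplus> lincomb xs"

lemma lincomb_closed: "set xs \<subseteq> UNIV \<times> carrier H \<Longrightarrow> lincomb xs \<in> carrier H"
  by (induction xs) (auto simp: smult_in)

lemma hinner_lincomb_right:
  "\<lbrakk>v \<in> carrier H; set xs \<subseteq> UNIV \<times> carrier H\<rbrakk> \<Longrightarrow>
    hinner H v (lincomb xs) = (\<Sum>p\<leftarrow>xs. fst p * hinner H v (snd p))"
  by (induction xs) (auto simp: hinner_zero hinner_add hinner_smult smult_in lincomb_closed)

lemma hinner_lincomb_left: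
  assumes "v \<in> carrier H" "set xs \<subseteq> UNIV \<times> carrier H"
  shows "hinner H (lincomb xs) v = (\<Sum>p\<leftarrow>xs. cnj (fst p) * hinner H (snd p) v)"
proof -
  have "hinner H (lincomb xs) v = cnj (\<Sum>p\<leftarrow>xs. fst p * hinner H v (snd p))"
    using hinner_cnj[of v "lincomb xs"] assms by (simp add: lincomb_closed hinner_lincomb_right)
  also have "\<dots> = (\<Sum>p\<leftarrow>xs. cnj (fst p) * hinner H (snd p) v)"
    unfolding sum_list_cnj map_map using assms
    by (intro arg_cong[of _ _ sum_list] map_cong) (auto simp: hinner_cnj[of v])
  finally show ?thesis .
qed

lemma hinner_lincomb:
  assumes "set xs \<subseteq> UNIV \<times> carrier H" "set ys \<subseteq> UNIV \<times> carrier H"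
  shows "hinner H (lincomb xs) (lincomb ys) = kip (hinner H) xs ys"
proof -
  have "hinner H (lincomb xs) (lincomb ys) = (\<Sum>p\<leftarrow>xs. cnj (fst p) * hinner H (snd p) (lincomb ys))"
    by (rule hinner_lincomb_left) (use assms lincomb_closed in auto)
  also have "\<dots> = kip (hinner H) xs ys"
    unfolding kip_def using assms
    by (intro arg_cong[of _ _ sum_list] map_cong)
       (auto simp: hinner_lincomb_right mult.assoc simp flip: sum_list_const_mult)
  finally show ?thesis .
qed

text \<open>A Hilbert space is viewed as a kernel on its own carrier, which turns computations with
  norms and distances into expansions of \<open>kip\<close>.\<close>

lemma psd_kernel_hinner: "psd_kernel (carrier H) (hinner H)"
proof
  fix xs :: "(complex \<times> 'h) list" assume "set xs \<subseteq> UNIV \<times> carrier H"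
  then show "0 \<le> Re (kip (hinner H) xs xs)"
    using hinner_nonneg[OF lincomb_closed, of xs] hinner_lincomb[of xs xs] by simp
qed (rule hinner_cnj)

end

section \<open>Invariant kernels and their unitary representations\<close>

definition lact :: "('i \<Rightarrow> 'i) \<Rightarrow> (complex \<times> 'i) list \<Rightarrow> (complex \<times> 'i) list" where
  "lact f xs = map (\<lambda>p. (fst p, f (snd p))) xs"

locale invariant_kernel = group G + psd_kernel I k
  for G :: "('a, 'm) monoid_scheme" (structure) and I :: "'i set" and k +
  fixes act :: "'a \<Rightarrow> 'i \<Rightarrow> 'i"
  assumes act_closed: "\<lbrakk>g \<in> carrier G; i \<in> I\<rbrakk> \<Longrightarrow> act g i \<in> I"
    and act_mult: "\<lbrakk>g \<in> carrier G; h \<in> carrier G; i \<in> I\<rbrakk> \<Longrightarrow> act (g \<otimes>\<^bsub>G\<^esub> h) i = act g (act h i)"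
    and act_one: "i \<in> I \<Longrightarrow> act \<one>\<^bsub>G\<^esub> i = i"
    and act_invariant: "\<lbrakk>g \<in> carrier G; i \<in> I; j \<in> I\<rbrakk> \<Longrightarrow> k (act g i) (act g j) = k i j"
begin

lemma act_inv: "\<lbrakk>g \<in> carrier G; i \<in> I\<rbrakk> \<Longrightarrow> act g (act (inv g) i) = i"
  "\<lbrakk>g \<in> carrier G; i \<in> I\<rbrakk> \<Longrightarrow> act (inv g) (act g i) = i"
  using act_mult[of g "inv g" i] act_mult[of "inv g" g i] act_one by simp_all

lemma lact_valid: "\<lbrakk>g \<in> carrier G; valid xs\<rbrakk> \<Longrightarrow> valid (lact (act g) xs)"
  using act_closed by (auto simp: lact_def)

lemma kip_lact:
  assumes "g \<in> carrier G" "valid xs" "valid ys"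
  shows "kip k (lact (act g) xs) (lact (act g) ys) = kip k xs ys"
proof -
  have "kip k (lact (act g) xs) (lact (act g) ys) = kip (\<lambda>i j. k (act g i) (act g j)) xs ys"
    by (simp add: kip_def lact_def o_def)
  also have "\<dots> = kip k xs ys" using assms by (intro kip_cong act_invariant) auto
  finally show ?thesis .
qed

lemma lact_ldiff: "lact f (ldiff xs ys) = ldiff (lact f xs) (lact f ys)"
  by (simp add: lact_def ldiff_def lscale_def)

lemma knorm_lact: "\<lbrakk>g \<in> carrier G; valid xs\<rbrakk> \<Longrightarrow> knorm (lact (act g) xs) = knorm xs"
  by (simp add: knorm_def kip_lact)

text \<open>In coordinates the action is translation by the inverse, since pairing \<open>i\<close>
  with the translate of \<open>F\<close> equals pairing \<open>act (inv g) i\<close> with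
  \<open>F\<close>.\<close>

definition kact :: "'a \<Rightarrow> ('i \<Rightarrow> complex) \<Rightarrow> 'i \<Rightarrow> complex" where
  "kact g F = (\<lambda>i. if i \<in> I then F (act (inv g) i) else 0)"

lemma repr_kact:
  assumes g: "g \<in> carrier G" and X: "repr F X"
  shows "repr (kact g F) (\<lambda>n. lact (act g) (X n))"
  unfolding repr_def
proof (intro conjI ballI)
  have v: "valid (X n)" for n using X by (rule repr_valid)
  have "knorm (ldiff (lact (act g) (X m)) (lact (act g) (X n))) = knorm (ldiff (X m) (X n))" for m n
    using knorm_lact[OF g, of "ldiff (X m) (X n)"] v by (simp add: lact_ldiff set_ldiff)
  then show "cauchy_seq (\<lambda>n. lact (act g) (X n))"
    using X lact_valid[OF g v] by (simp add: repr_def cauchy_seq_def)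
  fix i assume i: "i \<in> I"
  then have gi: "act (inv g) i \<in> I" using g act_closed by simp
  have "kip k [(1, i)] (lact (act g) (X n)) = kip k [(1, act (inv g) i)] (X n)" for n
    using kip_lact[OF g, of "[(1, act (inv g) i)]" "X n"] gi v i g by (simp add: lact_def act_inv)
  then show "(\<lambda>n. kip k [(1, i)] (lact (act g) (X n))) \<longlonglongrightarrow> kact g F i"
    using X gi i by (simp add: repr_def kact_def)
qed (simp add: kact_def)

lemma unitary_rep_completion: "unitary_rep G completion kact"
  unfolding unitary_rep_def
proof (intro conjI ballI allI)
  fix g assume g: "g \<in> carrier G"
  have closed: "kact g F \<in> carrier completion" if "F \<in> carrier completion" "g \<in> carrier G" for F g
    using that repr_kact by auto
  have off: "F i = 0" if "F \<in> carrier completion" "i \<notin> I" for F i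
    using that by (auto simp: repr_def)
  show "bij_betw (kact g) (carrier completion) (carrier completion)"
  proof (rule bij_betwI[where g = "kact (inv g)"])
    show "kact (inv g) (kact g F) = F" if "F \<in> carrier completion" for F
      using off[OF that] g by (auto simp: kact_def act_inv act_closed)
    show "kact g (kact (inv g) F) = F" if "F \<in> carrier completion" for F
      using off[OF that] g by (auto simp: kact_def act_inv act_closed)
  qed (use closed g in \<open>auto simp del: completion_simps\<close>)
  fix F F' assume "F \<in> carrier completion" "F' \<in> carrier completion"
  then obtain X Y where XY: "repr F X" "repr F' Y" by auto
  show "hinner completion (kact g F) (kact g F') = hinner completion F F'"
    using hip_lim[OF repr_kact[OF g XY(1)] repr_kact[OF g XY(2)]] hip_lim[OF XY]
    by (simp add: kip_lact[OF g repr_valid[OF XY(1)] repr_valid[OF XY(2)]] LIMSEQ_unique)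
next
  fix g h F assume "g \<in> carrier G" "h \<in> carrier G"
  then show "kact (g \<otimes>\<^bsub>G\<^esub> h) F = kact g (kact h F)"
    by (auto simp: kact_def inv_mult_group act_mult act_closed)
qed (auto simp: kact_def)

text \<open>The GNS construction: the group permutes the generators and preserves the kernel, so it
  acts unitarily on the completion, and the coefficients at embedded finite combinations are already
  given by \<open>kip\<close>. All members of the Fourier-Stieltjes algebra that are not visibly
  coefficients are obtained in this way.\<close>

lemma invariant_kernel_fourier_stieltjes:
  assumes xs: "valid xs" and ys: "valid ys"
  shows "(\<lambda>g. if g \<in> carrier G then kip k xs (lact (act g) ys) else 0) \<in> fourier_stieltjes G"
proof -
  have "hip (embed xs) (kact g (embed ys)) = kip k xs (lact (act g) ys)" if g: "g \<in> carrier G" for g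
    using hip_lim[OF repr_embed[OF xs] repr_kact[OF g repr_embed[OF ys]]]
    by (simp add: LIMSEQ_const_iff)
  then have "matrix_coeff G completion kact (embed xs) (embed ys) =
      (\<lambda>g. if g \<in> carrier G then kip k xs (lact (act g) ys) else 0)"
    by (auto simp: matrix_coeff_def)
  moreover have "matrix_coeff G completion kact (embed xs) (embed ys) \<in> fourier_stieltjes G"
    by (rule fourier_stieltjesI[OF _ complex_hilbert_completion unitary_rep_completion])
       (use repr_embed xs ys is_group in auto)
  ultimately show ?thesis by simp
qed

corollary kernel_fourier_stieltjes:
  assumes "i \<in> I" "j \<in> I"
  shows "(\<lambda>g. if g \<in> carrier G then k i (act g j) else 0) \<in> fourier_stieltjes G"
  using invariant_kernel_fourier_stieltjes[of "[(1, i)]" "[(1, j)]"] assms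
  by (simp add: kip_def lact_def cong: if_cong)

end

section \<open>Unitary representations\<close>

locale hilbert_rep = group G + complex_hilbert H
  for G :: "('a, 'm) monoid_scheme" and H :: "('h, 'n) inner_module_scheme" (structure) +
  fixes \<pi> :: "'a \<Rightarrow> 'h \<Rightarrow> 'h"
  assumes rep: "unitary_rep G H \<pi>"
begin

lemma rep_closed: "\<lbrakk>g \<in> carrier G; u \<in> carrier H\<rbrakk> \<Longrightarrow> \<pi> g u \<in> carrier H"
  using rep by (fastforce simp: unitary_rep_def bij_betw_def)

lemma rep_add: "\<lbrakk>g \<in> carrier G; u \<in> carrier H; v \<in> carrier H\<rbrakk> \<Longrightarrow> \<pi> g (u \<oplus> v) = \<pi> g u \<oplus> \<pi> g v"
  and rep_smult: "\<lbrakk>g \<in> carrier G; u \<in> carrier H\<rbrakk> \<Longrightarrow> \<pi> g (c \<odot> u) = c \<odot> \<pi> g u"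
  and rep_inner: "\<lbrakk>g \<in> carrier G; u \<in> carrier H; v \<in> carrier H\<rbrakk> \<Longrightarrow>
        hinner H (\<pi> g u) (\<pi> g v) = hinner H u v"
  and rep_mult: "\<lbrakk>g \<in> carrier G; h \<in> carrier G; u \<in> carrier H\<rbrakk> \<Longrightarrow> \<pi> (g \<otimes>\<^bsub>G\<^esub> h) u = \<pi> g (\<pi> h u)"
  using rep by (auto simp: unitary_rep_def)

lemma rep_one: "u \<in> carrier H \<Longrightarrow> \<pi> \<one>\<^bsub>G\<^esub> u = u"
proof -
  assume u: "u \<in> carrier H"
  have "\<pi> \<one>\<^bsub>G\<^esub> (\<pi> \<one>\<^bsub>G\<^esub> u) = \<pi> \<one>\<^bsub>G\<^esub> u"
    using rep_mult[of "\<one>\<^bsub>G\<^esub>" "\<one>\<^bsub>G\<^esub>" u] u by simp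
  moreover have "inj_on (\<pi> \<one>\<^bsub>G\<^esub>) (carrier H)"
    using rep by (auto simp: unitary_rep_def bij_betw_def)
  ultimately show ?thesis using u rep_closed[of "\<one>\<^bsub>G\<^esub>" u] by (auto dest: inj_onD)
qed

lemma rep_inv: "\<lbrakk>g \<in> carrier G; u \<in> carrier H\<rbrakk> \<Longrightarrow> \<pi> g (\<pi> (inv\<^bsub>G\<^esub> g) u) = u"
  "\<lbrakk>g \<in> carrier G; u \<in> carrier H\<rbrakk> \<Longrightarrow> \<pi> (inv\<^bsub>G\<^esub> g) (\<pi> g u) = u"
  using rep_mult[of g "inv\<^bsub>G\<^esub> g" u] rep_mult[of "inv\<^bsub>G\<^esub> g" g u] rep_one by simp_all

lemma rep_adjoint:
  assumes "g \<in> carrier G" "u \<in> carrier H" "v \<in> carrier H"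
  shows "hinner H u (\<pi> g v) = hinner H (\<pi> (inv\<^bsub>G\<^esub> g) u) v"
  using rep_inner[of g "\<pi> (inv\<^bsub>G\<^esub> g) u" v] rep_closed rep_inv assms by simp

text \<open>A representation is an invariant kernel on its own space, so orbits can be averaged as
  formal combinations inside any representation.\<close>

sublocale K: invariant_kernel G "carrier H" "hinner H" \<pi>
  by (rule invariant_kernel.intro[OF is_group psd_kernel_hinner])
     (unfold_locales, auto intro: rep_closed rep_mult rep_one rep_inner)

lemma matrix_coeff_in: "\<lbrakk>y \<in> carrier H; x \<in> carrier H\<rbrakk> \<Longrightarrow> matrix_coeff G H \<pi> y x \<in> fourier_stieltjes G"
  by (rule fourier_stieltjesI[OF is_group complex_hilbert_axioms rep])

end

lemma fourier_stieltjesE: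
  fixes G :: "('a, 'm) monoid_scheme"
  assumes "group G" "\<phi> \<in> fourier_stieltjes G"
  obtains H :: "('a \<Rightarrow> complex) inner_module" and \<pi> x y where
    "hilbert_rep G H \<pi>" "x \<in> carrier H" "y \<in> carrier H"
    "\<phi> = matrix_coeff G H \<pi> y x"
proof -
  from assms(2) obtain H :: "('a \<Rightarrow> complex) inner_module" and \<pi> x y where H:
    "complex_hilbert H" "unitary_rep G H \<pi>" "x \<in> carrier H" "y \<in> carrier H"
    "\<phi> = matrix_coeff G H \<pi> y x"
    unfolding fourier_stieltjes_def by blast
  then have "hilbert_rep G H \<pi>"
    using assms(1) by (simp add: hilbert_rep_def hilbert_rep_axioms_def)
  with that H show thesis by blast
qed

section \<open>Closure properties of the Fourier-Stieltjes algebra\<close>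

definition rtrans :: "('a, 'm) monoid_scheme \<Rightarrow> 'a \<Rightarrow> ('a \<Rightarrow> complex) \<Rightarrow> 'a \<Rightarrow> complex" where
  "rtrans G s \<phi> = (\<lambda>g. if g \<in> carrier G then \<phi> (g \<otimes>\<^bsub>G\<^esub> s) else 0)"

context group
begin

lemma fourier_stieltjes_one: "indicator (carrier G) \<in> fourier_stieltjes G"
proof -
  interpret K: psd_kernel "UNIV :: unit set" "\<lambda>_ _. 1" by (rule psd_kernel_one)
  interpret K: invariant_kernel G "UNIV :: unit set" "\<lambda>_ _. 1" "\<lambda>_ u. u" by unfold_locales auto
  have "(\<lambda>g. if g \<in> carrier G then 1 else 0) \<in> fourier_stieltjes G"
    using K.kernel_fourier_stieltjes[of "()" "()"] by simp
  moreover have "(\<lambda>g. if g \<in> carrier G then 1 else 0) = (indicator (carrier G) :: 'a \<Rightarrow> complex)" by auto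
  ultimately show ?thesis by simp
qed

lemma fourier_stieltjes_scale:
  assumes "\<phi> \<in> fourier_stieltjes G"
  shows "(\<lambda>g. c * \<phi> g) \<in> fourier_stieltjes G"
proof -
  obtain H :: "('a \<Rightarrow> complex) inner_module" and \<pi> x y where H:
    "hilbert_rep G H \<pi>" "x \<in> carrier H" "y \<in> carrier H"
    "\<phi> = matrix_coeff G H \<pi> y x"
    using fourier_stieltjesE[OF is_group assms] .
  interpret hilbert_rep G H \<pi> by (rule H)
  have "(\<lambda>g. c * \<phi> g) = matrix_coeff G H \<pi> y (c \<odot>\<^bsub>H\<^esub> x)"
    using H by (auto simp: matrix_coeff_def rep_smult hinner_smult rep_closed)
  then show ?thesis using H matrix_coeff_in smult_in by simp
qed

text \<open>Conjugating the kernel on the same index set, with the same action, plays the role of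
  the conjugate Hilbert space.\<close>

lemma fourier_stieltjes_cnj:
  assumes "\<phi> \<in> fourier_stieltjes G"
  shows "(\<lambda>g. cnj (\<phi> g)) \<in> fourier_stieltjes G"
proof -
  obtain H :: "('a \<Rightarrow> complex) inner_module" and \<pi> x y where H:
    "hilbert_rep G H \<pi>" "x \<in> carrier H" "y \<in> carrier H"
    "\<phi> = matrix_coeff G H \<pi> y x"
    using fourier_stieltjesE[OF is_group assms] .
  interpret hilbert_rep G H \<pi> by (rule H)
  interpret C: psd_kernel "carrier H" "\<lambda>u v. cnj (hinner H u v)"
    by (rule psd_kernel_cnj[OF psd_kernel_hinner])
  interpret C: invariant_kernel G "carrier H" "\<lambda>u v. cnj (hinner H u v)" \<pi>
    by unfold_locales (auto intro: rep_closed rep_mult rep_one simp: rep_inner)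
  have "(\<lambda>g. cnj (\<phi> g)) = (\<lambda>g. if g \<in> carrier G then cnj (hinner H y (\<pi> g x)) else 0)"
    using H by (auto simp: matrix_coeff_def)
  then show ?thesis using C.kernel_fourier_stieltjes[of y x] H by simp
qed

text \<open>On pairs of vectors, the sum of the two inner products is the kernel of the direct sum,
  and their product is that of the tensor product of elementary tensors; positivity of the latter is
  the Schur product theorem.\<close>

lemma fourier_stieltjes_combine:
  assumes \<phi>: "\<phi> \<in> fourier_stieltjes G" and \<psi>: "\<psi> \<in> fourier_stieltjes G"
  shows fourier_stieltjes_add: "(\<lambda>g. \<phi> g + \<psi> g) \<in> fourier_stieltjes G"
    and fourier_stieltjes_mult: "(\<lambda>g. \<phi> g * \<psi> g) \<in> fourier_stieltjes G"
proof -
  obtain H :: "('a \<Rightarrow> complex) inner_module" and \<pi> x y where H: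
    "hilbert_rep G H \<pi>" "x \<in> carrier H" "y \<in> carrier H"
    "\<phi> = matrix_coeff G H \<pi> y x"
    using fourier_stieltjesE[OF is_group \<phi>] .
  obtain H' :: "('a \<Rightarrow> complex) inner_module" and \<pi>' x' y' where H':
    "hilbert_rep G H' \<pi>'" "x' \<in> carrier H'" "y' \<in> carrier H'"
    "\<psi> = matrix_coeff G H' \<pi>' y' x'"
    using fourier_stieltjesE[OF is_group \<psi>] .
  interpret R: hilbert_rep G H \<pi> by (rule H)
  interpret R': hilbert_rep G H' \<pi>' by (rule H')
  let ?I = "carrier H \<times> carrier H'"
  let ?act = "\<lambda>g p. (\<pi> g (fst p), \<pi>' g (snd p))"
  have psd: "psd_kernel ?I (\<lambda>p q. hinner H (fst p) (fst q))"
      "psd_kernel ?I (\<lambda>p q. hinner H' (snd p) (snd q))"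
    using psd_kernel_comap[OF R.psd_kernel_hinner, of ?I fst]
      psd_kernel_comap[OF R'.psd_kernel_hinner, of ?I snd] by auto
  interpret A: psd_kernel ?I "\<lambda>p q. hinner H (fst p) (fst q) + hinner H' (snd p) (snd q)"
    by (rule psd_kernel_add[OF psd])
  interpret A: invariant_kernel G ?I "\<lambda>p q. hinner H (fst p) (fst q) + hinner H' (snd p) (snd q)" ?act
    by unfold_locales (auto simp: R.rep_closed R'.rep_closed R.rep_mult R'.rep_mult
      R.rep_one R'.rep_one R.rep_inner R'.rep_inner)
  interpret M: psd_kernel ?I "\<lambda>p q. hinner H (fst p) (fst q) * hinner H' (snd p) (snd q)"
    by (rule psd_kernel_mult[OF psd])
  interpret M: invariant_kernel G ?I "\<lambda>p q. hinner H (fst p) (fst q) * hinner H' (snd p) (snd q)" ?act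
    by unfold_locales (auto simp: R.rep_closed R'.rep_closed R.rep_mult R'.rep_mult
      R.rep_one R'.rep_one R.rep_inner R'.rep_inner)
  have "(\<lambda>g. \<phi> g + \<psi> g) = (\<lambda>g. if g \<in> carrier G then hinner H y (\<pi> g x) + hinner H' y' (\<pi>' g x') else 0)"
    "(\<lambda>g. \<phi> g * \<psi> g) = (\<lambda>g. if g \<in> carrier G then hinner H y (\<pi> g x) * hinner H' y' (\<pi>' g x') else 0)"
    using H H' by (auto simp: matrix_coeff_def)
  then show "(\<lambda>g. \<phi> g + \<psi> g) \<in> fourier_stieltjes G" "(\<lambda>g. \<phi> g * \<psi> g) \<in> fourier_stieltjes G"
    using A.kernel_fourier_stieltjes[of "(y, y')" "(x, x')"]
      M.kernel_fourier_stieltjes[of "(y, y')" "(x, x')"] H H' by (simp_all cong: if_cong)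
qed

lemma fourier_stieltjes_translate:
  assumes \<phi>: "\<phi> \<in> fourier_stieltjes G" and s: "s \<in> carrier G"
  shows fourier_stieltjes_rtrans: "rtrans G s \<phi> \<in> fourier_stieltjes G"
    and fourier_stieltjes_ltrans: "ltrans G s \<phi> \<in> fourier_stieltjes G"
proof -
  obtain H :: "('a \<Rightarrow> complex) inner_module" and \<pi> x y where H:
    "hilbert_rep G H \<pi>" "x \<in> carrier H" "y \<in> carrier H"
    "\<phi> = matrix_coeff G H \<pi> y x"
    using fourier_stieltjesE[OF is_group \<phi>] .
  interpret R: hilbert_rep G H \<pi> by (rule H)
  have "rtrans G s \<phi> = matrix_coeff G H \<pi> y (\<pi> s x)"
    using H s by (auto simp: matrix_coeff_def rtrans_def R.rep_mult)
  then show "rtrans G s \<phi> \<in> fourier_stieltjes G" using R.matrix_coeff_in R.rep_closed H s by simp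
  have "ltrans G s \<phi> = matrix_coeff G H \<pi> (\<pi> s y) x"
    using H s by (auto simp: matrix_coeff_def ltrans_def R.rep_mult R.rep_adjoint R.rep_closed R.rep_inv)
  then show "ltrans G s \<phi> \<in> fourier_stieltjes G" using R.matrix_coeff_in R.rep_closed H s by simp
qed

lemma fourier_stieltjes_linf:
  assumes \<phi>: "\<phi> \<in> fourier_stieltjes G" shows "\<phi> \<in> linf G"
proof -
  obtain H :: "('a \<Rightarrow> complex) inner_module" and \<pi> x y where H:
    "hilbert_rep G H \<pi>" "x \<in> carrier H" "y \<in> carrier H"
    "\<phi> = matrix_coeff G H \<pi> y x"
    using fourier_stieltjesE[OF is_group \<phi>] .
  interpret R: hilbert_rep G H \<pi> by (rule H)
  have nx: "hnorm H (\<pi> g x) = hnorm H x" if "g \<in> carrier G" for g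
    using that H by (simp add: hnorm_def R.rep_inner)
  have "cmod (\<phi> g) \<le> hnorm H y * hnorm H x" for g
  proof (cases "g \<in> carrier G")
    case True
    then show ?thesis using R.Cauchy_Schwarz[OF H(3) R.rep_closed[OF True H(2)]] nx H
      by (simp add: matrix_coeff_def)
  next
    case False
    then show ?thesis using H R.hinner_nonneg by (simp add: hnorm_def matrix_coeff_def)
  qed
  then have "bounded (range \<phi>)" by (auto intro!: boundedI)
  then show ?thesis using H by (auto simp: linf_def matrix_coeff_def)
qed

end

section \<open>Invariant means on the Fourier-Stieltjes algebra\<close>

definition avg :: "('b \<Rightarrow> complex) \<Rightarrow> 'b list \<Rightarrow> complex" where
  "avg f xs = (\<Sum>x\<leftarrow>xs. f x) / of_nat (length xs)"

lemma avg_close: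
  assumes "xs \<noteq> []" "\<And>x. x \<in> set xs \<Longrightarrow> cmod (f x - z) \<le> \<delta>"
  shows "cmod (avg f xs - z) \<le> \<delta>"
proof -
  have *: "cmod ((\<Sum>x\<leftarrow>xs. f x) - of_nat (length xs) * z) \<le> real (length xs) * \<delta>"
    using assms(2)
  proof (induction xs)
    case (Cons x xs)
    have "(\<Sum>y\<leftarrow>x # xs. f y) - of_nat (length (x # xs)) * z =
        (f x - z) + ((\<Sum>y\<leftarrow>xs. f y) - of_nat (length xs) * z)" by (simp add: algebra_simps)
    also have "cmod \<dots> \<le> \<delta> + real (length xs) * \<delta>"
      using Cons by (intro norm_triangle_mono) auto
    finally show ?case by (simp add: algebra_simps)
  qed simp
  have "avg f xs - z = ((\<Sum>x\<leftarrow>xs. f x) - of_nat (length xs) * z) / of_nat (length xs)"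
    using assms(1) by (simp add: avg_def field_simps)
  then have "cmod (avg f xs - z) = cmod ((\<Sum>x\<leftarrow>xs. f x) - of_nat (length xs) * z) / real (length xs)"
    by (simp add: norm_divide)
  also have "\<dots> \<le> \<delta>" using * assms(1) by (simp add: divide_le_eq mult.commute)
  finally show ?thesis .
qed

lemma avg_cong: "(\<And>x. x \<in> set xs \<Longrightarrow> f x = f' x) \<Longrightarrow> avg f xs = avg f' xs"
  unfolding avg_def by (metis map_eq_conv)

lemma avg_add: "avg (\<lambda>x. f x + f' x) xs = avg f xs + avg f' xs"
  by (simp add: avg_def sum_list_addf add_divide_distrib)

lemma avg_cmult: "avg (\<lambda>x. c * f x) xs = c * avg f xs"
  by (simp add: avg_def sum_list_const_mult)

lemma avg_cnj: "avg (\<lambda>x. cnj (f x)) xs = cnj (avg f xs)"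
  by (simp add: avg_def sum_list_cnj o_def)

lemma avg_map: "avg f (map h xs) = avg (\<lambda>x. f (h x)) xs"
  by (simp add: avg_def o_def)

lemma sum_list_divide: "(\<Sum>x\<leftarrow>xs. f x / c) = (\<Sum>x\<leftarrow>xs. f x) / (c :: complex)"
  by (simp add: divide_inverse sum_list_mult_const)

lemma avg_swap: "avg (\<lambda>x. avg (\<lambda>y. f x y) ys) xs = avg (\<lambda>y. avg (\<lambda>x. f x y) xs) ys"
proof -
  have "(\<Sum>x\<leftarrow>xs. (\<Sum>y\<leftarrow>ys. f x y)) = (\<Sum>y\<leftarrow>ys. (\<Sum>x\<leftarrow>xs. f x y))"
    by (induction xs) (simp_all add: sum_list_addf)
  then show ?thesis by (simp add: avg_def sum_list_divide mult.commute)
qed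

text \<open>Repeating each list as often as the other one is long gives both the same weight, so the
  midpoint of two averages is again the average over a plain list.\<close>

lemma avg_midpoint:
  assumes "xs \<noteq> []" "ys \<noteq> []"
  shows "avg f (concat (replicate (length ys) xs) @ concat (replicate (length xs) ys)) =
    (avg f xs + avg f ys) / 2"
proof -
  have s: "sum_list (map f (concat (replicate n zs))) = of_nat n * sum_list (map f zs)" for n zs
    by (induction n) (simp_all add: algebra_simps)
  have l: "length (concat (replicate n zs)) = n * length zs" for n and zs :: "'a list"
    by (induction n) simp_all
  show ?thesis using assms by (simp add: avg_def s l field_simps)
qed

text \<open>The convolution of the uniform distributions on two lists.\<close>

definition lconv :: "('a, 'm) monoid_scheme \<Rightarrow> 'a list \<Rightarrow> 'a list \<Rightarrow> 'a list" where
  "lconv G ts ss = concat (map (\<lambda>t. map (\<lambda>s. t \<otimes>\<^bsub>G\<^esub> s) ss) ts)"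

lemma avg_lconv: "avg f (lconv G ts ss) = avg (\<lambda>t. avg (\<lambda>s. f (t \<otimes>\<^bsub>G\<^esub> s)) ss) ts"
proof -
  have 1: "sum_list (map f (lconv G ts ss)) = (\<Sum>t\<leftarrow>ts. \<Sum>s\<leftarrow>ss. f (t \<otimes>\<^bsub>G\<^esub> s))"
    by (induction ts) (simp_all add: lconv_def o_def)
  have 2: "length (lconv G ts ss) = length ts * length ss"
    by (induction ts) (simp_all add: lconv_def)
  show ?thesis by (simp add: avg_def sum_list_divide 1 2 mult.commute)
qed

lemma lconv_nonempty: "\<lbrakk>ts \<noteq> []; ss \<noteq> []\<rbrakk> \<Longrightarrow> lconv G ts ss \<noteq> []"
  by (cases ts; cases ss) (auto simp: lconv_def)

text \<open>Such a list encodes a finitely supported probability measure with rational weights,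
  given by multiplicities.\<close>

definition glist :: "('a, 'm) monoid_scheme \<Rightarrow> 'a list \<Rightarrow> bool" where
  "glist G ss \<longleftrightarrow> ss \<noteq> [] \<and> set ss \<subseteq> carrier G"

lemma (in group) glist_lconv: "\<lbrakk>glist G ts; glist G ss\<rbrakk> \<Longrightarrow> glist G (lconv G ts ss)"
  by (auto simp: glist_def lconv_nonempty) (auto simp: lconv_def)

lemma (in group) glist_map: "\<lbrakk>glist G ts; g \<in> carrier G\<rbrakk> \<Longrightarrow> glist G (map (\<lambda>t. g \<otimes> t) ts)"
  by (auto simp: glist_def)

section \<open>Almost invariant averages of an orbit\<close>

context invariant_kernel
begin

definition orb :: "'a list \<Rightarrow> 'i \<Rightarrow> (complex \<times> 'i) list" where
  "orb ss i = map (\<lambda>s. (1 / of_nat (length ss), act s i)) ss"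

lemma orb_valid: "\<lbrakk>glist G ss; i \<in> I\<rbrakk> \<Longrightarrow> valid (orb ss i)"
  using act_closed by (auto simp: orb_def glist_def)

lemma kip_orb: "kip k (orb ss i) zs = avg (\<lambda>s. kip k [(1, act s i)] zs) ss"
proof -
  have "(\<Sum>q\<leftarrow>zs. 1 / of_nat n * fst q * k (act s i) (snd q)) =
      (\<Sum>q\<leftarrow>zs. fst q * k (act s i) (snd q)) / of_nat n" for s and n :: nat
    by (simp flip: sum_list_divide)
  then show ?thesis by (simp add: kip_def orb_def avg_def o_def sum_list_divide)
qed

lemma kip_orb_right:
  assumes "glist G ss" "i \<in> I" "valid zs"
  shows "kip k zs (orb ss i) = avg (\<lambda>s. kip k zs [(1, act s i)]) ss"
proof -
  have "kip k zs (orb ss i) = cnj (kip k (orb ss i) zs)"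
    by (rule kip_sym) (use assms orb_valid in auto)
  also have "\<dots> = avg (\<lambda>s. cnj (kip k [(1, act s i)] zs)) ss" by (simp add: kip_orb avg_cnj)
  also have "\<dots> = avg (\<lambda>s. kip k zs [(1, act s i)]) ss"
    using assms by (intro avg_cong kip_sym[symmetric]) (auto simp: glist_def act_closed subset_iff)
  finally show ?thesis .
qed

lemma lact_orb:
  assumes "glist G ss" "g \<in> carrier G" "i \<in> I"
  shows "lact (act g) (orb ss i) = orb (map (\<lambda>s. g \<otimes> s) ss) i"
  using assms by (auto simp: lact_def orb_def glist_def act_mult subset_iff)

text \<open>The midpoint of two orbit averages is an orbit average, so its squared norm is at least
  \<open>d\<close>; the parallelogram law then bounds the squared distance by
  \<open>2 (d + e) + 2 (d + e) - 4 d\<close>.\<close>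

lemma orb_parallelogram:
  assumes i: "i \<in> I" and ss: "glist G ss" and ts: "glist G ts"
    and d: "\<And>us. glist G us \<Longrightarrow> d \<le> (knorm (orb us i))\<^sup>2"
    and e: "(knorm (orb ss i))\<^sup>2 \<le> d + e" "(knorm (orb ts i))\<^sup>2 \<le> d + e"
  shows "(knorm (ldiff (orb ss i) (orb ts i)))\<^sup>2 \<le> 4 * e"
proof -
  define us where "us = concat (replicate (length ts) ss) @ concat (replicate (length ss) ts)"
  define a where "a = orb ss i"
  define b where "b = orb ts i"
  define c where "c = orb us i"
  have us: "glist G us" using ss ts by (auto simp: us_def glist_def concat_replicate_trivial)
  have v: "valid a" "valid b" "valid c" using orb_valid us ss ts i by (auto simp: a_def b_def c_def)
  have mid: "kip k c zs = (kip k a zs + kip k b zs) / 2" for zs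
    unfolding a_def b_def c_def kip_orb unfolding us_def
    by (rule avg_midpoint) (use ss ts in \<open>auto simp: glist_def\<close>)
  have mid': "kip k zs c = (kip k zs a + kip k zs b) / 2" if "valid zs" for zs
    using mid[of zs] kip_sym[OF that v(1)] kip_sym[OF that v(2)] kip_sym[OF that v(3)]
    by (metis complex_cnj_add complex_cnj_cnj complex_cnj_divide complex_cnj_numeral)
  have "kip k c c = (kip k a a + kip k a b + kip k b a + kip k b b) / 4"
    using v by (simp only: mid mid') (simp add: field_simps)
  then have cc: "(knorm c)\<^sup>2 = (Re (kip k a a) + Re (kip k a b) + Re (kip k b a) + Re (kip k b b)) / 4"
    using v(3) by (simp only: knorm_sq) (simp add: complex_eq_iff)
  have "(knorm (ldiff a b))\<^sup>2 = Re (kip k a a) - Re (kip k a b) - Re (kip k b a) + Re (kip k b b)"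
    using v by (simp add: knorm_sq set_ldiff)
  also have "\<dots> = 2 * (knorm a)\<^sup>2 + 2 * (knorm b)\<^sup>2 - 4 * (knorm c)\<^sup>2"
    using v(1,2) by (simp add: cc knorm_sq field_simps)
  also have "\<dots> \<le> 2 * (d + e) + 2 * (d + e) - 4 * d"
  proof -
    have "2 * x + 2 * y - 4 * z \<le> 2 * (d + e) + 2 * (d + e) - 4 * d"
      if "x \<le> d + e" "y \<le> d + e" "d \<le> z" for x y z :: real using that by (simp add: algebra_simps)
    then show ?thesis using e d[OF us] unfolding a_def b_def c_def by blast
  qed
  finally show ?thesis by (simp add: a_def b_def)
qed

lemma orb_minimizing:
  assumes i: "i \<in> I"
  obtains d where "\<And>us. glist G us \<Longrightarrow> d \<le> (knorm (orb us i))\<^sup>2"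
    "\<And>e. e > 0 \<Longrightarrow> \<exists>us. glist G us \<and> (knorm (orb us i))\<^sup>2 < d + e"
proof -
  define S where "S = (\<lambda>us. (knorm (orb us i))\<^sup>2) ` {us. glist G us}"
  have ne: "S \<noteq> {}" using one_closed by (auto simp: S_def glist_def intro!: exI[of _ "[\<one>]"])
  have bdd: "bdd_below S" by (rule bdd_belowI[of _ 0]) (auto simp: S_def)
  show thesis
  proof (rule that[of "Inf S"])
    show "Inf S \<le> (knorm (orb us i))\<^sup>2" if "glist G us" for us
      by (rule cInf_lower[OF _ bdd]) (use that in \<open>auto simp: S_def\<close>)
    show "\<exists>us. glist G us \<and> (knorm (orb us i))\<^sup>2 < Inf S + e" if "e > 0" for e
      using cInf_lessD[OF ne, of "Inf S + e"] that by (auto simp: S_def)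
  qed
qed

text \<open>A translate of an orbit average is an orbit average of the same norm. If the norm is
  nearly minimal, both are nearly minimal and thus close to each other, uniformly in
  \<open>g\<close>. In the limit this is the fixed point of least norm in the closed convex hull of
  the orbit.\<close>

lemma almost_invariant:
  assumes i: "i \<in> I" and d: "\<delta> > 0"
  shows "\<exists>ss. glist G ss \<and> (\<forall>g\<in>carrier G. knorm (ldiff (lact (act g) (orb ss i)) (orb ss i)) \<le> \<delta>)"
proof -
  obtain d where d: "\<And>us. glist G us \<Longrightarrow> d \<le> (knorm (orb us i))\<^sup>2"
    "\<And>e. e > 0 \<Longrightarrow> \<exists>us. glist G us \<and> (knorm (orb us i))\<^sup>2 < d + e"
    using orb_minimizing[OF i] by blast
  obtain ss where ss: "glist G ss" "(knorm (orb ss i))\<^sup>2 < d + \<delta>\<^sup>2 / 4"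
    using d(2)[of "\<delta>\<^sup>2 / 4"] \<open>\<delta> > 0\<close> by auto
  have "knorm (ldiff (lact (act g) (orb ss i)) (orb ss i)) \<le> \<delta>" if g: "g \<in> carrier G" for g
  proof (rule power2_le_imp_le)
    have "knorm (orb (map (\<lambda>s. g \<otimes> s) ss) i) = knorm (orb ss i)"
      using knorm_lact[OF g orb_valid[OF ss(1) i]] lact_orb[OF ss(1) g i] by simp
    then show "(knorm (ldiff (lact (act g) (orb ss i)) (orb ss i)))\<^sup>2 \<le> \<delta>\<^sup>2"
      using orb_parallelogram[OF i glist_map[OF ss(1) g] ss(1), of d "\<delta>\<^sup>2 / 4"] d(1) ss(2)
      by (simp add: lact_orb[OF ss(1) g i])
  qed (use \<open>\<delta> > 0\<close> in simp)
  then show ?thesis using ss by blast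
qed

end

section \<open>Mean values as uniform limits of averages\<close>

definition rmean :: "('a, 'm) monoid_scheme \<Rightarrow> ('a \<Rightarrow> complex) \<Rightarrow> complex \<Rightarrow> bool" where
  "rmean G \<phi> z \<longleftrightarrow> (\<forall>\<delta>>0. \<exists>ss. glist G ss \<and>
     (\<forall>g\<in>carrier G. cmod (avg (\<lambda>s. \<phi> (g \<otimes>\<^bsub>G\<^esub> s)) ss - z) \<le> \<delta>))"

text \<open>Here the averages run over left translates, in \<open>rmean\<close> over right
  translates, each time uniformly on the group. Existence on one side gives uniqueness on the
  other.\<close>

definition lmean :: "('a, 'm) monoid_scheme \<Rightarrow> ('a \<Rightarrow> complex) \<Rightarrow> complex \<Rightarrow> bool" where
  "lmean G \<phi> z \<longleftrightarrow> (\<forall>\<delta>>0. \<exists>ss. glist G ss \<and>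
     (\<forall>g\<in>carrier G. cmod (avg (\<lambda>s. \<phi> (s \<otimes>\<^bsub>G\<^esub> g)) ss - z) \<le> \<delta>))"

context group
begin

text \<open>The double average of \<open>\<phi> (t s)\<close> is near \<open>z\<close> because every
  inner average over \<open>s\<close> is, and near \<open>w\<close> because every inner average over
  \<open>t\<close> is.\<close>

lemma two_sided_avg:
  assumes ss: "glist G ss" "\<And>g. g \<in> carrier G \<Longrightarrow> cmod (avg (\<lambda>s. \<phi> (g \<otimes> s)) ss - z) \<le> \<delta>"
    and ts: "glist G ts" "\<And>g. g \<in> carrier G \<Longrightarrow> cmod (avg (\<lambda>t. \<phi> (t \<otimes> g)) ts - w) \<le> \<epsilon>"
  shows "cmod (z - w) \<le> \<delta> + \<epsilon>"
proof -
  define c where "c = avg (\<lambda>t. avg (\<lambda>s. \<phi> (t \<otimes> s)) ss) ts"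
  have "cmod (c - z) \<le> \<delta>" unfolding c_def
    by (rule avg_close) (use ss ts in \<open>auto simp: glist_def\<close>)
  moreover have "cmod (c - w) \<le> \<epsilon>" unfolding c_def avg_swap[of _ ss ts]
    by (rule avg_close) (use ss ts in \<open>auto simp: glist_def\<close>)
  ultimately show ?thesis
    using norm_triangle_ineq4[of "c - w" "c - z"] by simp
qed

lemma rmean_lmean_unique:
  assumes "rmean G \<phi> z" "lmean G \<phi> w"
  shows "z = w"
proof (rule ccontr)
  assume "z \<noteq> w"
  then have e: "cmod (z - w) / 3 > 0" by simp
  obtain ss where "glist G ss" "\<And>g. g \<in> carrier G \<Longrightarrow> cmod (avg (\<lambda>s. \<phi> (g \<otimes> s)) ss - z) \<le> cmod (z - w) / 3"
    using assms(1) e unfolding rmean_def by meson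
  moreover obtain ts where "glist G ts" "\<And>g. g \<in> carrier G \<Longrightarrow> cmod (avg (\<lambda>t. \<phi> (t \<otimes> g)) ts - w) \<le> cmod (z - w) / 3"
    using assms(2) e unfolding lmean_def by meson
  ultimately have "cmod (z - w) \<le> cmod (z - w) / 3 + cmod (z - w) / 3" by (rule two_sided_avg)
  then show False using e by simp
qed

text \<open>Averaging \<open>\<phi> (g s)\<close> over \<open>s\<close> replaces the vector
  \<open>x\<close> of the coefficient by the almost invariant combination \<open>orb ss x\<close>,
  on which \<open>g\<close> hardly acts. The \<open>+ 1\<close> in the choice of \<open>e\<close>
  covers the case \<open>y = 0\<close>.\<close>

lemma fourier_stieltjes_ravg:
  assumes \<phi>: "\<phi> \<in> fourier_stieltjes G" and d: "\<delta> > 0"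
  shows "\<exists>ss z. glist G ss \<and> (\<forall>g\<in>carrier G. cmod (avg (\<lambda>s. \<phi> (g \<otimes> s)) ss - z) \<le> \<delta>)"
proof -
  obtain H :: "('a \<Rightarrow> complex) inner_module" and \<pi> x y where H:
    "hilbert_rep G H \<pi>" "x \<in> carrier H" "y \<in> carrier H" "\<phi> = matrix_coeff G H \<pi> y x"
    using fourier_stieltjesE[OF is_group \<phi>] .
  interpret R: hilbert_rep G H \<pi> by (rule H)
  define e where "e = \<delta> / (R.K.knorm [(1, y)] + 1)"
  have ny: "R.K.knorm [(1, y)] \<ge> 0" using H by simp
  then have "e > 0" using d by (simp add: e_def add_nonneg_pos)
  then obtain ss where ss: "glist G ss"
    "\<And>g. g \<in> carrier G \<Longrightarrow> R.K.knorm (ldiff (lact (\<pi> g) (R.K.orb ss x)) (R.K.orb ss x)) \<le> e"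
    using R.K.almost_invariant[OF H(2)] by blast
  define z where "z = kip (hinner H) [(1, y)] (R.K.orb ss x)"
  have "cmod (avg (\<lambda>s. \<phi> (g \<otimes> s)) ss - z) \<le> \<delta>" if g: "g \<in> carrier G" for g
  proof -
    have vo: "R.K.valid (R.K.orb ss x)" using ss H by (intro R.K.orb_valid)
    have gl: "glist G (map (\<lambda>s. g \<otimes> s) ss)" using ss(1) g by (rule glist_map)
    have "avg (\<lambda>s. \<phi> (g \<otimes> s)) ss = avg (\<lambda>s. kip (hinner H) [(1, y)] [(1, \<pi> (g \<otimes> s) x)]) ss"
      using ss g H by (intro avg_cong) (auto simp: matrix_coeff_def kip_def glist_def subset_iff)
    also have "\<dots> = kip (hinner H) [(1, y)] (R.K.orb (map (\<lambda>s. g \<otimes> s) ss) x)"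
      using R.K.kip_orb_right[OF gl H(2), of "[(1, y)]"] H by (simp add: avg_map)
    also have "\<dots> = kip (hinner H) [(1, y)] (lact (\<pi> g) (R.K.orb ss x))"
      using R.K.lact_orb[OF ss(1) g H(2)] by simp
    finally have eq: "avg (\<lambda>s. \<phi> (g \<otimes> s)) ss - z =
        kip (hinner H) [(1, y)] (ldiff (lact (\<pi> g) (R.K.orb ss x)) (R.K.orb ss x))"
      by (simp add: z_def)
    have "cmod (avg (\<lambda>s. \<phi> (g \<otimes> s)) ss - z) \<le> R.K.knorm [(1, y)] * R.K.knorm (ldiff (lact (\<pi> g) (R.K.orb ss x)) (R.K.orb ss x))"
      unfolding eq using H vo R.K.lact_valid[OF g vo] by (intro R.K.kip_CS) (auto simp: set_ldiff)
    also have "\<dots> \<le> R.K.knorm [(1, y)] * e"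
      by (rule mult_left_mono[OF ss(2)[OF g] ny])
    also have "\<dots> \<le> (R.K.knorm [(1, y)] + 1) * e"
      using \<open>e > 0\<close> by (simp add: distrib_right)
    also have "\<dots> = \<delta>" using ny by (simp add: e_def add_nonneg_eq_0_iff)
    finally show ?thesis .
  qed
  then show ?thesis using ss by blast
qed

text \<open>Inversion and conjugation exchange the two vectors of a coefficient; this reduces left
  averages to right averages.\<close>

lemma fourier_stieltjes_flip:
  assumes \<phi>: "\<phi> \<in> fourier_stieltjes G"
  shows "(\<lambda>g. if g \<in> carrier G then cnj (\<phi> (inv g)) else 0) \<in> fourier_stieltjes G"
proof -
  obtain H :: "('a \<Rightarrow> complex) inner_module" and \<pi> x y where H:
    "hilbert_rep G H \<pi>" "x \<in> carrier H" "y \<in> carrier H" "\<phi> = matrix_coeff G H \<pi> y x"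
    using fourier_stieltjesE[OF is_group \<phi>] .
  interpret R: hilbert_rep G H \<pi> by (rule H)
  have "cnj (hinner H y (\<pi> (inv g) x)) = hinner H x (\<pi> g y)" if g: "g \<in> carrier G" for g
  proof -
    have "hinner H x (\<pi> g y) = hinner H (\<pi> (inv g) x) y" by (rule R.rep_adjoint) (use g H in auto)
    also have "\<dots> = cnj (hinner H y (\<pi> (inv g) x))"
      by (rule R.hinner_cnj) (use g H R.rep_closed in auto)
    finally show ?thesis by simp
  qed
  then have "(\<lambda>g. if g \<in> carrier G then cnj (\<phi> (inv g)) else 0) = matrix_coeff G H \<pi> x y"
    using H by (auto simp: matrix_coeff_def)
  then show ?thesis using R.matrix_coeff_in H by simp
qed

lemma fourier_stieltjes_lavg:
  assumes \<phi>: "\<phi> \<in> fourier_stieltjes G" and d: "\<delta> > 0"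
  shows "\<exists>ts z. glist G ts \<and> (\<forall>g\<in>carrier G. cmod (avg (\<lambda>t. \<phi> (t \<otimes> g)) ts - z) \<le> \<delta>)"
proof -
  define \<psi> where "\<psi> = (\<lambda>g. if g \<in> carrier G then cnj (\<phi> (inv g)) else 0)"
  have "\<psi> \<in> fourier_stieltjes G" unfolding \<psi>_def using \<phi> by (rule fourier_stieltjes_flip)
  then obtain ss z where ss: "glist G ss" "\<And>g. g \<in> carrier G \<Longrightarrow> cmod (avg (\<lambda>s. \<psi> (g \<otimes> s)) ss - z) \<le> \<delta>"
    using fourier_stieltjes_ravg[OF _ d] by blast
  have "cmod (avg (\<lambda>t. \<phi> (t \<otimes> g)) (map (\<lambda>s. inv s) ss) - cnj z) \<le> \<delta>" if g: "g \<in> carrier G" for g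
  proof -
    have "avg (\<lambda>t. \<phi> (t \<otimes> g)) (map (\<lambda>s. inv s) ss) = avg (\<lambda>s. cnj (\<psi> (inv g \<otimes> s))) ss"
      unfolding avg_map using ss g
      by (intro avg_cong) (auto simp: \<psi>_def glist_def subset_iff inv_mult_group)
    then have "avg (\<lambda>t. \<phi> (t \<otimes> g)) (map (\<lambda>s. inv s) ss) - cnj z = cnj (avg (\<lambda>s. \<psi> (inv g \<otimes> s)) ss - z)"
      by (simp add: avg_cnj)
    then show ?thesis using ss(2)[of "inv g"] g by (metis complex_mod_cnj inv_closed)
  qed
  moreover have "glist G (map (\<lambda>s. inv s) ss)" using ss by (auto simp: glist_def)
  ultimately show ?thesis by blast
qed

text \<open>Right and left averages of error \<open>1 / (n + 1)\<close> give candidates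
  \<open>z n\<close> and \<open>w n\<close>. Two-sided averaging bounds \<open>z n - w m\<close> for
  all \<open>n\<close> and \<open>m\<close>, which yields convergence and equality of the limits at
  the same time.\<close>

lemma fourier_stieltjes_mean_exists:
  assumes \<phi>: "\<phi> \<in> fourier_stieltjes G"
  shows "\<exists>z. rmean G \<phi> z \<and> lmean G \<phi> z"
proof -
  have "\<forall>n. \<exists>ss z. glist G ss \<and> (\<forall>g\<in>carrier G. cmod (avg (\<lambda>s. \<phi> (g \<otimes> s)) ss - z) \<le> inverse (real (Suc n)))"
    by (intro allI fourier_stieltjes_ravg[OF \<phi>]) simp
  then obtain ss z where ss: "\<And>n. glist G (ss n)"
    "\<And>n g. g \<in> carrier G \<Longrightarrow> cmod (avg (\<lambda>s. \<phi> (g \<otimes> s)) (ss n) - z n) \<le> inverse (real (Suc n))"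
    by metis
  have "\<forall>n. \<exists>ss z. glist G ss \<and> (\<forall>g\<in>carrier G. cmod (avg (\<lambda>s. \<phi> (s \<otimes> g)) ss - z) \<le> inverse (real (Suc n)))"
    by (intro allI fourier_stieltjes_lavg[OF \<phi>]) simp
  then obtain ts w where ts: "\<And>n. glist G (ts n)"
    "\<And>n g. g \<in> carrier G \<Longrightarrow> cmod (avg (\<lambda>s. \<phi> (s \<otimes> g)) (ts n) - w n) \<le> inverse (real (Suc n))"
    by metis
  have zw: "cmod (z n - w m) \<le> inverse (real (Suc n)) + inverse (real (Suc m))" for n m
    by (rule two_sided_avg[OF ss(1) ss(2) ts(1) ts(2)])
  have small: "\<exists>N. \<forall>n\<ge>N. inverse (real (Suc n)) < e" if e: "e > 0" for e :: real
  proof -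
    obtain N where "inverse (real (Suc N)) < e" using reals_Archimedean[OF e] by auto
    moreover have "inverse (real (Suc n)) \<le> inverse (real (Suc N))" if "n \<ge> N" for n
      using that by (simp add: divide_simps)
    ultimately show ?thesis by (meson order_le_less_trans)
  qed
  have "Cauchy z"
  proof (rule metric_CauchyI)
    fix e :: real assume "e > 0"
    then obtain N where N: "\<And>n. n \<ge> N \<Longrightarrow> inverse (real (Suc n)) < e / 4" using small[of "e / 4"] by auto
    have "dist (z m) (z n) < e" if "m \<ge> N" "n \<ge> N" for m n
    proof -
      have "cmod (z m - z n) \<le> cmod (z m - w N) + cmod (z n - w N)"
        using norm_triangle_ineq4[of "z m - w N" "z n - w N"] by simp
      then show ?thesis using zw[of m N] zw[of n N] N[of m] N[of n] N[of N] that
        by (simp add: dist_norm)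
    qed
    then show "\<exists>M. \<forall>m\<ge>M. \<forall>n\<ge>M. dist (z m) (z n) < e" by blast
  qed
  then obtain c where c: "z \<longlonglongrightarrow> c" using Cauchy_convergent convergent_def by blast
  have wc: "cmod (c - w m) \<le> inverse (real (Suc m))" for m
  proof (rule LIMSEQ_le[OF tendsto_norm[OF tendsto_diff[OF c tendsto_const]]])
    show "(\<lambda>n. inverse (real (Suc n)) + inverse (real (Suc m))) \<longlonglongrightarrow> inverse (real (Suc m))"
      using tendsto_add[OF LIMSEQ_inverse_real_of_nat tendsto_const[of "inverse (real (Suc m))"]] by simp
  qed (use zw in blast)
  have zc: "cmod (z n - c) \<le> 2 * inverse (real (Suc n)) + e" if e: "e > 0" for n e
  proof -
    obtain N where N: "\<And>n. n \<ge> N \<Longrightarrow> inverse (real (Suc n)) < e / 2" using small[of "e / 2"] e by auto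
    have "cmod (z n - c) \<le> cmod (z n - w N) + cmod (c - w N)"
      using norm_triangle_ineq4[of "z n - w N" "c - w N"] by simp
    moreover have "0 \<le> inverse (real (Suc n))" by simp
    ultimately show ?thesis using zw[of n N] wc[of N] N[OF order_refl] by linarith
  qed
  have "rmean G \<phi> c"
    unfolding rmean_def
  proof (intro allI impI)
    fix \<delta> :: real assume d: "\<delta> > 0"
    then obtain N where N: "\<And>n. n \<ge> N \<Longrightarrow> inverse (real (Suc n)) < \<delta> / 4" using small[of "\<delta> / 4"] by auto
    have "cmod (avg (\<lambda>s. \<phi> (g \<otimes> s)) (ss N) - c) \<le> \<delta>" if g: "g \<in> carrier G" for g
      using ss(2)[OF g, of N] zc[of "\<delta> / 4" N] N[of N] d
        norm_triangle_ineq[of "avg (\<lambda>s. \<phi> (g \<otimes> s)) (ss N) - z N" "z N - c"] by simp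
    then show "\<exists>ss. glist G ss \<and> (\<forall>g\<in>carrier G. cmod (avg (\<lambda>s. \<phi> (g \<otimes> s)) ss - c) \<le> \<delta>)"
      using ss by blast
  qed
  moreover have "lmean G \<phi> c"
    unfolding lmean_def
  proof (intro allI impI)
    fix \<delta> :: real assume d: "\<delta> > 0"
    then obtain N where N: "\<And>n. n \<ge> N \<Longrightarrow> inverse (real (Suc n)) < \<delta> / 4" using small[of "\<delta> / 4"] by auto
    have "cmod (avg (\<lambda>s. \<phi> (s \<otimes> g)) (ts N) - c) \<le> \<delta>" if g: "g \<in> carrier G" for g
      using ts(2)[OF g, of N] wc[of N] N[of N] d
        norm_triangle_ineq4[of "avg (\<lambda>s. \<phi> (s \<otimes> g)) (ts N) - w N" "c - w N"] by simp
    then show "\<exists>ss. glist G ss \<and> (\<forall>g\<in>carrier G. cmod (avg (\<lambda>s. \<phi> (s \<otimes> g)) ss - c) \<le> \<delta>)"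
      using ts by blast
  qed
  ultimately show ?thesis by blast
qed

lemma fourier_stieltjes_avg_rtrans:
  assumes \<phi>: "\<phi> \<in> fourier_stieltjes G" and ss: "set ss \<subseteq> carrier G"
  shows "(\<lambda>g. if g \<in> carrier G then avg (\<lambda>s. \<phi> (g \<otimes> s)) ss else 0) \<in> fourier_stieltjes G"
proof -
  have "(\<lambda>g. if g \<in> carrier G then (\<Sum>s\<leftarrow>ss. \<phi> (g \<otimes> s)) else 0) \<in> fourier_stieltjes G"
    using ss
  proof (induction ss)
    case Nil
    show ?case using fourier_stieltjes_scale[OF fourier_stieltjes_one, of 0] by (simp cong: if_cong)
  next
    case (Cons s ss)
    have "(\<lambda>g. rtrans G s \<phi> g + (if g \<in> carrier G then (\<Sum>s\<leftarrow>ss. \<phi> (g \<otimes> s)) else 0)) \<in> fourier_stieltjes G"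
      using Cons \<phi> by (intro fourier_stieltjes_add fourier_stieltjes_rtrans) auto
    moreover have "(\<lambda>g. rtrans G s \<phi> g + (if g \<in> carrier G then (\<Sum>s\<leftarrow>ss. \<phi> (g \<otimes> s)) else 0)) =
        (\<lambda>g. if g \<in> carrier G then (\<Sum>s\<leftarrow>s # ss. \<phi> (g \<otimes> s)) else 0)"
      by (auto simp: rtrans_def)
    ultimately show ?case by simp
  qed
  from fourier_stieltjes_scale[OF this, of "1 / of_nat (length ss)"]
  show ?thesis by (simp add: avg_def if_distrib cong: if_cong)
qed

text \<open>Left and right translations commute, so averaging over right translates keeps the left
  mean value. By uniqueness it keeps the right one too, which is what allows averages to be improved
  one function after another.\<close>

lemma lmean_avg_rtrans:
  assumes "lmean G \<phi> z" "glist G ss"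
  shows "lmean G (\<lambda>g. if g \<in> carrier G then avg (\<lambda>s. \<phi> (g \<otimes> s)) ss else 0) z"
  unfolding lmean_def
proof (intro allI impI)
  fix \<delta> :: real assume "\<delta> > 0"
  then obtain ts where ts: "glist G ts" "\<And>g. g \<in> carrier G \<Longrightarrow> cmod (avg (\<lambda>s. \<phi> (s \<otimes> g)) ts - z) \<le> \<delta>"
    using assms(1) unfolding lmean_def by meson
  have "cmod (avg (\<lambda>t. if t \<otimes> g \<in> carrier G then avg (\<lambda>s. \<phi> (t \<otimes> g \<otimes> s)) ss else 0) ts - z) \<le> \<delta>"
    if g: "g \<in> carrier G" for g
  proof -
    have "avg (\<lambda>t. if t \<otimes> g \<in> carrier G then avg (\<lambda>s. \<phi> (t \<otimes> g \<otimes> s)) ss else 0) ts =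
        avg (\<lambda>t. avg (\<lambda>s. \<phi> (t \<otimes> (g \<otimes> s))) ss) ts"
      by (rule avg_cong, simp, intro conjI impI avg_cong)
         (use ts(1) assms(2) g in \<open>auto simp: glist_def m_assoc subset_iff\<close>)
    also have "\<dots> = avg (\<lambda>s. avg (\<lambda>t. \<phi> (t \<otimes> (g \<otimes> s))) ts) ss" by (rule avg_swap)
    also have "cmod (\<dots> - z) \<le> \<delta>"
      by (rule avg_close) (use ts(2) assms(2) g in \<open>auto simp: glist_def subset_iff\<close>)
    finally show ?thesis .
  qed
  then show "\<exists>ts. glist G ts \<and> (\<forall>g\<in>carrier G. cmod
      (avg (\<lambda>t. if t \<otimes> g \<in> carrier G then avg (\<lambda>s. \<phi> (t \<otimes> g \<otimes> s)) ss else 0) ts - z) \<le> \<delta>)"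
    using ts(1) by blast
qed

text \<open>Later averages are convolved from the left, which does not spoil the earlier ones.\<close>

lemma joint_ravg:
  assumes "\<And>\<phi>. \<phi> \<in> set \<phi>s \<Longrightarrow> \<phi> \<in> fourier_stieltjes G" and "\<delta> > 0"
  shows "\<exists>ss. glist G ss \<and> (\<forall>\<phi>\<in>set \<phi>s. \<forall>z. rmean G \<phi> z \<longrightarrow>
     (\<forall>g\<in>carrier G. cmod (avg (\<lambda>s. \<phi> (g \<otimes> s)) ss - z) \<le> \<delta>))"
  using assms(1)
proof (induction \<phi>s)
  case Nil
  show ?case by (rule exI[of _ "[\<one>]"]) (simp add: glist_def)
next
  case (Cons \<phi> \<phi>s)
  then obtain ss where ss: "glist G ss" "\<And>\<psi> z g. \<psi> \<in> set \<phi>s \<Longrightarrow> rmean G \<psi> z \<Longrightarrow> g \<in> carrier G \<Longrightarrow>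
      cmod (avg (\<lambda>s. \<psi> (g \<otimes> s)) ss - z) \<le> \<delta>" by auto
  obtain z where z: "rmean G \<phi> z" "lmean G \<phi> z"
    using fourier_stieltjes_mean_exists Cons.prems by auto
  define \<psi> where "\<psi> = (\<lambda>g. if g \<in> carrier G then avg (\<lambda>s. \<phi> (g \<otimes> s)) ss else 0)"
  have "\<psi> \<in> fourier_stieltjes G"
    unfolding \<psi>_def using Cons.prems ss(1) by (intro fourier_stieltjes_avg_rtrans) (auto simp: glist_def)
  moreover have "lmean G \<psi> z" unfolding \<psi>_def by (rule lmean_avg_rtrans[OF z(2) ss(1)])
  \<comment> \<open>\<open>\<psi>\<close> has some right mean value, which must agree with its left
    mean value \<open>z\<close>.\<close>
  ultimately have "rmean G \<psi> z"
    using fourier_stieltjes_mean_exists rmean_lmean_unique by blast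
  then obtain ts where ts: "glist G ts" "\<And>g. g \<in> carrier G \<Longrightarrow> cmod (avg (\<lambda>t. \<psi> (g \<otimes> t)) ts - z) \<le> \<delta>"
    using assms(2) unfolding rmean_def by meson
  have conv: "avg (\<lambda>u. \<theta> (g \<otimes> u)) (lconv G ts ss) = avg (\<lambda>t. avg (\<lambda>s. \<theta> (g \<otimes> t \<otimes> s)) ss) ts"
    if "g \<in> carrier G" for g and \<theta> :: "'a \<Rightarrow> complex"
    unfolding avg_lconv using ts(1) ss(1) that
    by (intro avg_cong) (auto simp: glist_def m_assoc subset_iff)
  show ?case
  proof (rule exI[of _ "lconv G ts ss"], intro conjI ballI allI impI)
    fix \<theta> c g assume \<theta>: "\<theta> \<in> set (\<phi> # \<phi>s)" and c: "rmean G \<theta> c" and g: "g \<in> carrier G"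
    show "cmod (avg (\<lambda>s. \<theta> (g \<otimes> s)) (lconv G ts ss) - c) \<le> \<delta>"
    proof (cases "\<theta> \<in> set \<phi>s")
      case True
      show ?thesis unfolding conv[OF g]
        by (rule avg_close) (use ss(2)[OF True c] ts(1) g in \<open>auto simp: glist_def subset_iff\<close>)
    next
      case False
      then have [simp]: "\<theta> = \<phi>" using \<theta> by simp
      have "c = z" using rmean_lmean_unique c z by auto
      moreover have "avg (\<lambda>t. avg (\<lambda>s. \<phi> (g \<otimes> t \<otimes> s)) ss) ts = avg (\<lambda>t. \<psi> (g \<otimes> t)) ts"
        using ts(1) g by (intro avg_cong) (auto simp: \<psi>_def glist_def subset_iff)
      ultimately show ?thesis using ts(2)[OF g] by (simp add: conv[OF g])
    qed
  qed (rule glist_lconv[OF ts(1) ss(1)])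
qed

text \<open>Additivity needs one family that works for both functions; this is the first use of
  joint averaging.\<close>

lemma rmean_add:
  assumes "\<phi> \<in> fourier_stieltjes G" "\<psi> \<in> fourier_stieltjes G" "rmean G \<phi> z" "rmean G \<psi> w"
  shows "rmean G (\<lambda>g. \<phi> g + \<psi> g) (z + w)"
  unfolding rmean_def
proof (intro allI impI)
  fix \<delta> :: real assume "\<delta> > 0"
  then obtain ss where ss: "glist G ss" "\<And>\<theta> z g. \<theta> \<in> set [\<phi>, \<psi>] \<Longrightarrow> rmean G \<theta> z \<Longrightarrow> g \<in> carrier G \<Longrightarrow>
      cmod (avg (\<lambda>s. \<theta> (g \<otimes> s)) ss - z) \<le> \<delta> / 2"
    using joint_ravg[of "[\<phi>, \<psi>]" "\<delta> / 2"] assms(1,2) by (auto simp del: le_divide_eq_numeral1) blast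
  have "cmod (avg (\<lambda>s. \<phi> (g \<otimes> s) + \<psi> (g \<otimes> s)) ss - (z + w)) \<le> \<delta>" if "g \<in> carrier G" for g
  proof -
    have "avg (\<lambda>s. \<phi> (g \<otimes> s) + \<psi> (g \<otimes> s)) ss - (z + w) =
        (avg (\<lambda>s. \<phi> (g \<otimes> s)) ss - z) + (avg (\<lambda>s. \<psi> (g \<otimes> s)) ss - w)" by (simp add: avg_add)
    also have "cmod \<dots> \<le> \<delta> / 2 + \<delta> / 2"
      using that assms by (intro norm_triangle_mono ss(2)) auto
    finally show ?thesis by simp
  qed
  then show "\<exists>ss. glist G ss \<and> (\<forall>g\<in>carrier G. cmod (avg (\<lambda>s. \<phi> (g \<otimes> s) + \<psi> (g \<otimes> s)) ss - (z + w)) \<le> \<delta>)"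
    using ss by blast
qed

end

section \<open>Extension of means\<close>

definition star_space :: "('a, 'm) monoid_scheme \<Rightarrow> ('a \<Rightarrow> complex) set \<Rightarrow> bool" where
  "star_space G V \<longleftrightarrow> V \<subseteq> linf G \<and> indicator (carrier G) \<in> V \<and>
     (\<forall>\<phi>\<in>V. \<forall>\<psi>\<in>V. (\<lambda>x. \<phi> x + \<psi> x) \<in> V) \<and> (\<forall>c. \<forall>\<phi>\<in>V. (\<lambda>x. c * \<phi> x) \<in> V) \<and>
     (\<forall>\<phi>\<in>V. (\<lambda>x. cnj (\<phi> x)) \<in> V)"

lemma star_spaceD:
  assumes "star_space G V"
  shows "V \<subseteq> linf G" "indicator (carrier G) \<in> V"
    "\<lbrakk>\<phi> \<in> V; \<psi> \<in> V\<rbrakk> \<Longrightarrow> (\<lambda>x. \<phi> x + \<psi> x) \<in> V" "\<phi> \<in> V \<Longrightarrow> (\<lambda>x. c * \<phi> x) \<in> V"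
    "\<phi> \<in> V \<Longrightarrow> (\<lambda>x. cnj (\<phi> x)) \<in> V"
  using assms by (auto simp: star_space_def)

lemma linf_bound:
  assumes "\<phi> \<in> linf G"
  obtains C where "0 < C" "\<And>x. cmod (\<phi> x) \<le> C"
  using assms by (auto simp: linf_def bounded_pos)

lemma linf_zero: "\<phi> \<in> linf G \<Longrightarrow> x \<notin> carrier G \<Longrightarrow> \<phi> x = 0"
  by (auto simp: linf_def)

lemma linfI: "\<lbrakk>\<And>x. x \<notin> carrier G \<Longrightarrow> \<phi> x = 0; \<And>x. x \<in> carrier G \<Longrightarrow> cmod (\<phi> x) \<le> C\<rbrakk> \<Longrightarrow> \<phi> \<in> linf G"
  unfolding linf_def by (auto intro!: boundedI[of _ "max C 0"]) (metis le_max_iff_disj norm_zero order_refl)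

lemma star_space_linf: "star_space G (linf G)"
  unfolding star_space_def
proof (intro conjI ballI allI)
  show "indicator (carrier G) \<in> linf G" by (rule linfI[where C = 1]) auto
  fix \<phi> assume \<phi>: "\<phi> \<in> linf G"
  obtain C where C: "0 < C" "\<And>x. cmod (\<phi> x) \<le> C" using linf_bound[OF \<phi>] by blast
  show "(\<lambda>x. cnj (\<phi> x)) \<in> linf G"
    by (rule linfI[where C = C]) (use C linf_zero[OF \<phi>] in auto)
  show "(\<lambda>x. c * \<phi> x) \<in> linf G" for c
    by (rule linfI[where C = "cmod c * C"]) (use C linf_zero[OF \<phi>] in \<open>auto simp: norm_mult mult_left_mono\<close>)
  fix \<psi> assume \<psi>: "\<psi> \<in> linf G"
  obtain D where D: "0 < D" "\<And>x. cmod (\<psi> x) \<le> D" using linf_bound[OF \<psi>] by blast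
  show "(\<lambda>x. \<phi> x + \<psi> x) \<in> linf G"
    by (rule linfI[where C = "C + D"])
       (use C D linf_zero[OF \<phi>] linf_zero[OF \<psi>] in \<open>auto intro!: norm_triangle_mono\<close>)
qed simp

lemma of_real_nonneg: "complex_of_real x \<in> \<real>\<^sub>\<ge>\<^sub>0 \<longleftrightarrow> 0 \<le> x"
  by (simp add: complex_nonneg_Reals_iff)

text \<open>The definition gives the norm as a supremum; the point is that a positive functional
  attains it at the constant \<open>1\<close>. To bound \<open>\<mu> \<phi>\<close>, rotate it onto
  the positive axis, pass to the real part of the rotated function and compare that with
  \<open>1\<close>. Hence the norm is \<open>m\<close>, the value at \<open>1\<close>, and
  \<open>m = 1\<close>.\<close>

lemma
  assumes V: "star_space G V" and \<mu>: "mean_on V \<mu>"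
  shows mean_add: "\<lbrakk>\<phi> \<in> V; \<psi> \<in> V\<rbrakk> \<Longrightarrow> \<mu> (\<lambda>x. \<phi> x + \<psi> x) = \<mu> \<phi> + \<mu> \<psi>"
    and mean_scale: "\<phi> \<in> V \<Longrightarrow> \<mu> (\<lambda>x. c * \<phi> x) = c * \<mu> \<phi>"
    and mean_pos: "\<lbrakk>\<phi> \<in> V; \<And>x. \<phi> x \<in> \<real>\<^sub>\<ge>\<^sub>0\<rbrakk> \<Longrightarrow> \<mu> \<phi> \<in> \<real>\<^sub>\<ge>\<^sub>0"
    and mean_real: "\<lbrakk>\<phi> \<in> V; \<And>x. \<phi> x \<in> \<real>\<rbrakk> \<Longrightarrow> \<mu> \<phi> \<in> \<real>"
    and mean_one: "\<mu> (indicator (carrier G)) = 1"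
    and mean_bound: "\<lbrakk>\<phi> \<in> V; 0 \<le> C; \<And>x. x \<in> carrier G \<Longrightarrow> cmod (\<phi> x) \<le> C\<rbrakk> \<Longrightarrow> cmod (\<mu> \<phi>) \<le> C"
proof -
  let ?one = "indicator (carrier G) :: 'a \<Rightarrow> complex"
  note V' = star_spaceD[OF V]
  show add: "\<mu> (\<lambda>x. \<phi> x + \<psi> x) = \<mu> \<phi> + \<mu> \<psi>" if "\<phi> \<in> V" "\<psi> \<in> V" for \<phi> \<psi>
    using \<mu> that by (simp add: mean_on_def)
  show scale: "\<mu> (\<lambda>x. c * \<phi> x) = c * \<mu> \<phi>" if "\<phi> \<in> V" for c \<phi>
    using \<mu> that by (simp add: mean_on_def)
  show pos: "\<mu> \<phi> \<in> \<real>\<^sub>\<ge>\<^sub>0" if "\<phi> \<in> V" "\<And>x. \<phi> x \<in> \<real>\<^sub>\<ge>\<^sub>0" for \<phi>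
    using \<mu> that by (simp add: mean_on_def)
  have one: "\<mu> ?one \<in> \<real>\<^sub>\<ge>\<^sub>0" by (rule pos[OF V'(2)]) (simp add: indicator_def)
  show real: "\<mu> \<phi> \<in> \<real>" if \<phi>: "\<phi> \<in> V" "\<And>x. \<phi> x \<in> \<real>" for \<phi>
  proof -
    obtain C where C: "0 < C" "\<And>x. cmod (\<phi> x) \<le> C" using linf_bound[of \<phi>] V' \<phi> by blast
    have "\<phi> x + of_real C * ?one x \<in> \<real>\<^sub>\<ge>\<^sub>0" for x
    proof -
      obtain r where r: "\<phi> x = of_real r" using \<phi>(2) Reals_cases by blast
      then show ?thesis using C(2)[of x] linf_zero[of \<phi> G x] V'(1) \<phi>(1)
        by (cases "x \<in> carrier G") (auto simp flip: of_real_add simp: of_real_nonneg)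
    qed
    then have "\<mu> (\<lambda>x. \<phi> x + of_real C * ?one x) \<in> \<real>\<^sub>\<ge>\<^sub>0"
      using V' \<phi> by (intro pos) auto
    then have "\<mu> \<phi> + of_real C * \<mu> ?one \<in> \<real>"
      using V' \<phi> add scale nonneg_Reals_subset_Reals by auto
    moreover have "of_real C * \<mu> ?one \<in> \<real>" using one nonneg_Reals_subset_Reals by auto
    ultimately show ?thesis using Reals_diff by fastforce
  qed
  obtain m where m: "\<mu> ?one = of_real m" "m \<ge> 0" using one by (auto elim!: nonneg_Reals_cases)
  have bd: "cmod (\<mu> \<phi>) \<le> m" if \<phi>: "\<phi> \<in> V" and le: "\<And>x. cmod (\<phi> x) \<le> 1" for \<phi>
  proof (cases "\<mu> \<phi> = 0")
    case False
    define c where "c = cnj (\<mu> \<phi>) / cmod (\<mu> \<phi>)"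
    have c: "cmod c = 1" using False by (simp add: c_def norm_divide)
    have "c * \<mu> \<phi> = of_real (cmod (\<mu> \<phi>))"
      using False by (simp add: c_def complex_norm_square[symmetric] power2_eq_square mult.commute[of "cnj _"])
    define \<psi> where "\<psi> = (\<lambda>x. c * \<phi> x)"
    have \<psi>: "\<psi> \<in> V" using \<phi> V' by (simp add: \<psi>_def)
    have \<mu>\<psi>: "\<mu> \<psi> = of_real (cmod (\<mu> \<phi>))" using \<phi> scale \<open>c * \<mu> \<phi> = _\<close> by (simp add: \<psi>_def)
    have le': "cmod (\<psi> x) \<le> 1" for x using le[of x] c by (simp add: \<psi>_def norm_mult)
    define r where "r = (\<lambda>x. (1/2) * (\<psi> x + cnj (\<psi> x)))"
    define i where "i = (\<lambda>x. (-\<i>/2) * (\<psi> x + (-1) * cnj (\<psi> x)))"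
    have ri: "r \<in> V" "i \<in> V" unfolding r_def i_def by (intro V'(3) V'(4) V'(5) \<psi>)+
    have rr: "r x = of_real (Re (\<psi> x))" "i x = of_real (Im (\<psi> x))" for x
      by (auto simp: r_def i_def complex_eq_iff)
    have \<psi>_eq: "\<psi> = (\<lambda>x. r x + \<i> * i x)" unfolding rr by (auto simp: complex_eq_iff)
    have "\<mu> \<psi> = \<mu> r + \<i> * \<mu> i"
      using add[OF ri(1) V'(4)[OF ri(2), of \<i>]] scale[OF ri(2), of \<i>] by (simp flip: \<psi>_eq)
    moreover have "\<mu> r \<in> \<real>" "\<mu> i \<in> \<real>" using ri rr by (auto intro: real)
    ultimately have eq: "Re (\<mu> r) = cmod (\<mu> \<phi>)" using \<mu>\<psi>
      by (simp add: complex_is_Real_iff complex_eq_iff)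
    have "\<mu> (\<lambda>x. ?one x + (-1) * r x) \<in> \<real>\<^sub>\<ge>\<^sub>0"
    proof (rule pos)
      show "(\<lambda>x. ?one x + (-1) * r x) \<in> V" by (intro V'(2) V'(3) V'(4) ri)
      show "?one x + (-1) * r x \<in> \<real>\<^sub>\<ge>\<^sub>0" for x
      proof (cases "x \<in> carrier G")
        case True
        have "Re (\<psi> x) \<le> 1" using le'[of x] complex_Re_le_cmod order_trans by blast
        moreover have "?one x + (-1) * r x = of_real (1 - Re (\<psi> x))" using True by (simp add: rr)
        ultimately show ?thesis by (simp only: of_real_nonneg)
      next
        case False
        then have "\<psi> x = 0" using linf_zero[of \<psi> G x] \<psi> V'(1) by auto
        then show ?thesis using False by (simp add: rr)
      qed
    qed
    then have "Re (\<mu> ?one + (-1) * \<mu> r) \<ge> 0"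
      using add[OF V'(2) V'(4)[OF ri(1), of "-1"]] scale[OF ri(1), of "-1"]
      by (simp add: complex_nonneg_Reals_iff)
    then show ?thesis using eq m by simp
  qed (use m in simp)
  have sup: "(SUP \<phi>\<in>{\<phi> \<in> V. \<forall>x. cmod (\<phi> x) \<le> 1}. ereal (cmod (\<mu> \<phi>))) = 1"
    using \<mu> by (simp add: mean_on_def)
  have "ereal (cmod (\<mu> ?one)) \<le> 1"
    unfolding sup[symmetric]
  proof (rule SUP_upper)
    show "?one \<in> {\<phi> \<in> V. \<forall>x. cmod (\<phi> x) \<le> 1}"
      using V'(2) by (simp split: split_indicator)
  qed
  moreover have "1 \<le> ereal m"
    unfolding sup[symmetric] by (rule SUP_least) (use bd in auto)
  ultimately have m1: "m = 1" using m by (simp add: one_ereal_def)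
  then show "\<mu> ?one = 1" using m by simp
  show "cmod (\<mu> \<phi>) \<le> C" if \<phi>: "\<phi> \<in> V" and C: "0 \<le> C" "\<And>x. x \<in> carrier G \<Longrightarrow> cmod (\<phi> x) \<le> C" for \<phi> C
  proof (rule field_le_epsilon)
    fix e :: real assume e: "e > 0"
    \<comment> \<open>Dividing by \<open>C + e\<close> instead of \<open>C\<close> includes the case
      \<open>C = 0\<close>.\<close>
    have "cmod (\<mu> (\<lambda>x. of_real (1 / (C + e)) * \<phi> x)) \<le> m"
    proof (rule bd)
      show "cmod (of_real (1 / (C + e)) * \<phi> x) \<le> 1" for x
      proof (cases "x \<in> carrier G")
        case True
        have "cmod (of_real (1 / (C + e)) * \<phi> x) = cmod (\<phi> x) / (C + e)"
          using C(1) e by (simp only: norm_mult norm_of_real) simp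
        then show ?thesis using C(2)[OF True] C(1) e by simp
      next
        case False
        then show ?thesis using linf_zero[of \<phi> G x] \<phi> V'(1) by auto
      qed
    qed (rule V'(4)[OF \<phi>])
    then show "cmod (\<mu> \<phi>) \<le> C + e"
      using C(1) e m1 by (simp only: scale[OF \<phi>] norm_mult norm_of_real) (simp add: field_simps)
  qed
qed

lemma mean_onI:
  assumes V: "star_space G V"
    and "\<And>\<phi> \<psi>. \<lbrakk>\<phi> \<in> V; \<psi> \<in> V\<rbrakk> \<Longrightarrow> \<mu> (\<lambda>x. \<phi> x + \<psi> x) = \<mu> \<phi> + \<mu> \<psi>"
    and "\<And>c \<phi>. \<phi> \<in> V \<Longrightarrow> \<mu> (\<lambda>x. c * \<phi> x) = c * \<mu> \<phi>"
    and pos: "\<And>\<phi>. \<lbrakk>\<phi> \<in> V; \<And>x. \<phi> x \<in> \<real>\<^sub>\<ge>\<^sub>0\<rbrakk> \<Longrightarrow> \<mu> \<phi> \<in> \<real>\<^sub>\<ge>\<^sub>0"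
    and one: "\<mu> (indicator (carrier G)) = 1"
    and le: "\<And>\<phi>. \<lbrakk>\<phi> \<in> V; \<And>x. cmod (\<phi> x) \<le> 1\<rbrakk> \<Longrightarrow> cmod (\<mu> \<phi>) \<le> 1"
  shows "mean_on V \<mu>"
proof -
  have "(SUP \<phi>\<in>{\<phi> \<in> V. \<forall>x. cmod (\<phi> x) \<le> 1}. ereal (cmod (\<mu> \<phi>))) = 1"
  proof (rule antisym)
    show "(SUP \<phi>\<in>{\<phi> \<in> V. \<forall>x. cmod (\<phi> x) \<le> 1}. ereal (cmod (\<mu> \<phi>))) \<le> 1"
      by (rule SUP_least) (use le in \<open>auto simp: one_ereal_def\<close>)
    have "ereal (cmod (\<mu> (indicator (carrier G)))) \<le>
        (SUP \<phi>\<in>{\<phi> \<in> V. \<forall>x. cmod (\<phi> x) \<le> 1}. ereal (cmod (\<mu> \<phi>)))"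
    proof (rule SUP_upper)
      show "indicator (carrier G) \<in> {\<phi> \<in> V. \<forall>x. cmod (\<phi> x) \<le> 1}"
        using star_spaceD(2)[OF V] by (simp split: split_indicator)
    qed
    then show "1 \<le> (SUP \<phi>\<in>{\<phi> \<in> V. \<forall>x. cmod (\<phi> x) \<le> 1}. ereal (cmod (\<mu> \<phi>)))"
      by (simp add: one one_ereal_def)
  qed
  with assms show ?thesis unfolding mean_on_def by blast
qed

section \<open>The Hahn-Banach theorem\<close>

definition sublinear_on :: "('b \<Rightarrow> real) set \<Rightarrow> (('b \<Rightarrow> real) \<Rightarrow> real) \<Rightarrow> bool" where
  "sublinear_on E p \<longleftrightarrow> (\<forall>x\<in>E. \<forall>y\<in>E. p (\<lambda>b. x b + y b) \<le> p x + p y) \<and>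
     (\<forall>c\<ge>0. \<forall>x\<in>E. p (\<lambda>b. c * x b) = c * p x)"

text \<open>Hahn-Banach: a minimal sublinear functional below \<open>q\<close> is linear.\<close>

lemma sublinear_minorant_linear:
  fixes E :: "('b \<Rightarrow> real) set"
  assumes E: "\<And>x y. \<lbrakk>x \<in> E; y \<in> E\<rbrakk> \<Longrightarrow> (\<lambda>b. x b + y b) \<in> E" "\<And>c x. x \<in> E \<Longrightarrow> (\<lambda>b. c * x b) \<in> E"
    and q: "sublinear_on E q"
  shows "\<exists>p. (\<forall>x\<in>E. \<forall>y\<in>E. p (\<lambda>b. x b + y b) = p x + p y) \<and>
    (\<forall>c. \<forall>x\<in>E. p (\<lambda>b. c * x b) = c * p x) \<and> (\<forall>x\<in>E. p x \<le> q x)"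
proof -
  define S where "S = {p. sublinear_on E p \<and> (\<forall>x\<in>E. p x \<le> q x) \<and> (\<forall>x. x \<notin> E \<longrightarrow> p x = 0)}"
  let ?P = "\<lambda>p p'. \<forall>x. p' x \<le> (p x :: real)"
  have sub: "p (\<lambda>b. x b + y b) \<le> p x + p y" if "p \<in> S" "x \<in> E" "y \<in> E" for p x y
    using that by (auto simp: S_def sublinear_on_def)
  have hom: "p (\<lambda>b. c * x b) = c * p x" if "p \<in> S" "x \<in> E" "c \<ge> 0" for p x c
    using that by (auto simp: S_def sublinear_on_def)
  have leq: "p x \<le> q x" if "p \<in> S" "x \<in> E" for p x using that by (auto simp: S_def)
  have lower: "- p (\<lambda>b. - 1 * x b) \<le> p x" if "p \<in> S" "x \<in> E" for p x
  proof -
    have "p (\<lambda>b. 0 * x b) = 0" using hom[OF that, of 0] by simp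
    then show ?thesis using sub[OF that E(2)[OF that(2), of "-1"]] by simp
  qed
  \<comment> \<open>For homogeneity one inequality with \<open>c > 0\<close> suffices, as the other
    follows from it at \<open>1 / c\<close>. Functionals in \<open>S\<close> vanish off
    \<open>E\<close>, so comparing them on the whole type is comparing them on
    \<open>E\<close>.\<close>
  have S_I: "(\<lambda>x. if x \<in> E then r x else 0) \<in> S"
    if "\<And>x y. \<lbrakk>x \<in> E; y \<in> E\<rbrakk> \<Longrightarrow> r (\<lambda>b. x b + y b) \<le> r x + r y"
      "\<And>c x. \<lbrakk>c > 0; x \<in> E\<rbrakk> \<Longrightarrow> r (\<lambda>b. c * x b) \<le> c * r x"
      "\<And>x. x \<in> E \<Longrightarrow> r x \<le> q x" "\<And>x. x \<in> E \<Longrightarrow> r (\<lambda>b. 0 * x b) = 0" for r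
  proof -
    have "r (\<lambda>b. c * x b) = c * r x" if "c \<ge> 0" "x \<in> E" for c x
    proof (cases "c = 0")
      case True
      then show ?thesis using \<open>\<And>x. x \<in> E \<Longrightarrow> r (\<lambda>b. 0 * x b) = 0\<close> that by simp
    next
      case False
      then have "r (\<lambda>b. (1 / c) * (c * x b)) \<le> (1 / c) * r (\<lambda>b. c * x b)"
        using that E by (intro \<open>\<And>c x. \<lbrakk>c > 0; x \<in> E\<rbrakk> \<Longrightarrow> r (\<lambda>b. c * x b) \<le> c * r x\<close>) auto
      then have "c * r x \<le> r (\<lambda>b. c * x b)" using False that by (simp add: field_simps)
      moreover have "r (\<lambda>b. c * x b) \<le> c * r x"
        using False that by (intro \<open>\<And>c x. \<lbrakk>c > 0; x \<in> E\<rbrakk> \<Longrightarrow> r (\<lambda>b. c * x b) \<le> c * r x\<close>) auto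
      ultimately show ?thesis by simp
    qed
    then show ?thesis using that E by (auto simp: S_def sublinear_on_def)
  qed
  have "\<exists>m\<in>S. \<forall>a\<in>S. ?P m a \<longrightarrow> a = m"
  proof (rule predicate_Zorn)
    show "partial_order_on S (relation_of ?P S)"
      by (rule partial_order_on_relation_ofI) (auto intro: order_trans intro!: ext simp: order_antisym)
    fix C assume C: "C \<in> Chains (relation_of ?P S)"
    then have CS: "C \<subseteq> S" and tot: "\<And>p p'. p \<in> C \<Longrightarrow> p' \<in> C \<Longrightarrow> ?P p p' \<or> ?P p' p"
      by (auto simp: Chains_def relation_of_def)
    show "\<exists>u\<in>S. \<forall>a\<in>C. ?P a u"
    proof (cases "C = {}")
      case True
      have "(\<lambda>x. if x \<in> E then q x else 0) \<in> S"
      proof (rule S_I)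
        show "q (\<lambda>b. 0 * x b) = 0" if "x \<in> E" for x
        proof -
          have "q (\<lambda>b. 0 * x b) = 0 * q x" using q that unfolding sublinear_on_def by blast
          then show ?thesis by simp
        qed
      qed (use q in \<open>auto simp: sublinear_on_def\<close>)
      then show ?thesis using True by blast
    next
      case False
      \<comment> \<open>The lower bound of a nonempty chain is the pointwise infimum. It is finite
        because \<open>p x\<close> is at least \<open>- p (- x)\<close> and hence at least
        \<open>- q (- x)\<close> for every \<open>p\<close> in \<open>S\<close>.\<close>
      define u where "u x = (INF p\<in>C. p x)" for x
      have bdd: "bdd_below ((\<lambda>p. p x) ` C)" if "x \<in> E" for x
      proof (rule bdd_belowI2)
        fix p assume "p \<in> C"
        then show "- q (\<lambda>b. - 1 * x b) \<le> p x"
          using lower[of p x] leq[of p "\<lambda>b. - 1 * x b"] CS that E(2)[OF that, of "-1"] by auto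
      qed
      have u_le: "u x \<le> p x" if "p \<in> C" "x \<in> E" for p x
        unfolding u_def by (rule cINF_lower[OF bdd[OF that(2)] that(1)])
      have u_ge: "c \<le> u x" if "\<And>p. p \<in> C \<Longrightarrow> c \<le> p x" for c x
        unfolding u_def using False that by (rule cINF_greatest)
      have "(\<lambda>x. if x \<in> E then u x else 0) \<in> S"
      proof (rule S_I)
        fix x y assume x: "x \<in> E" and y: "y \<in> E"
        have "u (\<lambda>b. x b + y b) - p x \<le> u y" if p: "p \<in> C" for p
        proof (rule u_ge)
          fix p' assume p': "p' \<in> C"
          obtain p'' where p'': "p'' \<in> C" "p'' x \<le> p x" "p'' y \<le> p' y"
            using tot[OF p p'] p p' by auto
          have "u (\<lambda>b. x b + y b) \<le> p'' x + p'' y"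
            using u_le[OF p''(1) E(1)[OF x y]] sub[of p'' x y] p''(1) CS x y by force
          then show "u (\<lambda>b. x b + y b) - p x \<le> p' y" using p'' by simp
        qed
        then have "u (\<lambda>b. x b + y b) - u y \<le> u x" by (intro u_ge) (simp add: algebra_simps)
        then show "u (\<lambda>b. x b + y b) \<le> u x + u y" by simp
      next
        fix c :: real and x assume c: "c > 0" and x: "x \<in> E"
        have "u (\<lambda>b. c * x b) / c \<le> u x"
        proof (rule u_ge)
          fix p assume p: "p \<in> C"
          show "u (\<lambda>b. c * x b) / c \<le> p x"
            using u_le[OF p E(2)[OF x, of c]] hom[of p x c] p CS x c by (auto simp: field_simps)
        qed
        then show "u (\<lambda>b. c * x b) \<le> c * u x" using c by (simp add: field_simps)
      next
        fix x assume x: "x \<in> E"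
        obtain p where p: "p \<in> C" using False by auto
        then show "u x \<le> q x" using u_le[OF p x] leq[of p x] CS x by force
        have "p (\<lambda>b. 0 * x b) = 0" if "p \<in> C" for p using hom[of p x 0] CS x that by auto
        then have "(\<lambda>p. p (\<lambda>b. 0 * x b)) ` C = (\<lambda>_. 0) ` C" by (intro image_cong) auto
        then have "(\<lambda>p. p (\<lambda>b. 0 * x b)) ` C = {0}" using False
          by (simp only: image_constant_conv if_False)
        then show "u (\<lambda>b. 0 * x b) = 0" by (simp add: u_def)
      qed
      moreover have "?P p (\<lambda>x. if x \<in> E then u x else 0)" if "p \<in> C" for p
        using u_le[OF that] CS that by (auto simp: S_def)
      ultimately show ?thesis by (intro bexI[of _ "\<lambda>x. if x \<in> E then u x else 0"] ballI)
    qed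
  qed
  then obtain p where p: "p \<in> S" and min: "\<And>r. r \<in> S \<Longrightarrow> (\<And>x. r x \<le> p x) \<Longrightarrow> r = p" by blast
  have super: "p x + p y \<le> p (\<lambda>b. x b + y b)" if x: "x \<in> E" and y: "y \<in> E" for x y
  proof -
    \<comment> \<open>\<open>r\<close> lowers \<open>p\<close> along the ray through
      \<open>y\<close>, subtracting what linearity in that direction would contribute. It is
      sublinear and below \<open>p\<close>, so minimality forces \<open>r = p\<close>, and the term
      \<open>t = 1\<close> gives superadditivity.\<close>
    define r where "r x = (INF t\<in>{0..}. p (\<lambda>b. x b + t * y b) - t * p y)" for x
    have bdd: "bdd_below ((\<lambda>t. p (\<lambda>b. x b + t * y b) - t * p y) ` {0..})" if x: "x \<in> E" for x
    proof (rule bdd_belowI2)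
      fix t :: real assume t: "t \<in> {0..}"
      have "p (\<lambda>b. (x b + t * y b) + (-1) * x b) \<le> p (\<lambda>b. x b + t * y b) + p (\<lambda>b. (-1) * x b)"
        by (intro sub[OF p] E x y)
      moreover have "p (\<lambda>b. t * y b) = t * p y" using t by (intro hom[OF p y]) simp
      ultimately show "- p (\<lambda>b. (-1) * x b) \<le> p (\<lambda>b. x b + t * y b) - t * p y" by simp
    qed
    have r_le: "r x \<le> p (\<lambda>b. x b + t * y b) - t * p y" if "x \<in> E" "t \<ge> 0" for x t
      unfolding r_def by (rule cINF_lower[OF bdd[OF that(1)]]) (use that in simp)
    have r_ge: "c \<le> r x" if "\<And>t. t \<ge> 0 \<Longrightarrow> c \<le> p (\<lambda>b. x b + t * y b) - t * p y" for c x
      unfolding r_def by (rule cINF_greatest) (use that in auto)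
    have r_p: "r x \<le> p x" if "x \<in> E" for x using r_le[OF that, of 0] by simp
    have "(\<lambda>x. if x \<in> E then r x else 0) \<in> S"
    proof (rule S_I)
      fix x x' assume x: "x \<in> E" and x': "x' \<in> E"
      have "r (\<lambda>b. x b + x' b) - (p (\<lambda>b. x b + t * y b) - t * p y) \<le> r x'" if t: "t \<ge> 0" for t
      proof (rule r_ge)
        fix t' :: real assume t': "t' \<ge> 0"
        have "p (\<lambda>b. (x b + x' b) + (t + t') * y b) = p (\<lambda>b. (x b + t * y b) + (x' b + t' * y b))"
          by (simp add: algebra_simps)
        also have "\<dots> \<le> p (\<lambda>b. x b + t * y b) + p (\<lambda>b. x' b + t' * y b)"
          using x x' y E by (intro sub[OF p]) auto
        finally show "r (\<lambda>b. x b + x' b) - (p (\<lambda>b. x b + t * y b) - t * p y)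
            \<le> p (\<lambda>b. x' b + t' * y b) - t' * p y"
          using r_le[OF E(1)[OF x x'], of "t + t'"] t t' by (simp add: algebra_simps)
      qed
      then have "r (\<lambda>b. x b + x' b) - r x' \<le> r x" by (intro r_ge) (simp add: algebra_simps)
      then show "r (\<lambda>b. x b + x' b) \<le> r x + r x'" by simp
    next
      fix c :: real and x assume c: "c > 0" and x: "x \<in> E"
      have "r (\<lambda>b. c * x b) / c \<le> r x"
      proof (rule r_ge)
        fix t :: real assume t: "t \<ge> 0"
        have "r (\<lambda>b. c * x b) \<le> p (\<lambda>b. c * x b + (c * t) * y b) - (c * t) * p y"
          using c t x E by (intro r_le) auto
        also have "p (\<lambda>b. c * x b + (c * t) * y b) = p (\<lambda>b. c * (x b + t * y b))"
          by (simp add: algebra_simps)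
        also have "\<dots> = c * p (\<lambda>b. x b + t * y b)" using x y E c by (intro hom[OF p]) auto
        finally show "r (\<lambda>b. c * x b) / c \<le> p (\<lambda>b. x b + t * y b) - t * p y"
          using c by (simp add: field_simps)
      qed
      then show "r (\<lambda>b. c * x b) \<le> c * r x" using c by (simp add: field_simps)
    next
      fix x assume x: "x \<in> E"
      show "r x \<le> q x" using r_p[OF x] leq[OF p x] by simp
      have z: "p (\<lambda>b. 0 * x b + t * y b) - t * p y = 0" if "t \<ge> 0" for t
        using hom[OF p y that] by simp
      show "r (\<lambda>b. 0 * x b) = 0"
        using r_le[OF E(2)[OF x, of 0], of 0] z[of 0] r_ge[of 0 "\<lambda>b. 0 * x b"] z by (intro antisym) auto
    qed
    then have "(\<lambda>x. if x \<in> E then r x else 0) = p"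
      by (rule min) (use r_p p in \<open>auto simp: S_def\<close>)
    from fun_cong[OF this, of x] have "p x = r x" using x by simp
    then show ?thesis using r_le[OF x, of 1] by simp
  qed
  have add: "p (\<lambda>b. x b + y b) = p x + p y" if "x \<in> E" "y \<in> E" for x y
    using super[OF that] sub[OF p that] by simp
  moreover have "p (\<lambda>b. c * x b) = c * p x" if x: "x \<in> E" for c x
  proof (cases "c \<ge> 0")
    case False
    have "p (\<lambda>b. c * x b + (-c) * x b) = p (\<lambda>b. c * x b) + p (\<lambda>b. (-c) * x b)"
      by (intro add E x)
    moreover have "p (\<lambda>b. (-c) * x b) = (-c) * p x" using False by (intro hom[OF p x]) simp
    moreover have "p (\<lambda>b. 0 * x b) = 0" using hom[OF p x, of 0] by simp
    ultimately show ?thesis by simp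
  qed (rule hom[OF p x])
  ultimately show ?thesis using leq[OF p] by blast
qed

section \<open>Extension of a mean to all bounded functions\<close>

definition creal :: "('a, 'm) monoid_scheme \<Rightarrow> ('a \<Rightarrow> real) \<Rightarrow> 'a \<Rightarrow> complex" where
  "creal G r = (\<lambda>x. if x \<in> carrier G then complex_of_real (r x) else 0)"

definition real_mean :: "('a, 'm) monoid_scheme \<Rightarrow> (('a \<Rightarrow> complex) \<Rightarrow> complex) \<Rightarrow> ('a \<Rightarrow> real) \<Rightarrow> real" where
  "real_mean G \<mu> r = Re (\<mu> (creal G r))"

lemma creal_add: "creal G (\<lambda>x. r x + r' x) = (\<lambda>x. creal G r x + creal G r' x)"
  and creal_scale: "creal G (\<lambda>x. c * r x) = (\<lambda>x. of_real c * creal G r x)"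
  and creal_const: "creal G (\<lambda>_. c) = (\<lambda>x. of_real c * indicator (carrier G) x)"
  by (auto simp: creal_def)

lemma
  assumes V: "star_space G V" and \<mu>: "mean_on V \<mu>"
  shows real_mean_add: "\<lbrakk>creal G r \<in> V; creal G r' \<in> V\<rbrakk> \<Longrightarrow> real_mean G \<mu> (\<lambda>x. r x + r' x) = real_mean G \<mu> r + real_mean G \<mu> r'"
    and real_mean_scale: "creal G r \<in> V \<Longrightarrow> real_mean G \<mu> (\<lambda>x. c * r x) = c * real_mean G \<mu> r"
    and real_mean_const: "real_mean G \<mu> (\<lambda>_. c) = c"
    and real_mean_mono: "\<lbrakk>creal G r \<in> V; creal G r' \<in> V; \<And>x. x \<in> carrier G \<Longrightarrow> r x \<le> r' x\<rbrakk> \<Longrightarrow> real_mean G \<mu> r \<le> real_mean G \<mu> r'"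
    and real_mean_of_real: "creal G r \<in> V \<Longrightarrow> \<mu> (creal G r) = of_real (real_mean G \<mu> r)"
proof -
  note V' = star_spaceD[OF V]
  show add: "real_mean G \<mu> (\<lambda>x. r x + r' x) = real_mean G \<mu> r + real_mean G \<mu> r'" if "creal G r \<in> V" "creal G r' \<in> V" for r r'
    using mean_add[OF V \<mu> that] by (simp add: real_mean_def creal_add)
  show scale: "real_mean G \<mu> (\<lambda>x. c * r x) = c * real_mean G \<mu> r" if "creal G r \<in> V" for r c
    using mean_scale[OF V \<mu> that] by (simp add: real_mean_def creal_scale)
  show "real_mean G \<mu> (\<lambda>_. c) = c"
    using mean_scale[OF V \<mu> V'(2)] mean_one[OF V \<mu>] by (simp add: real_mean_def creal_const)
  show "\<mu> (creal G r) = of_real (real_mean G \<mu> r)" if "creal G r \<in> V" for r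
    using mean_real[OF V \<mu> that] by (simp add: real_mean_def creal_def)
  show "real_mean G \<mu> r \<le> real_mean G \<mu> r'" if r: "creal G r \<in> V" "creal G r' \<in> V" "\<And>x. x \<in> carrier G \<Longrightarrow> r x \<le> r' x" for r r'
  proof -
    have c: "creal G (\<lambda>x. -1 * r x) \<in> V" unfolding creal_scale by (rule V'(4)[OF r(1)])
    have "creal G (\<lambda>x. r' x + -1 * r x) \<in> V" unfolding creal_add by (rule V'(3)[OF r(2) c])
    moreover have "creal G (\<lambda>x. r' x + -1 * r x) x \<in> \<real>\<^sub>\<ge>\<^sub>0" for x
      using r(3) by (simp add: creal_def of_real_nonneg flip: of_real_diff)
    ultimately have "\<mu> (creal G (\<lambda>x. r' x + -1 * r x)) \<in> \<real>\<^sub>\<ge>\<^sub>0" by (rule mean_pos[OF V \<mu>])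
    then have "real_mean G \<mu> (\<lambda>x. r' x + -1 * r x) \<ge> 0"
      by (simp add: real_mean_def complex_nonneg_Reals_iff)
    then show ?thesis using add[OF r(2) c] scale[OF r(1), of "-1"] by simp
  qed
qed

lemma real_mean_cong: "(\<And>x. x \<in> carrier G \<Longrightarrow> r x = r' x) \<Longrightarrow> real_mean G \<mu> r = real_mean G \<mu> r'"
  unfolding real_mean_def creal_def by (intro arg_cong[of _ _ Re] arg_cong[of _ _ \<mu>]) auto

lemma creal_linfI: "(\<And>x. x \<in> carrier G \<Longrightarrow> \<bar>r x\<bar> \<le> C) \<Longrightarrow> creal G r \<in> linf G"
  by (rule linfI[where C = C]) (auto simp: creal_def)

lemma creal_linfD:
  assumes "creal G r \<in> linf G"
  obtains C where "0 < C" "\<And>x. x \<in> carrier G \<Longrightarrow> \<bar>r x\<bar> \<le> C"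
proof -
  obtain C where C: "0 < C" "\<And>x. cmod (creal G r x) \<le> C" using linf_bound[OF assms] by blast
  have "\<bar>r x\<bar> \<le> C" if "x \<in> carrier G" for x using C(2)[of x] that by (simp add: creal_def)
  then show thesis by (rule that[OF C(1)])
qed

text \<open>The sublinear functional is the upper mean \<open>q\<close>: the infimum of
  \<open>\<eta>\<close> over the majorants in \<open>V\<close>, finite since \<open>V\<close>
  contains the constants. A linear functional below \<open>q\<close> agrees with
  \<open>\<eta>\<close> on \<open>V\<close>, by comparison at \<open>r\<close> and at
  \<open>- r\<close>, and it respects constant upper bounds, which gives positivity and the norm.
  Real and imaginary parts are extended separately.\<close>

theorem mean_extension:
  assumes V: "star_space G V" and \<eta>: "mean_on V \<eta>"
  obtains \<mu> where "\<mu> \<in> means G" "\<And>\<phi>. \<phi> \<in> V \<Longrightarrow> \<mu> \<phi> = \<eta> \<phi>"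
proof -
  note V' = star_spaceD[OF V]
  define E where "E = {r :: 'a \<Rightarrow> real. creal G r \<in> linf G \<and> (\<forall>x. x \<notin> carrier G \<longrightarrow> r x = 0)}"
  define maj where "maj r = {s. creal G s \<in> V \<and> (\<forall>x\<in>carrier G. r x \<le> s x)}" for r
  define q where "q r = Inf (real_mean G \<eta> ` maj r)" for r
  note L = star_spaceD[OF star_space_linf[of G]]
  have Ecl: "(\<lambda>b. x b + y b) \<in> E" "(\<lambda>b. c * x b) \<in> E" if "x \<in> E" "y \<in> E" for x y c
    using that L by (auto simp: E_def creal_add creal_scale)
  have constV: "creal G (\<lambda>_. c) \<in> V" for c unfolding creal_const by (rule V'(4)[OF V'(2)])
  have E_bd: "\<exists>C. \<forall>x\<in>carrier G. \<bar>r x\<bar> \<le> C" if r: "r \<in> E" for r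
  proof -
    have "creal G r \<in> linf G" using r by (simp add: E_def)
    then show ?thesis by (rule creal_linfD) blast
  qed
  have ne: "maj r \<noteq> {}" if r: "r \<in> E" for r
  proof -
    obtain C where "\<And>x. x \<in> carrier G \<Longrightarrow> \<bar>r x\<bar> \<le> C" using E_bd[OF r] by blast
    then have "(\<lambda>_. C) \<in> maj r" using constV by (fastforce simp: maj_def)
    then show ?thesis by auto
  qed
  have lower: "-C \<le> real_mean G \<eta> s" if "s \<in> maj r" "\<And>x. x \<in> carrier G \<Longrightarrow> \<bar>r x\<bar> \<le> C" for r s C
  proof -
    have "real_mean G \<eta> (\<lambda>_. -C) \<le> real_mean G \<eta> s"
      by (rule real_mean_mono[OF V \<eta>]) (use that constV in \<open>force simp: maj_def\<close>)+
    then show ?thesis using real_mean_const[OF V \<eta>] by simp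
  qed
  have bdd: "bdd_below (real_mean G \<eta> ` maj r)" if r: "r \<in> E" for r
  proof -
    obtain C where "\<And>x. x \<in> carrier G \<Longrightarrow> \<bar>r x\<bar> \<le> C" using E_bd[OF r] by blast
    then show ?thesis using lower by (intro bdd_belowI2[of _ "-C"]) blast
  qed
  have q_le: "q r \<le> real_mean G \<eta> s" if "r \<in> E" "s \<in> maj r" for r s
    unfolding q_def using bdd[OF that(1)] that(2) by (intro cInf_lower) auto
  have q_ge: "c \<le> q r" if "r \<in> E" "\<And>s. s \<in> maj r \<Longrightarrow> c \<le> real_mean G \<eta> s" for r c
    unfolding q_def using ne[OF that(1)] that(2) by (intro cInf_greatest) auto
  have "sublinear_on E q"
    unfolding sublinear_on_def
  proof (intro conjI ballI allI impI)
    fix x y assume x: "x \<in> E" and y: "y \<in> E"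
    have "q (\<lambda>b. x b + y b) - real_mean G \<eta> s \<le> q y" if s: "s \<in> maj x" for s
    proof (rule q_ge[OF y])
      fix s' assume s': "s' \<in> maj y"
      have "(\<lambda>b. s b + s' b) \<in> maj (\<lambda>b. x b + y b)"
        using s s' V' by (auto simp: maj_def creal_add intro: add_mono)
      then have "q (\<lambda>b. x b + y b) \<le> real_mean G \<eta> (\<lambda>b. s b + s' b)" using Ecl(1)[OF x y] by (intro q_le)
      then show "q (\<lambda>b. x b + y b) - real_mean G \<eta> s \<le> real_mean G \<eta> s'"
        using real_mean_add[OF V \<eta>, of s s'] s s' by (simp add: maj_def)
    qed
    then have "q (\<lambda>b. x b + y b) - q y \<le> q x" by (intro q_ge[OF x]) (simp add: algebra_simps)
    then show "q (\<lambda>b. x b + y b) \<le> q x + q y" by simp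
  next
    fix c :: real and x assume c: "c \<ge> 0" and x: "x \<in> E"
    have le: "q (\<lambda>b. c * x b) \<le> c * q x" if c: "c > 0" and x: "x \<in> E" for c x
    proof -
      have "q (\<lambda>b. c * x b) / c \<le> q x"
      proof (rule q_ge[OF x])
        fix s assume s: "s \<in> maj x"
        have "(\<lambda>b. c * s b) \<in> maj (\<lambda>b. c * x b)"
          using s V' c by (auto simp: maj_def creal_scale)
        then have "q (\<lambda>b. c * x b) \<le> real_mean G \<eta> (\<lambda>b. c * s b)" using Ecl(2)[OF x x] by (intro q_le)
        then show "q (\<lambda>b. c * x b) / c \<le> real_mean G \<eta> s"
          using real_mean_scale[OF V \<eta>, of s c] s c by (simp add: maj_def field_simps)
      qed
      then show ?thesis using c by (simp add: field_simps)
    qed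
    show "q (\<lambda>b. c * x b) = c * q x"
    proof (cases "c = 0")
      case True
      have z: "(\<lambda>b. 0) \<in> E" using Ecl(2)[OF x x, of 0] by simp
      have "q (\<lambda>b. 0) = 0"
      proof (rule antisym)
        have "(\<lambda>_. 0) \<in> maj (\<lambda>_. 0)" using constV[of 0] by (simp add: maj_def)
        then show "q (\<lambda>b. 0) \<le> 0" using q_le[OF z] real_mean_const[OF V \<eta>, of 0] by fastforce
        show "0 \<le> q (\<lambda>b. 0)" using lower[of _ "\<lambda>_. 0" 0] by (intro q_ge[OF z]) simp
      qed
      then show ?thesis using True by simp
    next
      case False
      then have "q (\<lambda>b. (1 / c) * (c * x b)) \<le> (1 / c) * q (\<lambda>b. c * x b)"
        using c Ecl(2)[OF x x] by (intro le) auto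
      then have "c * q x \<le> q (\<lambda>b. c * x b)" using False c by (simp add: field_simps)
      then show ?thesis using le[of c x] False c x by simp
    qed
  qed
  then have "\<exists>p. (\<forall>x\<in>E. \<forall>y\<in>E. p (\<lambda>b. x b + y b) = p x + p y) \<and>
    (\<forall>c. \<forall>x\<in>E. p (\<lambda>b. c * x b) = c * p x) \<and> (\<forall>x\<in>E. p x \<le> q x)"
    by (rule sublinear_minorant_linear[rotated 2]) (use Ecl in blast)+
  then obtain p where p: "\<And>x y. \<lbrakk>x \<in> E; y \<in> E\<rbrakk> \<Longrightarrow> p (\<lambda>b. x b + y b) = p x + p y"
    "\<And>c x. x \<in> E \<Longrightarrow> p (\<lambda>b. c * x b) = c * p x" "\<And>x. x \<in> E \<Longrightarrow> p x \<le> q x" by blast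
  have p_V: "p r = real_mean G \<eta> r" if r: "creal G r \<in> V" "r \<in> E" for r
  proof (rule antisym)
    have "r \<in> maj r" using r by (simp add: maj_def)
    then show "p r \<le> real_mean G \<eta> r" using p(3)[OF r(2)] q_le[OF r(2)] by fastforce
    have "creal G (\<lambda>b. -1 * r b) \<in> V" unfolding creal_scale by (rule V'(4)[OF r(1)])
    then have m: "(\<lambda>b. -1 * r b) \<in> maj (\<lambda>b. -1 * r b)" by (simp add: maj_def)
    have E': "(\<lambda>b. -1 * r b) \<in> E" by (rule Ecl(2)[OF r(2) r(2)])
    show "real_mean G \<eta> r \<le> p r"
      using p(3)[OF E'] q_le[OF E' m] p(2)[OF r(2), of "-1"] real_mean_scale[OF V \<eta> r(1), of "-1"] by linarith
  qed
  have ReE: "(\<lambda>x. Re (\<phi> x)) \<in> E" and ImE: "(\<lambda>x. Im (\<phi> x)) \<in> E" if \<phi>: "\<phi> \<in> linf G" for \<phi>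
  proof -
    obtain C where C: "\<And>x. cmod (\<phi> x) \<le> C" using linf_bound[OF \<phi>] by blast
    have "\<bar>Re (\<phi> x)\<bar> \<le> C" "\<bar>Im (\<phi> x)\<bar> \<le> C" for x
      using C[of x] abs_Re_le_cmod[of "\<phi> x"] abs_Im_le_cmod[of "\<phi> x"] by linarith+
    then show "(\<lambda>x. Re (\<phi> x)) \<in> E" "(\<lambda>x. Im (\<phi> x)) \<in> E"
      using linf_zero[OF \<phi>] by (auto simp: E_def intro: creal_linfI)
  qed
  define \<mu> where "\<mu> \<phi> = Complex (p (\<lambda>x. Re (\<phi> x))) (p (\<lambda>x. Im (\<phi> x)))" for \<phi> :: "'a \<Rightarrow> complex"
  have ext: "\<mu> \<phi> = \<eta> \<phi>" if \<phi>: "\<phi> \<in> V" for \<phi>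
  proof -
    have l: "\<phi> \<in> linf G" using \<phi> V' by auto
    have eq: "creal G (\<lambda>x. Re (\<phi> x)) = (\<lambda>x. (1/2) * (\<phi> x + cnj (\<phi> x)))"
      "creal G (\<lambda>x. Im (\<phi> x)) = (\<lambda>x. (-\<i>/2) * (\<phi> x + (-1) * cnj (\<phi> x)))"
      using linf_zero[OF l] by (auto simp: creal_def complex_eq_iff)
    have c: "creal G (\<lambda>x. Re (\<phi> x)) \<in> V" "creal G (\<lambda>x. Im (\<phi> x)) \<in> V"
      unfolding eq by (intro V'(3) V'(4) V'(5) \<phi>)+
    have "\<phi> = (\<lambda>x. creal G (\<lambda>x. Re (\<phi> x)) x + \<i> * creal G (\<lambda>x. Im (\<phi> x)) x)"
      using linf_zero[OF l] by (auto simp: creal_def complex_eq_iff)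
    then have "\<eta> \<phi> = \<eta> (creal G (\<lambda>x. Re (\<phi> x))) + \<i> * \<eta> (creal G (\<lambda>x. Im (\<phi> x)))"
      using mean_add[OF V \<eta> c(1) V'(4)[OF c(2), of \<i>]] mean_scale[OF V \<eta> c(2), of \<i>] by simp
    then show ?thesis
      using p_V[OF c(1) ReE[OF l]] p_V[OF c(2) ImE[OF l]] real_mean_of_real[OF V \<eta> c(1)] real_mean_of_real[OF V \<eta> c(2)]
      by (simp add: \<mu>_def complex_eq_iff)
  qed
  have p_le: "p r \<le> C" if "r \<in> E" "\<And>x. x \<in> carrier G \<Longrightarrow> r x \<le> C" for r C
  proof -
    have "(\<lambda>_. C) \<in> maj r" using that constV by (simp add: maj_def)
    then show ?thesis using p(3)[OF that(1)] q_le[OF that(1)] real_mean_const[OF V \<eta>, of C] by fastforce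
  qed
  have scale: "\<mu> (\<lambda>x. c * \<phi> x) = c * \<mu> \<phi>" if \<phi>: "\<phi> \<in> linf G" for c \<phi>
  proof -
    note E = ReE[OF \<phi>] ImE[OF \<phi>]
    have "p (\<lambda>x. Re c * Re (\<phi> x) + (- Im c) * Im (\<phi> x)) = Re c * p (\<lambda>x. Re (\<phi> x)) + (- Im c) * p (\<lambda>x. Im (\<phi> x))"
      "p (\<lambda>x. Re c * Im (\<phi> x) + Im c * Re (\<phi> x)) = Re c * p (\<lambda>x. Im (\<phi> x)) + Im c * p (\<lambda>x. Re (\<phi> x))"
      using p(1)[OF Ecl(2)[OF E(1) E(1), of "Re c"] Ecl(2)[OF E(2) E(2), of "- Im c"]]
        p(1)[OF Ecl(2)[OF E(2) E(2), of "Re c"] Ecl(2)[OF E(1) E(1), of "Im c"]]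
      by (simp_all only: p(2)[OF E(1)] p(2)[OF E(2)])
    then show ?thesis by (simp add: \<mu>_def complex_eq_iff)
  qed
  have "mean_on (linf G) \<mu>"
  proof (rule mean_onI[OF star_space_linf])
    show "\<mu> (\<lambda>x. \<phi> x + \<psi> x) = \<mu> \<phi> + \<mu> \<psi>" if "\<phi> \<in> linf G" "\<psi> \<in> linf G" for \<phi> \<psi>
      using p(1)[OF ReE ReE] p(1)[OF ImE ImE] that by (simp add: \<mu>_def complex_eq_iff)
    show "\<mu> (indicator (carrier G)) = 1" using ext[OF V'(2)] mean_one[OF V \<eta>] by simp
    show "\<mu> \<phi> \<in> \<real>\<^sub>\<ge>\<^sub>0" if \<phi>: "\<phi> \<in> linf G" "\<And>x. \<phi> x \<in> \<real>\<^sub>\<ge>\<^sub>0" for \<phi>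
    proof -
      have "p (\<lambda>x. -1 * Re (\<phi> x)) \<le> 0"
        using \<phi> Ecl(2)[OF ReE ReE, of \<phi> \<phi> "-1"] by (intro p_le) (auto simp: complex_nonneg_Reals_iff)
      moreover have "p (\<lambda>x. Im (\<phi> x)) = 0"
        using \<phi>(2) p(2)[OF ImE[OF \<phi>(1)], of 0] by (simp add: complex_nonneg_Reals_iff)
      ultimately show ?thesis using p(2)[OF ReE[OF \<phi>(1)], of "-1"]
        by (simp add: \<mu>_def complex_nonneg_Reals_iff)
    qed
    show "cmod (\<mu> \<phi>) \<le> 1" if \<phi>: "\<phi> \<in> linf G" "\<And>x. cmod (\<phi> x) \<le> 1" for \<phi>
    proof (cases "\<mu> \<phi> = 0")
      case False
      \<comment> \<open>Rotating \<open>\<mu> \<phi>\<close> onto the positive axis reduces the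
        bound to a real function, to which \<open>p_le\<close> applies.\<close>
      define c where "c = cnj (\<mu> \<phi>) / cmod (\<mu> \<phi>)"
      have c: "cmod c = 1" using False by (simp add: c_def norm_divide)
      have "c * \<mu> \<phi> = of_real (cmod (\<mu> \<phi>))"
        using False by (simp add: c_def complex_norm_square[symmetric] power2_eq_square mult.commute[of "cnj _"])
      then have "cmod (\<mu> \<phi>) = Re (\<mu> (\<lambda>x. c * \<phi> x))" using scale[OF \<phi>(1)] by simp
      also have "\<dots> = p (\<lambda>x. Re (c * \<phi> x))" by (simp add: \<mu>_def)
      also have "\<dots> \<le> 1"
      proof (rule p_le)
        show "(\<lambda>x. Re (c * \<phi> x)) \<in> E" by (rule ReE[OF L(4)[OF \<phi>(1)]])
        show "Re (c * \<phi> x) \<le> 1" for x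
          using complex_Re_le_cmod[of "c * \<phi> x"] \<phi>(2)[of x] c by (simp add: norm_mult)
      qed
      finally show ?thesis .
    qed simp
  qed (rule scale)
  then show thesis using that[of \<mu>] ext by (simp add: means_def)
qed

definition ravg :: "('b \<Rightarrow> real) \<Rightarrow> 'b list \<Rightarrow> real" where
  "ravg f xs = (\<Sum>x\<leftarrow>xs. f x) / real (length xs)"

lemma avg_of_real: "avg (\<lambda>x. complex_of_real (f x)) xs = of_real (ravg f xs)"
proof -
  have "(\<Sum>x\<leftarrow>xs. complex_of_real (f x)) = of_real (\<Sum>x\<leftarrow>xs. f x)" by (induction xs) auto
  then show ?thesis by (simp add: avg_def ravg_def)
qed

section \<open>The invariant mean on the Fourier-Stieltjes algebra\<close>

context group
begin

lemma star_space_fourier_stieltjes: "star_space G (fourier_stieltjes G)"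
  unfolding star_space_def
  using fourier_stieltjes_linf fourier_stieltjes_one fourier_stieltjes_add fourier_stieltjes_scale
    fourier_stieltjes_cnj by blast

text \<open>An average of left translates of \<open>\<phi>\<close> has the same value under
  \<open>\<mu>\<close> as \<open>\<phi>\<close> itself, and it is uniformly close to the constant
  \<open>z\<close>.\<close>

lemma left_invariant_mean_eq:
  assumes \<mu>: "mean_on (fourier_stieltjes G) \<mu>" and inv: "left_invariant_on G (fourier_stieltjes G) \<mu>"
    and \<phi>: "\<phi> \<in> fourier_stieltjes G" and z: "lmean G \<phi> z"
  shows "\<mu> \<phi> = z"
proof -
  note S = star_space_fourier_stieltjes
  have "cmod (\<mu> \<phi> - z) \<le> \<delta>" if d: "\<delta> > 0" for \<delta>
  proof -
    obtain ts where ts: "glist G ts" "\<And>g. g \<in> carrier G \<Longrightarrow> cmod (avg (\<lambda>t. \<phi> (t \<otimes> g)) ts - z) \<le> \<delta>"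
      using z d unfolding lmean_def by meson
    define T where "T = (\<lambda>us g. \<Sum>t\<leftarrow>us. ltrans G (inv t) \<phi> g)"
    have T_ind: "T us \<in> fourier_stieltjes G \<and> \<mu> (T us) = of_nat (length us) * \<mu> \<phi>" if "set us \<subseteq> carrier G" for us
      using that
    proof (induction us)
      case Nil
      show ?case
        using fourier_stieltjes_scale[OF \<phi>, of 0] mean_scale[OF S \<mu> \<phi>, of 0] by (simp_all add: T_def)
    next
      case (Cons t us)
      have eq: "T (t # us) = (\<lambda>g. ltrans G (inv t) \<phi> g + T us g)" by (simp add: T_def)
      have t: "ltrans G (inv t) \<phi> \<in> fourier_stieltjes G" "\<mu> (ltrans G (inv t) \<phi>) = \<mu> \<phi>"
        using Cons.prems fourier_stieltjes_ltrans[OF \<phi>] inv \<phi> by (auto simp: left_invariant_on_def)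
      have "T (t # us) \<in> fourier_stieltjes G"
        unfolding eq using t Cons by (intro fourier_stieltjes_add) auto
      moreover have "\<mu> (T (t # us)) = of_nat (length (t # us)) * \<mu> \<phi>"
        unfolding eq using mean_add[OF S \<mu> t(1), of "T us"] t Cons by (simp add: algebra_simps)
      ultimately show ?case by blast
    qed
    have T: "T us \<in> fourier_stieltjes G" "\<mu> (T us) = of_nat (length us) * \<mu> \<phi>" if "set us \<subseteq> carrier G" for us
      using T_ind[OF that] by auto
    define n where "n = length ts"
    have n: "n > 0" using ts by (simp add: n_def glist_def)
    have set: "set ts \<subseteq> carrier G" using ts by (simp add: glist_def)
    define \<psi> where "\<psi> = (\<lambda>g. (1 / of_nat n) * T ts g + (- z) * indicator (carrier G) g)"
    have \<psi>: "\<psi> \<in> fourier_stieltjes G" unfolding \<psi>_def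
      by (intro fourier_stieltjes_add fourier_stieltjes_scale T set fourier_stieltjes_one)
    have "\<mu> \<psi> = (1 / of_nat n) * \<mu> (T ts) + (- z) * \<mu> (indicator (carrier G))"
      unfolding \<psi>_def
      by (subst mean_add[OF S \<mu>], (intro fourier_stieltjes_scale T set fourier_stieltjes_one)+,
          subst mean_scale[OF S \<mu> T(1)[OF set]], subst mean_scale[OF S \<mu> fourier_stieltjes_one], rule refl)
    then have eq: "\<mu> \<psi> = \<mu> \<phi> - z"
      using n by (simp add: T(2)[OF set] mean_one[OF S \<mu>] flip: n_def)
    have "cmod (\<mu> \<psi>) \<le> \<delta>"
    proof (rule mean_bound[OF S \<mu> \<psi>])
      show "cmod (\<psi> g) \<le> \<delta>" if g: "g \<in> carrier G" for g
      proof -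
        have "T ts g = (\<Sum>t\<leftarrow>ts. \<phi> (t \<otimes> g))"
          unfolding T_def using set g by (intro arg_cong[of _ _ sum_list] map_cong) (auto simp: ltrans_def)
        then have "\<psi> g = avg (\<lambda>t. \<phi> (t \<otimes> g)) ts - z"
          using g by (simp add: \<psi>_def avg_def n_def)
        then show ?thesis using ts(2)[OF g] by simp
      qed
    qed (use d in simp)
    then show ?thesis by (simp add: eq)
  qed
  then have "cmod (\<mu> \<phi> - z) \<le> 0" by - (rule field_le_epsilon, simp)
  then show ?thesis by simp
qed

lemma rmean_eqI: "\<lbrakk>\<phi> \<in> fourier_stieltjes G; rmean G \<phi> z; rmean G \<phi> w\<rbrakk> \<Longrightarrow> z = w"
  using fourier_stieltjes_mean_exists rmean_lmean_unique by blast

lemma rmean_one: "rmean G (indicator (carrier G)) 1"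
  unfolding rmean_def
  by (intro allI impI exI[of _ "[\<one>]"]) (auto simp: glist_def avg_def)

lemma rmean_ltrans:
  assumes "rmean G \<phi> z" "h \<in> carrier G"
  shows "rmean G (ltrans G h \<phi>) z"
  unfolding rmean_def
proof (intro allI impI)
  fix \<delta> :: real assume "\<delta> > 0"
  then obtain ss where ss: "glist G ss" "\<And>g. g \<in> carrier G \<Longrightarrow> cmod (avg (\<lambda>s. \<phi> (g \<otimes> s)) ss - z) \<le> \<delta>"
    using assms(1) unfolding rmean_def by meson
  have "avg (\<lambda>s. ltrans G h \<phi> (g \<otimes> s)) ss = avg (\<lambda>s. \<phi> (inv h \<otimes> g \<otimes> s)) ss" if "g \<in> carrier G" for g
    using ss(1) that assms(2) by (intro avg_cong) (auto simp: ltrans_def glist_def m_assoc subset_iff)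
  then show "\<exists>ss. glist G ss \<and> (\<forall>g\<in>carrier G. cmod (avg (\<lambda>s. ltrans G h \<phi> (g \<otimes> s)) ss - z) \<le> \<delta>)"
    using ss assms(2) by (intro exI[of _ ss]) simp
qed

lemma rmean_scale:
  assumes "rmean G \<phi> z"
  shows "rmean G (\<lambda>g. c * \<phi> g) (c * z)"
  unfolding rmean_def
proof (intro allI impI)
  fix \<delta> :: real assume d: "\<delta> > 0"
  then have "\<delta> / (cmod c + 1) > 0" by (simp add: add_nonneg_pos)
  then obtain ss where ss: "glist G ss"
    "\<And>g. g \<in> carrier G \<Longrightarrow> cmod (avg (\<lambda>s. \<phi> (g \<otimes> s)) ss - z) \<le> \<delta> / (cmod c + 1)"
    using assms(1) unfolding rmean_def by meson
  have "cmod (avg (\<lambda>s. c * \<phi> (g \<otimes> s)) ss - c * z) \<le> \<delta>" if g: "g \<in> carrier G" for g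
  proof -
    have "cmod (avg (\<lambda>s. c * \<phi> (g \<otimes> s)) ss - c * z) = cmod c * cmod (avg (\<lambda>s. \<phi> (g \<otimes> s)) ss - z)"
      by (simp add: avg_cmult flip: norm_mult right_diff_distrib)
    also have "\<dots> \<le> (cmod c + 1) * (\<delta> / (cmod c + 1))"
      using ss(2)[OF g] d by (intro mult_mono) auto
    also have "\<dots> = \<delta>" using add_nonneg_pos[of "cmod c" 1] by (simp del: add_nonneg_pos)
    finally show ?thesis .
  qed
  then show "\<exists>ss. glist G ss \<and> (\<forall>g\<in>carrier G. cmod (avg (\<lambda>s. c * \<phi> (g \<otimes> s)) ss - c * z) \<le> \<delta>)"
    using ss(1) by blast
qed

lemma rmean_bound:
  assumes "rmean G \<phi> z" "\<And>g. cmod (\<phi> g) \<le> C"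
  shows "cmod z \<le> C"
proof (rule field_le_epsilon)
  fix e :: real assume "e > 0"
  then obtain ss where ss: "glist G ss" "\<And>g. g \<in> carrier G \<Longrightarrow> cmod (avg (\<lambda>s. \<phi> (g \<otimes> s)) ss - z) \<le> e"
    using assms(1) unfolding rmean_def by meson
  have "cmod (avg (\<lambda>s. \<phi> (\<one> \<otimes> s)) ss - 0) \<le> C"
    by (rule avg_close) (use ss assms in \<open>auto simp: glist_def\<close>)
  then show "cmod z \<le> C + e"
    using ss(2)[OF one_closed] norm_triangle_ineq4[of "avg (\<lambda>s. \<phi> (\<one> \<otimes> s)) ss" "avg (\<lambda>s. \<phi> (\<one> \<otimes> s)) ss - z"]
    by simp
qed

lemma rmean_nonneg:
  assumes "rmean G \<phi> z" "\<And>g. \<phi> g \<in> \<real>\<^sub>\<ge>\<^sub>0"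
  shows "z \<in> \<real>\<^sub>\<ge>\<^sub>0"
proof -
  have *: "- Re z \<le> 0 + e \<and> \<bar>Im z\<bar> \<le> 0 + e" if e: "e > 0" for e
  proof -
    obtain ss where ss: "glist G ss" "\<And>g. g \<in> carrier G \<Longrightarrow> cmod (avg (\<lambda>s. \<phi> (g \<otimes> s)) ss - z) \<le> e"
      using assms(1) e unfolding rmean_def by meson
    define w where "w = avg (\<lambda>s. \<phi> (\<one> \<otimes> s)) ss"
    have "(\<Sum>s\<leftarrow>xs. \<phi> (\<one> \<otimes> s)) \<in> \<real>\<^sub>\<ge>\<^sub>0" for xs
      using assms(2) by (induction xs) (auto intro: nonneg_Reals_add_I)
    then have "w \<in> \<real>\<^sub>\<ge>\<^sub>0" unfolding w_def avg_def by (intro nonneg_Reals_divide_I) auto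
    then have "Re w \<ge> 0" "Im w = 0" by (simp_all add: complex_nonneg_Reals_iff)
    moreover have "\<bar>Re w - Re z\<bar> \<le> e" "\<bar>Im w - Im z\<bar> \<le> e"
      using ss(2)[OF one_closed] abs_Re_le_cmod[of "w - z"] abs_Im_le_cmod[of "w - z"] by (simp_all add: w_def)
    ultimately show ?thesis by auto
  qed
  have "- Re z \<le> 0" by (rule field_le_epsilon) (use * in blast)
  moreover have "\<bar>Im z\<bar> \<le> 0" by (rule field_le_epsilon) (use * in blast)
  ultimately show ?thesis by (simp add: complex_nonneg_Reals_iff)
qed

text \<open>Existence: the right mean value is linear by joint averaging, and it is left invariant
  because its averages are uniform in \<open>g\<close>. Uniqueness: the left mean value determines
  every left invariant mean. Thus the definite description behind \<open>fs_mean\<close>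
  denotes.\<close>

lemma fs_mean_props:
  "mean_on (fourier_stieltjes G) (fs_mean G)" "left_invariant_on G (fourier_stieltjes G) (fs_mean G)"
  "fs_mean G \<in> extensional (fourier_stieltjes G)"
proof -
  let ?B = "fourier_stieltjes G"
  let ?P = "\<lambda>\<mu>. \<mu> \<in> extensional ?B \<and> mean_on ?B \<mu> \<and> left_invariant_on G ?B \<mu>"
  define m where "m = restrict (\<lambda>\<phi>. THE z. rmean G \<phi> z) ?B"
  have m: "rmean G \<phi> (m \<phi>)" if \<phi>: "\<phi> \<in> ?B" for \<phi>
  proof -
    obtain z where z: "rmean G \<phi> z" using fourier_stieltjes_mean_exists[OF \<phi>] by blast
    then have "(THE z. rmean G \<phi> z) = z" using rmean_eqI[OF \<phi>] by blast
    then show ?thesis using z \<phi> by (simp add: m_def)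
  qed
  have m_eq: "m \<phi> = z" if "\<phi> \<in> ?B" "rmean G \<phi> z" for \<phi> z
    using rmean_eqI[OF that(1) m[OF that(1)] that(2)] .
  have "mean_on ?B m"
  proof (rule mean_onI[OF star_space_fourier_stieltjes])
    show "m (\<lambda>x. \<phi> x + \<psi> x) = m \<phi> + m \<psi>" if "\<phi> \<in> ?B" "\<psi> \<in> ?B" for \<phi> \<psi>
      using that by (intro m_eq fourier_stieltjes_add rmean_add m)
    show "m (\<lambda>x. c * \<phi> x) = c * m \<phi>" if "\<phi> \<in> ?B" for \<phi> c
      using that by (intro m_eq fourier_stieltjes_scale rmean_scale m)
    show "m \<phi> \<in> \<real>\<^sub>\<ge>\<^sub>0" if "\<phi> \<in> ?B" "\<And>x. \<phi> x \<in> \<real>\<^sub>\<ge>\<^sub>0" for \<phi>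
      using rmean_nonneg[OF m] that by blast
    show "m (indicator (carrier G)) = 1" by (intro m_eq fourier_stieltjes_one rmean_one)
    show "cmod (m \<phi>) \<le> 1" if "\<phi> \<in> ?B" "\<And>x. cmod (\<phi> x) \<le> 1" for \<phi>
      using rmean_bound[OF m] that by blast
  qed
  moreover have "left_invariant_on G ?B m"
    unfolding left_invariant_on_def
    by (intro ballI m_eq fourier_stieltjes_ltrans rmean_ltrans m)
  ultimately have 1: "?P m" by (simp add: m_def)
  have 2: "\<mu> = m" if "?P \<mu>" for \<mu>
  proof
    fix \<phi>
    show "\<mu> \<phi> = m \<phi>"
    proof (cases "\<phi> \<in> ?B")
      case True
      then obtain z where z: "rmean G \<phi> z" "lmean G \<phi> z" using fourier_stieltjes_mean_exists by blast
      then show ?thesis using left_invariant_mean_eq[OF _ _ True z(2)] that m_eq[OF True z(1)] by simp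
    next
      case False
      then show ?thesis using that by (simp add: m_def extensional_def)
    qed
  qed
  have "?P (THE \<mu>. ?P \<mu>)" by (rule theI[of ?P, OF 1 2])
  then show "mean_on ?B (fs_mean G)" "left_invariant_on G ?B (fs_mean G)"
    "fs_mean G \<in> extensional ?B"
    unfolding fs_mean_def by blast+
qed

text \<open>Needed for the supremum in the upper density to be approached by an actual mean.\<close>

lemma FS_nonempty: "FS G \<noteq> {}"
proof -
  obtain \<mu> where \<mu>: "\<mu> \<in> means G" "\<And>\<phi>. \<phi> \<in> fourier_stieltjes G \<Longrightarrow> \<mu> \<phi> = fs_mean G \<phi>"
    using mean_extension[OF star_space_fourier_stieltjes fs_mean_props(1)] by blast
  have "restrict \<mu> (fourier_stieltjes G) = fs_mean G"
    using \<mu>(2) fs_mean_props(3) by (auto simp: restrict_def extensional_def)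
  then show ?thesis using \<mu>(1) by (auto simp: FS_def)
qed

lemma FS_mean:
  assumes "\<Lambda> \<in> FS G" "\<phi> \<in> fourier_stieltjes G"
  shows "rmean G \<phi> (\<Lambda> \<phi>)" "lmean G \<phi> (\<Lambda> \<phi>)"
proof -
  obtain z where z: "rmean G \<phi> z" "lmean G \<phi> z" using fourier_stieltjes_mean_exists assms(2) by blast
  have "restrict \<Lambda> (fourier_stieltjes G) \<phi> = fs_mean G \<phi>" using assms(1) by (simp add: FS_def)
  then have "\<Lambda> \<phi> = z"
    using left_invariant_mean_eq[OF fs_mean_props(1,2) assms(2) z(2)] assms(2) by simp
  then show "rmean G \<phi> (\<Lambda> \<phi>)" "lmean G \<phi> (\<Lambda> \<phi>)" using z by simp_all
qed

definition fs_real :: "('a \<Rightarrow> real) \<Rightarrow> bool" where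
  "fs_real r \<longleftrightarrow> creal G r \<in> fourier_stieltjes G"

lemma fs_real_linf: "fs_real r \<Longrightarrow> creal G r \<in> linf G"
  by (simp add: fs_real_def fourier_stieltjes_linf)

lemma fs_real_cong: "(\<And>x. x \<in> carrier G \<Longrightarrow> r x = r' x) \<Longrightarrow> fs_real r = fs_real r'"
proof -
  assume "\<And>x. x \<in> carrier G \<Longrightarrow> r x = r' x"
  then have "creal G r = creal G r'" by (auto simp: creal_def)
  then show ?thesis by (simp add: fs_real_def)
qed

lemma fs_real_add: "\<lbrakk>fs_real r; fs_real r'\<rbrakk> \<Longrightarrow> fs_real (\<lambda>x. r x + r' x)"
  by (simp add: fs_real_def creal_add fourier_stieltjes_add)

lemma fs_real_cmult: "fs_real r \<Longrightarrow> fs_real (\<lambda>x. c * r x)"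
  by (simp add: fs_real_def creal_scale fourier_stieltjes_scale)

lemma fs_real_const: "fs_real (\<lambda>_. c)"
  by (simp add: fs_real_def creal_const fourier_stieltjes_scale fourier_stieltjes_one)

lemma fs_real_diff: "\<lbrakk>fs_real r; fs_real r'\<rbrakk> \<Longrightarrow> fs_real (\<lambda>x. r x - r' x)"
  using fs_real_add[OF _ fs_real_cmult[of r' "-1"], of r] by simp

lemma fs_real_mult: "\<lbrakk>fs_real r; fs_real r'\<rbrakk> \<Longrightarrow> fs_real (\<lambda>x. r x * r' x)"
proof -
  assume "fs_real r" "fs_real r'"
  then have "(\<lambda>x. creal G r x * creal G r' x) \<in> fourier_stieltjes G"
    by (simp add: fs_real_def fourier_stieltjes_mult)
  moreover have "(\<lambda>x. creal G r x * creal G r' x) = creal G (\<lambda>x. r x * r' x)" by (auto simp: creal_def)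
  ultimately show ?thesis by (simp add: fs_real_def)
qed

lemma fs_real_power: "fs_real r \<Longrightarrow> fs_real (\<lambda>x. r x ^ n)"
  by (induction n) (simp_all add: fs_real_const fs_real_mult)

lemma fs_real_sum_list: "(\<And>x. x \<in> set xs \<Longrightarrow> fs_real (f x)) \<Longrightarrow> fs_real (\<lambda>g. \<Sum>x\<leftarrow>xs. f x g)"
  by (induction xs) (simp_all add: fs_real_const fs_real_add)

lemma fs_real_left: "\<lbrakk>fs_real r; g \<in> carrier G\<rbrakk> \<Longrightarrow> fs_real (\<lambda>x. r (g \<otimes> x))"
proof -
  assume r: "fs_real r" and g: "g \<in> carrier G"
  have "creal G (\<lambda>x. r (g \<otimes> x)) = ltrans G (inv g) (creal G r)" using g
    by (auto simp: creal_def ltrans_def)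
  then show ?thesis using r g by (simp add: fs_real_def fourier_stieltjes_ltrans)
qed

lemma fs_real_Re:
  assumes \<phi>: "\<phi> \<in> fourier_stieltjes G"
  shows "fs_real (\<lambda>x. Re (\<phi> x))"
proof -
  have "(\<lambda>x. (1/2) * (\<phi> x + cnj (\<phi> x))) \<in> fourier_stieltjes G"
    by (intro fourier_stieltjes_scale fourier_stieltjes_add fourier_stieltjes_cnj \<phi>)
  moreover have "(\<lambda>x. (1/2) * (\<phi> x + cnj (\<phi> x))) = creal G (\<lambda>x. Re (\<phi> x))"
    using linf_zero[OF fourier_stieltjes_linf[OF \<phi>]] by (auto simp: creal_def complex_eq_iff)
  ultimately show ?thesis by (simp add: fs_real_def)
qed

lemma fs_real_norm_sq:
  assumes \<phi>: "\<phi> \<in> fourier_stieltjes G"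
  shows "fs_real (\<lambda>x. (cmod (\<phi> x))\<^sup>2)"
proof -
  have "(\<lambda>x. \<phi> x * cnj (\<phi> x)) \<in> fourier_stieltjes G"
    by (intro fourier_stieltjes_mult fourier_stieltjes_cnj \<phi>)
  moreover have "(\<lambda>x. \<phi> x * cnj (\<phi> x)) = creal G (\<lambda>x. (cmod (\<phi> x))\<^sup>2)"
    using linf_zero[OF fourier_stieltjes_linf[OF \<phi>]] complex_norm_square
    by (auto simp: creal_def simp flip: of_real_power)
  ultimately show ?thesis by (simp add: fs_real_def)
qed

lemma bounded_mult_linf: "\<lbrakk>creal G r \<in> linf G; creal G r' \<in> linf G\<rbrakk> \<Longrightarrow> creal G (\<lambda>x. r x * r' x) \<in> linf G"
proof -
  assume "creal G r \<in> linf G" "creal G r' \<in> linf G"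
  then obtain C D where CD: "0 < C" "\<And>x. x \<in> carrier G \<Longrightarrow> \<bar>r x\<bar> \<le> C" "0 < D" "\<And>x. x \<in> carrier G \<Longrightarrow> \<bar>r' x\<bar> \<le> D"
    using creal_linfD by metis
  show ?thesis
    by (rule creal_linfI[where C = "C * D"]) (use CD in \<open>auto simp: abs_mult intro!: mult_mono\<close>)
qed

lemma linf_indicator: "creal G (indicator S) \<in> linf G"
  by (rule creal_linfI[where C = 1]) (simp split: split_indicator)

lemma creal_indicator: "S \<subseteq> carrier G \<Longrightarrow> creal G (indicator S) = indicator S"
  by (auto simp: creal_def fun_eq_iff split: split_indicator)

end

section \<open>Means that extend the invariant mean\<close>

locale fs_functional = group G for G :: "('a, 'm) monoid_scheme" (structure) +
  fixes \<Lambda> :: "('a \<Rightarrow> complex) \<Rightarrow> complex"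
  assumes FS: "\<Lambda> \<in> FS G"
begin

abbreviation L :: "('a \<Rightarrow> real) \<Rightarrow> real" where
  "L r \<equiv> real_mean G \<Lambda> r"

lemma mean_\<Lambda>: "mean_on (linf G) \<Lambda>"
  using FS by (simp add: FS_def means_def)

lemmas L_add = real_mean_add[OF star_space_linf mean_\<Lambda>]
lemmas L_cmult = real_mean_scale[OF star_space_linf mean_\<Lambda>]
lemmas L_const = real_mean_const[OF star_space_linf mean_\<Lambda>]
lemmas L_mono = real_mean_mono[OF star_space_linf mean_\<Lambda>]
lemmas L_of_real = real_mean_of_real[OF star_space_linf mean_\<Lambda>]

text \<open>\<open>\<Lambda>\<close> inherits invariance from the mean on the Fourier-Stieltjes
  algebra, which is why \<open>r\<close> is taken from there.\<close>

lemma L_left: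
  assumes r: "fs_real r" and g: "g \<in> carrier G"
  shows "L (\<lambda>x. r (g \<otimes> x)) = L r"
proof -
  have *: "creal G (\<lambda>x. r (g \<otimes> x)) = ltrans G (inv g) (creal G r)" using g
    by (auto simp: creal_def ltrans_def)
  have c: "creal G r \<in> fourier_stieltjes G" using r by (simp add: fs_real_def)
  have "\<Lambda> (ltrans G (inv g) (creal G r)) = \<Lambda> (creal G r)"
    using g FS_mean[OF FS c] FS_mean[OF FS fourier_stieltjes_ltrans[OF c, of "inv g"]]
      rmean_ltrans[OF FS_mean(1)[OF FS c], of "inv g"] by (auto intro: rmean_lmean_unique[symmetric])
  then show ?thesis by (simp add: real_mean_def *)
qed

lemma avg_creal:
  assumes "glist G ss" "\<And>s. s \<in> set ss \<Longrightarrow> f s \<in> carrier G"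
  shows "avg (\<lambda>s. creal G r (f s)) ss = of_real (ravg (\<lambda>s. r (f s)) ss)"
  unfolding avg_of_real[symmetric] using assms by (intro avg_cong) (auto simp: creal_def)

text \<open>This is the form in which \<open>\<Lambda>\<close> is traded for a finite family:
  simultaneously for finitely many functions, and uniformly in the translation
  \<open>g\<close>.\<close>

lemma L_ravg:
  assumes rs: "\<And>r. r \<in> set rs \<Longrightarrow> fs_real r" and d: "\<delta> > 0"
  obtains ss where "glist G ss"
    "\<And>r g. \<lbrakk>r \<in> set rs; g \<in> carrier G\<rbrakk> \<Longrightarrow> \<bar>ravg (\<lambda>s. r (g \<otimes> s)) ss - L r\<bar> \<le> \<delta>"
proof -
  have "\<phi> \<in> fourier_stieltjes G" if "\<phi> \<in> set (map (creal G) rs)" for \<phi> using that rs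
    by (auto simp: fs_real_def)
  from joint_ravg[OF this d] obtain ss where ss: "glist G ss"
    "\<And>\<phi> z g. \<phi> \<in> set (map (creal G) rs) \<Longrightarrow> rmean G \<phi> z \<Longrightarrow> g \<in> carrier G \<Longrightarrow> cmod (avg (\<lambda>s. \<phi> (g \<otimes> s)) ss - z) \<le> \<delta>"
    by blast
  have "\<bar>ravg (\<lambda>s. r (g \<otimes> s)) ss - L r\<bar> \<le> \<delta>" if r: "r \<in> set rs" and g: "g \<in> carrier G" for r g
  proof -
    have c: "creal G r \<in> fourier_stieltjes G" using rs[OF r] by (simp add: fs_real_def)
    have "cmod (avg (\<lambda>s. creal G r (g \<otimes> s)) ss - of_real (L r)) \<le> \<delta>"
      using ss(2)[of "creal G r" "\<Lambda> (creal G r)" g] r g FS_mean(1)[OF FS c]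
        L_of_real[OF fourier_stieltjes_linf[OF c]] by auto
    moreover have "avg (\<lambda>s. creal G r (g \<otimes> s)) ss = of_real (ravg (\<lambda>s. r (g \<otimes> s)) ss)"
      using ss(1) g by (intro avg_creal) (auto simp: glist_def)
    ultimately show ?thesis by (simp flip: of_real_diff)
  qed
  then show thesis using that[of ss] ss(1) by blast
qed

lemma L_lavg:
  assumes r: "fs_real r" and d: "\<delta> > 0"
  obtains ts where "glist G ts" "\<And>g. g \<in> carrier G \<Longrightarrow> \<bar>ravg (\<lambda>t. r (t \<otimes> g)) ts - L r\<bar> \<le> \<delta>"
proof -
  have c: "creal G r \<in> fourier_stieltjes G" using r by (simp add: fs_real_def)
  obtain ts where ts: "glist G ts"
    "\<And>g. g \<in> carrier G \<Longrightarrow> cmod (avg (\<lambda>t. creal G r (t \<otimes> g)) ts - \<Lambda> (creal G r)) \<le> \<delta>"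
    using FS_mean(2)[OF FS c] d unfolding lmean_def by meson
  have "\<bar>ravg (\<lambda>t. r (t \<otimes> g)) ts - L r\<bar> \<le> \<delta>" if g: "g \<in> carrier G" for g
  proof -
    have "avg (\<lambda>t. creal G r (t \<otimes> g)) ts = of_real (ravg (\<lambda>t. r (t \<otimes> g)) ts)"
      using ts(1) g by (intro avg_creal) (auto simp: glist_def)
    then show ?thesis using ts(2)[OF g] L_of_real[OF fourier_stieltjes_linf[OF c]]
      by (simp flip: of_real_diff)
  qed
  then show thesis using that[of ts] ts(1) by blast
qed

end

section \<open>Compact vectors\<close>

text \<open>Total boundedness by finite colourings: unlike nets, these pull back along maps without
  a choice of points in the image.\<close>

definition tot_bdd :: "'a set \<Rightarrow> ('a \<Rightarrow> 'a \<Rightarrow> real) \<Rightarrow> bool" where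
  "tot_bdd S d \<longleftrightarrow> (\<forall>e>0. \<exists>c :: 'a \<Rightarrow> nat. finite (c ` S) \<and> (\<forall>g\<in>S. \<forall>h\<in>S. c g = c h \<longrightarrow> d g h < e))"

lemma tot_bdd_approx:
  assumes "\<And>e. e > 0 \<Longrightarrow> \<exists>d'. tot_bdd S d' \<and> (\<forall>g\<in>S. \<forall>h\<in>S. d g h \<le> d' g h + e)"
  shows "tot_bdd S d"
  unfolding tot_bdd_def
proof (intro allI impI)
  fix e :: real assume e: "e > 0"
  then obtain d' where d': "tot_bdd S d'" "\<And>g h. g \<in> S \<Longrightarrow> h \<in> S \<Longrightarrow> d g h \<le> d' g h + e / 2"
    using assms[of "e / 2"] by auto
  then obtain c :: "'a \<Rightarrow> nat" where c: "finite (c ` S)" "\<And>g h. g \<in> S \<Longrightarrow> h \<in> S \<Longrightarrow> c g = c h \<Longrightarrow> d' g h < e / 2"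
    using e unfolding tot_bdd_def by (metis half_gt_zero)
  have "d g h < e" if "g \<in> S" "h \<in> S" "c g = c h" for g h
    using d'(2)[of g h] c(2)[of g h] that by simp
  then show "\<exists>c :: 'a \<Rightarrow> nat. finite (c ` S) \<and> (\<forall>g\<in>S. \<forall>h\<in>S. c g = c h \<longrightarrow> d g h < e)"
    using c(1) by blast
qed

lemma tot_bdd_mono: "\<lbrakk>tot_bdd S d'; \<And>g h. \<lbrakk>g \<in> S; h \<in> S\<rbrakk> \<Longrightarrow> d g h \<le> d' g h\<rbrakk> \<Longrightarrow> tot_bdd S d"
  by (rule tot_bdd_approx) (metis add.right_neutral add_mono less_imp_le)

lemma tot_bdd_add:
  assumes "tot_bdd S d" "tot_bdd S d'"
  shows "tot_bdd S (\<lambda>g h. d g h + d' g h)"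
  unfolding tot_bdd_def
proof (intro allI impI)
  fix e :: real assume e: "e > 0"
  then have e2: "e / 2 > 0" by simp
  obtain c :: "'a \<Rightarrow> nat" where c: "finite (c ` S)" "\<And>g h. g \<in> S \<Longrightarrow> h \<in> S \<Longrightarrow> c g = c h \<Longrightarrow> d g h < e / 2"
    using assms(1) e2 unfolding tot_bdd_def by meson
  obtain c' :: "'a \<Rightarrow> nat" where c': "finite (c' ` S)" "\<And>g h. g \<in> S \<Longrightarrow> h \<in> S \<Longrightarrow> c' g = c' h \<Longrightarrow> d' g h < e / 2"
    using assms(2) e2 unfolding tot_bdd_def by meson
  define b where "b g = prod_encode (c g, c' g)" for g
  have "b ` S \<subseteq> prod_encode ` (c ` S \<times> c' ` S)" by (auto simp: b_def)
  then have "finite (b ` S)" using c(1) c'(1) by (meson finite_SigmaI finite_imageI finite_subset)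
  moreover have "d g h + d' g h < e" if "g \<in> S" "h \<in> S" "b g = b h" for g h
    using c(2)[of g h] c'(2)[of g h] that by (simp add: b_def)
  ultimately show "\<exists>c :: 'a \<Rightarrow> nat. finite (c ` S) \<and> (\<forall>g\<in>S. \<forall>h\<in>S. c g = c h \<longrightarrow> d g h + d' g h < e)"
    by blast
qed

lemma tot_bdd_zero: "tot_bdd S (\<lambda>_ _. 0)"
proof -
  have "finite ((\<lambda>_. 0 :: nat) ` S)" by (rule finite_subset[of _ "{0}"]) auto
  then show ?thesis unfolding tot_bdd_def by (intro allI impI exI[of _ "\<lambda>_. 0 :: nat"]) simp
qed

lemma tot_bdd_sum_list: "(\<And>x. x \<in> set xs \<Longrightarrow> tot_bdd S (d x)) \<Longrightarrow> tot_bdd S (\<lambda>g h. \<Sum>x\<leftarrow>xs. d x g h)"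
  by (induction xs) (simp_all add: tot_bdd_zero tot_bdd_add)

lemma tot_bdd_cmult:
  assumes "tot_bdd S d" "C \<ge> 0"
  shows "tot_bdd S (\<lambda>g h. C * d g h)"
  unfolding tot_bdd_def
proof (intro allI impI)
  fix e :: real assume e: "e > 0"
  then have "e / (C + 1) > 0" using assms(2) by simp
  then obtain c :: "'a \<Rightarrow> nat" where c: "finite (c ` S)" "\<And>g h. g \<in> S \<Longrightarrow> h \<in> S \<Longrightarrow> c g = c h \<Longrightarrow> d g h < e / (C + 1)"
    using assms(1) unfolding tot_bdd_def by meson
  have "C * d g h < e" if "g \<in> S" "h \<in> S" "c g = c h" for g h
  proof (cases "d g h \<ge> 0")
    case True
    then have "C * d g h \<le> (C + 1) * d g h" by (simp add: mult_right_mono)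
    also have "\<dots> < e" using c(2)[OF that] assms(2) by (simp add: less_divide_eq mult.commute)
    finally show ?thesis .
  next
    case False
    then show ?thesis using assms(2) e mult_nonneg_nonpos[of C "d g h"] by simp
  qed
  then show "\<exists>c :: 'a \<Rightarrow> nat. finite (c ` S) \<and> (\<forall>g\<in>S. \<forall>h\<in>S. c g = c h \<longrightarrow> C * d g h < e)"
    using c(1) by blast
qed

lemma tot_bdd_comp:
  assumes "tot_bdd S d" "\<And>g. g \<in> S \<Longrightarrow> f g \<in> S"
  shows "tot_bdd S (\<lambda>g h. d (f g) (f h))"
  unfolding tot_bdd_def
proof (intro allI impI)
  fix e :: real assume "e > 0"
  then obtain c :: "'a \<Rightarrow> nat" where c: "finite (c ` S)" "\<And>g h. g \<in> S \<Longrightarrow> h \<in> S \<Longrightarrow> c g = c h \<Longrightarrow> d g h < e"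
    using assms(1) unfolding tot_bdd_def by meson
  have "(\<lambda>g. c (f g)) ` S \<subseteq> c ` S" using assms(2) by auto
  then have "finite ((\<lambda>g. c (f g)) ` S)" using c(1) finite_subset by blast
  then show "\<exists>c :: 'a \<Rightarrow> nat. finite (c ` S) \<and> (\<forall>g\<in>S. \<forall>h\<in>S. c g = c h \<longrightarrow> d (f g) (f h) < e)"
    using c(2) assms(2) by (intro exI[of _ "\<lambda>g. c (f g)"]) auto
qed

lemma tot_bdd_bounded_real:
  fixes f :: "'a \<Rightarrow> real"
  assumes "\<And>g. g \<in> S \<Longrightarrow> \<bar>f g\<bar> \<le> C"
  shows "tot_bdd S (\<lambda>g h. \<bar>f g - f h\<bar>)"
  unfolding tot_bdd_def
proof (intro allI impI)
  fix e :: real assume e: "e > 0"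
  define c where "c g = to_nat \<lfloor>f g / e\<rfloor>" for g
  have "c ` S \<subseteq> to_nat ` {\<lfloor>- C / e\<rfloor>..\<lfloor>C / e\<rfloor>}"
  proof
    fix n assume "n \<in> c ` S"
    then obtain g where g: "g \<in> S" "n = c g" by auto
    have "- C / e \<le> f g / e" "f g / e \<le> C / e"
      using assms[OF g(1)] e divide_right_mono[of "- C" "f g" e] divide_right_mono[of "f g" C e] by auto
    then show "n \<in> to_nat ` {\<lfloor>- C / e\<rfloor>..\<lfloor>C / e\<rfloor>}"
      unfolding g c_def by (intro imageI) (auto intro: floor_mono)
  qed
  then have "finite (c ` S)" by (rule finite_subset) auto
  moreover have "\<bar>f g - f h\<bar> < e" if "c g = c h" for g h
  proof -
    have "\<lfloor>f g / e\<rfloor> = \<lfloor>f h / e\<rfloor>" using that by (simp add: c_def)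
    then have "\<bar>f g / e - f h / e\<bar> < 1" by linarith
    then show ?thesis using e by (simp add: divide_less_eq abs_divide flip: diff_divide_distrib)
  qed
  ultimately show "\<exists>c :: 'a \<Rightarrow> nat. finite (c ` S) \<and> (\<forall>g\<in>S. \<forall>h\<in>S. c g = c h \<longrightarrow> \<bar>f g - f h\<bar> < e)"
    by blast
qed

lemma tot_bdd_bounded:
  fixes f :: "'a \<Rightarrow> complex"
  assumes "\<And>g. g \<in> S \<Longrightarrow> cmod (f g) \<le> C"
  shows "tot_bdd S (\<lambda>g h. cmod (f g - f h))"
proof (rule tot_bdd_mono)
  have "\<bar>Re (f g)\<bar> \<le> C" "\<bar>Im (f g)\<bar> \<le> C" if "g \<in> S" for g
    using assms[OF that] abs_Re_le_cmod[of "f g"] abs_Im_le_cmod[of "f g"] by linarith+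
  then show "tot_bdd S (\<lambda>g h. \<bar>Re (f g) - Re (f h)\<bar> + \<bar>Im (f g) - Im (f h)\<bar>)"
    by (intro tot_bdd_add tot_bdd_bounded_real) auto
  show "cmod (f g - f h) \<le> \<bar>Re (f g) - Re (f h)\<bar> + \<bar>Im (f g) - Im (f h)\<bar>" for g h
    using cmod_le[of "f g - f h"] by simp
qed

lemma tot_bdd_net:
  assumes "tot_bdd S d" "e > 0"
  obtains F where "finite F" "F \<subseteq> S" "\<And>g. g \<in> S \<Longrightarrow> \<exists>f\<in>F. d g f < e"
proof -
  obtain c :: "'a \<Rightarrow> nat" where c: "finite (c ` S)" "\<And>g h. g \<in> S \<Longrightarrow> h \<in> S \<Longrightarrow> c g = c h \<Longrightarrow> d g h < e"
    using assms unfolding tot_bdd_def by meson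
  define r where "r n = (SOME g. g \<in> S \<and> c g = n)" for n
  have r: "r (c g) \<in> S" "c (r (c g)) = c g" if "g \<in> S" for g
    using someI[of "\<lambda>h. h \<in> S \<and> c h = c g" g] that by (auto simp: r_def)
  show thesis
  proof (rule that[of "r ` c ` S"])
    show "finite (r ` c ` S)" "r ` c ` S \<subseteq> S" using c(1) r by auto
    show "\<exists>f\<in>r ` c ` S. d g f < e" if "g \<in> S" for g
      using c(2)[OF that r(1)[OF that]] r(2)[OF that] that by auto
  qed
qed

section \<open>Distances and orthogonal projection in a Hilbert space\<close>

context complex_hilbert
begin

interpretation KH: psd_kernel "carrier H" "hinner H" by (rule psd_kernel_hinner)

definition hdist :: "'h \<Rightarrow> 'h \<Rightarrow> real" where
  "hdist u v = hnorm H (u \<ominus> v)"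

lemma hnorm_lincomb: "set xs \<subseteq> UNIV \<times> carrier H \<Longrightarrow> hnorm H (lincomb xs) = KH.knorm xs"
  by (simp add: hnorm_def KH.knorm_def hinner_lincomb)

lemma kip_lincomb:
  assumes "set xs \<subseteq> UNIV \<times> carrier H" "set zs \<subseteq> UNIV \<times> carrier H"
  shows "kip (hinner H) [(1, lincomb xs)] zs = kip (hinner H) xs zs"
    "kip (hinner H) zs [(1, lincomb xs)] = kip (hinner H) zs xs"
proof -
  have l: "set [(1, lincomb xs)] \<subseteq> UNIV \<times> carrier H" using lincomb_closed[OF assms(1)] by simp
  have "lincomb [(1, lincomb xs)] = lincomb xs"
    using lincomb_closed[OF assms(1)] smult_one[of "lincomb xs"] by simp
  then show "kip (hinner H) [(1, lincomb xs)] zs = kip (hinner H) xs zs"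
    "kip (hinner H) zs [(1, lincomb xs)] = kip (hinner H) zs xs"
    using hinner_lincomb[OF l assms(2)] hinner_lincomb[OF assms] hinner_lincomb[OF assms(2) l] hinner_lincomb[OF assms(2,1)]
    by simp_all
qed

lemma hdist_knorm:
  assumes "u \<in> carrier H" "v \<in> carrier H"
  shows "hdist u v = KH.knorm (ldiff [(1, u)] [(1, v)])"
proof -
  have "lincomb (ldiff [(1, u)] [(1, v)]) = u \<ominus> v"
    using assms smult_one[of u] smult_in[of v "-1"]
    by (simp add: ldiff_def lscale_def a_minus_def minus_eq_smult r_zero)
  then show ?thesis using hnorm_lincomb[of "ldiff [(1, u)] [(1, v)]"] assms
    by (simp add: hdist_def set_ldiff)
qed

lemma hnorm_knorm: "u \<in> carrier H \<Longrightarrow> hnorm H u = KH.knorm [(1, u)]"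
  by (simp add: hnorm_def KH.knorm_def kip_def)

lemma hnorm_nonneg: "u \<in> carrier H \<Longrightarrow> 0 \<le> hnorm H u"
  by (simp add: hnorm_def hinner_nonneg)

lemma hdist_nonneg: "\<lbrakk>u \<in> carrier H; v \<in> carrier H\<rbrakk> \<Longrightarrow> 0 \<le> hdist u v"
  by (simp add: hdist_knorm KH.knorm_nonneg set_ldiff)

lemma hdist_triangle:
  "\<lbrakk>u \<in> carrier H; v \<in> carrier H; w \<in> carrier H\<rbrakk> \<Longrightarrow> hdist u w \<le> hdist u v + hdist v w"
  by (simp add: hdist_knorm KH.knorm_triangle)

lemma hdist_commute: "\<lbrakk>u \<in> carrier H; v \<in> carrier H\<rbrakk> \<Longrightarrow> hdist u v = hdist v u"
  by (simp add: hdist_knorm KH.knorm_ldiff_commute[of "[(1, u)]"])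

lemma hdist_self: "u \<in> carrier H \<Longrightarrow> hdist u u = 0"
  by (simp add: hdist_knorm KH.knorm_def)

lemma hdist_sq:
  assumes "u \<in> carrier H" "v \<in> carrier H"
  shows "(hdist u v)\<^sup>2 = (hnorm H u)\<^sup>2 + (hnorm H v)\<^sup>2 - 2 * Re (hinner H u v)"
  using assms hinner_cnj[OF assms]
  by (simp add: hdist_knorm hnorm_knorm KH.knorm_sq set_ldiff) (simp add: kip_def)

text \<open>The norm by duality, tested at \<open>w = u - v\<close>. It allows operator estimates to
  be verified on matrix entries, where Hilbert-Schmidt norms give bounds.\<close>

lemma hdist_leI:
  assumes u: "u \<in> carrier H" "v \<in> carrier H" and C: "C \<ge> 0"
    and le: "\<And>w. w \<in> carrier H \<Longrightarrow> cmod (hinner H w u - hinner H w v) \<le> hnorm H w * C"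
  shows "hdist u v \<le> C"
proof (cases "hdist u v = 0")
  case False
  have uv: "u \<ominus> v \<in> carrier H" using u by simp
  have "(hdist u v)\<^sup>2 = Re (hinner H (u \<ominus> v) (u \<ominus> v))"
    using hinner_nonneg[OF uv] by (simp add: hdist_def hnorm_def)
  also have "\<dots> \<le> cmod (hinner H (u \<ominus> v) (u \<ominus> v))" by (rule complex_Re_le_cmod)
  also have "hinner H (u \<ominus> v) (u \<ominus> v) = hinner H (u \<ominus> v) u - hinner H (u \<ominus> v) v"
    using uv u by (simp add: hinner_diff)
  also have "cmod \<dots> \<le> hnorm H (u \<ominus> v) * C" by (rule le[OF uv])
  finally have "hdist u v * hdist u v \<le> hdist u v * C" by (simp add: hdist_def power2_eq_square)
  then show ?thesis using False hdist_nonneg[OF u] by simp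
qed (use C in simp)

text \<open>A minimising sequence for the distance to \<open>M\<close> is Cauchy by the
  parallelogram law, its limit stays in the closed subspace, and perturbing the nearest point along
  \<open>z\<close> shows orthogonality.\<close>

lemma projection:
  assumes M: "M \<subseteq> carrier H" "\<zero> \<in> M" "\<And>u v. \<lbrakk>u \<in> M; v \<in> M\<rbrakk> \<Longrightarrow> u \<oplus> v \<in> M" "\<And>c u. u \<in> M \<Longrightarrow> c \<odot> u \<in> M"
    and closed: "\<And>s l. \<lbrakk>\<And>n::nat. s n \<in> M; l \<in> carrier H; (\<lambda>n. hnorm H (s n \<ominus> l)) \<longlonglongrightarrow> 0\<rbrakk> \<Longrightarrow> l \<in> M"
    and x: "x \<in> carrier H"
  shows "\<exists>p\<in>M. \<forall>z\<in>M. hinner H z (x \<ominus> p) = 0"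
proof -
  have MH: "u \<in> carrier H" if "u \<in> M" for u using M(1) that by auto
  define S where "S = (\<lambda>m. (hdist x m)\<^sup>2) ` M"
  define d where "d = Inf S"
  have bdd: "bdd_below S" by (rule bdd_belowI[of _ 0]) (auto simp: S_def)
  have d_le: "d \<le> (hdist x m)\<^sup>2" if "m \<in> M" for m
    unfolding d_def using that bdd by (intro cInf_lower) (auto simp: S_def)
  have "\<exists>m\<in>M. (hdist x m)\<^sup>2 < d + inverse (real (Suc n))" for n
  proof -
    have "Inf S < d + inverse (real (Suc n))" by (simp add: d_def)
    moreover have "S \<noteq> {}" using M(2) by (auto simp: S_def)
    ultimately obtain y where "y \<in> S" "y < d + inverse (real (Suc n))" using cInf_lessD by blast
    then show ?thesis by (auto simp: S_def)
  qed
  then obtain m where m: "\<And>n. m n \<in> M" "\<And>n. (hdist x (m n))\<^sup>2 < d + inverse (real (Suc n))" by metis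
  have par: "(hdist u v)\<^sup>2 \<le> 2 * (hdist x u)\<^sup>2 + 2 * (hdist x v)\<^sup>2 - 4 * d" if u: "u \<in> M" and v: "v \<in> M" for u v
  proof -
    \<comment> \<open>The midpoint of \<open>u\<close> and \<open>v\<close> lies in
      \<open>M\<close>, so its squared distance to \<open>x\<close> is at least
      \<open>d\<close>.\<close>
    define l :: "(complex \<times> 'h) list" where "l = [(1/2, u), (1/2, v)]"
    have l: "set l \<subseteq> UNIV \<times> carrier H" using u v MH by (auto simp: l_def)
    have "lincomb l \<in> M" using u v M by (auto simp: l_def)
    then have "d \<le> (hdist x (lincomb l))\<^sup>2" by (rule d_le)
    also have "\<dots> = Re (kip (hinner H) (ldiff [(1, x)] l) (ldiff [(1, x)] l))"
      using x lincomb_closed[OF l] l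
      by (simp add: hdist_knorm KH.knorm_sq set_ldiff kip_lincomb)
    also have "4 * \<dots> = 2 * (hdist x u)\<^sup>2 + 2 * (hdist x v)\<^sup>2 - (hdist u v)\<^sup>2"
      using x u v MH by (simp add: hdist_knorm KH.knorm_sq set_ldiff) (simp add: kip_def l_def algebra_simps)
    finally show ?thesis by simp
  qed
  have small: "\<exists>N. \<forall>n\<ge>N. inverse (real (Suc n)) < e" if e: "e > 0" for e :: real
  proof -
    obtain N where "inverse (real (Suc N)) < e" using reals_Archimedean[OF e] by auto
    moreover have "inverse (real (Suc n)) \<le> inverse (real (Suc N))" if "n \<ge> N" for n
      using that by (simp add: divide_simps)
    ultimately show ?thesis by (meson order_le_less_trans)
  qed
  have "\<exists>N. \<forall>j\<ge>N. \<forall>k\<ge>N. hnorm H (m j \<ominus> m k) < e" if e: "e > 0" for e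
  proof -
    obtain N where N: "\<And>n. n \<ge> N \<Longrightarrow> inverse (real (Suc n)) < e\<^sup>2 / 4" using small[of "e\<^sup>2 / 4"] e by auto
    have "hnorm H (m j \<ominus> m k) < e" if "j \<ge> N" "k \<ge> N" for j k
    proof -
      have "(hdist (m j) (m k))\<^sup>2 < e\<^sup>2"
        using par[OF m(1)[of j] m(1)[of k]] m(2)[of j] m(2)[of k] N[OF that(1)] N[OF that(2)] by linarith
      then show ?thesis using e power2_less_imp_less unfolding hdist_def by fastforce
    qed
    then show ?thesis by blast
  qed
  then obtain p where p: "p \<in> carrier H" "(\<lambda>n. hnorm H (m n \<ominus> p)) \<longlonglongrightarrow> 0"
    using hcomplete[of m] MH m(1) by blast
  have pM: "p \<in> M" using closed[OF m(1) p] .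
  have dp: "(hdist x p)\<^sup>2 \<le> d"
  proof (rule LIMSEQ_le)
    have 1: "(\<lambda>n. sqrt (d + inverse (real (Suc n)))) \<longlonglongrightarrow> sqrt (d + 0)"
      by (intro tendsto_intros LIMSEQ_inverse_real_of_nat)
    show "(\<lambda>n. (sqrt (d + inverse (real (Suc n))) + hnorm H (m n \<ominus> p))\<^sup>2) \<longlonglongrightarrow> d"
    proof -
      have "d \<ge> 0" unfolding d_def S_def using M(2) by (intro cINF_greatest) auto
      then show ?thesis using tendsto_power[OF tendsto_add[OF 1 p(2)], of 2] by simp
    qed
    show "\<exists>N. \<forall>n\<ge>N. (hdist x p)\<^sup>2 \<le> (sqrt (d + inverse (real (Suc n))) + hnorm H (m n \<ominus> p))\<^sup>2"
    proof (intro exI allI impI power_mono hdist_nonneg x p)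
      fix n
      have "hdist x (m n) \<le> sqrt (d + inverse (real (Suc n)))"
        using m(2)[of n] by (intro real_le_rsqrt) simp
      then show "hdist x p \<le> sqrt (d + inverse (real (Suc n))) + hnorm H (m n \<ominus> p)"
        using hdist_triangle[OF x MH[OF m(1)[of n]] p(1)] by (simp add: hdist_def)
    qed
  qed simp
  have "hinner H z (x \<ominus> p) = 0" if z: "z \<in> M" for z
  proof -
    define a where "a = hinner H z (x \<ominus> p)"
    define b where "b = (hnorm H z)\<^sup>2"
    have zH: "z \<in> carrier H" using z MH by auto
    have ae: "a = kip (hinner H) [(1, z)] (ldiff [(1, x)] [(1, p)])"
      using zH x p by (simp add: a_def hinner_diff) (simp add: kip_def)
    have ae': "kip (hinner H) (ldiff [(1, x)] [(1, p)]) [(1, z)] = cnj a"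
      unfolding ae using zH x p by (intro KH.kip_sym) (auto simp: set_ldiff)
    have key: "0 \<le> - 2 * t * (cmod a)\<^sup>2 + t\<^sup>2 * (cmod a)\<^sup>2 * b" for t :: real
    proof -
      \<comment> \<open>The coefficient has the phase of \<open>a\<close>, which makes the first
        order term equal to \<open>- 2 t\<close> times the squared modulus of \<open>a\<close>; for
        \<open>t = 1 / (b + 1)\<close> the second order term cannot compensate it unless
        \<open>a = 0\<close>.\<close>
      define c where "c = of_real t * a"
      define l :: "(complex \<times> 'h) list" where "l = [(1, p), (c, z)]"
      have l: "set l \<subseteq> UNIV \<times> carrier H" using p zH by (auto simp: l_def)
      have "lincomb l \<in> M" using pM z M smult_one[of p] by (auto simp: l_def)
      then have "(hdist x p)\<^sup>2 \<le> (hdist x (lincomb l))\<^sup>2" using d_le dp by fastforce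
      also have "\<dots> = Re (kip (hinner H) (ldiff [(1, x)] l) (ldiff [(1, x)] l))"
        using x lincomb_closed[OF l] l
        by (simp add: hdist_knorm KH.knorm_sq set_ldiff kip_lincomb)
      also have "kip (hinner H) (ldiff [(1, x)] l) (ldiff [(1, x)] l) =
         kip (hinner H) (ldiff (ldiff [(1, x)] [(1, p)]) (lscale c [(1, z)])) (ldiff (ldiff [(1, x)] [(1, p)]) (lscale c [(1, z)]))"
        by (simp add: l_def ldiff_def lscale_def kip_def)
      also have "Re \<dots> = (hdist x p)\<^sup>2 - Re (c * cnj a) - Re (cnj c * a) + (cmod c)\<^sup>2 * b"
      proof -
        have "Re (kip (hinner H) (ldiff [(1, x)] [(1, p)]) (ldiff [(1, x)] [(1, p)])) = (hdist x p)\<^sup>2"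
          using x p by (simp add: hdist_knorm KH.knorm_sq set_ldiff)
        moreover have "kip (hinner H) [(1, z)] [(1, z)] = of_real b"
          using zH KH.kip_self[of "[(1, z)]"] by (simp add: b_def hnorm_knorm)
        moreover have "cnj c * c = of_real ((cmod c)\<^sup>2)"
          by (simp add: complex_norm_square[symmetric] mult.commute del: of_real_power)
        moreover have "b * (cmod c)\<^sup>2 = b * Im c * Im c + b * Re c * Re c"
          unfolding cmod_power2 unfolding power2_eq_square by (simp add: algebra_simps)
        ultimately show ?thesis
          unfolding kip_ldiff(1)[of _ "ldiff _ _"] kip_ldiff(2)[of _ _ "ldiff _ _"] kip_lscale ae' ae[symmetric]
          by (simp add: algebra_simps del: kip_ldiff of_real_power)
      qed
      also have "\<dots> = (hdist x p)\<^sup>2 - 2 * t * (cmod a)\<^sup>2 + t\<^sup>2 * (cmod a)\<^sup>2 * b"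
        unfolding c_def cmod_power2 by (simp add: power2_eq_square algebra_simps)
      finally show ?thesis by simp
    qed
    have b: "b \<ge> 0" by (simp add: b_def)
    define t where "t = 1 / (b + 1)"
    have t: "t > 0" "t * b < 1" using b by (auto simp: t_def)
    have "t * (cmod a)\<^sup>2 * (2 - t * b) \<le> 0" using key[of t] by (simp add: power2_eq_square algebra_simps)
    moreover have "2 - t * b > 0" using t by simp
    ultimately have "(cmod a)\<^sup>2 \<le> 0" using t by (simp add: mult_le_0_iff)
    then show ?thesis by (simp add: a_def)
  qed
  then show ?thesis using pM by blast
qed

end

section \<open>Compact vectors and the weakly mixing complement\<close>

context hilbert_rep
begin

text \<open>In a complete space, total boundedness of the orbit is its relative compactness.\<close>

definition compact_vectors :: "'h set" where
  "compact_vectors = {z \<in> carrier H. tot_bdd (carrier G) (\<lambda>g h. hdist (\<pi> g z) (\<pi> h z))}"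

lemma rep_dist: "\<lbrakk>g \<in> carrier G; u \<in> carrier H; v \<in> carrier H\<rbrakk> \<Longrightarrow> hdist (\<pi> g u) (\<pi> g v) = hdist u v"
  using K.knorm_lact[of g "ldiff [(1, u)] [(1, v)]"]
  by (simp add: hdist_knorm rep_closed set_ldiff lact_def ldiff_def lscale_def)

lemma rep_norm: "\<lbrakk>g \<in> carrier G; u \<in> carrier H\<rbrakk> \<Longrightarrow> hnorm H (\<pi> g u) = hnorm H u"
  by (simp add: hnorm_def rep_inner)

lemma compact_vectors_limit:
  assumes s: "\<And>e. e > 0 \<Longrightarrow> \<exists>s\<in>compact_vectors. hdist s l < e" and l: "l \<in> carrier H"
  shows "l \<in> compact_vectors"
proof -
  have "tot_bdd (carrier G) (\<lambda>g h. hdist (\<pi> g l) (\<pi> h l))"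
  proof (rule tot_bdd_approx)
    fix e :: real assume "e > 0"
    then obtain s where s: "s \<in> compact_vectors" "hdist s l < e / 2" using s[of "e / 2"] by auto
    have sH: "s \<in> carrier H" using s by (simp add: compact_vectors_def)
    have "hdist (\<pi> g l) (\<pi> h l) \<le> hdist (\<pi> g s) (\<pi> h s) + e" if "g \<in> carrier G" "h \<in> carrier G" for g h
      using hdist_triangle[of "\<pi> g l" "\<pi> g s" "\<pi> h l"] hdist_triangle[of "\<pi> g s" "\<pi> h s" "\<pi> h l"]
        rep_dist[of g l s] rep_dist[of h s l] hdist_commute[of l s] s(2) that l sH
          by (simp add: rep_closed)
    then show "\<exists>d'. tot_bdd (carrier G) d' \<and> (\<forall>g\<in>carrier G. \<forall>h\<in>carrier G. hdist (\<pi> g l) (\<pi> h l) \<le> d' g h + e)"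
      using s(1) unfolding compact_vectors_def by blast
  qed
  then show ?thesis using l by (simp add: compact_vectors_def)
qed

lemma compact_vectors_zero: "\<zero>\<^bsub>H\<^esub> \<in> compact_vectors"
proof -
  have "\<pi> g \<zero>\<^bsub>H\<^esub> = \<zero>\<^bsub>H\<^esub>" if "g \<in> carrier G" for g
    using rep_smult[OF that, of "\<zero>\<^bsub>H\<^esub>" 0] smult_l_null[of "\<zero>\<^bsub>H\<^esub>"] smult_l_null[of "\<pi> g \<zero>\<^bsub>H\<^esub>"] rep_closed[OF that]
    by simp
  then have "tot_bdd (carrier G) (\<lambda>g h. hdist (\<pi> g \<zero>\<^bsub>H\<^esub>) (\<pi> h \<zero>\<^bsub>H\<^esub>))"
    by (intro tot_bdd_mono[OF tot_bdd_zero]) (simp add: hdist_self)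
  then show ?thesis by (simp add: compact_vectors_def)
qed

lemma compact_vectors_add:
  assumes "u \<in> compact_vectors" "v \<in> compact_vectors"
  shows "u \<oplus> v \<in> compact_vectors"
proof -
  have H: "u \<in> carrier H" "v \<in> carrier H" using assms by (auto simp: compact_vectors_def)
  have le: "hdist (a \<oplus> b) (c \<oplus> d) \<le> hdist a c + hdist b d"
    if "a \<in> carrier H" "b \<in> carrier H" "c \<in> carrier H" "d \<in> carrier H" for a b c d
  proof (rule hdist_leI)
    show "cmod (hinner H w (a \<oplus> b) - hinner H w (c \<oplus> d)) \<le> hnorm H w * (hdist a c + hdist b d)"
      if w: "w \<in> carrier H" for w
    proof -
      have "hinner H w (a \<oplus> b) - hinner H w (c \<oplus> d) = hinner H w (a \<ominus> c) + hinner H w (b \<ominus> d)"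
        using that \<open>a \<in> _\<close> \<open>b \<in> _\<close> \<open>c \<in> _\<close> \<open>d \<in> _\<close> by (simp add: hinner_add hinner_diff)
      then show ?thesis
        using norm_triangle_ineq[of "hinner H w (a \<ominus> c)" "hinner H w (b \<ominus> d)"]
          Cauchy_Schwarz[OF w, of "a \<ominus> c"] Cauchy_Schwarz[OF w, of "b \<ominus> d"]
          \<open>a \<in> _\<close> \<open>b \<in> _\<close> \<open>c \<in> _\<close> \<open>d \<in> _\<close> by (simp add: hdist_def distrib_left)
    qed
  qed (use that hdist_nonneg in auto)
  have "tot_bdd (carrier G) (\<lambda>g h. hdist (\<pi> g (u \<oplus> v)) (\<pi> h (u \<oplus> v)))"
  proof (rule tot_bdd_mono)
    show "tot_bdd (carrier G) (\<lambda>g h. hdist (\<pi> g u) (\<pi> h u) + hdist (\<pi> g v) (\<pi> h v))"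
      using assms by (intro tot_bdd_add) (auto simp: compact_vectors_def)
    show "hdist (\<pi> g (u \<oplus> v)) (\<pi> h (u \<oplus> v)) \<le> hdist (\<pi> g u) (\<pi> h u) + hdist (\<pi> g v) (\<pi> h v)"
      if "g \<in> carrier G" "h \<in> carrier G" for g h
      using le that H by (simp add: rep_add rep_closed)
  qed
  then show ?thesis using H by (simp add: compact_vectors_def)
qed

lemma compact_vectors_smult:
  assumes "u \<in> compact_vectors"
  shows "c \<odot> u \<in> compact_vectors"
proof -
  have H: "u \<in> carrier H" using assms by (auto simp: compact_vectors_def)
  have le: "hdist (c \<odot> a) (c \<odot> b) \<le> cmod c * hdist a b" if "a \<in> carrier H" "b \<in> carrier H" for a b
  proof (rule hdist_leI)
    show "cmod (hinner H w (c \<odot> a) - hinner H w (c \<odot> b)) \<le> hnorm H w * (cmod c * hdist a b)"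
      if w: "w \<in> carrier H" for w
    proof -
      have "hinner H w (c \<odot> a) - hinner H w (c \<odot> b) = c * hinner H w (a \<ominus> b)"
        using that \<open>a \<in> _\<close> \<open>b \<in> _\<close> by (simp add: hinner_smult hinner_diff algebra_simps)
      then show ?thesis
        using Cauchy_Schwarz[OF w, of "a \<ominus> b"] \<open>a \<in> _\<close> \<open>b \<in> _\<close>
        by (simp add: hdist_def norm_mult mult.left_commute mult_left_mono)
    qed
  qed (use that hdist_nonneg smult_in in auto)
  have "tot_bdd (carrier G) (\<lambda>g h. hdist (\<pi> g (c \<odot> u)) (\<pi> h (c \<odot> u)))"
  proof (rule tot_bdd_mono)
    show "tot_bdd (carrier G) (\<lambda>g h. cmod c * hdist (\<pi> g u) (\<pi> h u))"
      using assms by (intro tot_bdd_cmult) (auto simp: compact_vectors_def)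
    show "hdist (\<pi> g (c \<odot> u)) (\<pi> h (c \<odot> u)) \<le> cmod c * hdist (\<pi> g u) (\<pi> h u)"
      if "g \<in> carrier G" "h \<in> carrier G" for g h
      using le that H by (simp add: rep_smult rep_closed)
  qed
  then show ?thesis using H by (simp add: compact_vectors_def smult_in)
qed

lemma compact_vectors_rep:
  assumes "u \<in> compact_vectors" "k \<in> carrier G"
  shows "\<pi> k u \<in> compact_vectors"
proof -
  have H: "u \<in> carrier H" using assms by (auto simp: compact_vectors_def)
  have "tot_bdd (carrier G) (\<lambda>g h. hdist (\<pi> (g \<otimes>\<^bsub>G\<^esub> k) u) (\<pi> (h \<otimes>\<^bsub>G\<^esub> k) u))"
    using assms by (intro tot_bdd_comp[where f = "\<lambda>g. g \<otimes>\<^bsub>G\<^esub> k"]) (auto simp: compact_vectors_def)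
  then have "tot_bdd (carrier G) (\<lambda>g h. hdist (\<pi> g (\<pi> k u)) (\<pi> h (\<pi> k u)))"
    by (rule tot_bdd_mono) (use assms H in \<open>simp add: rep_mult\<close>)
  then show ?thesis using H assms by (simp add: compact_vectors_def rep_closed)
qed

text \<open>The operators \<open>T ss y\<close> average the rank one operators \<open>y \<mapsto> \<langle>v, y\<rangle> v\<close> over the orbit of \<open>x\<close>.
  In Hilbert-Schmidt norm they approximate an invariant compact operator, whose range
  consists of compact vectors; if \<open>x\<close> is orthogonal to those, it vanishes.\<close>

lemma orthogonal_weakly_mixing:
  assumes x: "x \<in> carrier H" and orth: "\<And>z. z \<in> compact_vectors \<Longrightarrow> hinner H z x = 0"
    and y: "y \<in> carrier H"
  shows "rmean G (\<lambda>g. of_real ((cmod (hinner H y (\<pi> g x)))\<^sup>2)) 0"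
proof -
  let ?I = "carrier H \<times> carrier H"
  \<comment> \<open>A pair \<open>(w, v)\<close> stands for the rank one operator sending
    \<open>z\<close> to the multiple of \<open>w\<close> by the inner product of \<open>v\<close>
    and \<open>z\<close>; \<open>?k\<close> is the Hilbert-Schmidt inner product of such
    operators.\<close>
  let ?k = "\<lambda>p q. hinner H (fst p) (fst q) * cnj (hinner H (snd p) (snd q))"
  let ?act = "\<lambda>g p. (\<pi> g (fst p), \<pi> g (snd p))"
  have psd: "psd_kernel ?I (\<lambda>p q. hinner H (fst p) (fst q))"
    "psd_kernel ?I (\<lambda>p q. cnj (hinner H (snd p) (snd q)))"
    using psd_kernel_comap[OF psd_kernel_hinner, of ?I fst]
      psd_kernel_comap[OF psd_kernel_cnj[OF psd_kernel_hinner], of ?I snd] by auto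
  interpret P: psd_kernel ?I ?k by (rule psd_kernel_mult[OF psd])
  interpret P: invariant_kernel G ?I ?k ?act
    by unfold_locales (auto simp: rep_closed rep_mult rep_one rep_inner)
  let ?i = "(x, x)"
  have i: "?i \<in> ?I" using x by simp
  obtain d where d: "\<And>us. glist G us \<Longrightarrow> d \<le> (P.knorm (P.orb us ?i))\<^sup>2"
    "\<And>e. e > 0 \<Longrightarrow> \<exists>us. glist G us \<and> (P.knorm (P.orb us ?i))\<^sup>2 < d + e"
    using P.orb_minimizing[OF i] by blast
  have "\<forall>n. \<exists>us. glist G us \<and> (P.knorm (P.orb us ?i))\<^sup>2 < d + inverse (real (Suc n))"
    by (intro allI d(2)) simp
  then obtain ss where "\<forall>n. glist G (ss n) \<and> (P.knorm (P.orb (ss n) ?i))\<^sup>2 < d + inverse (real (Suc n))"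
    by (auto dest!: choice)
  then have ss: "\<And>n. glist G (ss n)" "\<And>n. (P.knorm (P.orb (ss n) ?i))\<^sup>2 < d + inverse (real (Suc n))"
    by blast+
  \<comment> \<open>By \<open>orb_parallelogram\<close>, averages whose squared norms exceed
    \<open>d\<close> by at most \<open>1 / (n + 1)\<close> are at most this far apart.\<close>
  define \<epsilon> where "\<epsilon> n = sqrt (4 * inverse (real (Suc n)))" for n
  have \<epsilon>0: "\<epsilon> n \<ge> 0" for n by (simp add: \<epsilon>_def)
  have \<epsilon>_lim: "\<epsilon> \<longlonglongrightarrow> 0"
    unfolding \<epsilon>_def using tendsto_real_sqrt[OF tendsto_mult_left[OF LIMSEQ_inverse_real_of_nat, of 4]] by simp
  have a_val: "P.valid (P.orb (ss n) ?i)" for n by (rule P.orb_valid[OF ss(1) i])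
  have close: "P.knorm (ldiff (P.orb us ?i) (P.orb (ss n) ?i)) \<le> \<epsilon> n"
    if "glist G us" "(P.knorm (P.orb us ?i))\<^sup>2 \<le> d + inverse (real (Suc n))" for us n
    unfolding \<epsilon>_def
    by (rule real_le_rsqrt, rule P.orb_parallelogram[OF i that(1) ss(1) d(1) that(2)]) (use ss(2) less_imp_le in auto)
  have close1: "P.knorm (ldiff (P.orb (ss m) ?i) (P.orb (ss n) ?i)) \<le> \<epsilon> n" if "m \<ge> n" for m n
  proof (rule close[OF ss(1)])
    have "inverse (real (Suc m)) \<le> inverse (real (Suc n))" using that by simp
    then show "(P.knorm (P.orb (ss m) ?i))\<^sup>2 \<le> d + inverse (real (Suc n))" using ss(2)[of m] by linarith
  qed
  have close2: "P.knorm (ldiff (lact (?act g) (P.orb (ss n) ?i)) (P.orb (ss n) ?i)) \<le> \<epsilon> n" if g: "g \<in> carrier G" for g n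
  proof -
    have "P.knorm (lact (?act g) (P.orb (ss n) ?i)) = P.knorm (P.orb (ss n) ?i)"
      using P.knorm_lact[OF g a_val] .
    then show ?thesis
      using close[OF glist_map[OF ss(1) g], of n n] ss(2)[of n] P.lact_orb[OF ss(1)[of n] g i] by simp
  qed
  \<comment> \<open>The operator represented by the \<open>n\<close>-th orbit average. Its matrix
    entries are pairings with that average, so estimates for the kernel seminorm bound
    \<open>T\<close> in operator norm.\<close>
  define T where "T n v = lincomb (map (\<lambda>s. (hinner H (\<pi> s x) v / of_nat (length (ss n)), \<pi> s x)) (ss n))" for n v
  have T: "T n v \<in> carrier H" for n v
    unfolding T_def by (rule lincomb_closed) (use ss(1)[of n] x in \<open>auto simp: glist_def rep_closed subset_iff\<close>)
  have T_avg: "hinner H w (T n v) = avg (\<lambda>s. hinner H (\<pi> s x) v * hinner H w (\<pi> s x)) (ss n)"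
    if w: "w \<in> carrier H" for n v w
  proof -
    have val: "set (map (\<lambda>s. (hinner H (\<pi> s x) v / of_nat (length (ss n)), \<pi> s x)) (ss n)) \<subseteq> UNIV \<times> carrier H"
      using ss(1)[of n] x by (auto simp: glist_def rep_closed subset_iff)
    have "hinner H w (T n v) = (\<Sum>s\<leftarrow>ss n. hinner H (\<pi> s x) v / of_nat (length (ss n)) * hinner H w (\<pi> s x))"
      unfolding T_def hinner_lincomb_right[OF w val] by (simp add: o_def)
    then show ?thesis by (simp add: avg_def sum_list_divide)
  qed
  have T_kip: "hinner H w (T n v) = kip ?k [(1, (w, v))] (P.orb (ss n) ?i)"
    if w: "w \<in> carrier H" "v \<in> carrier H" for n v w
  proof -
    have "kip ?k [(1, (w, v))] (P.orb (ss n) ?i) = avg (\<lambda>s. kip ?k [(1, (w, v))] [(1, ?act s ?i)]) (ss n)"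
      using w by (intro P.kip_orb_right[OF ss(1) i]) auto
    also have "\<dots> = avg (\<lambda>s. hinner H (\<pi> s x) v * hinner H w (\<pi> s x)) (ss n)"
      using ss(1)[of n] x w hinner_cnj[OF w(2)]
      by (intro avg_cong) (auto simp: kip_def glist_def rep_closed subset_iff)
    finally show ?thesis using T_avg[OF w(1)] by simp
  qed
  have pair_norm: "P.knorm [(1, (w, v))] = hnorm H w * hnorm H v" if "w \<in> carrier H" "v \<in> carrier H" for w v
  proof -
    have im: "hinner H u u = of_real ((hnorm H u)\<^sup>2)" if "u \<in> carrier H" for u
      using hinner_cnj[OF that that] hinner_nonneg[OF that] by (simp add: hnorm_def complex_eq_iff)
    show ?thesis using that
      by (simp add: P.knorm_def kip_def im real_sqrt_mult hnorm_nonneg flip: of_real_power)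
  qed
  have CS: "cmod (kip ?k [(1, (w, v))] l) \<le> hnorm H w * hnorm H v * P.knorm l"
    if "w \<in> carrier H" "v \<in> carrier H" "P.valid l" for w v l
    using P.kip_CS[of "[(1, (w, v))]" l] that pair_norm by simp
  have T_close: "hdist (T m v) (T n v) \<le> hnorm H v * \<epsilon> n" if v: "v \<in> carrier H" and mn: "m \<ge> n" for m n v
  proof (rule hdist_leI[OF T T])
    show "cmod (hinner H w (T m v) - hinner H w (T n v)) \<le> hnorm H w * (hnorm H v * \<epsilon> n)" if w: "w \<in> carrier H" for w
    proof -
      have "hinner H w (T m v) - hinner H w (T n v) = kip ?k [(1, (w, v))] (ldiff (P.orb (ss m) ?i) (P.orb (ss n) ?i))"
        using T_kip[OF w v] by simp
      then have "cmod (hinner H w (T m v) - hinner H w (T n v)) \<le>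
          hnorm H w * hnorm H v * P.knorm (ldiff (P.orb (ss m) ?i) (P.orb (ss n) ?i))"
        using CS[OF w v set_ldiff[OF a_val a_val]] by simp
      also have "\<dots> \<le> hnorm H w * hnorm H v * \<epsilon> n"
        using close1[OF mn] w v by (intro mult_left_mono) (auto simp: hnorm_nonneg)
      finally show ?thesis by (simp add: mult.assoc)
    qed
  qed (use v \<epsilon>0 hnorm_nonneg in auto)
  \<comment> \<open>Moving \<open>g\<close> to the left argument and then applying invariance puts
    it on the orbit average, which is almost invariant; hence \<open>T n\<close> almost commutes
    with the representation.\<close>
  have T_equiv: "hdist (\<pi> g (T n v)) (T n (\<pi> g v)) \<le> hnorm H v * \<epsilon> n" if v: "v \<in> carrier H" and g: "g \<in> carrier G" for g n v
  proof (rule hdist_leI[OF rep_closed[OF g T] T])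
    show "cmod (hinner H w (\<pi> g (T n v)) - hinner H w (T n (\<pi> g v))) \<le> hnorm H w * (hnorm H v * \<epsilon> n)" if w: "w \<in> carrier H" for w
    proof -
      have gw: "\<pi> (inv\<^bsub>G\<^esub> g) w \<in> carrier H" "\<pi> g v \<in> carrier H" using g w v rep_closed by auto
      have "hinner H w (\<pi> g (T n v)) = hinner H (\<pi> (inv\<^bsub>G\<^esub> g) w) (T n v)" using g w T
        by (rule rep_adjoint)
      also have "\<dots> = kip ?k [(1, (\<pi> (inv\<^bsub>G\<^esub> g) w, v))] (P.orb (ss n) ?i)" by (rule T_kip[OF gw(1) v])
      also have "\<dots> = kip ?k (lact (?act g) [(1, (\<pi> (inv\<^bsub>G\<^esub> g) w, v))]) (lact (?act g) (P.orb (ss n) ?i))"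
        using gw(1) v by (intro P.kip_lact[OF g _ a_val, symmetric]) auto
      also have "lact (?act g) [(1, (\<pi> (inv\<^bsub>G\<^esub> g) w, v))] = [(1, (w, \<pi> g v))]"
        using g w by (simp add: lact_def rep_inv)
      finally have "hinner H w (\<pi> g (T n v)) - hinner H w (T n (\<pi> g v)) =
          kip ?k [(1, (w, \<pi> g v))] (ldiff (lact (?act g) (P.orb (ss n) ?i)) (P.orb (ss n) ?i))"
        using T_kip[OF w gw(2)] by simp
      then have "cmod (hinner H w (\<pi> g (T n v)) - hinner H w (T n (\<pi> g v))) \<le>
          hnorm H w * hnorm H (\<pi> g v) * P.knorm (ldiff (lact (?act g) (P.orb (ss n) ?i)) (P.orb (ss n) ?i))"
        using CS[OF w gw(2) set_ldiff[OF P.lact_valid[OF g a_val] a_val]] by simp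
      also have "\<dots> \<le> hnorm H w * hnorm H v * \<epsilon> n"
        using close2[OF g] w v g by (simp add: rep_norm) (intro mult_left_mono, auto simp: hnorm_nonneg)
      finally show ?thesis by (simp add: mult.assoc)
    qed
  qed (use v \<epsilon>0 hnorm_nonneg in auto)
  \<comment> \<open>\<open>T n\<close> has finite rank: the bounded scalar functions
    \<open>g \<mapsto> hinner H (\<pi> s x) (\<pi> g v)\<close>, one for each \<open>s\<close> in
    the list, control the vector \<open>T n (\<pi> g v)\<close>.\<close>
  have T_tb: "tot_bdd (carrier G) (\<lambda>g h. hdist (T n (\<pi> g v)) (T n (\<pi> h v)))" if v: "v \<in> carrier H" for n v
  proof (rule tot_bdd_mono)
    show "tot_bdd (carrier G) (\<lambda>g h. hnorm H x * (\<Sum>s\<leftarrow>ss n. cmod (hinner H (\<pi> s x) (\<pi> g v) - hinner H (\<pi> s x) (\<pi> h v))))"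
    proof (intro tot_bdd_cmult tot_bdd_sum_list)
      fix s assume "s \<in> set (ss n)"
      then have s: "s \<in> carrier G" using ss(1)[of n] by (auto simp: glist_def)
      show "tot_bdd (carrier G) (\<lambda>g h. cmod (hinner H (\<pi> s x) (\<pi> g v) - hinner H (\<pi> s x) (\<pi> h v)))"
      proof (rule tot_bdd_bounded)
        show "cmod (hinner H (\<pi> s x) (\<pi> g v)) \<le> hnorm H x * hnorm H v" if "g \<in> carrier G" for g
          using Cauchy_Schwarz[of "\<pi> s x" "\<pi> g v"] s x v that by (simp add: rep_closed rep_norm)
      qed
    qed (use x hnorm_nonneg in auto)
    fix g h assume g: "g \<in> carrier G" and h: "h \<in> carrier G"
    let ?S = "\<Sum>s\<leftarrow>ss n. cmod (hinner H (\<pi> s x) (\<pi> g v) - hinner H (\<pi> s x) (\<pi> h v))"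
    have S0: "?S \<ge> 0" by (rule sum_list_nonneg) auto
    show "hdist (T n (\<pi> g v)) (T n (\<pi> h v)) \<le> hnorm H x * ?S"
    proof (rule hdist_leI[OF T T])
      fix w assume w: "w \<in> carrier H"
      have "hinner H w (T n (\<pi> g v)) - hinner H w (T n (\<pi> h v)) =
        avg (\<lambda>s. (hinner H (\<pi> s x) (\<pi> g v) - hinner H (\<pi> s x) (\<pi> h v)) * hinner H w (\<pi> s x)) (ss n)"
        using T_avg[OF w] by (simp add: avg_def left_diff_distrib sum_list_subtractf diff_divide_distrib)
      moreover have "cmod (avg (\<lambda>s. (hinner H (\<pi> s x) (\<pi> g v) - hinner H (\<pi> s x) (\<pi> h v)) * hinner H w (\<pi> s x)) (ss n) - 0)
          \<le> hnorm H w * (hnorm H x * ?S)"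
      proof (rule avg_close)
        fix s assume s: "s \<in> set (ss n)"
        then have sG: "s \<in> carrier G" using ss(1)[of n] by (auto simp: glist_def)
        have "cmod (hinner H w (\<pi> s x)) \<le> hnorm H w * hnorm H x"
          using Cauchy_Schwarz[OF w rep_closed[OF sG x]] sG x by (simp add: rep_norm)
        moreover have "cmod (hinner H (\<pi> s x) (\<pi> g v) - hinner H (\<pi> s x) (\<pi> h v)) \<le> ?S"
          by (rule member_le_sum_list) (use s in auto)
        ultimately have "cmod (hinner H (\<pi> s x) (\<pi> g v) - hinner H (\<pi> s x) (\<pi> h v)) * cmod (hinner H w (\<pi> s x))
            \<le> ?S * (hnorm H w * hnorm H x)" using S0 by (intro mult_mono) auto
        then show "cmod ((hinner H (\<pi> s x) (\<pi> g v) - hinner H (\<pi> s x) (\<pi> h v)) * hinner H w (\<pi> s x) - 0)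
            \<le> hnorm H w * (hnorm H x * ?S)" by (simp add: norm_mult mult_ac)
      qed (use ss(1) in \<open>simp add: glist_def\<close>)
      ultimately show "cmod (hinner H w (T n (\<pi> g v)) - hinner H w (T n (\<pi> h v))) \<le> hnorm H w * (hnorm H x * ?S)"
        by simp
    qed (use x S0 hnorm_nonneg in auto)
  qed
  have T_small: "hnorm H (T n v) \<le> hnorm H v * \<epsilon> n" if v: "v \<in> carrier H" for n v
  proof -
    have nv: "hnorm H v \<ge> 0" using v by (rule hnorm_nonneg)
    have e_small: "\<exists>N. \<forall>n\<ge>N. hnorm H v * \<epsilon> n < e" if "e > 0" for e
    proof -
      have "(\<lambda>n. hnorm H v * \<epsilon> n) \<longlonglongrightarrow> 0" using tendsto_mult_left[OF \<epsilon>_lim, of "hnorm H v"] by simp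
      from order_tendstoD(2)[OF this that] show ?thesis unfolding eventually_sequentially .
    qed
    have "\<exists>N. \<forall>m\<ge>N. \<forall>n\<ge>N. hnorm H (T m v \<ominus> T n v) < e" if e: "e > 0" for e
    proof -
      obtain N where N: "\<And>n. n \<ge> N \<Longrightarrow> hnorm H v * \<epsilon> n < e / 2" using e_small[of "e / 2"] e by auto
      have "hdist (T m v) (T n v) < e" if "m \<ge> N" "n \<ge> N" for m n
        using hdist_triangle[OF T T T, of m v n v N v] T_close[OF v that(1)] T_close[OF v that(2)]
          hdist_commute[OF T T, of n v N v] N[of N] by simp
      then show ?thesis unfolding hdist_def by blast
    qed
    then obtain l where l: "l \<in> carrier H" "(\<lambda>n. hnorm H (T n v \<ominus> l)) \<longlonglongrightarrow> 0"
      using hcomplete[of "\<lambda>n. T n v"] T by blast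
    have Tl: "hdist l (T n v) \<le> hnorm H v * \<epsilon> n" for n
    proof (rule LIMSEQ_le_const)
      show "(\<lambda>m. hnorm H (T m v \<ominus> l) + hnorm H v * \<epsilon> n) \<longlonglongrightarrow> hnorm H v * \<epsilon> n"
        using tendsto_add[OF l(2) tendsto_const[of "hnorm H v * \<epsilon> n"]] by simp
      show "\<exists>N. \<forall>m\<ge>N. hdist l (T n v) \<le> hnorm H (T m v \<ominus> l) + hnorm H v * \<epsilon> n"
      proof (intro exI allI impI)
        fix m assume "m \<ge> n"
        then show "hdist l (T n v) \<le> hnorm H (T m v \<ominus> l) + hnorm H v * \<epsilon> n"
          using hdist_triangle[OF l(1) T T, of n v m v] T_close[OF v, of n m] hdist_commute[OF l(1) T, of m v]
          by (simp add: hdist_def)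
      qed
    qed
    \<comment> \<open>By almost equivariance \<open>\<pi> g l\<close> stays uniformly close to
      \<open>T N (\<pi> g v)\<close>, and these vectors form a totally bounded family. So the limit
      \<open>l\<close> of \<open>T n v\<close> is a compact vector.\<close>
    have "tot_bdd (carrier G) (\<lambda>g h. hdist (\<pi> g l) (\<pi> h l))"
    proof (rule tot_bdd_approx)
      fix e :: real assume "e > 0"
      then obtain N where N: "hnorm H v * \<epsilon> N < e / 4" using e_small[of "e / 4"] by auto
      have one: "hdist (\<pi> g l) (T N (\<pi> g v)) \<le> e / 2" if g: "g \<in> carrier G" for g
        using hdist_triangle[OF rep_closed[OF g l(1)] rep_closed[OF g T] T, of N "\<pi> g v" N v]
          rep_dist[OF g l(1) T, of N v] Tl[of N] T_equiv[OF v g, of N] N by simp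
      have "hdist (\<pi> g l) (\<pi> h l) \<le> hdist (T N (\<pi> g v)) (T N (\<pi> h v)) + e"
        if g: "g \<in> carrier G" and h: "h \<in> carrier G" for g h
        using hdist_triangle[OF rep_closed[OF g l(1)] T rep_closed[OF h l(1)], of N "\<pi> g v"]
          hdist_triangle[OF T T rep_closed[OF h l(1)], of N "\<pi> g v" N "\<pi> h v"]
          hdist_commute[OF rep_closed[OF h l(1)] T, of N "\<pi> h v"] one[OF g] one[OF h] by simp
      then show "\<exists>d'. tot_bdd (carrier G) d' \<and> (\<forall>g\<in>carrier G. \<forall>h\<in>carrier G. hdist (\<pi> g l) (\<pi> h l) \<le> d' g h + e)"
        using T_tb[OF v, of N] by blast
    qed
    then have lc: "l \<in> compact_vectors" using l(1) by (simp add: compact_vectors_def)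
    \<comment> \<open>\<open>T n v\<close> is a combination of vectors \<open>\<pi> s x\<close>, all
      orthogonal to the compact vectors because these are invariant under the group. Thus
      \<open>l\<close> is orthogonal to a sequence converging to \<open>l\<close>, and
      vanishes.\<close>
    have "hinner H l (T n v) = 0" for n
    proof -
      have "hinner H l (\<pi> s x) = 0" if "s \<in> set (ss n)" for s
      proof -
        have s: "s \<in> carrier G" using ss(1)[of n] that by (auto simp: glist_def)
        have "hinner H l (\<pi> s x) = hinner H (\<pi> (inv\<^bsub>G\<^esub> s) l) x" using s l(1) x by (rule rep_adjoint)
        also have "\<dots> = 0" by (rule orth[OF compact_vectors_rep[OF lc]]) (use s in simp)
        finally show ?thesis .
      qed
      then have "avg (\<lambda>s. hinner H (\<pi> s x) v * hinner H l (\<pi> s x)) (ss n) = avg (\<lambda>s. 0) (ss n)"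
        by (intro avg_cong) simp
      then show ?thesis by (simp add: T_avg[OF l(1)] avg_def)
    qed
    then have "hinner H l l = 0" using hinner_limit_zero[OF l(1) T l(1,2)] by blast
    then have l0: "l = \<zero>\<^bsub>H\<^esub>" using l(1) hinner_definite by blast
    have "hinner H (T n v \<ominus> l) (T n v \<ominus> l) = hinner H (T n v) (T n v)"
    proof -
      have "T n v \<ominus> l = T n v" using T l0 by (simp add: a_minus_def)
      then show ?thesis by simp
    qed
    then have "hnorm H (T n v) = hdist (T n v) l" by (simp add: hdist_def hnorm_def)
    then show ?thesis using Tl[of n] hdist_commute[OF l(1) T, of n v] by simp
  qed
  show ?thesis
    unfolding rmean_def
  proof (intro allI impI)
    fix \<delta> :: real assume d: "\<delta> > 0"
    have "(\<lambda>n. (hnorm H y)\<^sup>2 * \<epsilon> n) \<longlonglongrightarrow> 0" using tendsto_mult_left[OF \<epsilon>_lim, of "(hnorm H y)\<^sup>2"] by simp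
    from order_tendstoD(2)[OF this d] obtain n where n: "(hnorm H y)\<^sup>2 * \<epsilon> n < \<delta>"
      unfolding eventually_sequentially by blast
    have "cmod (avg (\<lambda>s. of_real ((cmod (hinner H y (\<pi> (g \<otimes>\<^bsub>G\<^esub> s) x)))\<^sup>2)) (ss n) - 0) \<le> \<delta>" if g: "g \<in> carrier G" for g
    proof -
      \<comment> \<open>Moving \<open>g\<close> to the other side yields a vector of the same norm
        as \<open>y\<close>, so the final bound does not depend on \<open>g\<close>.\<close>
      define v where "v = \<pi> (inv\<^bsub>G\<^esub> g) y"
      have v: "v \<in> carrier H" "hnorm H v = hnorm H y" using g y by (auto simp: v_def rep_closed rep_norm)
      have "of_real ((cmod (hinner H y (\<pi> (g \<otimes>\<^bsub>G\<^esub> s) x)))\<^sup>2) = hinner H (\<pi> s x) v * hinner H v (\<pi> s x)"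
        if "s \<in> set (ss n)" for s
      proof -
        have s: "s \<in> carrier G" using ss(1)[of n] that by (auto simp: glist_def)
        have "hinner H y (\<pi> (g \<otimes>\<^bsub>G\<^esub> s) x) = hinner H v (\<pi> s x)"
          using rep_adjoint[OF g y rep_closed[OF s x]] s g x by (simp add: v_def rep_mult)
        then show ?thesis
          using hinner_cnj[OF v(1) rep_closed[OF s x]] by (simp add: complex_norm_square mult.commute del: of_real_power)
      qed
      then have "avg (\<lambda>s. of_real ((cmod (hinner H y (\<pi> (g \<otimes>\<^bsub>G\<^esub> s) x)))\<^sup>2)) (ss n) = hinner H v (T n v)"
        unfolding T_avg[OF v(1)] by (rule avg_cong)
      also have "cmod \<dots> \<le> hnorm H v * hnorm H (T n v)" by (rule Cauchy_Schwarz[OF v(1) T])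
      also have "\<dots> \<le> hnorm H v * (hnorm H v * \<epsilon> n)"
        using T_small[OF v(1)] hnorm_nonneg[OF v(1)] by (rule mult_left_mono)
      also have "\<dots> \<le> \<delta>" using n v(2) by (simp add: power2_eq_square mult.assoc)
      finally show ?thesis by simp
    qed
    then show "\<exists>ss. glist G ss \<and> (\<forall>g\<in>carrier G. cmod (avg (\<lambda>s. of_real ((cmod (hinner H y (\<pi> (g \<otimes>\<^bsub>G\<^esub> s) x)))\<^sup>2)) ss - 0) \<le> \<delta>)"
      using ss(1) by blast
  qed
qed

text \<open>The compact vectors form a closed subspace, and the remainder of the orthogonal
  projection satisfies the hypothesis of \<open>orthogonal_weakly_mixing\<close>.\<close>

theorem compact_part:
  assumes x: "x \<in> carrier H"
  obtains x\<^sub>c where "x\<^sub>c \<in> compact_vectors"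
    "\<And>y. y \<in> carrier H \<Longrightarrow> rmean G (\<lambda>g. of_real ((cmod (hinner H y (\<pi> g (x \<ominus> x\<^sub>c))))\<^sup>2)) 0"
proof -
  have "\<exists>p\<in>compact_vectors. \<forall>z\<in>compact_vectors. hinner H z (x \<ominus> p) = 0"
  proof (rule projection[OF _ compact_vectors_zero compact_vectors_add compact_vectors_smult _ x])
    show "compact_vectors \<subseteq> carrier H" by (auto simp: compact_vectors_def)
    fix s l assume s: "\<And>n::nat. s n \<in> compact_vectors" and l: "l \<in> carrier H" "(\<lambda>n. hnorm H (s n \<ominus> l)) \<longlonglongrightarrow> 0"
    have "\<exists>s\<in>compact_vectors. hdist s l < e" if e: "e > 0" for e
    proof -
      obtain n where "hnorm H (s n \<ominus> l) < e"
        using order_tendstoD(2)[OF l(2) e] unfolding eventually_sequentially by blast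
      then show ?thesis using s by (auto simp: hdist_def)
    qed
    then show "l \<in> compact_vectors" using l(1) by (rule compact_vectors_limit)
  qed
  then obtain p where p: "p \<in> compact_vectors" "\<And>z. z \<in> compact_vectors \<Longrightarrow> hinner H z (x \<ominus> p) = 0"
    by blast
  have "x \<ominus> p \<in> carrier H" using x p(1) by (simp add: compact_vectors_def)
  then show thesis using that[OF p(1)] orthogonal_weakly_mixing p(2) by blast
qed

end

section \<open>Averages of real functions\<close>

lemma ravg_cong: "(\<And>x. x \<in> set xs \<Longrightarrow> f x = f' x) \<Longrightarrow> ravg f xs = ravg f' xs"
  unfolding ravg_def by (metis map_eq_conv)

lemma ravg_mono:
  assumes "\<And>x. x \<in> set xs \<Longrightarrow> f x \<le> f' x"
  shows "ravg f xs \<le> ravg f' xs"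
  unfolding ravg_def using assms by (intro divide_right_mono sum_list_mono) auto

lemma ravg_const: "xs \<noteq> [] \<Longrightarrow> ravg (\<lambda>_. c) xs = c"
  by (simp add: ravg_def sum_list_triv)

lemma ravg_diff: "ravg (\<lambda>x. f x - f' x) xs = ravg f xs - ravg f' xs"
  by (simp add: ravg_def sum_list_subtractf diff_divide_distrib)

lemma ravg_cmult: "ravg (\<lambda>x. c * f x) xs = c * ravg f xs"
  by (simp add: ravg_def sum_list_const_mult)

lemma ravg_nonneg: "(\<And>x. x \<in> set xs \<Longrightarrow> 0 \<le> f x) \<Longrightarrow> 0 \<le> ravg f xs"
  unfolding ravg_def by (intro divide_nonneg_nonneg sum_list_nonneg) auto

lemma
  assumes V: "star_space G V" and \<mu>: "mean_on V \<mu>"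
    and f: "\<And>s. s \<in> set ss \<Longrightarrow> creal G (f s) \<in> V"
  shows real_mean_ravg: "real_mean G \<mu> (\<lambda>x. ravg (\<lambda>s. f s x) ss) = ravg (\<lambda>s. real_mean G \<mu> (f s)) ss"
    and creal_ravg: "creal G (\<lambda>x. ravg (\<lambda>s. f s x) ss) \<in> V"
proof -
  note V' = star_spaceD[OF V]
  have "creal G (\<lambda>x. \<Sum>s\<leftarrow>us. f s x) \<in> V \<and> real_mean G \<mu> (\<lambda>x. \<Sum>s\<leftarrow>us. f s x) = (\<Sum>s\<leftarrow>us. real_mean G \<mu> (f s))"
    if "set us \<subseteq> set ss" for us
    using that
  proof (induction us)
    case Nil
    have "creal G (\<lambda>_. 0) \<in> V" unfolding creal_const by (rule V'(4)[OF V'(2)])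
    then show ?case using real_mean_const[OF V \<mu>, of 0] by simp
  next
    case (Cons s us)
    then have s: "creal G (f s) \<in> V" using f by auto
    show ?case
      using Cons s real_mean_add[OF V \<mu> s, of "\<lambda>x. \<Sum>s\<leftarrow>us. f s x"] V'(3)[OF s, of "creal G (\<lambda>x. \<Sum>s\<leftarrow>us. f s x)"]
      by (simp add: creal_add)
  qed
  then have S: "creal G (\<lambda>x. \<Sum>s\<leftarrow>ss. f s x) \<in> V" "real_mean G \<mu> (\<lambda>x. \<Sum>s\<leftarrow>ss. f s x) = (\<Sum>s\<leftarrow>ss. real_mean G \<mu> (f s))"
    by auto
  have eq: "ravg g ss = (1 / real (length ss)) * (\<Sum>s\<leftarrow>ss. g s)" for g by (simp add: ravg_def)
  show "real_mean G \<mu> (\<lambda>x. ravg (\<lambda>s. f s x) ss) = ravg (\<lambda>s. real_mean G \<mu> (f s)) ss"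
    unfolding eq real_mean_scale[OF V \<mu> S(1)] S(2) ..
  show "creal G (\<lambda>x. ravg (\<lambda>s. f s x) ss) \<in> V"
    unfolding eq creal_scale by (rule V'(4)[OF S(1)])
qed

section \<open>Almost periodic functions and the covering argument\<close>

text \<open>The model is \<open>\<rho> g h = \<parallel>\<pi> g x - \<pi> h x\<parallel>\<close> for a compact vector \<open>x\<close>.\<close>

locale orbit_metric = group G for G :: "('a, 'm) monoid_scheme" (structure) +
  fixes \<rho> :: "'a \<Rightarrow> 'a \<Rightarrow> real" and B :: real
  assumes \<rho>_self: "g \<in> carrier G \<Longrightarrow> \<rho> g g = 0"
    and \<rho>_nonneg: "\<lbrakk>g \<in> carrier G; h \<in> carrier G\<rbrakk> \<Longrightarrow> 0 \<le> \<rho> g h"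
    and \<rho>_commute: "\<lbrakk>g \<in> carrier G; h \<in> carrier G\<rbrakk> \<Longrightarrow> \<rho> g h = \<rho> h g"
    and \<rho>_triangle: "\<lbrakk>g \<in> carrier G; h \<in> carrier G; k \<in> carrier G\<rbrakk> \<Longrightarrow> \<rho> g k \<le> \<rho> g h + \<rho> h k"
    and \<rho>_left: "\<lbrakk>g \<in> carrier G; h \<in> carrier G; k \<in> carrier G\<rbrakk> \<Longrightarrow> \<rho> (k \<otimes> g) (k \<otimes> h) = \<rho> g h"
    and \<rho>_tb: "tot_bdd (carrier G) \<rho>"
    and \<rho>_bound: "\<lbrakk>g \<in> carrier G; h \<in> carrier G\<rbrakk> \<Longrightarrow> \<rho> g h \<le> B" and B_pos: "B > 0"
    and \<rho>_fsr: "creal G (\<lambda>g. (\<rho> g \<one>)\<^sup>2) \<in> fourier_stieltjes G"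
begin

text \<open>Taking the supremum over right translates makes the left invariant \<open>\<rho>\<close>
  invariant on both sides; multiplication and inversion are then continuous, so that the completion
  is a group.\<close>

definition \<Delta> :: "'a \<Rightarrow> 'a \<Rightarrow> real" where
  "\<Delta> g h = (SUP s\<in>carrier G. \<rho> (g \<otimes> s) (h \<otimes> s))"

lemma \<rho>_le_\<Delta>: "\<lbrakk>g \<in> carrier G; h \<in> carrier G; s \<in> carrier G\<rbrakk> \<Longrightarrow> \<rho> (g \<otimes> s) (h \<otimes> s) \<le> \<Delta> g h"
  unfolding \<Delta>_def by (rule cSUP_upper) (auto intro!: bdd_aboveI2[where M = B] \<rho>_bound)

lemma \<Delta>_leI: "(\<And>s. s \<in> carrier G \<Longrightarrow> \<rho> (g \<otimes> s) (h \<otimes> s) \<le> c) \<Longrightarrow> \<Delta> g h \<le> c"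
  unfolding \<Delta>_def using one_closed by (intro cSUP_least) auto

lemma \<Delta>_self: "g \<in> carrier G \<Longrightarrow> \<Delta> g g = 0"
  using \<rho>_self \<rho>_le_\<Delta>[of g g \<one>] by (intro antisym \<Delta>_leI) auto

lemma \<Delta>_nonneg: "\<lbrakk>g \<in> carrier G; h \<in> carrier G\<rbrakk> \<Longrightarrow> 0 \<le> \<Delta> g h"
  using \<rho>_nonneg[of g h] \<rho>_le_\<Delta>[of g h \<one>] by simp

lemma \<Delta>_commute: "\<lbrakk>g \<in> carrier G; h \<in> carrier G\<rbrakk> \<Longrightarrow> \<Delta> g h = \<Delta> h g"
  unfolding \<Delta>_def by (rule SUP_cong) (auto intro: \<rho>_commute)

lemma \<Delta>_triangle:
  assumes "g \<in> carrier G" "h \<in> carrier G" "k \<in> carrier G"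
  shows "\<Delta> g k \<le> \<Delta> g h + \<Delta> h k"
proof (rule \<Delta>_leI)
  fix s assume s: "s \<in> carrier G"
  show "\<rho> (g \<otimes> s) (k \<otimes> s) \<le> \<Delta> g h + \<Delta> h k"
    using \<rho>_triangle[of "g \<otimes> s" "h \<otimes> s" "k \<otimes> s"] \<rho>_le_\<Delta>[of g h s] \<rho>_le_\<Delta>[of h k s] assms s by simp
qed

lemma \<Delta>_left:
  assumes "g \<in> carrier G" "h \<in> carrier G" "k \<in> carrier G"
  shows "\<Delta> (k \<otimes> g) (k \<otimes> h) = \<Delta> g h"
  unfolding \<Delta>_def using assms by (intro SUP_cong) (auto simp: m_assoc \<rho>_left)

lemma \<Delta>_right:
  assumes "g \<in> carrier G" "h \<in> carrier G" "k \<in> carrier G"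
  shows "\<Delta> (g \<otimes> k) (h \<otimes> k) = \<Delta> g h"
proof (rule antisym)
  have *: "\<Delta> (g \<otimes> k) (h \<otimes> k) \<le> \<Delta> g h" if "g \<in> carrier G" "h \<in> carrier G" "k \<in> carrier G" for g h k
    using that \<rho>_le_\<Delta>[of g h "k \<otimes> _"] by (intro \<Delta>_leI) (simp add: m_assoc)
  show "\<Delta> (g \<otimes> k) (h \<otimes> k) \<le> \<Delta> g h" using assms by (rule *)
  show "\<Delta> g h \<le> \<Delta> (g \<otimes> k) (h \<otimes> k)"
    using *[of "g \<otimes> k" "h \<otimes> k" "inv k"] assms by (simp add: m_assoc)
qed

text \<open>Left invariance bounds the difference of \<open>\<rho> (g s) (h s)\<close> and
  \<open>\<rho> (g f) (h f)\<close> by \<open>2 \<rho> s f\<close>, so a finite net of points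
  \<open>f\<close> controls the whole supremum.\<close>

lemma \<Delta>_tb: "tot_bdd (carrier G) \<Delta>"
proof (rule tot_bdd_approx)
  fix e :: real assume e: "e > 0"
  obtain F where F: "finite F" "F \<subseteq> carrier G" "\<And>g. g \<in> carrier G \<Longrightarrow> \<exists>f\<in>F. \<rho> g f < e / 2"
    using tot_bdd_net[OF \<rho>_tb, of "e / 2"] e by auto
  obtain fs where fs: "set fs = F" using F(1) finite_list by blast
  have "tot_bdd (carrier G) (\<lambda>g h. \<Sum>f\<leftarrow>fs. \<rho> (g \<otimes> f) (h \<otimes> f))"
    using F(2) fs by (intro tot_bdd_sum_list tot_bdd_comp[OF \<rho>_tb]) auto
  moreover have "\<Delta> g h \<le> (\<Sum>f\<leftarrow>fs. \<rho> (g \<otimes> f) (h \<otimes> f)) + e" if g: "g \<in> carrier G" and h: "h \<in> carrier G" for g h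
  proof (rule \<Delta>_leI)
    fix s assume s: "s \<in> carrier G"
    then obtain f where f: "f \<in> F" "\<rho> s f < e / 2" using F(3) by blast
    have fG: "f \<in> carrier G" using f F by auto
    have "\<rho> (g \<otimes> s) (h \<otimes> s) \<le> \<rho> (g \<otimes> s) (g \<otimes> f) + \<rho> (g \<otimes> f) (h \<otimes> f) + \<rho> (h \<otimes> f) (h \<otimes> s)"
      using \<rho>_triangle[of "g \<otimes> s" "g \<otimes> f" "h \<otimes> s"] \<rho>_triangle[of "g \<otimes> f" "h \<otimes> f" "h \<otimes> s"] g h s fG by simp
    also have "\<dots> = 2 * \<rho> s f + \<rho> (g \<otimes> f) (h \<otimes> f)"
      using g h s fG \<rho>_left \<rho>_commute[of f s] by simp
    also have "\<rho> (g \<otimes> f) (h \<otimes> f) \<le> (\<Sum>f\<leftarrow>fs. \<rho> (g \<otimes> f) (h \<otimes> f))"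
      by (rule member_le_sum_list) (use f fs F g h in \<open>auto intro!: \<rho>_nonneg\<close>)
    finally show "\<rho> (g \<otimes> s) (h \<otimes> s) \<le> (\<Sum>f\<leftarrow>fs. \<rho> (g \<otimes> f) (h \<otimes> f)) + e" using f(2) by simp
  qed
  ultimately show "\<exists>d'. tot_bdd (carrier G) d' \<and> (\<forall>g\<in>carrier G. \<forall>h\<in>carrier G. \<Delta> g h \<le> d' g h + e)"
    by blast
qed

end

text \<open>Both summands are coefficients of the representation that yields \<open>\<phi>\<close>,
  at the compact part \<open>z\<close> of \<open>x\<close> and at the remainder. The metric is the
  distance along the orbit of \<open>z\<close>, for which \<open>\<psi>\<close> is Lipschitz by
  Cauchy-Schwarz.\<close>

lemma (in fs_functional) compact_decomposition:
  assumes \<phi>: "\<phi> \<in> fourier_stieltjes G"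
  obtains \<psi> \<rho> B C where "orbit_metric G \<rho> B" "\<psi> \<in> fourier_stieltjes G"
    "L (\<lambda>g. (cmod (\<phi> g - \<psi> g))\<^sup>2) = 0" "C \<ge> 0"
    "\<And>g h. \<lbrakk>g \<in> carrier G; h \<in> carrier G\<rbrakk> \<Longrightarrow> cmod (\<psi> g - \<psi> h) \<le> C * \<rho> g h"
proof -
  obtain H :: "('a \<Rightarrow> complex) inner_module" and \<pi> x y where H:
    "hilbert_rep G H \<pi>" "x \<in> carrier H" "y \<in> carrier H" "\<phi> = matrix_coeff G H \<pi> y x"
    using fourier_stieltjesE[OF is_group \<phi>] .
  interpret R: hilbert_rep G H \<pi> by (rule H)
  obtain z where z: "z \<in> R.compact_vectors"
    "\<And>y. y \<in> carrier H \<Longrightarrow> rmean G (\<lambda>g. of_real ((cmod (hinner H y (\<pi> g (x \<ominus>\<^bsub>H\<^esub> z))))\<^sup>2)) 0"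
    using R.compact_part[OF H(2)] by blast
  have zH: "z \<in> carrier H" using z(1) by (simp add: R.compact_vectors_def)
  define \<rho> where "\<rho> g h = R.hdist (\<pi> g z) (\<pi> h z)" for g h
  define \<psi> where "\<psi> = matrix_coeff G H \<pi> y z"
  have nz: "hnorm H (\<pi> g z) = hnorm H z" if "g \<in> carrier G" for g using that zH by (rule R.rep_norm)
  \<comment> \<open>At \<open>h = \<one>\<close> this identity exhibits the squared distance as a
    Fourier-Stieltjes function of \<open>g\<close>.\<close>
  have sq: "(\<rho> g h)\<^sup>2 = 2 * (hnorm H z)\<^sup>2 - 2 * Re (hinner H (\<pi> g z) (\<pi> h z))"
    if "g \<in> carrier G" "h \<in> carrier G" for g h
    using that zH R.hdist_sq[of "\<pi> g z" "\<pi> h z"] by (simp add: \<rho>_def R.rep_closed nz)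
  \<comment> \<open>The summand \<open>1\<close> keeps the bound positive when
    \<open>z = 0\<close>.\<close>
  have "orbit_metric G \<rho> (2 * hnorm H z + 1)"
  proof
    fix g h k assume g: "g \<in> carrier G" and h: "h \<in> carrier G"
    note [simp] = R.rep_closed[OF g zH] R.rep_closed[OF h zH]
    show "\<rho> g g = 0" by (simp add: \<rho>_def R.hdist_self)
    show "0 \<le> \<rho> g h" by (simp add: \<rho>_def R.hdist_nonneg)
    show "\<rho> g h = \<rho> h g" by (simp add: \<rho>_def R.hdist_commute)
    have "(\<rho> g h)\<^sup>2 \<le> (2 * hnorm H z + 1)\<^sup>2"
    proof -
      have "- Re (hinner H (\<pi> g z) (\<pi> h z)) \<le> cmod (hinner H (\<pi> g z) (\<pi> h z))"
        using abs_Re_le_cmod[of "hinner H (\<pi> g z) (\<pi> h z)"] by linarith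
      also have "\<dots> \<le> (hnorm H z)\<^sup>2"
        using R.Cauchy_Schwarz[of "\<pi> g z" "\<pi> h z"] g h by (simp add: nz power2_eq_square)
      finally have "(\<rho> g h)\<^sup>2 \<le> 4 * (hnorm H z)\<^sup>2" using sq[OF g h] by simp
      also have "\<dots> \<le> (2 * hnorm H z + 1)\<^sup>2" using R.hnorm_nonneg[OF zH]
        by (simp add: power2_eq_square algebra_simps)
      finally show ?thesis .
    qed
    then show "\<rho> g h \<le> 2 * hnorm H z + 1"
      by (rule power2_le_imp_le) (use R.hnorm_nonneg[OF zH] in simp)
    assume k: "k \<in> carrier G"
    show "\<rho> g k \<le> \<rho> g h + \<rho> h k" using R.rep_closed[OF k zH] by (simp add: \<rho>_def R.hdist_triangle)
    show "\<rho> (k \<otimes> g) (k \<otimes> h) = \<rho> g h"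
      using g h k zH by (simp add: \<rho>_def R.rep_mult R.rep_dist)
  next
    show "tot_bdd (carrier G) \<rho>" using z(1) by (simp add: R.compact_vectors_def \<rho>_def[abs_def])
    show "0 < 2 * hnorm H z + 1" using R.hnorm_nonneg[OF zH] by simp
    have 1: "fs_real (\<lambda>g. Re (matrix_coeff G H \<pi> z z g))"
      by (rule fs_real_Re[OF R.matrix_coeff_in[OF zH zH]])
    have "fs_real (\<lambda>g. 2 * (hnorm H z)\<^sup>2 + (-2) * Re (matrix_coeff G H \<pi> z z g))"
      by (intro fs_real_add fs_real_cmult fs_real_const 1)
    moreover have "(\<rho> g \<one>)\<^sup>2 = 2 * (hnorm H z)\<^sup>2 + (-2) * Re (matrix_coeff G H \<pi> z z g)" if "g \<in> carrier G" for g
      using sq[OF that one_closed] that zH R.hinner_cnj[OF zH R.rep_closed[OF that zH]]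
      by (simp add: matrix_coeff_def R.rep_one)
    ultimately have "fs_real (\<lambda>g. (\<rho> g \<one>)\<^sup>2)"
      using fs_real_cong[of "\<lambda>g. (\<rho> g \<one>)\<^sup>2" "\<lambda>g. 2 * (hnorm H z)\<^sup>2 + (-2) * Re (matrix_coeff G H \<pi> z z g)"] by simp
    then show "creal G (\<lambda>g. (\<rho> g \<one>)\<^sup>2) \<in> fourier_stieltjes G" by (simp add: fs_real_def)
  qed
  moreover have \<psi>: "\<psi> \<in> fourier_stieltjes G" unfolding \<psi>_def by (rule R.matrix_coeff_in[OF H(3) zH])
  moreover have "L (\<lambda>g. (cmod (\<phi> g - \<psi> g))\<^sup>2) = 0"
  proof -
    have xz: "x \<ominus>\<^bsub>H\<^esub> z \<in> carrier H" using H zH by simp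
    have m: "\<pi> g (x \<ominus>\<^bsub>H\<^esub> z) = \<pi> g x \<ominus>\<^bsub>H\<^esub> \<pi> g z" if g: "g \<in> carrier G" for g
      using R.rep_add[OF g H(2) R.smult_in[OF zH, of "-1"]] R.rep_smult[OF g zH, of "-1"] H(2) zH R.rep_closed[OF g zH]
      by (simp add: a_minus_def R.minus_eq_smult)
    have c: "\<phi> g - \<psi> g = hinner H y (\<pi> g (x \<ominus>\<^bsub>H\<^esub> z))" if "g \<in> carrier G" for g
      using that H zH by (simp add: \<psi>_def matrix_coeff_def m R.hinner_diff R.rep_closed)
    let ?r = "\<lambda>g. (cmod (\<phi> g - \<psi> g))\<^sup>2"
    have "(\<lambda>g. \<phi> g + (-1) * \<psi> g) \<in> fourier_stieltjes G"
      by (intro fourier_stieltjes_add fourier_stieltjes_scale \<phi> \<psi>)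
    from fs_real_norm_sq[OF this] have r: "fs_real ?r" by simp
    have "rmean G (creal G ?r) 0"
      unfolding rmean_def
    proof (intro allI impI)
      fix \<delta> :: real assume "\<delta> > 0"
      then obtain ss where ss: "glist G ss"
        "\<And>g. g \<in> carrier G \<Longrightarrow> cmod (avg (\<lambda>s. of_real ((cmod (hinner H y (\<pi> (g \<otimes> s) (x \<ominus>\<^bsub>H\<^esub> z))))\<^sup>2)) ss - 0) \<le> \<delta>"
        using z(2)[OF H(3)] unfolding rmean_def by blast
      have "avg (\<lambda>s. creal G ?r (g \<otimes> s)) ss = avg (\<lambda>s. of_real ((cmod (hinner H y (\<pi> (g \<otimes> s) (x \<ominus>\<^bsub>H\<^esub> z))))\<^sup>2)) ss"
        if "g \<in> carrier G" for g
        using ss(1) that by (intro avg_cong) (auto simp: creal_def c glist_def subset_iff)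
      then show "\<exists>ss. glist G ss \<and> (\<forall>g\<in>carrier G. cmod (avg (\<lambda>s. creal G ?r (g \<otimes> s)) ss - 0) \<le> \<delta>)"
        using ss by (intro exI[of _ ss]) simp
    qed
    then have "\<Lambda> (creal G ?r) = 0" using r rmean_eqI FS_mean(1)[OF FS] unfolding fs_real_def by blast
    then show ?thesis by (simp add: real_mean_def)
  qed
  moreover have "hnorm H y \<ge> 0" using H by (intro R.hnorm_nonneg)
  moreover have "cmod (\<psi> g - \<psi> h) \<le> hnorm H y * \<rho> g h" if "g \<in> carrier G" "h \<in> carrier G" for g h
    using R.Cauchy_Schwarz[of y "\<pi> g z \<ominus>\<^bsub>H\<^esub> \<pi> h z"] that H zH
    by (simp add: \<psi>_def matrix_coeff_def \<rho>_def R.hdist_def R.hinner_diff R.rep_closed)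
  ultimately show thesis by (rule that)
qed

section \<open>Approximate identities and coverings by translates\<close>

context fs_functional
begin

lemma fs_real_sum: "(\<And>x. x \<in> A \<Longrightarrow> fs_real (f x)) \<Longrightarrow> fs_real (\<lambda>g. \<Sum>x\<in>A. f x g)"
  by (induction A rule: infinite_finite_induct) (simp_all add: fs_real_const fs_real_add)

lemma L_sum: "\<lbrakk>\<And>x. x \<in> A \<Longrightarrow> fs_real (f x)\<rbrakk> \<Longrightarrow> L (\<lambda>g. \<Sum>x\<in>A. f x g) = (\<Sum>x\<in>A. L (f x))"
  by (induction A rule: infinite_finite_induct)
     (simp_all add: L_const L_add fs_real_linf fs_real_sum)

lemma L_nonneg: "\<lbrakk>creal G r \<in> linf G; \<And>x. x \<in> carrier G \<Longrightarrow> 0 \<le> r x\<rbrakk> \<Longrightarrow> 0 \<le> L r"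
  using L_mono[of "\<lambda>_. 0" r] L_const[of 0] fs_real_linf[OF fs_real_const[of 0]] by simp

text \<open>High powers of a Fourier-Stieltjes bump, divided by their mean. That mean cannot decay
  too fast: finitely many translates of a small ball cover \<open>G\<close>, and on each of them the
  translated bump is close to \<open>1\<close>.\<close>

lemma approximate_identity:
  assumes "orbit_metric G \<rho> B" and "\<tau> > 0"
  obtains q where "fs_real q" "\<And>g. g \<in> carrier G \<Longrightarrow> 0 \<le> q g" "L q = 1"
    "\<And>g. g \<in> carrier G \<Longrightarrow> q (inv g) = q g" "L (\<lambda>g. q g * \<rho> g \<one>) \<le> \<tau>"
proof -
  interpret orbit_metric G \<rho> B by fact
  define \<sigma> where "\<sigma> = min \<tau> B"
  have \<sigma>: "\<sigma> > 0" "\<sigma> \<le> \<tau>" "\<sigma> \<le> B" using assms(2) B_pos by (auto simp: \<sigma>_def)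
  \<comment> \<open>With this value \<open>\<omega>\<close> is at most \<open>1 - a\<close> at
    distance \<open>\<sigma> / 2\<close> or more and at least \<open>1 - a / 4\<close> within
    distance \<open>\<sigma> / 4\<close>. Cutting \<open>\<sigma>\<close> off at \<open>B\<close>
    ensures \<open>a \<le> 1 / 4\<close>.\<close>
  define a where "a = \<sigma>\<^sup>2 / (4 * B\<^sup>2)"
  have "\<sigma>\<^sup>2 \<le> B\<^sup>2" using \<sigma> by (intro power_mono) auto
  then have a: "0 < a" "a \<le> 1 / 4" using \<sigma> B_pos by (auto simp: a_def field_simps)
  define \<omega> where "\<omega> g = 1 + (- 1 / B\<^sup>2) * (\<rho> g \<one>)\<^sup>2" for g
  have \<omega>_fsr: "fs_real \<omega>"
    unfolding \<omega>_def using \<rho>_fsr by (intro fs_real_add fs_real_cmult fs_real_const) (simp add: fs_real_def)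
  have \<rho>2: "(\<rho> g \<one>)\<^sup>2 \<le> B\<^sup>2" if "g \<in> carrier G" for g
    using \<rho>_bound[OF that one_closed] \<rho>_nonneg[OF that one_closed] by (rule power_mono)
  have \<omega>01: "0 \<le> \<omega> g" "\<omega> g \<le> 1" if "g \<in> carrier G" for g
    using \<rho>2[OF that] B_pos by (auto simp: \<omega>_def field_simps)
  have \<omega>_far: "\<omega> g \<le> 1 - a" if g: "g \<in> carrier G" and far: "\<sigma> / 2 \<le> \<rho> g \<one>" for g
  proof -
    have "(\<sigma> / 2)\<^sup>2 \<le> (\<rho> g \<one>)\<^sup>2" using far \<sigma> by (intro power_mono) auto
    then have "(\<sigma> / 2)\<^sup>2 / B\<^sup>2 \<le> (\<rho> g \<one>)\<^sup>2 / B\<^sup>2" by (rule divide_right_mono) simp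
    then show ?thesis by (simp add: \<omega>_def a_def power_divide)
  qed
  have \<omega>_near: "1 - a / 4 \<le> \<omega> g" if g: "g \<in> carrier G" and near: "\<rho> g \<one> < \<sigma> / 4" for g
  proof -
    have "(\<rho> g \<one>)\<^sup>2 \<le> (\<sigma> / 4)\<^sup>2" using near \<rho>_nonneg[OF g one_closed] by (intro power_mono) auto
    then have "(\<rho> g \<one>)\<^sup>2 / B\<^sup>2 \<le> (\<sigma> / 4)\<^sup>2 / B\<^sup>2" by (rule divide_right_mono) simp
    then show ?thesis by (simp add: \<omega>_def a_def power_divide)
  qed
  have "\<sigma> / 4 > 0" using \<sigma> by simp
  from tot_bdd_net[OF \<rho>_tb this] obtain F where F: "finite F" "F \<subseteq> carrier G" "\<And>g. g \<in> carrier G \<Longrightarrow> \<exists>f\<in>F. \<rho> g f < \<sigma> / 4"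
    by blast
  define N where "N = real (card F)"
  have "F \<noteq> {}" using F(3)[OF one_closed] by auto
  then have N: "N > 0" using F(1) by (simp add: N_def card_gt_0_iff)
  have lower: "(1 - a / 4) ^ k \<le> N * L (\<lambda>g. \<omega> g ^ k)" for k
  proof -
    have inF: "inv f \<in> carrier G" if "f \<in> F" for f using that F by auto
    have "(1 - a / 4) ^ k \<le> (\<Sum>f\<in>F. \<omega> (inv f \<otimes> g) ^ k)" if g: "g \<in> carrier G" for g
    proof -
      obtain f where f: "f \<in> F" "\<rho> g f < \<sigma> / 4" using F(3)[OF g] by blast
      have fG: "f \<in> carrier G" using f F by auto
      have "\<rho> (inv f \<otimes> g) \<one> = \<rho> g f"
        using \<rho>_left[of g f "inv f"] g fG by simp
      then have "(1 - a / 4) ^ k \<le> \<omega> (inv f \<otimes> g) ^ k"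
        using f(2) fG g a by (intro power_mono \<omega>_near) auto
      also have "\<dots> \<le> (\<Sum>f\<in>F. \<omega> (inv f \<otimes> g) ^ k)"
        by (rule member_le_sum[OF f(1)]) (use F g \<omega>01 in auto)
      finally show ?thesis .
    qed
    then have "L (\<lambda>_. (1 - a / 4) ^ k) \<le> L (\<lambda>g. \<Sum>f\<in>F. \<omega> (inv f \<otimes> g) ^ k)"
      by (intro L_mono fs_real_linf fs_real_const fs_real_sum fs_real_power fs_real_left \<omega>_fsr inF)
    also have "\<dots> = (\<Sum>f\<in>F. L (\<lambda>g. \<omega> (inv f \<otimes> g) ^ k))"
      by (intro L_sum fs_real_power fs_real_left \<omega>_fsr inF)
    also have "\<dots> = (\<Sum>f\<in>F. L (\<lambda>g. \<omega> g ^ k))"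
      by (intro sum.cong refl L_left[OF fs_real_power[OF \<omega>_fsr, of k]] inF)
    finally show ?thesis by (simp add: L_const N_def)
  qed
  have "(\<lambda>k. ((1 - a) / (1 - a / 4)) ^ k) \<longlonglongrightarrow> 0" using a
    by (intro LIMSEQ_realpow_zero) (auto simp: field_simps)
  moreover have "\<sigma> / (2 * B * N) > 0" using \<sigma> B_pos N by simp
  ultimately have "\<forall>\<^sub>F k in sequentially. ((1 - a) / (1 - a / 4)) ^ k < \<sigma> / (2 * B * N)"
    by (rule order_tendstoD(2))
  \<comment> \<open>The points within distance \<open>\<sigma> / 2\<close> contribute at most
    \<open>\<sigma> / 2\<close> to the mean of \<open>q g * \<rho> g \<one>\<close>, all others at
    most \<open>B * (1 - a) ^ k / m\<close>; this \<open>k\<close> makes the latter at most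
    \<open>\<sigma> / 2\<close> too.\<close>
  then obtain k where k: "((1 - a) / (1 - a / 4)) ^ k < \<sigma> / (2 * B * N)"
    unfolding eventually_sequentially by blast
  define m where "m = L (\<lambda>g. \<omega> g ^ k)"
  have pos: "(1 - a / 4) ^ k > 0" using a by simp
  then have "N * m > 0" using lower[of k] unfolding m_def by linarith
  then have m: "m > 0" using N by (simp add: zero_less_mult_iff)
  have "B * (1 - a) ^ k \<le> \<sigma> / 2 * m"
  proof -
    have "(1 - a) ^ k < \<sigma> / (2 * B * N) * (1 - a / 4) ^ k"
      using k pos by (simp add: power_divide divide_less_eq)
    also have "\<dots> \<le> \<sigma> / (2 * B * N) * (N * m)"
      using lower[of k] \<sigma> B_pos N unfolding m_def by (intro mult_left_mono) auto
    finally show ?thesis using B_pos N by (simp add: field_simps)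
  qed
  define q where "q g = (1 / m) * \<omega> g ^ k" for g
  have q_fsr: "fs_real q" unfolding q_def by (intro fs_real_cmult fs_real_power \<omega>_fsr)
  have q0: "0 \<le> q g" if "g \<in> carrier G" for g using \<omega>01[OF that] m by (simp add: q_def)
  have L1: "L q = 1" using L_cmult[OF fs_real_linf[OF fs_real_power[OF \<omega>_fsr, of k]], of "1 / m"] m
    by (simp add: q_def[abs_def] flip: m_def)
  have \<rho>_linf: "creal G (\<lambda>g. \<rho> g \<one>) \<in> linf G"
    by (rule creal_linfI[where C = B]) (use \<rho>_bound \<rho>_nonneg in \<open>auto simp: abs_le_iff intro: order_trans[of _ 0] less_imp_le[OF B_pos]\<close>)
  show thesis
  proof (rule that[OF q_fsr q0 L1])
    fix g assume g: "g \<in> carrier G"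
    have "\<rho> (inv g) \<one> = \<rho> g \<one>" using \<rho>_left[of "inv g" \<one> g] \<rho>_commute[of g \<one>] g by simp
    then show "q (inv g) = q g" by (simp add: q_def \<omega>_def)
  next
    have "q g * \<rho> g \<one> \<le> \<sigma> / 2 * q g + (1 / m) * (B * (1 - a) ^ k)" if g: "g \<in> carrier G" for g
    proof (cases "\<rho> g \<one> \<le> \<sigma> / 2")
      case True
      then have "q g * \<rho> g \<one> \<le> q g * (\<sigma> / 2)" using q0[OF g] by (rule mult_left_mono)
      moreover have "0 \<le> (1 / m) * (B * (1 - a) ^ k)" using m B_pos a by simp
      ultimately show ?thesis by (simp add: mult.commute)
    next
      case False
      then have "\<omega> g ^ k \<le> (1 - a) ^ k" using \<omega>_far[OF g] \<omega>01[OF g] by (intro power_mono) auto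
      then have "\<omega> g ^ k * \<rho> g \<one> \<le> (1 - a) ^ k * B"
        using \<rho>_bound[OF g one_closed] \<rho>_nonneg[OF g one_closed] a by (intro mult_mono) auto
      then have "q g * \<rho> g \<one> \<le> (1 / m) * (B * (1 - a) ^ k)"
        using m by (simp add: q_def divide_right_mono mult.commute)
      moreover have "0 \<le> \<sigma> / 2 * q g" using q0[OF g] \<sigma> by simp
      ultimately show ?thesis by simp
    qed
    then have "L (\<lambda>g. q g * \<rho> g \<one>) \<le> L (\<lambda>g. \<sigma> / 2 * q g + (1 / m) * (B * (1 - a) ^ k))"
      by (intro L_mono bounded_mult_linf \<rho>_linf fs_real_linf fs_real_add fs_real_cmult fs_real_const q_fsr)
    also have "\<dots> = \<sigma> / 2 * 1 + (1 / m) * (B * (1 - a) ^ k)"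
      using L_add[OF fs_real_linf[OF fs_real_cmult[OF q_fsr, of "\<sigma> / 2"]] fs_real_linf[OF fs_real_const[of "(1 / m) * (B * (1 - a) ^ k)"]]]
      unfolding L_cmult[OF fs_real_linf[OF q_fsr]] L_const L1 .
    also have "\<dots> \<le> \<sigma> / 2 + (1 / m) * (\<sigma> / 2 * m)"
      using \<open>B * (1 - a) ^ k \<le> \<sigma> / 2 * m\<close> m by (intro add_mono mult_left_mono) auto
    also have "\<dots> \<le> \<tau>" using m \<sigma> by simp
    finally show "L (\<lambda>g. q g * \<rho> g \<one>) \<le> \<tau>" .
  qed
qed

text \<open>Nonnegativity of the variance of \<open>r\<close>.\<close>

lemma L_square: "fs_real r \<Longrightarrow> (L r)\<^sup>2 \<le> L (\<lambda>x. r x * r x)"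
proof -
  assume r: "fs_real r"
  have r2: "fs_real (\<lambda>x. r x * r x)" using r r by (rule fs_real_mult)
  have "0 \<le> L (\<lambda>x. (r x * r x + (- 2 * L r) * r x) + (L r)\<^sup>2)"
  proof (rule L_nonneg)
    show "creal G (\<lambda>x. (r x * r x + (- 2 * L r) * r x) + (L r)\<^sup>2) \<in> linf G"
      by (intro fs_real_linf fs_real_add fs_real_cmult fs_real_const r r2)
    show "0 \<le> (r x * r x + (- 2 * L r) * r x) + (L r)\<^sup>2" for x
      using zero_le_power2[of "r x - L r"] by (simp add: power2_diff power2_eq_square algebra_simps)
  qed
  also have "\<dots> = (L (\<lambda>x. r x * r x) + (- 2 * L r) * L r) + (L r)\<^sup>2"
    using r r2 by (simp only: L_add L_cmult L_const fs_real_linf fs_real_add fs_real_cmult fs_real_const)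
  finally show ?thesis by (simp add: power2_eq_square)
qed

text \<open>With \<open>c r = f (t r) H r\<close>, translates of \<open>c\<close> with pairwise small correlation are few,
  and a maximal such family yields the covering.\<close>

lemma covering:
  assumes f: "fs_real f" "\<And>g. g \<in> carrier G \<Longrightarrow> 0 \<le> f g \<and> f g \<le> 1"
    and H: "fs_real H" "\<And>g. g \<in> carrier G \<Longrightarrow> 0 \<le> H g \<and> H g \<le> 1"
    and t: "t \<in> carrier G" and \<epsilon>: "\<epsilon> > 0"
    and \<gamma>: "\<gamma> \<le> L (\<lambda>r. f (t \<otimes> r) * H r)" "\<gamma> > 0" "real (Suc N) * \<epsilon> < \<gamma> * (real (Suc N) * \<gamma> - 1)"
  obtains Y where "finite Y" "Y \<subseteq> carrier G" "card Y \<le> N"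
    "\<And>w. w \<in> carrier G \<Longrightarrow> \<exists>y\<in>Y. \<exists>p\<in>carrier G. \<epsilon> < L (\<lambda>r. f (p \<otimes> r) * H r) \<and> w = y \<otimes> p"
proof -
  define c where "c r = f (t \<otimes> r) * H r" for r
  define \<gamma>' where "\<gamma>' = L c"
  have c_fsr: "fs_real c" unfolding c_def by (intro fs_real_mult fs_real_left f H t)
  have c01: "0 \<le> c g" "c g \<le> 1" "c g \<le> f (t \<otimes> g)" "c g \<le> H g" if "g \<in> carrier G" for g
    using f(2)[of "t \<otimes> g"] H(2)[OF that] t that
    by (auto simp: c_def mult_le_one mult_left_le mult_left_le_one_le)
  have \<gamma>': "\<gamma> \<le> \<gamma>'" using \<gamma>(1) by (simp add: \<gamma>'_def c_def[abs_def])
  have "real (Suc N) * \<gamma> - 1 > 0"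
  proof (rule ccontr)
    assume "\<not> real (Suc N) * \<gamma> - 1 > 0"
    then have "\<gamma> * (real (Suc N) * \<gamma> - 1) \<le> 0" using \<gamma>(2) by (intro mult_nonneg_nonpos) auto
    moreover have "real (Suc N) * \<epsilon> > 0" using \<epsilon> by simp
    ultimately show False using \<gamma>(3) by linarith
  qed
  then have key: "real (Suc N) * \<epsilon> < \<gamma>' * (real (Suc N) * \<gamma>' - 1)"
  proof -
    have "\<gamma> * (real (Suc N) * \<gamma> - 1) \<le> \<gamma>' * (real (Suc N) * \<gamma>' - 1)"
      using \<gamma>' \<gamma>(2) \<open>real (Suc N) * \<gamma> - 1 > 0\<close> by (intro mult_mono diff_right_mono mult_left_mono) auto
    then show ?thesis using \<gamma>(3) by linarith
  qed
  have cy: "fs_real (\<lambda>r. c (y \<otimes> r))" if "y \<in> carrier G" for y using that by (intro fs_real_left c_fsr)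
  have cyy: "fs_real (\<lambda>r. c (y \<otimes> r) * c (y' \<otimes> r))" if "y \<in> carrier G" "y' \<in> carrier G" for y y'
    using that by (intro fs_real_mult cy)
  define P where "P Y \<longleftrightarrow> finite Y \<and> Y \<subseteq> carrier G \<and>
    (\<forall>y\<in>Y. \<forall>y'\<in>Y. y \<noteq> y' \<longrightarrow> L (\<lambda>r. c (y \<otimes> r) * c (y' \<otimes> r)) \<le> \<epsilon>)" for Y
  have card: "card Y \<le> N" if Y: "P Y" for Y
  proof (rule ccontr)
    assume "\<not> card Y \<le> N"
    \<comment> \<open>With \<open>M = N + 1\<close> members, the sum \<open>S\<close> of the
      translates has mean \<open>M * \<gamma>'\<close>, while its second moment is at most
      \<open>M * \<gamma>' + M * M * \<epsilon>\<close>: the diagonal terms are at most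
      \<open>\<gamma>'\<close> as \<open>c\<close> lies between \<open>0\<close> and
      \<open>1\<close>. By \<open>key\<close> this violates \<open>L_square\<close>.\<close>
    then obtain Z where Z: "Z \<subseteq> Y" "card Z = Suc N" using obtain_subset_with_card_n[of "Suc N" Y] by auto
    have fin: "finite Z" by (rule finite_subset[OF Z(1)]) (use Y in \<open>simp add: P_def\<close>)
    have ZG: "Z \<subseteq> carrier G" using subset_trans[OF Z(1)] Y by (simp add: P_def)
    define S where "S r = (\<Sum>y\<in>Z. c (y \<otimes> r))" for r
    define M where "M = real (Suc N)"
    have S_fsr: "fs_real S" unfolding S_def using ZG by (intro fs_real_sum cy) auto
    have "L S = (\<Sum>y\<in>Z. L (\<lambda>r. c (y \<otimes> r)))" unfolding S_def using ZG by (intro L_sum cy) auto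
    also have "\<dots> = (\<Sum>y\<in>Z. \<gamma>')" using ZG L_left[OF c_fsr] by (intro sum.cong) (auto simp: \<gamma>'_def)
    finally have LS: "L S = M * \<gamma>'" using Z by (simp add: M_def)
    have "(M * \<gamma>')\<^sup>2 \<le> L (\<lambda>r. S r * S r)" using L_square[OF S_fsr] by (simp add: LS)
    also have "L (\<lambda>r. S r * S r) = L (\<lambda>r. \<Sum>y\<in>Z. \<Sum>y'\<in>Z. c (y \<otimes> r) * c (y' \<otimes> r))"
      by (simp add: S_def sum_product)
    also have "\<dots> = (\<Sum>y\<in>Z. L (\<lambda>r. \<Sum>y'\<in>Z. c (y \<otimes> r) * c (y' \<otimes> r)))"
      by (intro L_sum fs_real_sum cyy) (use ZG in auto)
    also have "\<dots> = (\<Sum>y\<in>Z. \<Sum>y'\<in>Z. L (\<lambda>r. c (y \<otimes> r) * c (y' \<otimes> r)))"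
      by (intro sum.cong refl L_sum cyy) (use ZG in auto)
    also have "\<dots> \<le> (\<Sum>y\<in>Z. \<Sum>y'\<in>Z. (if y = y' then \<gamma>' else 0) + \<epsilon>)"
    proof (intro sum_mono)
      fix y y' assume y: "y \<in> Z" "y' \<in> Z"
      then have yG: "y \<in> carrier G" "y' \<in> carrier G" using ZG by auto
      show "L (\<lambda>r. c (y \<otimes> r) * c (y' \<otimes> r)) \<le> (if y = y' then \<gamma>' else 0) + \<epsilon>"
      proof (cases "y = y'")
        case True
        have "L (\<lambda>r. c (y \<otimes> r) * c (y \<otimes> r)) \<le> L (\<lambda>r. c (y \<otimes> r))"
          using yG c01 by (intro L_mono fs_real_linf cyy cy) (auto simp: mult_left_le)
        also have "\<dots> = \<gamma>'" using L_left[OF c_fsr yG(1)] by (simp add: \<gamma>'_def)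
        finally show ?thesis using True \<epsilon> by simp
      next
        case False
        then show ?thesis using Y y Z(1) by (auto simp: P_def)
      qed
    qed
    also have "\<dots> = M * \<gamma>' + M * M * \<epsilon>"
      using fin Z(2) by (simp add: sum.distrib M_def algebra_simps)
    finally have "M * (M * \<gamma>'\<^sup>2) \<le> M * (\<gamma>' + M * \<epsilon>)" by (simp add: power2_eq_square algebra_simps)
    then have "M * \<gamma>'\<^sup>2 \<le> \<gamma>' + M * \<epsilon>" by (rule mult_left_le_imp_le) (simp add: M_def)
    moreover have "M * \<epsilon> < \<gamma>' * (M * \<gamma>' - 1)" using key by (simp only: M_def)
    ultimately show False by (simp add: power2_eq_square algebra_simps)
  qed
  have "P {}" by (simp add: P_def)
  then obtain Y where Y: "P Y" and max: "\<And>Z. P Z \<Longrightarrow> card Z \<le> card Y"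
    using ex_has_greatest_nat[of P "{}" card "Suc N"] card by (metis le_imp_less_Suc)
  have YG: "Y \<subseteq> carrier G" "finite Y" using Y by (auto simp: P_def)
  \<comment> \<open>Maximality: a new \<open>y\<close> must correlate with some member of
    \<open>Y\<close>, and a member correlates with itself because the mean of \<open>c\<close>
    squared is at least the square of \<open>\<gamma>'\<close>, which exceeds
    \<open>\<epsilon>\<close>.\<close>
  have corr: "\<exists>y'\<in>Y. \<epsilon> < L (\<lambda>r. c (y \<otimes> r) * c (y' \<otimes> r))" if y: "y \<in> carrier G" for y
  proof (cases "y \<in> Y")
    case True
    have "(\<gamma>')\<^sup>2 \<le> L (\<lambda>r. c (y \<otimes> r) * c (y \<otimes> r))"
      using L_square[OF cy[OF y]] L_left[OF c_fsr y] by (simp add: \<gamma>'_def)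
    moreover have "\<epsilon> < \<gamma>'\<^sup>2"
    proof -
      have "real (Suc N) * \<epsilon> < real (Suc N) * \<gamma>'\<^sup>2"
        using key \<gamma>' \<gamma>(2) by (simp add: power2_eq_square algebra_simps)
      then show ?thesis by (simp only: mult_less_cancel_left_pos of_nat_0_less_iff zero_less_Suc)
    qed
    ultimately show ?thesis using True by force
  next
    case False
    then have "card (insert y Y) > card Y" using YG by simp
    then have "\<not> P (insert y Y)" using max by fastforce
    then obtain a b where ab: "a \<in> insert y Y" "b \<in> insert y Y" "a \<noteq> b" "\<epsilon> < L (\<lambda>r. c (a \<otimes> r) * c (b \<otimes> r))"
      using y YG unfolding P_def by (auto simp: not_le)
    have "\<not> (a \<in> Y \<and> b \<in> Y)" using ab Y unfolding P_def by (meson not_le)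
    then consider "a = y" "b \<in> Y" | "b = y" "a \<in> Y" using ab by auto
    then show ?thesis
    proof cases
      case 1
      then show ?thesis using ab(4) by blast
    next
      case 2
      have "L (\<lambda>r. c (a \<otimes> r) * c (b \<otimes> r)) = L (\<lambda>r. c (b \<otimes> r) * c (a \<otimes> r))"
        by (rule real_mean_cong) (rule mult.commute)
      then show ?thesis using ab(4) 2 by auto
    qed
  qed
  show thesis
  \<comment> \<open>For \<open>w\<close>, a member \<open>y\<close> correlates with
    \<open>inv w\<close>. Shifting by \<open>w\<close>, and bounding one factor \<open>c\<close> by
    its \<open>H\<close> part and the other by its \<open>f\<close> part, leaves the correlation at
    \<open>p = t y w\<close>, that is, \<open>w = inv (t y) p\<close>.\<close>
  proof (rule that[of "(\<lambda>y. inv (t \<otimes> y)) ` Y"])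
    show "finite ((\<lambda>y. inv (t \<otimes> y)) ` Y)" "(\<lambda>y. inv (t \<otimes> y)) ` Y \<subseteq> carrier G" using YG t by auto
    show "card ((\<lambda>y. inv (t \<otimes> y)) ` Y) \<le> N" using card_image_le[OF YG(2)] card[OF Y] le_trans by blast
    fix w assume w: "w \<in> carrier G"
    then obtain y where y: "y \<in> Y" "\<epsilon> < L (\<lambda>r. c (inv w \<otimes> r) * c (y \<otimes> r))" using corr[of "inv w"] by auto
    have yG: "y \<in> carrier G" using y YG by auto
    define p where "p = t \<otimes> y \<otimes> w"
    have p: "p \<in> carrier G" using t yG w by (simp add: p_def)
    have "L (\<lambda>r. c (inv w \<otimes> r) * c (y \<otimes> r)) = L (\<lambda>r. c (inv w \<otimes> (w \<otimes> r)) * c (y \<otimes> (w \<otimes> r)))"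
      by (rule L_left[OF cyy w, symmetric]) (use w yG in auto)
    also have "\<dots> \<le> L (\<lambda>r. f (p \<otimes> r) * H r)"
    proof (rule L_mono)
      show "creal G (\<lambda>r. c (inv w \<otimes> (w \<otimes> r)) * c (y \<otimes> (w \<otimes> r))) \<in> linf G"
        using fs_real_left[OF cyy[of "inv w" y] w] w yG by (intro fs_real_linf) auto
      show "creal G (\<lambda>r. f (p \<otimes> r) * H r) \<in> linf G"
        by (intro fs_real_linf fs_real_mult fs_real_left f H p)
      fix r assume r: "r \<in> carrier G"
      have "c (inv w \<otimes> (w \<otimes> r)) = c r" using w r by (simp flip: m_assoc)
      moreover have "t \<otimes> (y \<otimes> (w \<otimes> r)) = p \<otimes> r" using t yG w r by (simp add: p_def m_assoc)
      moreover have "y \<otimes> (w \<otimes> r) \<in> carrier G" using yG w r by simp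
      ultimately show "c (inv w \<otimes> (w \<otimes> r)) * c (y \<otimes> (w \<otimes> r)) \<le> f (p \<otimes> r) * H r"
        using c01[of "y \<otimes> (w \<otimes> r)"] c01[OF r] by (simp add: mult.commute[of "f _"] mult_mono)
    qed
    finally have "\<epsilon> < L (\<lambda>r. f (p \<otimes> r) * H r)" using y(2) by simp
    moreover have "w = inv (t \<otimes> y) \<otimes> p" using t yG w m_assoc[of "inv (t \<otimes> y)" "t \<otimes> y" w]
      by (simp add: p_def)
    ultimately show "\<exists>y\<in>(\<lambda>y. inv (t \<otimes> y)) ` Y. \<exists>p\<in>carrier G. \<epsilon> < L (\<lambda>r. f (p \<otimes> r) * H r) \<and> w = y \<otimes> p"
      using y(1) p by blast
  qed
qed

end

section \<open>Real kernels and limits of kernels\<close>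

text \<open>For a real symmetric kernel the products of real with imaginary parts of coefficients do
  not contribute to the real part, so both parts can be tested separately.\<close>

lemma psd_kernel_real:
  fixes \<kappa> :: "'i \<Rightarrow> 'i \<Rightarrow> real"
  assumes sym: "\<And>i j. \<lbrakk>i \<in> I; j \<in> I\<rbrakk> \<Longrightarrow> \<kappa> j i = \<kappa> i j"
    and pos: "\<And>xs. snd ` set xs \<subseteq> I \<Longrightarrow> 0 \<le> (\<Sum>p\<leftarrow>xs. \<Sum>q\<leftarrow>xs. fst p * fst q * \<kappa> (snd p) (snd q))"
  shows "psd_kernel I (\<lambda>i j. of_real (\<kappa> i j))"
proof
  fix xs :: "(complex \<times> 'i) list" assume xs: "set xs \<subseteq> UNIV \<times> I"
  have Re_sum: "Re (sum_list zs) = (\<Sum>z\<leftarrow>zs. Re z)" for zs by (induction zs) auto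
  have "Re (kip (\<lambda>i j. of_real (\<kappa> i j)) xs xs) =
      (\<Sum>p\<leftarrow>xs. \<Sum>q\<leftarrow>xs. (Re (fst p) * Re (fst q) + Im (fst p) * Im (fst q)) * \<kappa> (snd p) (snd q))"
    by (simp add: kip_def Re_sum o_def)
  also have "\<dots> = (\<Sum>p\<leftarrow>map (\<lambda>p. (Re (fst p), snd p)) xs. \<Sum>q\<leftarrow>map (\<lambda>p. (Re (fst p), snd p)) xs. fst p * fst q * \<kappa> (snd p) (snd q))
    + (\<Sum>p\<leftarrow>map (\<lambda>p. (Im (fst p), snd p)) xs. \<Sum>q\<leftarrow>map (\<lambda>p. (Im (fst p), snd p)) xs. fst p * fst q * \<kappa> (snd p) (snd q))"
    by (simp add: o_def distrib_right sum_list_addf)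
  also have "\<dots> \<ge> 0" by (intro add_nonneg_nonneg pos) (use xs in auto)
  finally show "0 \<le> Re (kip (\<lambda>i j. of_real (\<kappa> i j)) xs xs)" .
qed (use sym in simp)

lemma psd_kernel_lim:
  assumes "\<And>n. psd_kernel I (K n)"
    and lim: "\<And>i j. \<lbrakk>i \<in> I; j \<in> I\<rbrakk> \<Longrightarrow> (\<lambda>n. K n i j) \<longlonglongrightarrow> k i j"
  shows "psd_kernel I k"
proof
  fix i j assume ij: "i \<in> I" "j \<in> I"
  have "(\<lambda>n. cnj (K n i j)) \<longlonglongrightarrow> cnj (k i j)" using lim[OF ij] by (rule tendsto_cnj)
  moreover have "(\<lambda>n. cnj (K n i j)) \<longlonglongrightarrow> k j i"
    using lim[OF ij(2,1)] psd_kernel.herm[OF assms(1) ij] by simp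
  ultimately show "k j i = cnj (k i j)" using LIMSEQ_unique by blast
next
  fix xs :: "(complex \<times> 'a) list" assume xs: "set xs \<subseteq> UNIV \<times> I"
  have sum_lim: "(\<lambda>n. \<Sum>y\<leftarrow>ys. F n y) \<longlonglongrightarrow> (\<Sum>y\<leftarrow>ys. l y)"
    if "\<And>y. y \<in> set ys \<Longrightarrow> (\<lambda>n. F n y) \<longlonglongrightarrow> l y" for F :: "nat \<Rightarrow> _ \<Rightarrow> complex" and l and ys :: "(complex \<times> 'a) list"
    using that
  proof (induction ys)
    case (Cons y ys)
    have "(\<lambda>n. F n y) \<longlonglongrightarrow> l y" by (rule Cons.prems) simp
    moreover have "(\<lambda>n. \<Sum>y\<leftarrow>ys. F n y) \<longlonglongrightarrow> (\<Sum>y\<leftarrow>ys. l y)"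
      by (rule Cons.IH, rule Cons.prems) simp
    ultimately show ?case by (auto intro: tendsto_add)
  qed simp
  have "(\<lambda>n. kip (K n) xs xs) \<longlonglongrightarrow> kip k xs xs"
    unfolding kip_def using xs by (intro sum_lim tendsto_mult_left lim) auto
  then show "0 \<le> Re (kip k xs xs)"
    using psd_kernel.pos[OF assms(1) xs] by (intro LIMSEQ_le_const[OF tendsto_Re]) auto
qed

lemma real_mean_sum_list:
  assumes V: "star_space G V" and \<mu>: "mean_on V \<mu>"
  shows "(\<And>s. s \<in> set ss \<Longrightarrow> creal G (f s) \<in> V) \<Longrightarrow>
    creal G (\<lambda>x. \<Sum>s\<leftarrow>ss. f s x) \<in> V \<and> real_mean G \<mu> (\<lambda>x. \<Sum>s\<leftarrow>ss. f s x) = (\<Sum>s\<leftarrow>ss. real_mean G \<mu> (f s))"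
proof (induction ss)
  case Nil
  have "creal G (\<lambda>_. 0) \<in> V" unfolding creal_const by (rule star_spaceD(4)[OF V star_spaceD(2)[OF V]])
  then show ?case using real_mean_const[OF V \<mu>, of 0] by simp
next
  case (Cons s us)
  then have s: "creal G (f s) \<in> V" by auto
  show ?case
    using Cons s real_mean_add[OF V \<mu> s, of "\<lambda>x. \<Sum>s\<leftarrow>us. f s x"] star_spaceD(3)[OF V s, of "creal G (\<lambda>x. \<Sum>s\<leftarrow>us. f s x)"]
    by (simp add: creal_add)
qed

section \<open>The Bebutov algebra\<close>

context group
begin

text \<open>Makes the family intersected in the definition of the Bebutov algebra nonempty, so that
  the members of the algebra are bounded functions supported on \<open>G\<close>.\<close>

lemma linf_invariant_cstar: "invariant_cstar_subalgebra G (linf G)"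
  unfolding invariant_cstar_subalgebra_def
proof (intro conjI ballI allI impI subset_refl)
  note S = star_spaceD[OF star_space_linf[of G]]
  show "(\<lambda>x. 0) \<in> linf G" by (rule linfI[where C = 0]) auto
  fix \<phi> assume \<phi>: "\<phi> \<in> linf G"
  show "(\<lambda>x. cnj (\<phi> x)) \<in> linf G" "(\<lambda>x. c * \<phi> x) \<in> linf G" for c using \<phi> S by auto
  obtain C where C: "0 < C" "\<And>x. cmod (\<phi> x) \<le> C" using linf_bound[OF \<phi>] by blast
  show "ltrans G g \<phi> \<in> linf G" for g
    by (rule linfI[where C = C]) (use C in \<open>auto simp: ltrans_def\<close>)
  fix \<psi> assume \<psi>: "\<psi> \<in> linf G"
  show "(\<lambda>x. \<phi> x + \<psi> x) \<in> linf G" using \<phi> \<psi> S by auto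
  obtain D where D: "0 < D" "\<And>x. cmod (\<psi> x) \<le> D" using linf_bound[OF \<psi>] by blast
  show "(\<lambda>x. \<phi> x * \<psi> x) \<in> linf G"
    by (rule linfI[where C = "C * D"]) (use C D linf_zero[OF \<phi>] in \<open>auto simp: norm_mult intro!: mult_mono\<close>)
next
  fix \<phi> :: "nat \<Rightarrow> 'a \<Rightarrow> complex" and \<psi>
  assume a: "(\<forall>n. \<phi> n \<in> linf G) \<and> uniform_limit UNIV \<phi> \<psi> sequentially"
  then obtain N where N: "\<And>x. dist (\<phi> N x) (\<psi> x) < 1"
    unfolding uniform_limit_sequentially_iff by (metis UNIV_I order_refl zero_less_one)
  have \<phi>N: "\<phi> N \<in> linf G" using a by simp
  obtain C where C: "0 < C" "\<And>x. cmod (\<phi> N x) \<le> C" using linf_bound[OF \<phi>N] by blast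
  show "\<psi> \<in> linf G"
  proof (rule linfI[where C = "C + 1"])
    show "cmod (\<psi> x) \<le> C + 1" for x
      using N[of x] C(2)[of x] norm_triangle_ineq4[of "\<phi> N x" "\<phi> N x - \<psi> x"] by (simp add: dist_norm)
    fix x assume x: "x \<notin> carrier G"
    have "(\<lambda>n. \<phi> n x) \<longlonglongrightarrow> \<psi> x" using a by (auto intro: tendsto_uniform_limitI)
    moreover have "\<phi> n x = 0" for n using a x linf_zero[of "\<phi> n" G x] by auto
    ultimately show "\<psi> x = 0" using LIMSEQ_const_iff[of 0 "\<psi> x"] by simp
  qed
qed

context
  fixes B assumes B: "B \<subseteq> carrier G"
begin

lemma bebutov_linf: "bebutov G B \<subseteq> linf G"
proof -
  have "indicator B \<in> linf G" by (rule linfI[where C = 1]) (use B in \<open>auto split: split_indicator\<close>)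
  moreover have "(\<lambda>x. c * indicator (carrier G) x) \<in> linf G" for c
    using star_spaceD(2,4)[OF star_space_linf[of G]] by blast
  ultimately show ?thesis using linf_invariant_cstar unfolding bebutov_def by blast
qed

lemma bebutov_indicator: "indicator B \<in> bebutov G B"
  and bebutov_const: "(\<lambda>x. c * indicator (carrier G) x) \<in> bebutov G B"
  and bebutov_add: "\<lbrakk>\<phi> \<in> bebutov G B; \<psi> \<in> bebutov G B\<rbrakk> \<Longrightarrow> (\<lambda>x. \<phi> x + \<psi> x) \<in> bebutov G B"
  and bebutov_mult: "\<lbrakk>\<phi> \<in> bebutov G B; \<psi> \<in> bebutov G B\<rbrakk> \<Longrightarrow> (\<lambda>x. \<phi> x * \<psi> x) \<in> bebutov G B"
  and bebutov_scale: "\<phi> \<in> bebutov G B \<Longrightarrow> (\<lambda>x. c * \<phi> x) \<in> bebutov G B"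
  and bebutov_cnj: "\<phi> \<in> bebutov G B \<Longrightarrow> (\<lambda>x. cnj (\<phi> x)) \<in> bebutov G B"
  and bebutov_ltrans: "\<lbrakk>\<phi> \<in> bebutov G B; g \<in> carrier G\<rbrakk> \<Longrightarrow> ltrans G g \<phi> \<in> bebutov G B"
  unfolding bebutov_def invariant_cstar_subalgebra_def by blast+

lemma star_space_bebutov: "star_space G (bebutov G B)"
  unfolding star_space_def
  using bebutov_linf bebutov_const[of 1] bebutov_add bebutov_scale bebutov_cnj by auto

text \<open>Extends the mean from the Bebutov algebra to all bounded functions; invariance concerns
  the subalgebra only and is therefore kept. In particular the class behind
  \<open>np_density\<close> is nonempty and gives \<open>B\<close> positive density.\<close>

lemma bebutov_mean:
  assumes "strongly_non_paradoxical G B"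
  obtains \<eta> where "\<eta> \<in> bebutov_means G B" "Re (\<eta> (indicator B)) > 0"
proof -
  obtain \<eta> where \<eta>: "mean_on (bebutov G B) \<eta>" "left_invariant_on G (bebutov G B) \<eta>" "Re (\<eta> (indicator B)) > 0"
    using assms by (auto simp: strongly_non_paradoxical_def)
  obtain \<mu> where \<mu>: "\<mu> \<in> means G" "\<And>\<phi>. \<phi> \<in> bebutov G B \<Longrightarrow> \<mu> \<phi> = \<eta> \<phi>"
    using mean_extension[OF star_space_bebutov \<eta>(1)] by blast
  have "\<mu> \<in> bebutov_means G B"
    using \<mu> \<eta>(2) bebutov_ltrans by (auto simp: bebutov_means_def left_invariant_on_def)
  then show thesis using \<mu>(2) bebutov_indicator \<eta>(3) by (intro that[of \<mu>]) auto
qed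

lemma strongly_non_paradoxicalI:
  assumes "\<mu> \<in> left_invariant_means G" "Re (\<mu> (indicator B)) > 0"
  shows "strongly_non_paradoxical G B"
proof -
  have \<mu>: "mean_on (linf G) \<mu>" "left_invariant_on G (linf G) \<mu>"
    using assms(1) by (auto simp: left_invariant_means_def means_def)
  note S = bebutov_linf[THEN subsetD]
  have "mean_on (bebutov G B) \<mu>"
  proof (rule mean_onI[OF star_space_bebutov])
    show "cmod (\<mu> \<phi>) \<le> 1" if "\<phi> \<in> bebutov G B" "\<And>x. cmod (\<phi> x) \<le> 1" for \<phi>
      using mean_bound[OF star_space_linf \<mu>(1), of \<phi> 1] S that by auto
  qed (use mean_add[OF star_space_linf \<mu>(1)] mean_scale[OF star_space_linf \<mu>(1)] S
      mean_pos[OF star_space_linf \<mu>(1)] mean_one[OF star_space_linf \<mu>(1)] in blast)+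
  moreover have "left_invariant_on G (bebutov G B) \<mu>" using \<mu>(2) S by (auto simp: left_invariant_on_def)
  ultimately show ?thesis using assms(2) by (auto simp: strongly_non_paradoxical_def)
qed

end

end

section \<open>The correlation function of the two sets\<close>

locale product_setup = fs_functional G \<Lambda> for G :: "('a, 'm) monoid_scheme" (structure) and \<Lambda> +
  fixes A B :: "'a set" and \<eta> and a :: "nat \<Rightarrow> 'a"
  assumes A_range: "A = range a" and A_sub: "A \<subseteq> carrier G" and B_sub: "B \<subseteq> carrier G"
    and \<eta>: "\<eta> \<in> bebutov_means G B"
begin

abbreviation E :: "('a \<Rightarrow> real) \<Rightarrow> real" where
  "E r \<equiv> real_mean G \<eta> r"

lemma mean_\<eta>: "mean_on (linf G) \<eta>"
  using \<eta> by (simp add: bebutov_means_def means_def)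

lemmas E_add = real_mean_add[OF star_space_linf mean_\<eta>]
lemmas E_cmult = real_mean_scale[OF star_space_linf mean_\<eta>]
lemmas E_const = real_mean_const[OF star_space_linf mean_\<eta>]
lemmas E_mono = real_mean_mono[OF star_space_linf mean_\<eta>]

definition bebutov_real :: "('a \<Rightarrow> real) \<Rightarrow> bool" where
  "bebutov_real r \<longleftrightarrow> creal G r \<in> bebutov G B"

lemma bebutov_real_linf: "bebutov_real r \<Longrightarrow> creal G r \<in> linf G"
  using bebutov_linf[OF B_sub] by (auto simp: bebutov_real_def)

lemma bebutov_real_cong: "(\<And>x. x \<in> carrier G \<Longrightarrow> r x = r' x) \<Longrightarrow> bebutov_real r = bebutov_real r'"
proof -
  assume "\<And>x. x \<in> carrier G \<Longrightarrow> r x = r' x"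
  then have "creal G r = creal G r'" by (auto simp: creal_def)
  then show ?thesis by (simp add: bebutov_real_def)
qed

lemma bebutov_real_indicator: "bebutov_real (indicator B)"
  using bebutov_indicator[OF B_sub] by (simp add: bebutov_real_def creal_indicator B_sub)

lemma bebutov_real_const: "bebutov_real (\<lambda>_. c)"
  using bebutov_const[OF B_sub] by (simp add: bebutov_real_def creal_const)

lemma bebutov_real_mult: "\<lbrakk>bebutov_real r; bebutov_real r'\<rbrakk> \<Longrightarrow> bebutov_real (\<lambda>x. r x * r' x)"
proof -
  assume "bebutov_real r" "bebutov_real r'"
  then have "(\<lambda>x. creal G r x * creal G r' x) \<in> bebutov G B"
    by (simp add: bebutov_real_def bebutov_mult[OF B_sub])
  moreover have "(\<lambda>x. creal G r x * creal G r' x) = creal G (\<lambda>x. r x * r' x)" by (auto simp: creal_def)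
  ultimately show ?thesis by (simp add: bebutov_real_def)
qed

lemma bebutov_real_compl: "bebutov_real r \<Longrightarrow> bebutov_real (\<lambda>x. 1 - r x)"
proof -
  assume "bebutov_real r"
  then have "creal G (\<lambda>x. 1 + (-1) * r x) \<in> bebutov G B"
    unfolding creal_add creal_scale using bebutov_real_const[of 1]
    by (intro bebutov_add[OF B_sub] bebutov_scale[OF B_sub]) (simp_all add: bebutov_real_def)
  then show ?thesis by (simp add: bebutov_real_def)
qed

lemma bebutov_real_left: "\<lbrakk>bebutov_real r; g \<in> carrier G\<rbrakk> \<Longrightarrow> bebutov_real (\<lambda>x. r (g \<otimes> x))"
  and E_left: "\<lbrakk>bebutov_real r; g \<in> carrier G\<rbrakk> \<Longrightarrow> E (\<lambda>x. r (g \<otimes> x)) = E r"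
proof -
  assume r: "bebutov_real r" and g: "g \<in> carrier G"
  have eq: "creal G (\<lambda>x. r (g \<otimes> x)) = ltrans G (inv g) (creal G r)" using g
    by (auto simp: creal_def ltrans_def)
  then show "bebutov_real (\<lambda>x. r (g \<otimes> x))" using r g bebutov_ltrans[OF B_sub]
    by (simp add: bebutov_real_def)
  show "E (\<lambda>x. r (g \<otimes> x)) = E r"
    using \<eta> r g unfolding real_mean_def eq by (simp add: bebutov_means_def left_invariant_on_def bebutov_real_def)
qed

definition D :: "nat \<Rightarrow> 'a set" where
  "D n = {x \<in> carrier G. \<forall>i<n. inv (a i) \<otimes> x \<notin> B}"

lemma a_in: "a i \<in> carrier G" "a i \<in> A"
  using A_range A_sub by auto

lemma D_product:
  assumes "x \<in> carrier G" "x \<notin> D n"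
  shows "x \<in> A <#> B"
proof -
  obtain i where "inv (a i) \<otimes> x \<in> B" using assms by (auto simp: D_def)
  moreover have "x = a i \<otimes> (inv (a i) \<otimes> x)" using assms a_in by (simp flip: m_assoc)
  ultimately show ?thesis using a_in(2)[of i] unfolding set_mult_def by blast
qed

lemma D_mono: "m \<le> n \<Longrightarrow> D n \<subseteq> D m"
  by (auto simp: D_def)

lemma bebutov_real_D: "bebutov_real (indicator (D n))"
proof (induction n)
  case 0
  have "bebutov_real (indicator (D 0)) = bebutov_real (\<lambda>_. 1)"
    by (rule bebutov_real_cong) (simp add: D_def)
  then show ?case using bebutov_real_const by simp
next
  case (Suc n)
  have "bebutov_real (indicator (D (Suc n))) = bebutov_real (\<lambda>x. indicator (D n) x * (1 - indicator B (inv (a n) \<otimes> x)))"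
    by (rule bebutov_real_cong) (auto simp: D_def less_Suc_eq split: split_indicator)
  then show ?case using Suc bebutov_real_indicator a_in
    by (simp add: bebutov_real_mult bebutov_real_compl bebutov_real_left)
qed

definition \<phi> :: "'a \<Rightarrow> real" where
  "\<phi> g = lim (\<lambda>n. E (\<lambda>x. indicator (D n) x * indicator B (inv g \<otimes> x)))"

text \<open>A single family of indicators: left translates of \<open>D n\<close> under the tag
  \<open>True\<close>, and of \<open>B\<close> under the tag \<open>False\<close>. Their
  correlations form one kernel, of which \<open>\<phi>\<close> is an entry between the two halves;
  this makes an off-diagonal correlation accessible to positivity.\<close>

definition X :: "bool \<times> 'a \<Rightarrow> nat \<Rightarrow> 'a \<Rightarrow> real" where
  "X i n x = (if fst i then indicator (D n) (inv (snd i) \<otimes> x) else indicator B (inv (snd i) \<otimes> x))"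

lemma bebutov_real_X: "snd i \<in> carrier G \<Longrightarrow> bebutov_real (X i n)"
  unfolding X_def using bebutov_real_left[OF bebutov_real_D, of "inv (snd i)"] bebutov_real_left[OF bebutov_real_indicator, of "inv (snd i)"]
  by (cases "fst i") simp_all

lemma X01: "0 \<le> X i n x" "X i n x \<le> 1"
  by (auto simp: X_def split: split_indicator)

lemma X_antimono: "m \<le> n \<Longrightarrow> X i n x \<le> X i m x"
  using D_mono[of m n] by (auto simp: X_def split: split_indicator)

text \<open>The sets \<open>D n\<close> shrink, so the correlations decrease in \<open>n\<close> and
  are bounded below by \<open>0\<close>.\<close>

lemma E_X_limit:
  assumes i: "snd i \<in> carrier G" and j: "snd j \<in> carrier G"
  shows "(\<lambda>n. E (\<lambda>x. X i n x * X j n x)) \<longlonglongrightarrow> lim (\<lambda>n. E (\<lambda>x. X i n x * X j n x))"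
proof -
  let ?e = "\<lambda>n. E (\<lambda>x. X i n x * X j n x)"
  have b: "bebutov_real (\<lambda>x. X i n x * X j n x)" for n using i j
    by (intro bebutov_real_mult bebutov_real_X)
  have "decseq ?e"
    unfolding decseq_def using b X_antimono X01 by (intro allI impI E_mono bebutov_real_linf mult_mono) auto
  moreover have "0 \<le> ?e n" for n
  proof -
    have "E (\<lambda>_. 0) \<le> ?e n" using b X01 bebutov_real_const by (intro E_mono bebutov_real_linf) auto
    then show ?thesis by (simp add: E_const)
  qed
  ultimately have "convergent ?e" using decseq_convergent convergent_def by blast
  then show ?thesis by (simp add: convergent_LIMSEQ_iff)
qed

lemma \<phi>_X: "g \<in> carrier G \<Longrightarrow> \<phi> g = lim (\<lambda>n. E (\<lambda>x. X (True, \<one>) n x * X (False, g) n x))"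
  unfolding \<phi>_def
  by (intro arg_cong[of _ _ lim] ext real_mean_cong) (simp add: X_def)

lemma \<phi>_lim:
  assumes "g \<in> carrier G"
  shows "(\<lambda>n. E (\<lambda>x. indicator (D n) x * indicator B (inv g \<otimes> x))) \<longlonglongrightarrow> \<phi> g"
proof -
  have "E (\<lambda>x. indicator (D n) x * indicator B (inv g \<otimes> x)) = E (\<lambda>x. X (True, \<one>) n x * X (False, g) n x)" for n
    by (intro real_mean_cong) (simp add: X_def)
  then show ?thesis using E_X_limit[of "(True, \<one>)" "(False, g)"] assms by (simp add: \<phi>_X)
qed

text \<open>For fixed \<open>n\<close> the quadratic form of the kernel is the
  \<open>\<eta>\<close>-mean of a square, hence nonnegative. Left invariance holds because all
  products involved lie in the Bebutov algebra. Both properties pass to the limit, and the GNS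
  construction applies.\<close>

lemma \<phi>_fs: "creal G \<phi> \<in> fourier_stieltjes G"
proof -
  let ?I = "UNIV \<times> carrier G :: (bool \<times> 'a) set"
  define K where "K n i j = complex_of_real (E (\<lambda>x. X i n x * X j n x))" for n i j
  define k where "k i j = complex_of_real (lim (\<lambda>n. E (\<lambda>x. X i n x * X j n x)))" for i j
  have "psd_kernel ?I (K n)" for n
    unfolding K_def
  proof (rule psd_kernel_real)
    fix xs :: "(real \<times> bool \<times> 'a) list" assume xs: "snd ` set xs \<subseteq> ?I"
    have v: "snd (snd p) \<in> carrier G" if "p \<in> set xs" for p using xs that by fastforce
    have bb: "creal G (\<lambda>x. X (snd p) n x * X (snd q) n x) \<in> linf G" if "p \<in> set xs" "q \<in> set xs" for p q
      by (rule bebutov_real_linf[OF bebutov_real_mult[OF bebutov_real_X[OF v[OF that(1)]] bebutov_real_X[OF v[OF that(2)]]]])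
    have b: "creal G (\<lambda>x. fst p * fst q * (X (snd p) n x * X (snd q) n x)) \<in> linf G"
      if "p \<in> set xs" "q \<in> set xs" for p q
      unfolding creal_scale by (rule star_spaceD(4)[OF star_space_linf bb[OF that]])
    have row: "creal G (\<lambda>x. \<Sum>q\<leftarrow>xs. fst p * fst q * (X (snd p) n x * X (snd q) n x)) \<in> linf G \<and>
        E (\<lambda>x. \<Sum>q\<leftarrow>xs. fst p * fst q * (X (snd p) n x * X (snd q) n x)) =
        (\<Sum>q\<leftarrow>xs. E (\<lambda>x. fst p * fst q * (X (snd p) n x * X (snd q) n x)))" if "p \<in> set xs" for p
      by (rule real_mean_sum_list[OF star_space_linf mean_\<eta>]) (rule b[OF that])
    have "(\<Sum>p\<leftarrow>xs. \<Sum>q\<leftarrow>xs. fst p * fst q * E (\<lambda>x. X (snd p) n x * X (snd q) n x)) =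
       (\<Sum>p\<leftarrow>xs. \<Sum>q\<leftarrow>xs. E (\<lambda>x. fst p * fst q * (X (snd p) n x * X (snd q) n x)))"
      by (intro arg_cong[of _ _ sum_list] map_cong refl E_cmult[symmetric] bb)
    also have "\<dots> = (\<Sum>p\<leftarrow>xs. E (\<lambda>x. \<Sum>q\<leftarrow>xs. fst p * fst q * (X (snd p) n x * X (snd q) n x)))"
      using row by (intro arg_cong[of _ _ sum_list] map_cong refl) simp
    also have "\<dots> = E (\<lambda>x. \<Sum>p\<leftarrow>xs. \<Sum>q\<leftarrow>xs. fst p * fst q * (X (snd p) n x * X (snd q) n x))"
      using real_mean_sum_list[OF star_space_linf mean_\<eta>, of xs "\<lambda>p x. \<Sum>q\<leftarrow>xs. fst p * fst q * (X (snd p) n x * X (snd q) n x)"]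
        row by simp
    also have "\<dots> = E (\<lambda>x. (\<Sum>p\<leftarrow>xs. fst p * X (snd p) n x) * (\<Sum>p\<leftarrow>xs. fst p * X (snd p) n x))"
    proof (rule real_mean_cong)
      have prod: "(\<Sum>p\<leftarrow>xs. u p) * (\<Sum>q\<leftarrow>xs. u q) = (\<Sum>p\<leftarrow>xs. \<Sum>q\<leftarrow>xs. u p * u q)" for u :: "_ \<Rightarrow> real"
        by (simp add: sum_list_const_mult sum_list_mult_const)
      show "(\<Sum>p\<leftarrow>xs. \<Sum>q\<leftarrow>xs. fst p * fst q * (X (snd p) n x * X (snd q) n x)) =
          (\<Sum>p\<leftarrow>xs. fst p * X (snd p) n x) * (\<Sum>p\<leftarrow>xs. fst p * X (snd p) n x)" for x
        unfolding prod by (simp add: mult_ac)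
    qed
    also have "\<dots> \<ge> 0"
    proof -
      have l: "creal G (\<lambda>x. \<Sum>p\<leftarrow>xs. fst p * X (snd p) n x) \<in> linf G"
        using real_mean_sum_list[OF star_space_linf mean_\<eta>, of xs "\<lambda>p x. fst p * X (snd p) n x"] xs
          star_spaceD(4)[OF star_space_linf bebutov_real_linf[OF bebutov_real_X[OF v]]]
        by (auto simp: creal_scale)
      have "E (\<lambda>_. 0) \<le> E (\<lambda>x. (\<Sum>p\<leftarrow>xs. fst p * X (snd p) n x) * (\<Sum>p\<leftarrow>xs. fst p * X (snd p) n x))"
        by (intro E_mono bebutov_real_linf[OF bebutov_real_const] bounded_mult_linf l) simp
      then show ?thesis by (simp add: E_const)
    qed
    finally show "0 \<le> (\<Sum>p\<leftarrow>xs. \<Sum>q\<leftarrow>xs. fst p * fst q * E (\<lambda>x. X (snd p) n x * X (snd q) n x))" .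
  qed (simp add: mult.commute)
  then have "psd_kernel ?I k"
    by (rule psd_kernel_lim) (auto simp: K_def k_def intro!: tendsto_of_real E_X_limit)
  then interpret k: psd_kernel ?I k .
  let ?act = "\<lambda>g i. (fst i, g \<otimes> snd i)"
  interpret k: invariant_kernel G ?I k ?act
  proof
    fix g i j assume g: "g \<in> carrier G" and i: "i \<in> ?I" and j: "j \<in> ?I"
    have "E (\<lambda>x. X (?act g i) n x * X (?act g j) n x) = E (\<lambda>x. X i n x * X j n x)" for n
    proof -
      have "E (\<lambda>x. X (?act g i) n x * X (?act g j) n x) = E (\<lambda>x. X i n (inv g \<otimes> x) * X j n (inv g \<otimes> x))"
        using g i j by (intro real_mean_cong) (auto simp: X_def inv_mult_group m_assoc)
      also have "\<dots> = E (\<lambda>x. X i n x * X j n x)"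
        by (rule E_left[where r = "\<lambda>x. X i n x * X j n x"]) (use g i j in \<open>auto intro!: bebutov_real_mult bebutov_real_X\<close>)
      finally show ?thesis .
    qed
    then show "k (?act g i) (?act g j) = k i j" by (simp add: k_def)
  qed (auto simp: m_assoc)
  have "(\<lambda>g. if g \<in> carrier G then k (True, \<one>) (?act g (False, \<one>)) else 0) \<in> fourier_stieltjes G"
    by (rule k.kernel_fourier_stieltjes) auto
  moreover have "(\<lambda>g. if g \<in> carrier G then k (True, \<one>) (?act g (False, \<one>)) else 0) = creal G \<phi>"
    by (auto simp: creal_def k_def \<phi>_X)
  ultimately show ?thesis by simp
qed

text \<open>\<open>D n\<close> is disjoint from the translate of \<open>B\<close> by
  \<open>a i\<close> as soon as \<open>n > i\<close>, so the sequence defining \<open>\<phi>\<close>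
  is eventually \<open>0\<close>.\<close>

lemma \<phi>_A: "g \<in> A \<Longrightarrow> \<phi> g = 0"
proof -
  assume "g \<in> A"
  then obtain i where i: "g = a i" using A_range by auto
  have "E (\<lambda>x. indicator (D n) x * indicator B (inv g \<otimes> x)) = 0" if "n \<ge> Suc i" for n
  proof -
    have "E (\<lambda>x. indicator (D n) x * indicator B (inv g \<otimes> x)) = E (\<lambda>_. 0)"
      using that by (intro real_mean_cong) (auto simp: D_def i split: split_indicator)
    then show ?thesis by (simp add: E_const)
  qed
  then have "(\<lambda>n. E (\<lambda>x. indicator (D n) x * indicator B (inv g \<otimes> x))) \<longlonglongrightarrow> 0"
    by (intro tendsto_eventually) (auto simp: eventually_sequentially)
  then show ?thesis using \<phi>_lim i a_in LIMSEQ_unique by blast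
qed

end

section \<open>Product sets on finite sets\<close>

text \<open>Distinct points may have distance \<open>0\<close>: this is a pseudometric, and the
  kernel of the map into the completion may be nontrivial.\<close>

locale biinvariant_metric = group G for G :: "('a, 'm) monoid_scheme" (structure) +
  fixes \<Delta> :: "'a \<Rightarrow> 'a \<Rightarrow> real"
  assumes \<Delta>_self: "g \<in> carrier G \<Longrightarrow> \<Delta> g g = 0"
    and \<Delta>_nonneg: "\<lbrakk>g \<in> carrier G; h \<in> carrier G\<rbrakk> \<Longrightarrow> 0 \<le> \<Delta> g h"
    and \<Delta>_commute: "\<lbrakk>g \<in> carrier G; h \<in> carrier G\<rbrakk> \<Longrightarrow> \<Delta> g h = \<Delta> h g"
    and \<Delta>_triangle: "\<lbrakk>g \<in> carrier G; h \<in> carrier G; k \<in> carrier G\<rbrakk> \<Longrightarrow> \<Delta> g k \<le> \<Delta> g h + \<Delta> h k"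
    and \<Delta>_left: "\<lbrakk>g \<in> carrier G; h \<in> carrier G; k \<in> carrier G\<rbrakk> \<Longrightarrow> \<Delta> (k \<otimes> g) (k \<otimes> h) = \<Delta> g h"
    and \<Delta>_right: "\<lbrakk>g \<in> carrier G; h \<in> carrier G; k \<in> carrier G\<rbrakk> \<Longrightarrow> \<Delta> (g \<otimes> k) (h \<otimes> k) = \<Delta> g h"
    and \<Delta>_tb: "tot_bdd (carrier G) \<Delta>"

lemma (in orbit_metric) biinvariant_metric: "biinvariant_metric G \<Delta>"
  by unfold_locales (auto intro: \<Delta>_self \<Delta>_nonneg \<Delta>_commute \<Delta>_triangle \<Delta>_left \<Delta>_right \<Delta>_tb)

section \<open>One stage for every finite set\<close>

context product_setup
begin

text \<open>The point \<open>h\<close> is found by averaging with \<open>\<eta>\<close>: the \<open>h\<close> for which \<open>B\<close> has the required density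
  along \<open>ss\<close> have measure at least \<open>\<kappa>\<close>, the \<open>h\<close> that fail for some \<open>g\<close> in \<open>F\<close> have smaller measure.\<close>

lemma finite_stage:
  assumes f: "\<And>k. fs_real (f k)" "\<And>k g. g \<in> carrier G \<Longrightarrow> 0 \<le> f k g \<and> f k g \<le> 1"
    and dec: "\<And>k g. \<lbrakk>k\<^sub>0 \<le> k; g \<in> carrier G\<rbrakk> \<Longrightarrow> f k g \<le> f k\<^sub>0 g"
    and small: "\<And>e. e > 0 \<Longrightarrow> \<exists>k\<ge>k\<^sub>0. L (\<lambda>g. f k g * \<phi> g) \<le> e"
    and close: "\<And>k. k\<^sub>0 \<le> k \<Longrightarrow> L (f k\<^sub>0) - L (f k) \<le> \<epsilon> / 4"
    and q: "fs_real q" and F: "finite F" "F \<subseteq> carrier G"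
    and \<kappa>: "0 < \<kappa>" "\<kappa> \<le> E (indicator B)" and \<epsilon>: "\<epsilon> > 0" and \<delta>: "\<delta> > 0"
  obtains ss h where "glist G ss" "h \<in> carrier G"
    "E (indicator B) - \<kappa> \<le> ravg (\<lambda>s. indicator B (inv s \<otimes> h)) ss"
    "\<And>g. \<lbrakk>g \<in> F; \<epsilon> < ravg (\<lambda>s. f k\<^sub>0 (g \<otimes> s) * indicator B (inv s \<otimes> h)) ss\<rbrakk> \<Longrightarrow> g \<otimes> h \<in> A <#> B"
    "\<And>g. g \<in> carrier G \<Longrightarrow> ravg (\<lambda>s. q (g \<otimes> s)) ss \<le> L q + \<delta>"
proof -
  define m where "m = real (card F)"
  \<comment> \<open>Each bad set will have mean at most \<open>6 e / \<epsilon>\<close>. With this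
    \<open>e\<close> the \<open>m\<close> of them together have at most \<open>3 / 4\<close> of
    \<open>\<kappa>\<close>; \<open>m + 1\<close> avoids division by \<open>0\<close>.\<close>
  define e where "e = \<kappa> * \<epsilon> / (8 * (m + 1))"
  have m: "m \<ge> 0" by (simp add: m_def)
  have e: "e > 0" using \<kappa> \<epsilon> m by (simp add: e_def)
  obtain k where k: "k \<ge> k\<^sub>0" "L (\<lambda>g. f k g * \<phi> g) \<le> e" using small[OF e] by blast
  have \<phi>_fsr: "fs_real \<phi>" using \<phi>_fs by (simp add: fs_real_def)
  define d where "d = min (min e (\<epsilon> / 4)) \<delta>"
  have d: "d > 0" "d \<le> e" "d \<le> \<epsilon> / 4" "d \<le> \<delta>" using e \<epsilon> \<delta> by (auto simp: d_def)
  \<comment> \<open>One family \<open>ss\<close> has to serve three functions: the product that is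
    nearly null, the loss from \<open>k\<^sub>0\<close> to \<open>k\<close>, and the function
    \<open>q\<close> used for smoothing.\<close>
  let ?rs = "[\<lambda>g. f k g * \<phi> g, \<lambda>g. f k\<^sub>0 g - f k g, q]"
  have "fs_real r" if "r \<in> set ?rs" for r using that f q \<phi>_fsr by (auto intro: fs_real_mult fs_real_diff)
  then obtain ss where ss: "glist G ss"
    "\<And>r g. \<lbrakk>r \<in> set ?rs; g \<in> carrier G\<rbrakk> \<Longrightarrow> \<bar>ravg (\<lambda>s. r (g \<otimes> s)) ss - L r\<bar> \<le> d"
    using L_ravg[of ?rs d] d(1) by blast
  have ssG: "s \<in> carrier G" if "s \<in> set ss" for s using ss(1) that by (auto simp: glist_def)
  let ?I = "\<lambda>n g x. indicator (D n) x * indicator B (inv g \<otimes> x) :: real"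
  have "\<forall>\<^sub>F n in sequentially. \<forall>g\<in>F. \<forall>s\<in>set ss. E (?I n (g \<otimes> s)) < \<phi> (g \<otimes> s) + e"
    using F(1)
  proof (intro eventually_ball_finite ballI)
    fix g s assume "g \<in> F" "s \<in> set ss"
    then have "g \<otimes> s \<in> carrier G" using F(2) ssG by auto
    from order_tendstoD(2)[OF \<phi>_lim[OF this], of "\<phi> (g \<otimes> s) + e"] e
    show "\<forall>\<^sub>F n in sequentially. E (?I n (g \<otimes> s)) < \<phi> (g \<otimes> s) + e" by simp
  qed auto
  then obtain n where n: "\<And>g s. \<lbrakk>g \<in> F; s \<in> set ss\<rbrakk> \<Longrightarrow> E (?I n (g \<otimes> s)) < \<phi> (g \<otimes> s) + e"
    unfolding eventually_sequentially by blast
  define W where "W g h = ravg (\<lambda>s. f k (g \<otimes> s) * indicator B (inv s \<otimes> h)) ss" for g h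
  \<comment> \<open>For \<open>h\<close> outside \<open>bad g\<close>, a value \<open>W g h\<close>
    above \<open>\<epsilon> / 2\<close> forces \<open>g h\<close> out of \<open>D n\<close> and
    hence into \<open>A B\<close>.\<close>
  define bad where "bad g = {h \<in> carrier G. g \<otimes> h \<in> D n \<and> \<epsilon> / 2 < W g h}" for g
  define good where "good = {h \<in> carrier G. E (indicator B) - \<kappa> \<le> ravg (\<lambda>s. indicator B (inv s \<otimes> h)) ss}"
  have bB: "bebutov_real (\<lambda>h. indicator B (inv s \<otimes> h))" if "s \<in> set ss" for s
    using bebutov_real_left[OF bebutov_real_indicator, of "inv s"] ssG[OF that] by simp
  \<comment> \<open>Markov's inequality. By invariance of \<open>\<eta>\<close> the mean of
    \<open>?J s\<close> is \<open>f k (g s)\<close> times a correlation that \<open>n\<close> has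
    brought within \<open>e\<close> of \<open>\<phi> (g s)\<close>, and the average of
    \<open>f k (g s) \<phi> (g s)\<close> over \<open>ss\<close> is at most
    \<open>2 e\<close>.\<close>
  have bad_le: "E (indicator (bad g)) \<le> 6 * e / \<epsilon>" if g: "g \<in> F" for g
  proof -
    have gG: "g \<in> carrier G" using g F by auto
    let ?J = "\<lambda>s x. f k (g \<otimes> s) * (indicator (D n) (g \<otimes> x) * indicator B (inv s \<otimes> x)) :: real"
    have bJ: "creal G (?J s) \<in> linf G" if "s \<in> set ss" for s
      unfolding creal_scale
      by (rule star_spaceD(4)[OF star_space_linf bebutov_real_linf[OF bebutov_real_mult[OF bebutov_real_left[OF bebutov_real_D gG] bB[OF that]]]])
    have lin: "creal G (\<lambda>x. ravg (\<lambda>s. ?J s x) ss) \<in> linf G"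
      by (rule creal_ravg[OF star_space_linf mean_\<eta> bJ])
    have "E (\<lambda>x. \<epsilon> / 2 * indicator (bad g) x) \<le> E (\<lambda>x. ravg (\<lambda>s. ?J s x) ss)"
    proof (rule E_mono)
      show "creal G (\<lambda>x. \<epsilon> / 2 * indicator (bad g) x) \<in> linf G"
        unfolding creal_scale by (rule star_spaceD(4)[OF star_space_linf linf_indicator])
      show "creal G (\<lambda>x. ravg (\<lambda>s. ?J s x) ss) \<in> linf G" by (rule lin)
      fix x assume x: "x \<in> carrier G"
      show "\<epsilon> / 2 * indicator (bad g) x \<le> ravg (\<lambda>s. ?J s x) ss"
      proof (cases "x \<in> bad g")
        case True
        then have "ravg (\<lambda>s. ?J s x) ss = W g x" by (simp add: bad_def W_def)
        then show ?thesis using True by (simp add: bad_def)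
      next
        case False
        have "0 \<le> ravg (\<lambda>s. ?J s x) ss" using f(2) gG ssG by (intro ravg_nonneg) auto
        then show ?thesis using False by simp
      qed
    qed
    also have "\<dots> = ravg (\<lambda>s. E (?J s)) ss" by (rule real_mean_ravg[OF star_space_linf mean_\<eta> bJ])
    also have "\<dots> \<le> ravg (\<lambda>s. f k (g \<otimes> s) * \<phi> (g \<otimes> s) + e) ss"
    proof (rule ravg_mono)
      fix s assume s: "s \<in> set ss"
      have sG: "s \<in> carrier G" using ssG s by auto
      have bI: "bebutov_real (?I n (g \<otimes> s))"
        using bebutov_real_left[OF bebutov_real_indicator, of "inv (g \<otimes> s)"] gG sG by (intro bebutov_real_mult bebutov_real_D) auto
      have "E (?J s) = f k (g \<otimes> s) * E (\<lambda>x. indicator (D n) (g \<otimes> x) * indicator B (inv s \<otimes> x))"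
        by (rule E_cmult[OF bebutov_real_linf[OF bebutov_real_mult[OF bebutov_real_left[OF bebutov_real_D gG] bB[OF s]]]])
      also have "E (\<lambda>x. indicator (D n) (g \<otimes> x) * indicator B (inv s \<otimes> x)) = E (\<lambda>x. ?I n (g \<otimes> s) (g \<otimes> x))"
        using gG sG by (intro real_mean_cong) (simp add: inv_mult_group m_assoc[symmetric] m_assoc[of "inv s" "inv g" g])
      also have "\<dots> = E (?I n (g \<otimes> s))" by (rule E_left[OF bI gG])
      also have "f k (g \<otimes> s) * E (?I n (g \<otimes> s)) \<le> f k (g \<otimes> s) * (\<phi> (g \<otimes> s) + e)"
        using n[OF g s] f(2)[of "g \<otimes> s" k] gG sG by (intro mult_left_mono) auto
      also have "\<dots> \<le> f k (g \<otimes> s) * \<phi> (g \<otimes> s) + e"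
        using f(2)[of "g \<otimes> s" k] gG sG e by (simp add: distrib_left mult_left_le_one_le)
      finally show "E (?J s) \<le> f k (g \<otimes> s) * \<phi> (g \<otimes> s) + e" .
    qed
    also have "\<dots> = ravg (\<lambda>s. f k (g \<otimes> s) * \<phi> (g \<otimes> s)) ss + e"
      using ravg_diff[of "\<lambda>s. f k (g \<otimes> s) * \<phi> (g \<otimes> s)" "\<lambda>_. - e" ss] ss(1) by (simp add: ravg_const glist_def)
    also have "\<dots> \<le> (e + e) + e"
      using ss(2)[of "\<lambda>g. f k g * \<phi> g" g] gG k(2) d(2) by (simp add: abs_le_iff)
    finally have "\<epsilon> / 2 * E (indicator (bad g)) \<le> 3 * e"
      by (simp only: E_cmult[OF linf_indicator])
    then show ?thesis using \<epsilon> by (simp add: field_simps)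
  qed
  \<comment> \<open>The average over \<open>ss\<close> has mean \<open>E (indicator B)\<close> by
    invariance and never exceeds \<open>1\<close>; so it cannot drop by more than
    \<open>\<kappa>\<close> below its mean except off a set of mean at least
    \<open>\<kappa>\<close>.\<close>
  have good_ge: "\<kappa> \<le> E (indicator good)"
  proof -
    have "E (\<lambda>h. ravg (\<lambda>s. indicator B (inv s \<otimes> h)) ss) = ravg (\<lambda>s. E (\<lambda>h. indicator B (inv s \<otimes> h))) ss"
      by (rule real_mean_ravg[OF star_space_linf mean_\<eta> bebutov_real_linf[OF bB]])
    also have "\<dots> = ravg (\<lambda>s. E (indicator B)) ss"
      using E_left[OF bebutov_real_indicator] ssG by (intro ravg_cong) auto
    also have "\<dots> = E (indicator B)" using ss(1) by (simp add: ravg_const glist_def)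
    finally have "E (indicator B) = E (\<lambda>h. ravg (\<lambda>s. indicator B (inv s \<otimes> h)) ss)" ..
    also have "\<dots> \<le> E (\<lambda>h. indicator good h + (E (indicator B) - \<kappa>))"
    proof (rule E_mono)
      show "creal G (\<lambda>h. ravg (\<lambda>s. indicator B (inv s \<otimes> h)) ss) \<in> linf G"
        by (rule creal_ravg[OF star_space_linf mean_\<eta> bebutov_real_linf[OF bB]])
      show "creal G (\<lambda>h. indicator good h + (E (indicator B) - \<kappa>)) \<in> linf G"
        unfolding creal_add by (rule star_spaceD(3)[OF star_space_linf linf_indicator bebutov_real_linf[OF bebutov_real_const]])
      fix h assume h: "h \<in> carrier G"
      have "ravg (\<lambda>s. indicator B (inv s \<otimes> h)) ss \<le> ravg (\<lambda>_. 1) ss"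
        by (rule ravg_mono) (simp split: split_indicator)
      then have "ravg (\<lambda>s. indicator B (inv s \<otimes> h)) ss \<le> (1 :: real)" using ss(1)
        by (simp add: ravg_const glist_def)
      then show "ravg (\<lambda>s. indicator B (inv s \<otimes> h)) ss \<le> indicator good h + (E (indicator B) - \<kappa>)"
        using \<kappa>(2) h by (cases "h \<in> good") (auto simp: good_def)
    qed
    also have "\<dots> = E (indicator good) + (E (indicator B) - \<kappa>)"
      by (simp only: E_add[OF linf_indicator bebutov_real_linf[OF bebutov_real_const]] E_const)
    finally show ?thesis by simp
  qed
  have "\<not> good \<subseteq> (\<Union>g\<in>F. bad g)"
  proof
    assume sub: "good \<subseteq> (\<Union>g\<in>F. bad g)"
    obtain gs where gs: "set gs = F" "distinct gs" using finite_distinct_list[OF F(1)] by blast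
    have len: "real (length gs) = m" using gs distinct_card[of gs] by (simp add: m_def)
    have S: "creal G (\<lambda>x. \<Sum>g\<leftarrow>gs. indicator (bad g) x) \<in> linf G \<and>
        E (\<lambda>x. \<Sum>g\<leftarrow>gs. indicator (bad g) x) = (\<Sum>g\<leftarrow>gs. E (indicator (bad g)))"
      by (rule real_mean_sum_list[OF star_space_linf mean_\<eta> linf_indicator])
    have "E (indicator good) \<le> E (\<lambda>x. \<Sum>g\<leftarrow>gs. indicator (bad g) x)"
    proof (rule E_mono[OF linf_indicator S[THEN conjunct1]])
      fix x
      show "indicator good x \<le> (\<Sum>g\<leftarrow>gs. indicator (bad g) x :: real)"
      proof (cases "x \<in> good")
        case True
        then obtain g where g: "g \<in> F" "x \<in> bad g" using sub by auto
        have "indicator (bad g) x \<le> (\<Sum>g\<leftarrow>gs. indicator (bad g) x :: real)"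
          by (rule member_le_sum_list) (auto simp: gs g(1) intro: image_eqI[of _ _ g])
        then show ?thesis using True g by simp
      next
        case False
        have "0 \<le> (\<Sum>g\<leftarrow>gs. indicator (bad g) x :: real)" by (rule sum_list_nonneg) auto
        then show ?thesis using False by simp
      qed
    qed
    also have "\<dots> = (\<Sum>g\<leftarrow>gs. E (indicator (bad g)))" using S by simp
    also have "\<dots> \<le> (\<Sum>g\<leftarrow>gs. 6 * e / \<epsilon>)" by (rule sum_list_mono) (use bad_le gs in auto)
    also have "\<dots> = m * (6 * e / \<epsilon>)" using len by (simp add: sum_list_triv)
    also have "6 * e / \<epsilon> = (3 / 4) * \<kappa> / (m + 1)" using \<epsilon> m by (simp add: e_def divide_simps)
    also have "m * ((3 / 4) * \<kappa> / (m + 1)) = (3 / 4) * \<kappa> * (m / (m + 1))" by simp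
    also have "\<dots> \<le> (3 / 4) * \<kappa> * 1" using \<kappa> m by (intro mult_left_mono) auto
    finally show False using good_ge \<kappa>(1) by simp
  qed
  then obtain h where h: "h \<in> good" "\<And>g. g \<in> F \<Longrightarrow> h \<notin> bad g" by blast
  have hG: "h \<in> carrier G" using h(1) by (simp add: good_def)
  show thesis
  proof (rule that[OF ss(1) hG])
    show "E (indicator B) - \<kappa> \<le> ravg (\<lambda>s. indicator B (inv s \<otimes> h)) ss" using h(1) by (simp add: good_def)
    show "ravg (\<lambda>s. q (g \<otimes> s)) ss \<le> L q + \<delta>" if "g \<in> carrier G" for g
      using ss(2)[of q g] that d(4) by (simp add: abs_le_iff)
    fix g assume g: "g \<in> F" and u: "\<epsilon> < ravg (\<lambda>s. f k\<^sub>0 (g \<otimes> s) * indicator B (inv s \<otimes> h)) ss"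
    have gG: "g \<in> carrier G" using g F by auto
    have "ravg (\<lambda>s. f k\<^sub>0 (g \<otimes> s) * indicator B (inv s \<otimes> h)) ss - W g h =
        ravg (\<lambda>s. (f k\<^sub>0 (g \<otimes> s) - f k (g \<otimes> s)) * indicator B (inv s \<otimes> h)) ss"
      unfolding W_def ravg_diff[symmetric] by (simp add: left_diff_distrib)
    also have "\<dots> \<le> ravg (\<lambda>s. f k\<^sub>0 (g \<otimes> s) - f k (g \<otimes> s)) ss"
      using dec[OF k(1)] gG ssG by (intro ravg_mono) (auto simp: mult_left_le split: split_indicator)
    also have "\<dots> \<le> L (\<lambda>g. f k\<^sub>0 g - f k g) + d"
      using ss(2)[of "\<lambda>g. f k\<^sub>0 g - f k g" g] gG by (simp add: abs_le_iff)
    also have "L (\<lambda>g. f k\<^sub>0 g - f k g) = L (f k\<^sub>0) - L (f k)"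
      using L_add[OF fs_real_linf[OF f(1)] fs_real_linf[OF fs_real_cmult[OF f(1), of "-1"]], of k\<^sub>0 k]
        L_cmult[OF fs_real_linf[OF f(1)], of "-1" k] by simp
    also have "L (f k\<^sub>0) - L (f k) + d \<le> \<epsilon> / 4 + \<epsilon> / 4" using close[OF k(1)] d(3) by simp
    finally have "\<epsilon> / 2 < W g h" using u by simp
    then have "g \<otimes> h \<notin> D n" using h(2)[OF g] hG by (simp add: bad_def)
    then show "g \<otimes> h \<in> A <#> B" using D_product gG hG by blast
  qed
qed

text \<open>The metric, the level \<open>k\<^sub>0\<close>, the smoothing and the radius are chosen
  before \<open>F\<close>; only \<open>h\<close>, \<open>Y\<close> and \<open>P\<close> depend on
  it. Membership in \<open>A B\<close> is claimed for all points of \<open>F\<close> within the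
  radius of \<open>P\<close>, because later \<open>P\<close> is replaced by a rounded copy.\<close>

lemma product_stages:
  assumes \<alpha>\<beta>: "1 < real (Suc N) * (L (indicator A) * E (indicator B))"
    and pos: "0 < L (indicator A)" "0 < E (indicator B)"
  obtains \<Delta> \<tau> where "biinvariant_metric G \<Delta>" "\<tau> > 0"
    "\<And>F. \<lbrakk>finite F; F \<subseteq> carrier G\<rbrakk> \<Longrightarrow> \<exists>h Y P. h \<in> carrier G \<and> finite Y \<and> Y \<subseteq> carrier G \<and> card Y \<le> N \<and>
       P \<subseteq> carrier G \<and> (\<forall>w\<in>carrier G. \<exists>y\<in>Y. \<exists>p\<in>P. w = y \<otimes> p) \<and>
       (\<forall>g\<in>F. \<forall>p\<in>P. \<Delta> g p < \<tau> \<longrightarrow> g \<otimes> h \<in> A <#> B)"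
proof -
  define \<alpha> where "\<alpha> = L (indicator A)"
  define \<beta> where "\<beta> = E (indicator B)"
  have ab: "\<alpha> > 0" "\<beta> > 0" using pos by (auto simp: \<alpha>_def \<beta>_def)
  define M' where "M' = real (Suc N)"
  have M': "M' > 0" "1 < M' * (\<alpha> * \<beta>)" using \<alpha>\<beta> unfolding M'_def \<alpha>_def \<beta>_def by auto
  \<comment> \<open>Midway between \<open>1 / (N + 1)\<close> and \<open>\<alpha> * \<beta>\<close>:
    the distance to the former feeds the covering, the distance to the latter pays for all
    approximations.\<close>
  define \<gamma> where "\<gamma> = (1 / M' + \<alpha> * \<beta>) / 2"
  have "1 / M' < \<alpha> * \<beta>" using M' by (simp add: divide_less_eq mult.commute)
  then have \<gamma>: "1 / M' < \<gamma>" "\<gamma> < \<alpha> * \<beta>" by (auto simp: \<gamma>_def)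
  then have \<gamma>0: "\<gamma> > 0" using M' by (meson divide_pos_pos less_trans zero_less_one)
  have "1 < M' * \<gamma>" using \<gamma>(1) M' by (simp add: divide_less_eq mult.commute)
  \<comment> \<open>Half of the threshold in the hypothesis of \<open>covering\<close>.\<close>
  define \<epsilon> where "\<epsilon> = \<gamma> * (M' * \<gamma> - 1) / (2 * M')"
  have \<epsilon>: "\<epsilon> > 0" "M' * \<epsilon> < \<gamma> * (M' * \<gamma> - 1)"
    using \<gamma>0 M' \<open>1 < M' * \<gamma>\<close> by (auto simp: \<epsilon>_def)
  \<comment> \<open>The same \<open>\<zeta>\<close> bounds the errors in the averages of
    \<open>f k\<^sub>0\<close>, in the density of \<open>B\<close> along \<open>ss\<close>, and in
    the supremum of the smoothed weight; the last inequality collects all three.\<close>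
  obtain \<zeta> where \<zeta>: "0 < \<zeta>" "\<zeta> < \<alpha>" "\<zeta> < \<beta>" "\<gamma> < (\<alpha> - \<zeta>) * (\<beta> - \<zeta>) / (1 + \<zeta>)"
  proof -
    have "((\<lambda>z. (\<alpha> - z) * (\<beta> - z) / (1 + z)) \<longlongrightarrow> (\<alpha> - 0) * (\<beta> - 0) / (1 + 0)) (at_right 0)"
      by (intro tendsto_intros) auto
    then have "\<forall>\<^sub>F z in at_right 0. \<gamma> < (\<alpha> - z) * (\<beta> - z) / (1 + z)"
      using \<gamma>(2) by (intro order_tendstoD) auto
    moreover have "\<forall>\<^sub>F z in at_right (0::real). z \<in> {0<..<min \<alpha> \<beta>}"
      using ab by (intro eventually_at_right_real) auto
    ultimately have "\<forall>\<^sub>F z in at_right (0::real). z \<in> {0<..<min \<alpha> \<beta>} \<and> \<gamma> < (\<alpha> - z) * (\<beta> - z) / (1 + z)"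
      by (rule eventually_conj[rotated])
    then obtain z where "z \<in> {0<..<min \<alpha> \<beta>}" "\<gamma> < (\<alpha> - z) * (\<beta> - z) / (1 + z)"
      using eventually_happens[of _ "at_right (0::real)"] trivial_limit_at_right_real by auto
    then show thesis by (intro that[of z]) auto
  qed
  obtain \<psi> \<rho> R C where dec: "orbit_metric G \<rho> R" "\<psi> \<in> fourier_stieltjes G"
    "L (\<lambda>g. (cmod (creal G \<phi> g - \<psi> g))\<^sup>2) = 0" "C \<ge> 0"
    "\<And>g h. \<lbrakk>g \<in> carrier G; h \<in> carrier G\<rbrakk> \<Longrightarrow> cmod (\<psi> g - \<psi> h) \<le> C * \<rho> g h"
    by (rule compact_decomposition[OF \<phi>_fs], rule that)
  interpret orbit_metric G \<rho> R by (rule dec(1))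
  obtain K where K: "0 < K" "\<And>x. cmod (\<psi> x) \<le> K" using linf_bound[OF fourier_stieltjes_linf[OF dec(2)]]
    by blast
  define \<theta> where "\<theta> g = (cmod (\<psi> g))\<^sup>2 / K\<^sup>2" for g
  have \<theta>01: "0 \<le> \<theta> g" "\<theta> g \<le> 1" for g
    using K power_mono[OF K(2)[of g], of 2] by (auto simp: \<theta>_def)
  have \<theta>_fsr: "fs_real \<theta>" using fs_real_cmult[OF fs_real_norm_sq[OF dec(2)], of "1 / K\<^sup>2"]
    by (simp add: \<theta>_def[abs_def])
  define f where "f k g = (1 - \<theta> g) ^ k" for k g
  have f_fsr: "fs_real (f k)" for k unfolding f_def
    by (intro fs_real_power fs_real_diff fs_real_const \<theta>_fsr)
  have f01: "0 \<le> f k g" "f k g \<le> 1" for k g using \<theta>01[of g] by (auto simp: f_def intro: power_le_one)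
  have f_dec: "f k g \<le> f j g" if "j \<le> k" for j k g
    unfolding f_def using \<theta>01[of g] that by (intro power_decreasing) auto
  define \<nu> where "\<nu> g = (cmod (creal G \<phi> g - \<psi> g))\<^sup>2" for g
  have \<nu>_fsr: "fs_real \<nu>"
  proof -
    have "(\<lambda>g. creal G \<phi> g + (-1) * \<psi> g) \<in> fourier_stieltjes G"
      by (intro fourier_stieltjes_add fourier_stieltjes_scale \<phi>_fs dec(2))
    from fs_real_norm_sq[OF this] show ?thesis by (simp add: \<nu>_def[abs_def])
  qed
  have L\<nu>: "L \<nu> = 0" using dec(3) by (simp add: \<nu>_def[abs_def])
  have \<phi>_fsr: "fs_real \<phi>" using \<phi>_fs by (simp add: fs_real_def)
  have f_large: "\<alpha> \<le> L (f k)" for k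
  proof -
    have "L (indicator A) \<le> L (\<lambda>g. f k g + (real k / K\<^sup>2) * \<nu> g)"
    proof (rule L_mono[OF linf_indicator])
      show "creal G (\<lambda>g. f k g + (real k / K\<^sup>2) * \<nu> g) \<in> linf G"
        by (intro fs_real_linf fs_real_add fs_real_cmult f_fsr \<nu>_fsr)
      fix g assume g: "g \<in> carrier G"
      show "indicator A g \<le> f k g + (real k / K\<^sup>2) * \<nu> g"
      proof (cases "g \<in> A")
        case True
        \<comment> \<open>Bernoulli bounds \<open>f k\<close> below by
          \<open>1 - k \<theta>\<close>. On \<open>A\<close>, where \<open>\<phi>\<close> vanishes,
          \<open>\<theta>\<close> equals \<open>\<nu> / K^2\<close>, and the correction term has
          mean \<open>0\<close>.\<close>
        have "1 + real k * (- \<theta> g) \<le> (1 + (- \<theta> g)) ^ k"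
          using \<theta>01[of g] by (intro Bernoulli_inequality) auto
        moreover have "\<nu> g = (cmod (\<psi> g))\<^sup>2" using True g \<phi>_A by (simp add: \<nu>_def creal_def)
        ultimately show ?thesis using True by (simp add: f_def \<theta>_def)
      next
        case False
        have "0 \<le> (real k / K\<^sup>2) * \<nu> g" by (simp add: \<nu>_def)
        then show ?thesis using False f01[of k g] by simp
      qed
    qed
    also have "\<dots> = L (f k)"
      by (simp only: L_add[OF fs_real_linf[OF f_fsr] fs_real_linf[OF fs_real_cmult[OF \<nu>_fsr]]] L_cmult[OF fs_real_linf[OF \<nu>_fsr]] L\<nu> mult_zero_right add_0_right)
    finally show ?thesis by (simp add: \<alpha>_def)
  qed
  \<comment> \<open>From \<open>(1 - \<theta>)^k * k \<theta> \<le> (1 - \<theta>^2)^k \<le>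
    1\<close> the product of \<open>f k\<close> with the modulus of \<open>\<psi>\<close> is at most
    \<open>K / sqrt k\<close>. The rest of \<open>\<phi>\<close> is at most
    \<open>s + \<nu> / s\<close>, of mean \<open>s\<close>; choosing \<open>s = K / sqrt k\<close>
    balances the two.\<close>
  have f_small: "L (\<lambda>g. f k g * \<phi> g) \<le> 2 * (K / sqrt (real k))" if k: "k > 0" for k
  proof -
    define s where "s = K / sqrt (real k)"
    have s: "s > 0" using K k by (simp add: s_def)
    have "L (\<lambda>g. f k g * \<phi> g) \<le> L (\<lambda>g. 2 * s + (1 / s) * \<nu> g)"
    proof (rule L_mono)
      show "creal G (\<lambda>g. f k g * \<phi> g) \<in> linf G" by (intro fs_real_linf fs_real_mult f_fsr \<phi>_fsr)
      show "creal G (\<lambda>g. 2 * s + (1 / s) * \<nu> g) \<in> linf G"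
        by (intro fs_real_linf fs_real_add fs_real_cmult fs_real_const \<nu>_fsr)
      fix g assume g: "g \<in> carrier G"
      define u where "u = cmod (creal G \<phi> g - \<psi> g)"
      have "\<phi> g \<le> cmod (creal G \<phi> g)" using g by (simp add: creal_def)
      also have "\<dots> \<le> cmod (\<psi> g) + u" unfolding u_def
        using norm_triangle_ineq[of "\<psi> g" "creal G \<phi> g - \<psi> g"] by simp
      finally have "f k g * \<phi> g \<le> f k g * (cmod (\<psi> g) + u)" using f01[of k g]
        by (intro mult_left_mono) auto
      also have "\<dots> \<le> f k g * cmod (\<psi> g) + u"
        using f01[of k g] by (simp add: distrib_left mult_left_le_one_le u_def)
      also have "f k g * cmod (\<psi> g) \<le> s"
      proof (rule power2_le_imp_le)
        have "(1 + real k * \<theta> g) \<le> (1 + \<theta> g) ^ k"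
          using \<theta>01[of g] by (intro Bernoulli_inequality) auto
        then have "f k g * (real k * \<theta> g) \<le> f k g * (1 + \<theta> g) ^ k"
          using f01[of k g] by (intro mult_left_mono) auto
        also have "\<dots> = (1 - \<theta> g * \<theta> g) ^ k" by (simp add: f_def algebra_simps flip: power_mult_distrib)
        also have "\<dots> \<le> 1" using \<theta>01[of g] by (intro power_le_one) (auto simp: mult_le_one)
        finally have 1: "f k g * \<theta> g \<le> 1 / real k" using k by (simp add: field_simps)
        have "(f k g * cmod (\<psi> g))\<^sup>2 = f k g * (f k g * \<theta> g) * K\<^sup>2"
          using K by (simp add: \<theta>_def power_mult_distrib power2_eq_square)
        also have "\<dots> \<le> 1 * (1 / real k) * K\<^sup>2"
          using 1 f01[of k g] \<theta>01[of g] by (intro mult_right_mono mult_mono) auto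
        also have "\<dots> = s\<^sup>2" using k by (simp add: s_def power_divide)
        finally show "(f k g * cmod (\<psi> g))\<^sup>2 \<le> s\<^sup>2" .
      qed (use s in simp)
      also have "u \<le> s + (1 / s) * \<nu> g"
      proof (cases "u \<le> s")
        case True
        have "0 \<le> (1 / s) * \<nu> g" using s by (simp add: \<nu>_def)
        then show ?thesis using True by simp
      next
        case False
        then have "u * s \<le> u * u" using s by (intro mult_left_mono) auto
        then have "u \<le> (1 / s) * \<nu> g" using s
          by (simp add: \<nu>_def power2_eq_square pos_le_divide_eq flip: u_def)
        then show ?thesis using s by simp
      qed
      finally show "f k g * \<phi> g \<le> 2 * s + (1 / s) * \<nu> g" by simp
    qed
    also have "\<dots> = 2 * s"
      by (simp only: L_add[OF fs_real_linf[OF fs_real_const] fs_real_linf[OF fs_real_cmult[OF \<nu>_fsr]]] L_cmult[OF fs_real_linf[OF \<nu>_fsr]] L\<nu> L_const mult_zero_right add_0_right)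
    finally show ?thesis by (simp add: s_def)
  qed
  have small: "\<exists>k\<ge>j. L (\<lambda>g. f k g * \<phi> g) \<le> e" if e: "e > 0" for e j
  proof -
    have "(\<lambda>k. 2 * (K / sqrt (real k))) \<longlonglongrightarrow> 2 * 0"
      by (intro tendsto_mult tendsto_const tendsto_divide_0[OF tendsto_const] filterlim_at_top_imp_at_infinity
        filterlim_compose[OF sqrt_at_top filterlim_real_sequentially])
    then have "\<forall>\<^sub>F k in sequentially. 2 * (K / sqrt (real k)) < e" using e by (intro order_tendstoD) auto
    then obtain k where "\<And>k'. k' \<ge> k \<Longrightarrow> 2 * (K / sqrt (real k')) < e" unfolding eventually_sequentially
      by blast
    moreover define k' where "k' = max (max k j) 1"
    ultimately have "2 * (K / sqrt (real k')) < e" "j \<le> k'" "0 < k'" by auto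
    then show ?thesis using f_small[of k'] by (intro exI[of _ k']) auto
  qed
  obtain k\<^sub>0 where k\<^sub>0: "\<And>k. k \<ge> k\<^sub>0 \<Longrightarrow> L (f k\<^sub>0) - L (f k) \<le> (\<epsilon> / 2) / 4"
  proof -
    \<comment> \<open>The means of \<open>f k\<close> decrease in \<open>k\<close> and stay above
      \<open>\<alpha>\<close>, so from some index on they hardly change.\<close>
    define I where "I = (INF k. L (f k))"
    have bdd: "bdd_below (range (\<lambda>k. L (f k)))" using f_large by (intro bdd_belowI2)
    obtain j where "L (f j) < I + \<epsilon> / 8"
      using cINF_less_iff[OF UNIV_not_empty bdd, of "I + \<epsilon> / 8"] \<epsilon>(1) unfolding I_def[symmetric] by auto
    then have "L (f j) - L (f k) \<le> (\<epsilon> / 2) / 4" for k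
      using cINF_lower[OF bdd, of k] unfolding I_def[symmetric] by simp
    then show thesis by (rule that)
  qed
  define C' where "C' = real k\<^sub>0 * (2 * C / K)"
  have C': "C' \<ge> 0" using dec(4) K by (simp add: C'_def)
  have f_lip: "\<bar>f k\<^sub>0 g - f k\<^sub>0 h\<bar> \<le> C' * \<rho> g h" if g: "g \<in> carrier G" and h: "h \<in> carrier G" for g h
  proof -
    have "\<bar>f k\<^sub>0 g - f k\<^sub>0 h\<bar> \<le> real k\<^sub>0 * \<bar>(1 - \<theta> g) - (1 - \<theta> h)\<bar>"
      using norm_power_diff[of "1 - \<theta> g" "1 - \<theta> h" k\<^sub>0] \<theta>01[of g] \<theta>01[of h] by (simp add: f_def)
    also have "\<bar>(1 - \<theta> g) - (1 - \<theta> h)\<bar> = \<bar>cmod (\<psi> g) - cmod (\<psi> h)\<bar> * (cmod (\<psi> g) + cmod (\<psi> h)) / K\<^sup>2"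
    proof -
      have "(1 - \<theta> g) - (1 - \<theta> h) = (cmod (\<psi> h) - cmod (\<psi> g)) * (cmod (\<psi> g) + cmod (\<psi> h)) / K\<^sup>2"
        by (simp add: \<theta>_def power2_eq_square algebra_simps diff_divide_distrib)
      then show ?thesis by (simp add: abs_mult abs_minus_commute)
    qed
    also have "\<dots> \<le> (C * \<rho> g h) * (K + K) / K\<^sup>2"
      using dec(5)[OF g h] norm_triangle_ineq3[of "\<psi> g" "\<psi> h"] K(2)[of g] K(2)[of h]
      by (intro divide_right_mono mult_mono) auto
    also have "real k\<^sub>0 * \<dots> = C' * \<rho> g h" using K(1) by (simp add: C'_def power2_eq_square field_simps)
    finally show ?thesis by (simp add: mult_left_mono)
  qed
  \<comment> \<open>Within this distance the values of \<open>f k\<^sub>0\<close> change by at most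
    \<open>\<epsilon> / 4\<close>; the \<open>+ 1\<close> is there because \<open>C'\<close> may be
    \<open>0\<close>.\<close>
  define \<sigma> where "\<sigma> = \<epsilon> / (4 * (C' + 1))"
  have \<sigma>: "\<sigma> > 0" "C' * \<sigma> \<le> \<epsilon> / 4" using \<epsilon> C' by (auto simp: \<sigma>_def field_simps)
  obtain q where q: "fs_real q" "\<And>g. g \<in> carrier G \<Longrightarrow> 0 \<le> q g" "L q = 1"
    "\<And>g. g \<in> carrier G \<Longrightarrow> q (inv g) = q g" "L (\<lambda>g. q g * \<rho> g \<one>) \<le> \<sigma>"
    using approximate_identity[OF dec(1) \<sigma>(1)] by blast
  have stage: "\<exists>h Y P. h \<in> carrier G \<and> finite Y \<and> Y \<subseteq> carrier G \<and> card Y \<le> N \<and>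
       P \<subseteq> carrier G \<and> (\<forall>w\<in>carrier G. \<exists>y\<in>Y. \<exists>p\<in>P. w = y \<otimes> p) \<and>
       (\<forall>g\<in>F. \<forall>p\<in>P. \<Delta> g p < \<sigma> \<longrightarrow> g \<otimes> h \<in> A <#> B)"
    if F: "finite F" "F \<subseteq> carrier G" for F
  proof -
    obtain ss h where sh: "glist G ss" "h \<in> carrier G"
      "\<beta> - \<zeta> \<le> ravg (\<lambda>s. indicator B (inv s \<otimes> h)) ss"
      "\<And>g. \<lbrakk>g \<in> F; \<epsilon> / 2 < ravg (\<lambda>s. f k\<^sub>0 (g \<otimes> s) * indicator B (inv s \<otimes> h)) ss\<rbrakk> \<Longrightarrow> g \<otimes> h \<in> A <#> B"
      "\<And>g. g \<in> carrier G \<Longrightarrow> ravg (\<lambda>s. q (g \<otimes> s)) ss \<le> L q + \<zeta>"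
    proof (rule finite_stage[where f = f and k\<^sub>0 = k\<^sub>0 and \<epsilon> = "\<epsilon> / 2" and q = q and F = F and \<kappa> = \<zeta> and \<delta> = \<zeta>])
      show "\<zeta> \<le> E (indicator B)" using \<zeta>(3) by (simp add: \<beta>_def)
    qed (use f_fsr f01 f_dec small k\<^sub>0 q(1) F \<zeta>(1) \<epsilon>(1) in \<open>auto simp: \<beta>_def\<close>)
    have ssG: "s \<in> carrier G" if "s \<in> set ss" for s using sh(1) that by (auto simp: glist_def)
    define b where "b s = (indicator B (inv s \<otimes> h) :: real)" for s
    have b01: "0 \<le> b s" "b s \<le> 1" for s by (auto simp: b_def split: split_indicator)
    define u where "u g = ravg (\<lambda>s. f k\<^sub>0 (g \<otimes> s) * b s) ss" for g
    \<comment> \<open>\<open>b\<close> is merely a weight on the finite list; spreading it out with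
      \<open>q\<close> gives a Fourier-Stieltjes function, to which \<open>\<Lambda>\<close> and the
      covering argument apply.\<close>
    define J where "J r = ravg (\<lambda>s. b s * q (inv s \<otimes> r)) ss" for r
    have q_left: "fs_real (\<lambda>r. q (inv s \<otimes> r))" if "s \<in> set ss" for s using ssG[OF that]
      by (intro fs_real_left q) auto
    have J_eq: "J = (\<lambda>r. (1 / real (length ss)) * (\<Sum>s\<leftarrow>ss. b s * q (inv s \<otimes> r)))"
      by (auto simp: J_def ravg_def)
    have J_fsr: "fs_real J" unfolding J_eq by (intro fs_real_cmult fs_real_sum_list q_left)
    have J0: "0 \<le> J r" if "r \<in> carrier G" for r
      unfolding J_def using b01 q(2) ssG that by (intro ravg_nonneg mult_nonneg_nonneg) auto
    \<comment> \<open>Symmetry of \<open>q\<close> turns the sum into an average of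
      \<open>q (inv r \<otimes> s)\<close> over \<open>s\<close>, which is at most
      \<open>1 + \<zeta>\<close> for all \<open>r\<close>. This uniform bound is the reason for
      carrying \<open>q\<close> through \<open>finite_stage\<close>.\<close>
    have J1: "J r \<le> 1 + \<zeta>" if r: "r \<in> carrier G" for r
    proof -
      have "J r \<le> ravg (\<lambda>s. q (inv r \<otimes> s)) ss"
        unfolding J_def
      proof (rule ravg_mono)
        fix s assume s: "s \<in> set ss"
        have "q (inv s \<otimes> r) = q (inv r \<otimes> s)"
          using q(4)[of "inv s \<otimes> r"] ssG[OF s] r by (simp add: inv_mult_group)
        then show "b s * q (inv s \<otimes> r) \<le> q (inv r \<otimes> s)"
          using b01[of s] q(2)[of "inv r \<otimes> s"] ssG[OF s] r by (simp add: mult_left_le_one_le)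
      qed
      also have "\<dots> \<le> 1 + \<zeta>" using sh(5)[of "inv r"] r q(3) by simp
      finally show ?thesis .
    qed
    have bq: "creal G (\<lambda>r. b s * q (inv s \<otimes> r)) \<in> linf G" if "s \<in> set ss" for s
      by (intro fs_real_linf fs_real_cmult q_left that)
    have LJ: "\<beta> - \<zeta> \<le> L J"
    proof -
      have "L J = ravg (\<lambda>s. L (\<lambda>r. b s * q (inv s \<otimes> r))) ss"
        unfolding J_def by (rule real_mean_ravg[OF star_space_linf mean_\<Lambda> bq])
      also have "\<dots> = ravg b ss"
      proof (rule ravg_cong)
        fix s assume s: "s \<in> set ss"
        show "L (\<lambda>r. b s * q (inv s \<otimes> r)) = b s"
          using L_cmult[OF fs_real_linf[OF q_left[OF s]], of "b s"] L_left[OF q(1), of "inv s"] ssG[OF s] q(3) by simp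
      qed
      finally show ?thesis using sh(3) by (simp add: b_def[abs_def])
    qed
    define J' where "J' r = (1 / (1 + \<zeta>)) * J r" for r
    have J'_fsr: "fs_real J'" unfolding J'_def by (intro fs_real_cmult J_fsr)
    have J'01: "0 \<le> J' r \<and> J' r \<le> 1" if "r \<in> carrier G" for r
      using J0[OF that] J1[OF that] \<zeta>(1) by (simp add: J'_def)
    have LJ': "(\<beta> - \<zeta>) / (1 + \<zeta>) \<le> L J'"
      using LJ \<zeta>(1) L_cmult[OF fs_real_linf[OF J_fsr], of "1 / (1 + \<zeta>)"] by (simp add: J'_def[abs_def] divide_right_mono)
    have fJ: "fs_real (\<lambda>r. f k\<^sub>0 (p \<otimes> r) * J r)" "fs_real (\<lambda>r. f k\<^sub>0 (p \<otimes> r) * J' r)" if "p \<in> carrier G" for p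
      using that by (intro fs_real_mult fs_real_left f_fsr J_fsr J'_fsr; simp)+
    \<comment> \<open>For each \<open>r\<close>, the average of
      \<open>f k\<^sub>0 (t \<otimes> r)\<close> over \<open>ts\<close> is at least
      \<open>\<alpha> - \<zeta>\<close>; after integrating against \<open>J'\<close>, some single
      \<open>t\<close> does at least as well as the average.\<close>
    obtain t where t: "t \<in> carrier G" "\<gamma> \<le> L (\<lambda>r. f k\<^sub>0 (t \<otimes> r) * J' r)"
    proof -
      obtain ts where ts: "glist G ts" "\<And>g. g \<in> carrier G \<Longrightarrow> \<bar>ravg (\<lambda>t. f k\<^sub>0 (t \<otimes> g)) ts - L (f k\<^sub>0)\<bar> \<le> \<zeta>"
        using L_lavg[OF f_fsr \<zeta>(1)] by blast
      have tsG: "t \<in> carrier G" if "t \<in> set ts" for t using ts(1) that by (auto simp: glist_def)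
      have "\<gamma> < (\<alpha> - \<zeta>) * ((\<beta> - \<zeta>) / (1 + \<zeta>))" using \<zeta>(4) by simp
      also have "\<dots> \<le> (\<alpha> - \<zeta>) * L J'" using LJ' \<zeta>(2) by (intro mult_left_mono) auto
      also have "\<dots> = L (\<lambda>r. (\<alpha> - \<zeta>) * J' r)" by (rule L_cmult[OF fs_real_linf[OF J'_fsr], symmetric])
      also have "\<dots> \<le> L (\<lambda>r. ravg (\<lambda>t. f k\<^sub>0 (t \<otimes> r) * J' r) ts)"
      proof (rule L_mono)
        show "creal G (\<lambda>r. (\<alpha> - \<zeta>) * J' r) \<in> linf G" by (intro fs_real_linf fs_real_cmult J'_fsr)
        show "creal G (\<lambda>r. ravg (\<lambda>t. f k\<^sub>0 (t \<otimes> r) * J' r) ts) \<in> linf G"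
          by (rule creal_ravg[OF star_space_linf mean_\<Lambda>]) (intro fs_real_linf fJ tsG)
        fix r assume r: "r \<in> carrier G"
        have "\<alpha> - \<zeta> \<le> ravg (\<lambda>t. f k\<^sub>0 (t \<otimes> r)) ts" using ts(2)[OF r] f_large[of k\<^sub>0]
          by (simp add: abs_le_iff)
        then have "(\<alpha> - \<zeta>) * J' r \<le> ravg (\<lambda>t. f k\<^sub>0 (t \<otimes> r)) ts * J' r" using J'01[OF r]
          by (intro mult_right_mono) auto
        also have "\<dots> = ravg (\<lambda>t. f k\<^sub>0 (t \<otimes> r) * J' r) ts"
          using ravg_cmult[of "J' r" "\<lambda>t. f k\<^sub>0 (t \<otimes> r)" ts] by (simp add: mult.commute)
        finally show "(\<alpha> - \<zeta>) * J' r \<le> ravg (\<lambda>t. f k\<^sub>0 (t \<otimes> r) * J' r) ts" .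
      qed
      also have "\<dots> = ravg (\<lambda>t. L (\<lambda>r. f k\<^sub>0 (t \<otimes> r) * J' r)) ts"
        by (rule real_mean_ravg[OF star_space_linf mean_\<Lambda>]) (intro fs_real_linf fJ tsG)
      finally have lt: "\<gamma> < ravg (\<lambda>t. L (\<lambda>r. f k\<^sub>0 (t \<otimes> r) * J' r)) ts" .
      have "\<exists>t\<in>set ts. \<gamma> < L (\<lambda>r. f k\<^sub>0 (t \<otimes> r) * J' r)"
      proof (rule ccontr)
        assume "\<not> ?thesis"
        then have "ravg (\<lambda>t. L (\<lambda>r. f k\<^sub>0 (t \<otimes> r) * J' r)) ts \<le> ravg (\<lambda>_. \<gamma>) ts"
          by (intro ravg_mono) (auto simp: not_less)
        then show False using lt ts(1) by (simp add: ravg_const glist_def)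
      qed
      then show thesis using that tsG less_imp_le by blast
    qed
    obtain Y where Y: "finite Y" "Y \<subseteq> carrier G" "card Y \<le> N"
      "\<And>w. w \<in> carrier G \<Longrightarrow> \<exists>y\<in>Y. \<exists>p\<in>carrier G. \<epsilon> < L (\<lambda>r. f k\<^sub>0 (p \<otimes> r) * J' r) \<and> w = y \<otimes> p"
    proof (rule covering[OF f_fsr[of k\<^sub>0] _ J'_fsr J'01 t(1) \<epsilon>(1) t(2) \<gamma>0 \<epsilon>(2)[unfolded M'_def]])
      show "0 \<le> f k\<^sub>0 g \<and> f k\<^sub>0 g \<le> 1" for g using f01 by simp
    qed (assumption, rule that)
    define P where "P = {p \<in> carrier G. \<epsilon> < L (\<lambda>r. f k\<^sub>0 (p \<otimes> r) * J' r)}"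
    \<comment> \<open>The smoothing is undone: \<open>q (inv s \<otimes> r)\<close> is concentrated
      near \<open>r = s\<close>, where replacing \<open>f k\<^sub>0 (p \<otimes> r)\<close> by
      \<open>f k\<^sub>0 (p \<otimes> s)\<close> costs at most \<open>C'\<close> times the mean of
      \<open>q r * \<rho> r \<one>\<close>, hence at most \<open>\<epsilon> / 4\<close>.\<close>
    have uP: "3 / 4 * \<epsilon> < u p" if p: "p \<in> P" for p
    proof -
      have pG: "p \<in> carrier G" using p by (simp add: P_def)
      have "\<epsilon> < L (\<lambda>r. f k\<^sub>0 (p \<otimes> r) * J' r)" using p by (simp add: P_def)
      also have "\<dots> \<le> L (\<lambda>r. f k\<^sub>0 (p \<otimes> r) * J r)"
      proof (rule L_mono[OF fs_real_linf[OF fJ(2)[OF pG]] fs_real_linf[OF fJ(1)[OF pG]]])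
        fix r assume r: "r \<in> carrier G"
        have "J' r \<le> J r" using J0[OF r] \<zeta>(1)
          by (simp add: J'_def divide_le_eq mult_left_le_one_le algebra_simps)
        then show "f k\<^sub>0 (p \<otimes> r) * J' r \<le> f k\<^sub>0 (p \<otimes> r) * J r" using f01 by (intro mult_left_mono) auto
      qed
      also have "\<dots> = L (\<lambda>r. ravg (\<lambda>s. b s * (f k\<^sub>0 (p \<otimes> r) * q (inv s \<otimes> r))) ss)"
      proof (rule real_mean_cong)
        show "f k\<^sub>0 (p \<otimes> r) * J r = ravg (\<lambda>s. b s * (f k\<^sub>0 (p \<otimes> r) * q (inv s \<otimes> r))) ss" for r
          unfolding J_def ravg_cmult[symmetric] by (simp add: mult.left_commute)
      qed
      also have "\<dots> = ravg (\<lambda>s. L (\<lambda>r. b s * (f k\<^sub>0 (p \<otimes> r) * q (inv s \<otimes> r)))) ss"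
        by (rule real_mean_ravg[OF star_space_linf mean_\<Lambda>]) (intro fs_real_linf fs_real_cmult fs_real_mult fs_real_left[OF f_fsr pG] q_left)
      also have "\<dots> \<le> ravg (\<lambda>s. f k\<^sub>0 (p \<otimes> s) * b s + \<epsilon> / 4) ss"
      proof (rule ravg_mono)
        fix s assume s: "s \<in> set ss"
        have sG: "s \<in> carrier G" using ssG s by auto
        have fq: "fs_real (\<lambda>r. f k\<^sub>0 (p \<otimes> r) * q (inv s \<otimes> r))"
          by (intro fs_real_mult fs_real_left[OF f_fsr pG] q_left s)
        have "L (\<lambda>r. f k\<^sub>0 (p \<otimes> r) * q (inv s \<otimes> r)) = L (\<lambda>r. f k\<^sub>0 (p \<otimes> (s \<otimes> r)) * q (inv s \<otimes> (s \<otimes> r)))"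
          by (rule L_left[OF fq sG, symmetric])
        also have "\<dots> \<le> L (\<lambda>r. f k\<^sub>0 (p \<otimes> s) * q r + C' * (q r * \<rho> r \<one>))"
        proof (rule L_mono)
          show "creal G (\<lambda>r. f k\<^sub>0 (p \<otimes> (s \<otimes> r)) * q (inv s \<otimes> (s \<otimes> r))) \<in> linf G"
            by (rule fs_real_linf[OF fs_real_left[OF fq sG]])
          have \<rho>_linf: "creal G (\<lambda>r. \<rho> r \<one>) \<in> linf G"
            by (rule creal_linfI[where C = R]) (simp add: \<rho>_bound \<rho>_nonneg)
          show "creal G (\<lambda>r. f k\<^sub>0 (p \<otimes> s) * q r + C' * (q r * \<rho> r \<one>)) \<in> linf G"
            unfolding creal_add creal_scale[of G "f k\<^sub>0 (p \<otimes> s)"] creal_scale[of G C']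
            by (intro star_spaceD(3,4)[OF star_space_linf] bounded_mult_linf \<rho>_linf fs_real_linf q(1))
          fix r assume r: "r \<in> carrier G"
          have "\<rho> (p \<otimes> (s \<otimes> r)) (p \<otimes> s) = \<rho> r \<one>"
            using \<rho>_left[of r \<one> "p \<otimes> s"] pG sG r by (simp add: m_assoc)
          then have "f k\<^sub>0 (p \<otimes> (s \<otimes> r)) \<le> f k\<^sub>0 (p \<otimes> s) + C' * \<rho> r \<one>"
            using f_lip[of "p \<otimes> (s \<otimes> r)" "p \<otimes> s"] pG sG r by (simp add: abs_le_iff)
          then have "f k\<^sub>0 (p \<otimes> (s \<otimes> r)) * q r \<le> (f k\<^sub>0 (p \<otimes> s) + C' * \<rho> r \<one>) * q r"
            using q(2)[OF r] by (rule mult_right_mono)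
          moreover have "inv s \<otimes> (s \<otimes> r) = r" using sG r by (simp flip: m_assoc)
          ultimately show "f k\<^sub>0 (p \<otimes> (s \<otimes> r)) * q (inv s \<otimes> (s \<otimes> r)) \<le> f k\<^sub>0 (p \<otimes> s) * q r + C' * (q r * \<rho> r \<one>)"
            by (simp add: algebra_simps)
        qed
        also have "\<dots> = f k\<^sub>0 (p \<otimes> s) * 1 + C' * L (\<lambda>r. q r * \<rho> r \<one>)"
        proof -
          have \<rho>_linf: "creal G (\<lambda>r. \<rho> r \<one>) \<in> linf G"
            by (rule creal_linfI[where C = R]) (simp add: \<rho>_bound \<rho>_nonneg)
          have q\<rho>: "creal G (\<lambda>r. q r * \<rho> r \<one>) \<in> linf G"
            by (intro bounded_mult_linf \<rho>_linf fs_real_linf q(1))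
          have "creal G (\<lambda>r. C' * (q r * \<rho> r \<one>)) \<in> linf G"
            unfolding creal_scale[of G C'] by (rule star_spaceD(4)[OF star_space_linf q\<rho>])
          then show ?thesis
            by (simp only: L_add[OF fs_real_linf[OF fs_real_cmult[OF q(1)]]] L_cmult[OF fs_real_linf[OF q(1)]] L_cmult[OF q\<rho>] q(3))
        qed
        also have "C' * L (\<lambda>r. q r * \<rho> r \<one>) \<le> C' * \<sigma>" using q(5) C' by (rule mult_left_mono)
        also have "C' * \<sigma> \<le> \<epsilon> / 4" by (rule \<sigma>(2))
        finally have le: "L (\<lambda>r. f k\<^sub>0 (p \<otimes> r) * q (inv s \<otimes> r)) \<le> f k\<^sub>0 (p \<otimes> s) + \<epsilon> / 4" by simp
        have "L (\<lambda>r. b s * (f k\<^sub>0 (p \<otimes> r) * q (inv s \<otimes> r))) = b s * L (\<lambda>r. f k\<^sub>0 (p \<otimes> r) * q (inv s \<otimes> r))"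
          by (rule L_cmult[OF fs_real_linf[OF fq]])
        also have "\<dots> \<le> b s * (f k\<^sub>0 (p \<otimes> s) + \<epsilon> / 4)" using le b01 by (intro mult_left_mono) auto
        also have "\<dots> \<le> f k\<^sub>0 (p \<otimes> s) * b s + \<epsilon> / 4"
          using b01[of s] \<epsilon>(1) mult_left_le_one_le[of "\<epsilon> / 4" "b s"] by (simp add: algebra_simps)
        finally show "L (\<lambda>r. b s * (f k\<^sub>0 (p \<otimes> r) * q (inv s \<otimes> r))) \<le> f k\<^sub>0 (p \<otimes> s) * b s + \<epsilon> / 4" .
      qed
      also have "\<dots> = u p + \<epsilon> / 4"
        using ravg_diff[of "\<lambda>s. f k\<^sub>0 (p \<otimes> s) * b s" "\<lambda>_. - \<epsilon> / 4" ss] sh(1) by (simp add: u_def ravg_const glist_def)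
      finally show ?thesis by simp
    qed
    \<comment> \<open>The Lipschitz bound takes another \<open>\<epsilon> / 4\<close>, which leaves
      more than \<open>\<epsilon> / 2\<close>, the threshold passed to
      \<open>finite_stage\<close>.\<close>
    have "g \<otimes> h \<in> A <#> B" if g: "g \<in> F" and p: "p \<in> P" and close: "\<Delta> g p < \<sigma>" for g p
    proof -
      have gp: "g \<in> carrier G" "p \<in> carrier G" using g F p by (auto simp: P_def)
      have "u p - u g = ravg (\<lambda>s. (f k\<^sub>0 (p \<otimes> s) - f k\<^sub>0 (g \<otimes> s)) * b s) ss"
        unfolding u_def ravg_diff[symmetric] by (simp add: left_diff_distrib)
      also have "\<dots> \<le> ravg (\<lambda>_. \<epsilon> / 4) ss"
      proof (rule ravg_mono)
        fix s assume s: "s \<in> set ss"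
        have "\<bar>f k\<^sub>0 (p \<otimes> s) - f k\<^sub>0 (g \<otimes> s)\<bar> \<le> C' * \<rho> (p \<otimes> s) (g \<otimes> s)" using gp ssG[OF s]
          by (intro f_lip) auto
        also have "\<dots> \<le> C' * \<Delta> g p" using gp ssG[OF s] \<rho>_le_\<Delta>[of p g s] \<Delta>_commute[of p g] C'
          by (intro mult_left_mono) auto
        also have "\<dots> \<le> C' * \<sigma>" using close C' by (intro mult_left_mono) auto
        finally have "\<bar>f k\<^sub>0 (p \<otimes> s) - f k\<^sub>0 (g \<otimes> s)\<bar> \<le> \<epsilon> / 4" using \<sigma>(2) by simp
        then have "\<bar>(f k\<^sub>0 (p \<otimes> s) - f k\<^sub>0 (g \<otimes> s)) * b s\<bar> \<le> (\<epsilon> / 4) * 1"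
          unfolding abs_mult using b01[of s] \<epsilon>(1) by (intro mult_mono) auto
        then show "(f k\<^sub>0 (p \<otimes> s) - f k\<^sub>0 (g \<otimes> s)) * b s \<le> \<epsilon> / 4" by (simp add: abs_le_iff)
      qed
      also have "\<dots> = \<epsilon> / 4" using sh(1) by (simp add: ravg_const glist_def)
      finally have "\<epsilon> / 2 < u g" using uP[OF p] by simp
      then show ?thesis using sh(4)[OF g] by (simp add: u_def b_def)
    qed
    moreover have "\<forall>w\<in>carrier G. \<exists>y\<in>Y. \<exists>p\<in>P. w = y \<otimes> p" using Y(4) unfolding P_def by blast
    moreover have "P \<subseteq> carrier G" by (auto simp: P_def)
    ultimately show ?thesis using sh(2) Y(1-3) by blast
  qed
  show thesis by (rule that[OF biinvariant_metric \<sigma>(1) stage])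
qed

end

section \<open>From finite sets to thick sets and compact groups\<close>

context biinvariant_metric
begin

text \<open>Rounding to a finite net leaves finitely many patterns \<open>(P, h, Y)\<close>.  The set \<open>T\<close> collects those
  members of an exhaustion of \<open>G\<close> by finite sets that share a pattern occurring infinitely often.\<close>

lemma stages_thick:
  assumes cnt: "countable (carrier G)" and \<tau>: "\<tau> > 0"
    and stages: "\<And>F. \<lbrakk>finite F; F \<subseteq> carrier G\<rbrakk> \<Longrightarrow> \<exists>h Y P. h \<in> carrier G \<and> finite Y \<and> Y \<subseteq> carrier G \<and>
      card Y \<le> N \<and> P \<subseteq> carrier G \<and> (\<forall>w\<in>carrier G. \<exists>y\<in>Y. \<exists>p\<in>P. w = y \<otimes> p) \<and>
      (\<forall>g\<in>F. \<forall>p\<in>P. \<Delta> g p < \<tau> \<longrightarrow> g \<otimes> h \<in> C)"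
  obtains Q Y T r where "finite Q" "Q \<subseteq> carrier G" "finite Y" "Y \<subseteq> carrier G" "card Y \<le> N" "r > 0"
    "right_thick G T" "\<And>w. w \<in> carrier G \<Longrightarrow> \<exists>y\<in>Y. \<exists>p\<in>Q. \<Delta> w (y \<otimes> p) \<le> r / 2"
    "\<And>g p. \<lbrakk>g \<in> T; p \<in> Q; \<Delta> g p < r\<rbrakk> \<Longrightarrow> g \<in> C"
proof -
  \<comment> \<open>The last estimate adds the radius \<open>4 t\<close>, one \<open>t\<close> for
    rounding \<open>h n\<close> and one for a point of \<open>P n\<close>, which makes
    \<open>\<tau>\<close>. The covering loses \<open>t\<close> for rounding \<open>y\<close> and
    \<open>t\<close> for rounding \<open>p\<close>, that is, half of the radius.\<close>
  define t where "t = \<tau> / 6"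
  have t: "t > 0" using \<tau> by (simp add: t_def)
  obtain E where E: "finite E" "E \<subseteq> carrier G" "\<And>x. x \<in> carrier G \<Longrightarrow> \<exists>e\<in>E. \<Delta> x e < t"
    using tot_bdd_net[OF \<Delta>_tb t] by blast
  define rnd where "rnd x = (SOME e. e \<in> E \<and> \<Delta> x e < t)" for x
  have rnd: "rnd x \<in> E" "rnd x \<in> carrier G" "\<Delta> x (rnd x) < t" if "x \<in> carrier G" for x
    using someI_ex[of "\<lambda>e. e \<in> E \<and> \<Delta> x e < t"] E(3)[OF that] E(2) unfolding rnd_def by blast+
  define F where "F n = from_nat_into (carrier G) ` {..n}" for n :: nat
  have FG: "F n \<subseteq> carrier G" for n unfolding F_def using from_nat_into[of "carrier G"] one_closed by auto
  define R where "R n h Y P \<longleftrightarrow> h \<in> carrier G \<and> finite Y \<and> Y \<subseteq> carrier G \<and> card Y \<le> N \<and> P \<subseteq> carrier G \<and>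
      (\<forall>w\<in>carrier G. \<exists>y\<in>Y. \<exists>p\<in>P. w = y \<otimes> p) \<and> (\<forall>g\<in>F n. \<forall>p\<in>P. \<Delta> g p < \<tau> \<longrightarrow> g \<otimes> h \<in> C)" for n h Y P
  have "\<exists>h Y P. R n h Y P" for n unfolding R_def by (rule stages[OF _ FG]) (simp add: F_def)
  then obtain h Y P where R: "\<And>n. R n (h n) (Y n) (P n)" by metis
  have S: "h n \<in> carrier G" "finite (Y n)" "Y n \<subseteq> carrier G" "card (Y n) \<le> N" "P n \<subseteq> carrier G"
      "w \<in> carrier G \<Longrightarrow> \<exists>y\<in>Y n. \<exists>p\<in>P n. w = y \<otimes> p"
      "\<lbrakk>g \<in> F n; p \<in> P n; \<Delta> g p < \<tau>\<rbrakk> \<Longrightarrow> g \<otimes> h n \<in> C" for n w g p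
    using R[of n] unfolding R_def by blast+
  \<comment> \<open>Of \<open>P n\<close> only the net points near it are recorded; they determine
    it up to \<open>t\<close>, and there are finitely many possible records.\<close>
  define cd where "cd n = ({e \<in> E. \<exists>p\<in>P n. \<Delta> p e < t}, rnd (h n), rnd ` Y n)" for n
  have "range cd \<subseteq> Pow E \<times> E \<times> Pow E" using rnd(1)[OF S(1)] rnd(1) S(3) by (auto simp: cd_def)
  then have "finite (range cd)" using E(1) by (meson finite_SigmaI finite_Pow_iff finite_subset)
  then obtain n\<^sub>0 where n\<^sub>0: "infinite {n \<in> UNIV. cd n = cd n\<^sub>0}"
    using pigeonhole_infinite[of UNIV cd] by auto
  define I where "I = {n. cd n = cd n\<^sub>0}"
  have I: "infinite I" using n\<^sub>0 by (simp add: I_def)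
  define V where "V = {e \<in> E. \<exists>p\<in>P n\<^sub>0. \<Delta> p e < t}"
  define e\<^sub>0 where "e\<^sub>0 = rnd (h n\<^sub>0)"
  have e\<^sub>0: "e\<^sub>0 \<in> carrier G" unfolding e\<^sub>0_def by (rule rnd(2)[OF S(1)])
  have VG: "V \<subseteq> carrier G" using E(2) by (auto simp: V_def)
  have inI: "V = {e \<in> E. \<exists>p\<in>P n. \<Delta> p e < t}" "e\<^sub>0 = rnd (h n)" if "n \<in> I" for n
    using that by (auto simp: I_def cd_def V_def e\<^sub>0_def)
  define T where "T = (\<Union>n\<in>I. F n #> h n)"
  show thesis
  proof (rule that[of "(\<lambda>p. p \<otimes> e\<^sub>0) ` V" "rnd ` Y n\<^sub>0" "4 * t" T])
    show "finite ((\<lambda>p. p \<otimes> e\<^sub>0) ` V)" using E(1) by (simp add: V_def)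
    show "(\<lambda>p. p \<otimes> e\<^sub>0) ` V \<subseteq> carrier G" using VG e\<^sub>0 by auto
    show "finite (rnd ` Y n\<^sub>0)" using S(2) by simp
    show "rnd ` Y n\<^sub>0 \<subseteq> carrier G" using rnd(2) S(3) by auto
    show "card (rnd ` Y n\<^sub>0) \<le> N" using card_image_le[OF S(2)] S(4) le_trans by blast
    show "0 < 4 * t" using t by simp
    show "right_thick G T"
      unfolding right_thick_def
    proof (intro conjI allI impI)
      show "T \<subseteq> carrier G" unfolding T_def using r_coset_subset_G[OF FG S(1)] by blast
      fix X assume X: "finite X \<and> X \<subseteq> carrier G"
      define c where "c = to_nat_on (carrier G)"
      obtain m where m: "\<And>x. x \<in> X \<Longrightarrow> c x \<le> m"
        using X finite_nat_set_iff_bounded_le[of "c ` X"] by auto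
      obtain n where n: "n \<in> I" "n \<ge> m" using I infinite_nat_iff_unbounded_le[of I] by blast
      have "X \<subseteq> F n"
      proof
        fix x assume x: "x \<in> X"
        then have "from_nat_into (carrier G) (c x) = x" using X cnt by (auto simp: c_def)
        then show "x \<in> F n" unfolding F_def using m[OF x] n(2) by (metis atMost_iff image_eqI le_trans)
      qed
      then have "X #> h n \<subseteq> T" using n(1) unfolding T_def r_coset_def by blast
      then show "\<exists>g\<in>carrier G. X #> g \<subseteq> T" using S(1) by blast
    qed
    show "\<exists>y\<in>rnd ` Y n\<^sub>0. \<exists>p\<in>(\<lambda>p. p \<otimes> e\<^sub>0) ` V. \<Delta> w (y \<otimes> p) \<le> 4 * t / 2" if w: "w \<in> carrier G" for w
    proof -
      have "w \<otimes> inv e\<^sub>0 \<in> carrier G" using w e\<^sub>0 by simp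
      from S(6)[OF this, of n\<^sub>0] obtain y p where yp: "y \<in> Y n\<^sub>0" "p \<in> P n\<^sub>0" "w \<otimes> inv e\<^sub>0 = y \<otimes> p"
        by blast
      have G: "y \<in> carrier G" "p \<in> carrier G" using yp S(3,5) by blast+
      note r = rnd[OF G(1)] rnd[OF G(2)]
      have "\<Delta> w (rnd y \<otimes> (rnd p \<otimes> e\<^sub>0)) = \<Delta> (y \<otimes> p \<otimes> e\<^sub>0) (rnd y \<otimes> rnd p \<otimes> e\<^sub>0)"
        using w e\<^sub>0 r by (simp add: yp(3)[symmetric] m_assoc)
      also have "\<dots> = \<Delta> (y \<otimes> p) (rnd y \<otimes> rnd p)" using G r e\<^sub>0 by (intro \<Delta>_right) auto
      also have "\<dots> \<le> \<Delta> (y \<otimes> p) (rnd y \<otimes> p) + \<Delta> (rnd y \<otimes> p) (rnd y \<otimes> rnd p)"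
        using G r by (intro \<Delta>_triangle) auto
      also have "\<dots> = \<Delta> y (rnd y) + \<Delta> p (rnd p)" using G r by (simp add: \<Delta>_left \<Delta>_right)
      also have "\<dots> \<le> 4 * t / 2" using r by simp
      finally have "\<Delta> w (rnd y \<otimes> (rnd p \<otimes> e\<^sub>0)) \<le> 4 * t / 2" .
      moreover have "rnd p \<in> V" using r yp(2) by (auto simp: V_def)
      ultimately show ?thesis using yp(1) by blast
    qed
    show "g \<in> C" if g: "g \<in> T" and p: "p \<in> (\<lambda>p. p \<otimes> e\<^sub>0) ` V" and lt: "\<Delta> g p < 4 * t" for g p
    proof -
      obtain n f where f: "n \<in> I" "f \<in> F n" "g = f \<otimes> h n" using g by (auto simp: T_def r_coset_def)
      obtain v where v: "v \<in> V" "p = v \<otimes> e\<^sub>0" using p by auto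
      then obtain p' where p': "p' \<in> P n" "\<Delta> p' v < t" using inI(1)[OF f(1)] by auto
      have G: "f \<in> carrier G" "v \<in> carrier G" "p' \<in> carrier G" "h n \<in> carrier G"
        using FG f(2) VG v(1) S(1,5) p'(1) by blast+
      have "\<Delta> f v = \<Delta> (f \<otimes> e\<^sub>0) (v \<otimes> e\<^sub>0)" using G e\<^sub>0 by (simp add: \<Delta>_right)
      also have "\<dots> \<le> \<Delta> (f \<otimes> e\<^sub>0) (f \<otimes> h n) + \<Delta> (f \<otimes> h n) (v \<otimes> e\<^sub>0)" using G e\<^sub>0
        by (intro \<Delta>_triangle) auto
      also have "\<Delta> (f \<otimes> e\<^sub>0) (f \<otimes> h n) = \<Delta> (h n) e\<^sub>0" using G e\<^sub>0
        by (simp add: \<Delta>_left \<Delta>_commute[of "h n"])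
      also have "\<Delta> (h n) e\<^sub>0 < t" using rnd(3)[OF G(4)] inI(2)[OF f(1)] by simp
      finally have "\<Delta> f v < 5 * t" using lt f(3) v(2) by simp
      moreover have "\<Delta> f p' \<le> \<Delta> f v + \<Delta> v p'" using G by (intro \<Delta>_triangle)
      moreover have "\<Delta> v p' = \<Delta> p' v" using G by (intro \<Delta>_commute)
      ultimately have "\<Delta> f p' < \<tau>" using p'(2) by (simp add: t_def)
      then show "g \<in> C" using S(7)[OF f(2) p'(1)] f(3) by simp
    qed
  qed
qed

text \<open>The completion of \<open>(G, \<Delta>)\<close> consists of the uniform limits of the functions \<open>\<Delta> g\<close>; the
  group operation extends to them as infimal convolution.\<close>

definition near :: "real \<Rightarrow> ('a \<Rightarrow> real) \<Rightarrow> 'a \<Rightarrow> bool" where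
  "near e p g \<longleftrightarrow> g \<in> carrier G \<and> (\<forall>h. h \<notin> carrier G \<longrightarrow> p h = 0) \<and> (\<forall>h\<in>carrier G. \<bar>p h - \<Delta> g h\<bar> \<le> e)"

definition profile :: "'a \<Rightarrow> 'a \<Rightarrow> real" where
  "profile g = (\<lambda>h. if h \<in> carrier G then \<Delta> g h else 0)"

definition profile_limits :: "('a \<Rightarrow> real) set" where
  "profile_limits = {p. \<forall>e>0. \<exists>g. near e p g}"

text \<open>For the functions \<open>\<Delta> g\<close> and \<open>\<Delta> k\<close> the infimum is
  attained at \<open>m = k\<close> and equals \<open>\<Delta> (g \<otimes> k)\<close>, by the
  triangle inequality and invariance on both sides. The product on the completion is thus an
  explicit formula that involves no choice of approximating sequences.\<close>

definition inf_conv :: "('a \<Rightarrow> real) \<Rightarrow> ('a \<Rightarrow> real) \<Rightarrow> 'a \<Rightarrow> real" where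
  "inf_conv p q = (\<lambda>h. if h \<in> carrier G then INF m\<in>carrier G. p (h \<otimes> inv m) + q m else 0)"

definition reflect :: "('a \<Rightarrow> real) \<Rightarrow> 'a \<Rightarrow> real" where
  "reflect p = (\<lambda>h. if h \<in> carrier G then p (inv h) else 0)"

text \<open>\<open>Metric_space\<close> requires nonnegativity on the whole type, where the supremum may be that of
  an unbounded set; hence the outer absolute value.\<close>

definition sup_dist :: "('a \<Rightarrow> real) \<Rightarrow> ('a \<Rightarrow> real) \<Rightarrow> real" where
  "sup_dist p q = \<bar>SUP h\<in>carrier G. \<bar>p h - q h\<bar>\<bar>"

definition profile_group :: "('a \<Rightarrow> real) monoid" where
  "profile_group = \<lparr>carrier = profile_limits, mult = inf_conv, one = profile \<one>\<rparr>"

lemma nearD: "near e p g \<Longrightarrow> g \<in> carrier G"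
    "\<lbrakk>near e p g; h \<notin> carrier G\<rbrakk> \<Longrightarrow> p h = 0"
    "\<lbrakk>near e p g; h \<in> carrier G\<rbrakk> \<Longrightarrow> \<bar>p h - \<Delta> g h\<bar> \<le> e"
  by (auto simp: near_def)

lemma near_mono: "\<lbrakk>near e p g; e \<le> f\<rbrakk> \<Longrightarrow> near f p g"
  by (force simp: near_def)

lemma near_profile: "\<lbrakk>g \<in> carrier G; 0 \<le> e\<rbrakk> \<Longrightarrow> near e (profile g) g"
  by (auto simp: near_def profile_def)

lemma profile_in: "g \<in> carrier G \<Longrightarrow> profile g \<in> profile_limits"
  using near_profile by (auto simp: profile_limits_def intro: less_imp_le)

lemma profile_limitsE:
  assumes "p \<in> profile_limits" "e > 0"
  obtains g where "near e p g"
  using assms by (auto simp: profile_limits_def)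

lemma near_inf_conv:
  assumes p: "near e p g" and q: "near f q k"
  shows "near (e + f) (inf_conv p q) (g \<otimes> k)"
  unfolding near_def
proof (intro conjI allI impI ballI)
  note G = nearD(1)[OF p] nearD(1)[OF q]
  show "g \<otimes> k \<in> carrier G" using G by simp
  show "inf_conv p q h = 0" if "h \<notin> carrier G" for h using that by (simp add: inf_conv_def)
  fix h assume h: "h \<in> carrier G"
  have lower: "\<Delta> (g \<otimes> k) h - (e + f) \<le> p (h \<otimes> inv m) + q m" if m: "m \<in> carrier G" for m
  proof -
    have "\<Delta> (g \<otimes> k) h \<le> \<Delta> (g \<otimes> k) (g \<otimes> m) + \<Delta> (g \<otimes> m) h" using G h m by (intro \<Delta>_triangle) auto
    also have "\<Delta> (g \<otimes> k) (g \<otimes> m) = \<Delta> k m" using G m by (intro \<Delta>_left)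
    also have "\<Delta> (g \<otimes> m) h = \<Delta> g (h \<otimes> inv m)"
      using \<Delta>_right[of g "h \<otimes> inv m" m] G m h by (simp add: m_assoc)
    finally show ?thesis
      using nearD(3)[OF p, of "h \<otimes> inv m"] nearD(3)[OF q m] h m by (simp add: abs_le_iff)
  qed
  have "\<Delta> (g \<otimes> k) h - (e + f) \<le> inf_conv p q h"
    using h lower one_closed by (auto simp: inf_conv_def intro!: cINF_greatest)
  moreover have "inf_conv p q h \<le> \<Delta> (g \<otimes> k) h + (e + f)"
  proof -
    have "inf_conv p q h \<le> p (h \<otimes> inv k) + q k"
      using h lower G(2) by (auto simp: inf_conv_def intro!: cINF_lower bdd_belowI2)
    moreover have "\<Delta> (g \<otimes> k) h = \<Delta> g (h \<otimes> inv k)"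
      using \<Delta>_right[of g "h \<otimes> inv k" k] G h by (simp add: m_assoc)
    ultimately show ?thesis
      using nearD(3)[OF p, of "h \<otimes> inv k"] nearD(3)[OF q G(2)] \<Delta>_self[OF G(2)] h G by (simp add: abs_le_iff)
  qed
  ultimately show "\<bar>inf_conv p q h - \<Delta> (g \<otimes> k) h\<bar> \<le> e + f" by (simp add: abs_le_iff)
qed

lemma near_reflect:
  assumes p: "near e p g"
  shows "near e (reflect p) (inv g)"
proof -
  note G = nearD(1)[OF p]
  have "\<Delta> (inv g) h = \<Delta> g (inv h)" if h: "h \<in> carrier G" for h
  proof -
    have "\<Delta> (inv g) h = \<Delta> (g \<otimes> inv g) (g \<otimes> h)" using G h by (simp only: \<Delta>_left inv_closed)
    also have "\<dots> = \<Delta> (\<one> \<otimes> inv h) (g \<otimes> h \<otimes> inv h)" using G h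
      by (simp only: \<Delta>_right r_inv one_closed inv_closed m_closed)
    also have "\<dots> = \<Delta> g (inv h)" using G h by (simp add: m_assoc \<Delta>_commute)
    finally show ?thesis .
  qed
  then show ?thesis using p by (auto simp: near_def reflect_def)
qed

text \<open>The criterion behind all group laws of the completion: both sides are arbitrarily close
  to the same element of \<open>G\<close>.\<close>

lemma near_eqI:
  assumes "\<And>e. e > 0 \<Longrightarrow> \<exists>g. near e p g \<and> near e q g"
  shows "p = q"
proof
  fix h
  show "p h = q h"
  proof (cases "h \<in> carrier G")
    case True
    have "\<bar>p h - q h\<bar> \<le> 0 + e" if "e > 0" for e
    proof -
      obtain g where g: "near (e / 2) p g" "near (e / 2) q g" using assms[of "e / 2"] \<open>e > 0\<close> by auto
      show ?thesis using nearD(3)[OF g(1) True] nearD(3)[OF g(2) True] by linarith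
    qed
    then have "\<bar>p h - q h\<bar> \<le> 0" by (rule field_le_epsilon)
    then show ?thesis by simp
  next
    case False
    obtain g where "near 1 p g" "near 1 q g" using assms[of 1] by auto
    then show ?thesis using False by (simp add: nearD(2))
  qed
qed

text \<open>The upper bound is the triangle inequality; the lower one comes from evaluating at
  \<open>h = k\<close>, where \<open>\<Delta> k\<close> vanishes.\<close>

lemma sup_dist_near:
  assumes p: "near e p g" and q: "near f q k"
  shows "\<bar>sup_dist p q - \<Delta> g k\<bar> \<le> e + f"
proof -
  note G = nearD(1)[OF p] nearD(1)[OF q]
  have upper: "\<bar>p h - q h\<bar> \<le> \<Delta> g k + (e + f)" if h: "h \<in> carrier G" for h
    using nearD(3)[OF p h] nearD(3)[OF q h] \<Delta>_triangle[OF G h] \<Delta>_triangle[OF G(2,1) h] \<Delta>_commute[OF G]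
    by (simp add: abs_le_iff)
  define S where "S = (SUP h\<in>carrier G. \<bar>p h - q h\<bar>)"
  have "S \<le> \<Delta> g k + (e + f)" unfolding S_def using upper one_closed by (intro cSUP_least) auto
  moreover have "\<bar>p k - q k\<bar> \<le> S" unfolding S_def using upper G(2) by (intro cSUP_upper bdd_aboveI2) auto
  ultimately show ?thesis
    using nearD(3)[OF p G(2)] nearD(3)[OF q G(2)] \<Delta>_self[OF G(2)] by (simp add: sup_dist_def abs_le_iff flip: S_def)
qed

lemma sup_dist_upper:
  assumes "p \<in> profile_limits" "q \<in> profile_limits" "h \<in> carrier G"
  shows "\<bar>p h - q h\<bar> \<le> sup_dist p q"
proof -
  obtain g where p: "near 1 p g" using profile_limitsE[OF assms(1), of 1] by auto
  obtain k where q: "near 1 q k" using profile_limitsE[OF assms(2), of 1] by auto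
  note G = nearD(1)[OF p] nearD(1)[OF q]
  have "\<bar>p h - q h\<bar> \<le> \<Delta> g k + 2" if h: "h \<in> carrier G" for h
    using nearD(3)[OF p h] nearD(3)[OF q h] \<Delta>_triangle[OF G h] \<Delta>_triangle[OF G(2,1) h] \<Delta>_commute[OF G]
    by (simp add: abs_le_iff)
  then have "\<bar>p h - q h\<bar> \<le> (SUP h\<in>carrier G. \<bar>p h - q h\<bar>)"
    using assms(3) by (intro cSUP_upper bdd_aboveI2) auto
  then show ?thesis by (simp add: sup_dist_def)
qed

lemma sup_dist_profile: "\<lbrakk>g \<in> carrier G; k \<in> carrier G\<rbrakk> \<Longrightarrow> sup_dist (profile g) (profile k) = \<Delta> g k"
  using sup_dist_near[OF near_profile near_profile, of g 0 k 0] by simp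

lemma inf_conv_closed:
  assumes "p \<in> profile_limits" "q \<in> profile_limits"
  shows "inf_conv p q \<in> profile_limits"
  unfolding profile_limits_def
proof (intro CollectI allI impI)
  fix e :: real assume e: "e > 0"
  obtain g where g: "near (e / 2) p g" using profile_limitsE[OF assms(1), of "e / 2"] e by auto
  obtain k where k: "near (e / 2) q k" using profile_limitsE[OF assms(2), of "e / 2"] e by auto
  from near_inf_conv[OF g k] show "\<exists>g. near e (inf_conv p q) g" by auto
qed

lemma group_profile_group: "group profile_group"
proof (rule groupI)
  show "x \<otimes>\<^bsub>profile_group\<^esub> y \<in> carrier profile_group"
    if "x \<in> carrier profile_group" "y \<in> carrier profile_group" for x y
    using that inf_conv_closed by (simp add: profile_group_def)
  show "\<one>\<^bsub>profile_group\<^esub> \<in> carrier profile_group" by (simp add: profile_group_def profile_in)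
next
  fix p q r assume "p \<in> carrier profile_group" "q \<in> carrier profile_group" "r \<in> carrier profile_group"
  then have pqr: "p \<in> profile_limits" "q \<in> profile_limits" "r \<in> profile_limits"
    by (simp_all add: profile_group_def)
  have "inf_conv (inf_conv p q) r = inf_conv p (inf_conv q r)"
  proof (rule near_eqI)
    fix e :: real assume "e > 0"
    then have e: "e / 3 > 0" by simp
    obtain g where g: "near (e / 3) p g" by (rule profile_limitsE[OF pqr(1) e])
    obtain k where k: "near (e / 3) q k" by (rule profile_limitsE[OF pqr(2) e])
    obtain m where m: "near (e / 3) r m" by (rule profile_limitsE[OF pqr(3) e])
    have "near e (inf_conv (inf_conv p q) r) (g \<otimes> k \<otimes> m)"
      by (rule near_mono[OF near_inf_conv[OF near_inf_conv[OF g k] m]]) simp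
    moreover have "near e (inf_conv p (inf_conv q r)) (g \<otimes> (k \<otimes> m))"
      by (rule near_mono[OF near_inf_conv[OF g near_inf_conv[OF k m]]]) simp
    moreover have "g \<otimes> k \<otimes> m = g \<otimes> (k \<otimes> m)" using nearD(1)[OF g] nearD(1)[OF k] nearD(1)[OF m]
      by (rule m_assoc)
    ultimately show "\<exists>g. near e (inf_conv (inf_conv p q) r) g \<and> near e (inf_conv p (inf_conv q r)) g"
      by auto
  qed
  then show "p \<otimes>\<^bsub>profile_group\<^esub> q \<otimes>\<^bsub>profile_group\<^esub> r = p \<otimes>\<^bsub>profile_group\<^esub> (q \<otimes>\<^bsub>profile_group\<^esub> r)"
    by (simp add: profile_group_def)
next
  fix p assume "p \<in> carrier profile_group"
  then have p: "p \<in> profile_limits" by (simp add: profile_group_def)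
  have "inf_conv (profile \<one>) p = p"
  proof (rule near_eqI)
    fix e :: real assume e: "e > 0"
    obtain g where g: "near e p g" by (rule profile_limitsE[OF p e])
    have "near e (inf_conv (profile \<one>) p) g"
      using near_inf_conv[OF near_profile[of \<one> 0] g] nearD(1)[OF g] by simp
    with g show "\<exists>g. near e (inf_conv (profile \<one>) p) g \<and> near e p g" by blast
  qed
  then show "\<one>\<^bsub>profile_group\<^esub> \<otimes>\<^bsub>profile_group\<^esub> p = p" by (simp add: profile_group_def)
  have "inf_conv (reflect p) p = profile \<one>"
  proof (rule near_eqI)
    fix e :: real assume e: "e > 0"
    then have "e / 2 > 0" by simp
    from profile_limitsE[OF p this] obtain g where g: "near (e / 2) p g" .
    have "near e (inf_conv (reflect p) p) \<one>"
      using near_inf_conv[OF near_reflect[OF g] g] nearD(1)[OF g] by simp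
    then show "\<exists>g. near e (inf_conv (reflect p) p) g \<and> near e (profile \<one>) g" using near_profile[of \<one> e] e
      by auto
  qed
  moreover have "reflect p \<in> profile_limits" using p near_reflect by (force simp: profile_limits_def)
  ultimately show "\<exists>q\<in>carrier profile_group. q \<otimes>\<^bsub>profile_group\<^esub> p = \<one>\<^bsub>profile_group\<^esub>"
    by (auto simp: profile_group_def)
qed

text \<open>Invariance on both sides, carried over to the completion; continuity of the product
  follows.\<close>

lemma sup_dist_mult:
  assumes "p \<in> profile_limits" "q \<in> profile_limits" "p' \<in> profile_limits" "q' \<in> profile_limits"
  shows "sup_dist (inf_conv p q) (inf_conv p' q') \<le> sup_dist p p' + sup_dist q q'"
proof (rule field_le_epsilon)
  fix e :: real assume "e > 0"
  then have e: "e / 8 > 0" by simp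
  obtain g where g: "near (e / 8) p g" by (rule profile_limitsE[OF assms(1) e])
  obtain k where k: "near (e / 8) q k" by (rule profile_limitsE[OF assms(2) e])
  obtain g' where g': "near (e / 8) p' g'" by (rule profile_limitsE[OF assms(3) e])
  obtain k' where k': "near (e / 8) q' k'" by (rule profile_limitsE[OF assms(4) e])
  note G = nearD(1)[OF g] nearD(1)[OF k] nearD(1)[OF g'] nearD(1)[OF k']
  have "\<Delta> (g \<otimes> k) (g' \<otimes> k') \<le> \<Delta> (g \<otimes> k) (g' \<otimes> k) + \<Delta> (g' \<otimes> k) (g' \<otimes> k')"
    using G by (intro \<Delta>_triangle) auto
  also have "\<dots> = \<Delta> g g' + \<Delta> k k'" using G by (simp add: \<Delta>_left \<Delta>_right)
  finally show "sup_dist (inf_conv p q) (inf_conv p' q') \<le> sup_dist p p' + sup_dist q q' + e"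
    using sup_dist_near[OF near_inf_conv[OF g k] near_inf_conv[OF g' k']] sup_dist_near[OF g g'] sup_dist_near[OF k k']
    by linarith
qed

lemma Metric_space_profile: "Metric_space profile_limits sup_dist"
proof
  fix p q r :: "'a \<Rightarrow> real"
  have "(SUP h\<in>carrier G. \<bar>p h - q h\<bar>) = (SUP h\<in>carrier G. \<bar>q h - p h\<bar>)"
    by (rule SUP_cong) (simp_all add: abs_minus_commute)
  then show "sup_dist p q = sup_dist q p" by (simp add: sup_dist_def)
  show "0 \<le> sup_dist p q" by (simp add: sup_dist_def)
  show "sup_dist p q = 0 \<longleftrightarrow> p = q" if p: "p \<in> profile_limits" and q: "q \<in> profile_limits"
  proof
    assume "sup_dist p q = 0"
    then have "p h = q h" if "h \<in> carrier G" for h using sup_dist_upper[OF p q that] by simp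
    moreover have "p h = q h" if "h \<notin> carrier G" for h
      using profile_limitsE[OF p, of 1] profile_limitsE[OF q, of 1] nearD(2)[OF _ that] by (metis zero_less_one)
    ultimately show "p = q" by blast
  next
    assume "p = q"
    moreover have "carrier G \<noteq> {}" using one_closed by blast
    ultimately show "sup_dist p q = 0" by (simp add: sup_dist_def)
  qed
  show "sup_dist p r \<le> sup_dist p q + sup_dist q r"
    if p: "p \<in> profile_limits" and q: "q \<in> profile_limits" and r: "r \<in> profile_limits"
  proof (rule field_le_epsilon)
    fix e :: real assume "e > 0"
    then have e: "e / 6 > 0" by simp
    obtain g where g: "near (e / 6) p g" by (rule profile_limitsE[OF p e])
    obtain k where k: "near (e / 6) q k" by (rule profile_limitsE[OF q e])
    obtain m where m: "near (e / 6) r m" by (rule profile_limitsE[OF r e])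
    show "sup_dist p r \<le> sup_dist p q + sup_dist q r + e"
      using sup_dist_near[OF g k] sup_dist_near[OF k m] sup_dist_near[OF g m]
        \<Delta>_triangle[OF nearD(1)[OF g] nearD(1)[OF k] nearD(1)[OF m]] by linarith
  qed
qed

interpretation M: Metric_space profile_limits sup_dist by (rule Metric_space_profile)

abbreviation profile_topology :: "('a \<Rightarrow> real) topology" where
  "profile_topology \<equiv> Metric_space.mtopology profile_limits sup_dist"

text \<open>A Cauchy sequence converges uniformly on \<open>G\<close>, and an element of
  \<open>G\<close> close to a late member is close to the limit, which therefore belongs to
  \<open>profile_limits\<close> again.\<close>

lemma profile_mcomplete: "M.mcomplete"
  unfolding M.mcomplete_def
proof (intro allI impI)
  fix \<sigma> assume c: "M.MCauchy \<sigma>"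
  then have \<sigma>: "\<sigma> n \<in> profile_limits" for n by (auto simp: M.MCauchy_def)
  have cau: "\<exists>N. \<forall>m\<ge>N. \<forall>n\<ge>N. sup_dist (\<sigma> m) (\<sigma> n) < e" if "e > 0" for e
  proof -
    have "\<exists>N. \<forall>m n. N \<le> m \<longrightarrow> N \<le> n \<longrightarrow> sup_dist (\<sigma> m) (\<sigma> n) < e" using c that by (simp add: M.MCauchy_def)
    then show ?thesis by blast
  qed
  define p where "p h = (if h \<in> carrier G then lim (\<lambda>n. \<sigma> n h) else 0)" for h
  have lim: "(\<lambda>n. \<sigma> n h) \<longlonglongrightarrow> p h" if h: "h \<in> carrier G" for h
  proof -
    have "Cauchy (\<lambda>n. \<sigma> n h)"
    proof (rule metric_CauchyI)
      fix e :: real assume "e > 0"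
      from cau[OF this] obtain N where "\<And>m n. \<lbrakk>m \<ge> N; n \<ge> N\<rbrakk> \<Longrightarrow> sup_dist (\<sigma> m) (\<sigma> n) < e" by blast
      then show "\<exists>N. \<forall>m\<ge>N. \<forall>n\<ge>N. dist (\<sigma> m h) (\<sigma> n h) < e"
        using sup_dist_upper[OF \<sigma> \<sigma> h] unfolding dist_real_def by (meson le_less_trans)
    qed
    then have "convergent (\<lambda>n. \<sigma> n h)" by (rule Cauchy_convergent)
    then show ?thesis using h by (simp add: p_def convergent_LIMSEQ_iff)
  qed
  have near_p: "near (2 * e) p g"
    if tail: "\<And>m. m \<ge> n \<Longrightarrow> sup_dist (\<sigma> m) (\<sigma> n) < e" and g: "near e (\<sigma> n) g" for n e g
    unfolding near_def
  proof (intro conjI allI impI ballI)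
    show "g \<in> carrier G" by (rule nearD(1)[OF g])
    show "p h = 0" if "h \<notin> carrier G" for h using that by (simp add: p_def)
    fix h assume h: "h \<in> carrier G"
    have "\<bar>\<sigma> m h - \<Delta> g h\<bar> \<le> 2 * e" if "m \<ge> n" for m
      using tail[OF that] sup_dist_upper[OF \<sigma> \<sigma> h, of m n] nearD(3)[OF g h] by linarith
    moreover have "(\<lambda>n. \<bar>\<sigma> n h - \<Delta> g h\<bar>) \<longlonglongrightarrow> \<bar>p h - \<Delta> g h\<bar>"
      by (intro tendsto_intros lim h)
    ultimately show "\<bar>p h - \<Delta> g h\<bar> \<le> 2 * e" by (intro LIMSEQ_le_const2) auto
  qed
  have p_in: "p \<in> profile_limits"
    unfolding profile_limits_def
  proof (intro CollectI allI impI)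
    fix e :: real assume "e > 0"
    then have e: "e / 2 > 0" by simp
    obtain N where N: "\<And>m. m \<ge> N \<Longrightarrow> sup_dist (\<sigma> m) (\<sigma> N) < e / 2" using cau[OF e] by blast
    obtain g where "near (e / 2) (\<sigma> N) g" by (rule profile_limitsE[OF \<sigma> e])
    from near_p[OF N this] show "\<exists>g. near e p g" by auto
  qed
  have "limitin M.mtopology \<sigma> p sequentially"
    unfolding M.limitin_metric
  proof (intro conjI allI impI)
    fix e :: real assume "e > 0"
    then have e: "e / 4 > 0" by simp
    obtain N where N: "\<And>m n. \<lbrakk>m \<ge> N; n \<ge> N\<rbrakk> \<Longrightarrow> sup_dist (\<sigma> m) (\<sigma> n) < e / 4" using cau[OF e] by blast
    have "sup_dist (\<sigma> n) p < e" if n: "n \<ge> N" for n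
    proof -
      obtain g where g: "near (e / 4) (\<sigma> n) g" by (rule profile_limitsE[OF \<sigma> e])
      have "near (2 * (e / 4)) p g" by (rule near_p[OF _ g]) (use n N in auto)
      from sup_dist_near[OF g this] \<Delta>_self[OF nearD(1)[OF g]] \<open>e > 0\<close> show ?thesis by linarith
    qed
    then show "\<forall>\<^sub>F n in sequentially. \<sigma> n \<in> profile_limits \<and> sup_dist (\<sigma> n) p < e"
      using \<sigma> unfolding eventually_sequentially by blast
  qed (rule p_in)
  then show "\<exists>x. limitin M.mtopology \<sigma> x sequentially" by (rule exI[of _ p])
qed

lemma sup_dist_near_profile: "\<lbrakk>near e p g; 0 \<le> e\<rbrakk> \<Longrightarrow> sup_dist p (profile g) \<le> e"
  using sup_dist_near[OF _ near_profile[of g 0], of e p g] \<Delta>_self[of g] nearD(1)[of e p g] by auto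

lemma profile_mtotally_bounded: "M.mtotally_bounded profile_limits"
  unfolding M.mtotally_bounded_def
proof (intro allI impI)
  fix e :: real assume "e > 0"
  then have e: "e / 2 > 0" by simp
  obtain E where E: "finite E" "E \<subseteq> carrier G" "\<And>x. x \<in> carrier G \<Longrightarrow> \<exists>k\<in>E. \<Delta> x k < e / 2"
    using tot_bdd_net[OF \<Delta>_tb e] by blast
  have "p \<in> (\<Union>x\<in>profile ` E. M.mball x e)" if p: "p \<in> profile_limits" for p
  proof -
    obtain g where g: "near (e / 2) p g" by (rule profile_limitsE[OF p e])
    note gG = nearD(1)[OF g]
    obtain k where k: "k \<in> E" "\<Delta> g k < e / 2" using E(3)[OF gG] by blast
    have kG: "k \<in> carrier G" using k E by auto
    have "sup_dist (profile k) p < e"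
      using sup_dist_near[OF g near_profile[OF kG order_refl]] k(2) M.commute[of "profile k" p] by linarith
    then show ?thesis using k(1) p profile_in[OF kG] by auto
  qed
  then show "\<exists>K. finite K \<and> K \<subseteq> profile_limits \<and> profile_limits \<subseteq> (\<Union>x\<in>K. M.mball x e)"
    using E(1,2) profile_in by (intro exI[of _ "profile ` E"]) auto
qed

lemma compact_hausdorff_profile_group: "compact_hausdorff_group profile_group profile_topology"
proof -
  interpret K: group profile_group by (rule group_profile_group)
  have car: "carrier profile_group = profile_limits" by (simp add: profile_group_def)
  have mult: "p \<otimes>\<^bsub>profile_group\<^esub> q = inf_conv p q" for p q by (simp add: profile_group_def)
  have closed: "inf_conv p q \<in> profile_limits" if "p \<in> profile_limits" "q \<in> profile_limits" for p q
    using that by (rule inf_conv_closed)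
  have inv: "inv\<^bsub>profile_group\<^esub> p \<in> profile_limits" if "p \<in> profile_limits" for p
    using K.inv_closed[of p] that by (simp add: car)
  \<comment> \<open>Write \<open>inv p\<close> as \<open>inv p * q * inv q\<close> and
    \<open>inv q\<close> as \<open>inv p * p * inv q\<close>; by \<open>sup_dist_mult\<close>
    inversion does not increase distances.\<close>
  have inv_dist: "sup_dist (inv\<^bsub>profile_group\<^esub> p) (inv\<^bsub>profile_group\<^esub> q) \<le> sup_dist p q"
    if p: "p \<in> profile_limits" and q: "q \<in> profile_limits" for p q
  proof -
    let ?p = "inv\<^bsub>profile_group\<^esub> p" and ?q = "inv\<^bsub>profile_group\<^esub> q"
    have "?p = inf_conv (inf_conv ?p q) ?q" "?q = inf_conv (inf_conv ?p p) ?q"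
      using p q inv[OF p] inv[OF q] K.m_assoc[of ?p q ?q] K.l_inv[of p] by (simp_all add: car flip: mult)
    then have "sup_dist ?p ?q = sup_dist (inf_conv (inf_conv ?p q) ?q) (inf_conv (inf_conv ?p p) ?q)"
      by metis
    also have "\<dots> \<le> sup_dist (inf_conv ?p q) (inf_conv ?p p) + sup_dist ?q ?q"
      using p q by (intro sup_dist_mult closed inv)
    also have "\<dots> \<le> (sup_dist ?p ?p + sup_dist q p) + sup_dist ?q ?q"
      using p q by (intro add_right_mono sup_dist_mult inv)
    finally show ?thesis using inv p q by (simp add: M.commute)
  qed
  have "continuous_map (prod_topology M.mtopology M.mtopology) M.mtopology (\<lambda>(x, y). x \<otimes>\<^bsub>profile_group\<^esub> y)"
    unfolding M.continuous_map_to_metric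
  proof (intro ballI allI impI)
    fix z and e :: real assume z: "z \<in> topspace (prod_topology M.mtopology M.mtopology)" and e: "e > 0"
    obtain p q where pq: "z = (p, q)" "p \<in> profile_limits" "q \<in> profile_limits" using z by auto
    let ?U = "M.mball p (e / 2) \<times> M.mball q (e / 2)"
    have "inf_conv p' q' \<in> M.mball (inf_conv p q) e" if "p' \<in> M.mball p (e / 2)" "q' \<in> M.mball q (e / 2)" for p' q'
      using that sup_dist_mult[OF pq(2,3), of p' q'] closed pq by auto
    then have "openin (prod_topology M.mtopology M.mtopology) ?U \<and> z \<in> ?U \<and>
        (\<forall>y\<in>?U. (case y of (x, y) \<Rightarrow> x \<otimes>\<^bsub>profile_group\<^esub> y) \<in> M.mball (case z of (x, y) \<Rightarrow> x \<otimes>\<^bsub>profile_group\<^esub> y) e)"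
      using pq e by (auto simp: openin_prod_Times_iff mult simp del: M.in_mball)
    then show "\<exists>U. openin (prod_topology M.mtopology M.mtopology) U \<and> z \<in> U \<and>
        (\<forall>y\<in>U. (case y of (x, y) \<Rightarrow> x \<otimes>\<^bsub>profile_group\<^esub> y) \<in> M.mball (case z of (x, y) \<Rightarrow> x \<otimes>\<^bsub>profile_group\<^esub> y) e)" by (rule exI[of _ ?U])
  qed
  moreover have "continuous_map M.mtopology M.mtopology (\<lambda>x. inv\<^bsub>profile_group\<^esub> x)"
    unfolding M.continuous_map_to_metric
  proof (intro ballI allI impI)
    fix p and e :: real assume p: "p \<in> topspace M.mtopology" and e: "e > 0"
    have "inv\<^bsub>profile_group\<^esub> q \<in> M.mball (inv\<^bsub>profile_group\<^esub> p) e" if "q \<in> M.mball p e" for q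
    proof -
      have pq: "p \<in> profile_limits" "q \<in> profile_limits" "sup_dist p q < e" using that
        unfolding M.in_mball by blast+
      show ?thesis
        unfolding M.in_mball using le_less_trans[OF inv_dist[OF pq(1,2)] pq(3)] inv[OF pq(1)] inv[OF pq(2)] by blast
    qed
    then show "\<exists>U. openin M.mtopology U \<and> p \<in> U \<and> (\<forall>y\<in>U. inv\<^bsub>profile_group\<^esub> y \<in> M.mball (inv\<^bsub>profile_group\<^esub> p) e)"
      using p e by (intro exI[of _ "M.mball p e"]) auto
  qed
  moreover have "compact_space M.mtopology"
    using M.compact_space_eq_mcomplete_mtotally_bounded profile_mcomplete profile_mtotally_bounded by simp
  ultimately show ?thesis
    unfolding compact_hausdorff_group_def using K.group_axioms M.Hausdorff_space_mtopology by (simp add: car)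
qed

lemma profile_approx:
  assumes "p \<in> profile_limits" "e > 0"
  obtains g where "g \<in> carrier G" "sup_dist p (profile g) < e"
proof -
  have e: "e / 2 > 0" using assms(2) by simp
  obtain g where g: "near (e / 2) p g" by (rule profile_limitsE[OF assms(1) e])
  from sup_dist_near_profile[OF this] e have "sup_dist p (profile g) < e" by simp
  with nearD(1)[OF g] show thesis by (rule that)
qed

lemma profile_mult: "\<lbrakk>g \<in> carrier G; h \<in> carrier G\<rbrakk> \<Longrightarrow> profile (g \<otimes> h) = profile g \<otimes>\<^bsub>profile_group\<^esub> profile h"
  by (rule near_eqI) (use near_inf_conv[OF near_profile[of g 0] near_profile[of h 0]] near_profile[of "g \<otimes> h"]
    in \<open>force simp: profile_group_def intro: near_mono\<close>)

lemma dense_hom_profile: "dense_hom G profile_group profile_topology profile"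
  unfolding dense_hom_def
proof
  show "profile \<in> hom G profile_group"
    unfolding hom_def by (auto simp: profile_mult) (simp add: profile_group_def profile_in)
  show "profile_topology closure_of (profile ` carrier G) = topspace profile_topology"
    unfolding M.metric_closure_of M.topspace_mtopology
  proof (intro equalityI subsetI)
    fix p assume p: "p \<in> profile_limits"
    have "\<exists>y\<in>profile ` carrier G. y \<in> M.mball p r" if r: "r > 0" for r
    proof -
      obtain g where g: "g \<in> carrier G" "sup_dist p (profile g) < r" by (rule profile_approx[OF p r])
      then show ?thesis using p profile_in[OF g(1)] by (intro bexI[of _ "profile g"]) auto
    qed
    then show "p \<in> {p \<in> profile_limits. \<forall>r>0. \<exists>y\<in>profile ` carrier G. y \<in> M.mball p r}" using p by simp
  qed simp
qed

lemma sup_dist_left: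
  assumes "p \<in> profile_limits" "q \<in> profile_limits" "r \<in> profile_limits"
  shows "sup_dist (r \<otimes>\<^bsub>profile_group\<^esub> p) (r \<otimes>\<^bsub>profile_group\<^esub> q) \<le> sup_dist p q"
  using sup_dist_mult[OF assms(3,1,3,2)] assms by (simp add: profile_group_def)

end

section \<open>Choice of the means and the open set in a compact group\<close>

lemma (in group) mean_indicator:
  assumes "\<mu> \<in> means G" "S \<subseteq> carrier G"
  shows "0 \<le> Re (\<mu> (indicator S))" "Re (\<mu> (indicator S)) \<le> 1"
    and "real_mean G \<mu> (indicator S) = Re (\<mu> (indicator S))"
proof -
  have m: "mean_on (linf G) \<mu>" using assms(1) by (simp add: means_def)
  have c: "creal G (\<lambda>_. c) \<in> linf G" for c by (rule creal_linfI[where C = "\<bar>c\<bar>"]) simp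
  show eq: "real_mean G \<mu> (indicator S) = Re (\<mu> (indicator S))"
    by (simp add: real_mean_def creal_indicator[OF assms(2)])
  have "real_mean G \<mu> (indicator S) \<le> real_mean G \<mu> (\<lambda>_. 1)"
    by (rule real_mean_mono[OF star_space_linf m linf_indicator c]) (simp split: split_indicator)
  then show "Re (\<mu> (indicator S)) \<le> 1" using eq real_mean_const[OF star_space_linf m, of 1] by simp
  have "real_mean G \<mu> (\<lambda>_. 0) \<le> real_mean G \<mu> (indicator S)"
    by (rule real_mean_mono[OF star_space_linf m c linf_indicator]) simp
  then show "0 \<le> Re (\<mu> (indicator S))" using eq real_mean_const[OF star_space_linf m, of 0] by simp
qed

lemma (in group) large_mean:
  assumes "\<C> \<subseteq> means G" "\<C> \<noteq> {}" "c < upper_density \<C> S"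
  obtains \<mu> where "\<mu> \<in> \<C>" "c < Re (\<mu> (indicator S))"
  using less_cSupD[of "(\<lambda>\<mu>. Re (\<mu> (indicator S))) ` \<C>" c] assms(2,3) unfolding upper_density_def by auto

lemma (in group) mean_le_upper_density:
  assumes "\<C> \<subseteq> means G" "\<mu> \<in> \<C>" "S \<subseteq> carrier G"
  shows "Re (\<mu> (indicator S)) \<le> upper_density \<C> S"
  unfolding upper_density_def
  using assms mean_indicator(2)[OF _ assms(3)] by (intro cSUP_upper bdd_aboveI2) auto

text \<open>\<open>V\<close> is the union of the balls of radius \<open>r\<close> about the profiles
  of \<open>Q\<close>. The covering of \<open>G\<close> uses up only \<open>r / 2\<close>, so a
  point of the completion within less than \<open>r / 2\<close> of a profile is covered as
  well.\<close>

lemma (in biinvariant_metric) thick_open_set: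
  assumes Q: "finite Q" "Q \<subseteq> carrier G" and Y: "finite Y" "Y \<subseteq> carrier G" and r: "r > 0"
    and cover: "\<And>w. w \<in> carrier G \<Longrightarrow> \<exists>y\<in>Y. \<exists>p\<in>Q. \<Delta> w (y \<otimes> p) \<le> r / 2"
    and T: "T \<subseteq> carrier G" and C: "\<And>g p. \<lbrakk>g \<in> T; p \<in> Q; \<Delta> g p < r\<rbrakk> \<Longrightarrow> g \<in> C"
  obtains V where "openin profile_topology V" "V \<noteq> {}" "profile -` V \<inter> T \<subseteq> C"
    "\<And>k. k \<in> carrier profile_group \<Longrightarrow> \<exists>y\<in>Y. inv\<^bsub>profile_group\<^esub> (profile y) \<otimes>\<^bsub>profile_group\<^esub> k \<in> V"
proof -
  interpret M: Metric_space profile_limits sup_dist by (rule Metric_space_profile)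
  interpret K: group profile_group by (rule group_profile_group)
  have car: "carrier profile_group = profile_limits" by (simp add: profile_group_def)
  define V where "V = (\<Union>p\<in>Q. M.mball (profile p) r)"
  have op: "openin profile_topology V" unfolding V_def by (intro openin_Union) auto
  have pre: "profile -` V \<inter> T \<subseteq> C"
  proof
    fix g assume g: "g \<in> profile -` V \<inter> T"
    then obtain p where p: "p \<in> Q" "sup_dist (profile p) (profile g) < r" by (auto simp: V_def)
    have G: "g \<in> carrier G" "p \<in> carrier G" using g p(1) T Q(2) by auto
    have "\<Delta> g p < r" using p(2) sup_dist_profile[OF G(2,1)] \<Delta>_commute[OF G] by simp
    then show "g \<in> C" using C p(1) g by blast
  qed
  have cov: "\<exists>y\<in>Y. inv\<^bsub>profile_group\<^esub> (profile y) \<otimes>\<^bsub>profile_group\<^esub> k \<in> V" if k: "k \<in> profile_limits" for k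
  proof -
    have "r / 2 > 0" using r by simp
    from profile_approx[OF k this] obtain w where w: "w \<in> carrier G" "sup_dist k (profile w) < r / 2" .
    obtain y p where yp: "y \<in> Y" "p \<in> Q" "\<Delta> w (y \<otimes> p) \<le> r / 2" using cover[OF w(1)] by blast
    have G: "y \<in> carrier G" "p \<in> carrier G" "y \<otimes> p \<in> carrier G" using yp Y Q by auto
    have P: "profile y \<in> profile_limits" "profile p \<in> profile_limits" "profile w \<in> profile_limits"
      "profile (y \<otimes> p) \<in> profile_limits" using profile_in w G by blast+
    let ?i = "inv\<^bsub>profile_group\<^esub> (profile y)"
    have i: "?i \<in> profile_limits" using K.inv_closed[of "profile y"] P by (simp add: car)
    have "sup_dist k (profile (y \<otimes> p)) \<le> sup_dist k (profile w) + sup_dist (profile w) (profile (y \<otimes> p))"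
      using k P by (intro M.triangle)
    also have "sup_dist (profile w) (profile (y \<otimes> p)) \<le> r / 2" using yp(3) sup_dist_profile[OF w(1) G(3)]
      by simp
    finally have "sup_dist k (profile (y \<otimes> p)) < r" using w(2) by simp
    moreover have "?i \<otimes>\<^bsub>profile_group\<^esub> profile (y \<otimes> p) = profile p"
      using P profile_mult[OF G(1,2)] K.m_assoc[of ?i "profile y" "profile p"] K.l_inv[of "profile y"] i
      by (simp add: car)
    moreover have "sup_dist (?i \<otimes>\<^bsub>profile_group\<^esub> k) (?i \<otimes>\<^bsub>profile_group\<^esub> profile (y \<otimes> p)) \<le> sup_dist k (profile (y \<otimes> p))"
      using k P(4) i by (rule sup_dist_left)
    ultimately have "sup_dist (profile p) (?i \<otimes>\<^bsub>profile_group\<^esub> k) < r"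
      unfolding M.commute[of "profile p"] by simp
    moreover have "?i \<otimes>\<^bsub>profile_group\<^esub> k \<in> profile_limits" using K.m_closed[of ?i k] i k
      by (simp add: car)
    ultimately show ?thesis using P(2) yp(1,2) unfolding V_def by auto
  qed
  have "\<one>\<^bsub>profile_group\<^esub> \<in> profile_limits" using K.one_closed by (simp add: car)
  from cov[OF this] have "V \<noteq> {}" by blast
  then show thesis using that op pre cov by (simp add: car)
qed

lemma (in group) product_open_set:
  assumes cnt: "countable (carrier G)" and A: "A \<subseteq> carrier G" "large (FS G) A"
    and B: "B \<subseteq> carrier G" "strongly_non_paradoxical G B"
  obtains K :: "('a \<Rightarrow> real) monoid" and Z \<tau> V T Y where
    "compact_hausdorff_group K Z" "dense_hom G K Z \<tau>" "openin Z V" "V \<noteq> {}"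
    "right_thick G T" "\<tau> -` V \<inter> T \<subseteq> A <#> B" "finite Y" "Y \<subseteq> carrier G"
    "int (card Y) \<le> \<lfloor>1 / (upper_density (FS G) A * np_density G B)\<rfloor>"
    "\<And>k. k \<in> carrier K \<Longrightarrow> \<exists>y\<in>Y. inv\<^bsub>K\<^esub> (\<tau> y) \<otimes>\<^bsub>K\<^esub> k \<in> V"
proof -
  define \<alpha> where "\<alpha> = upper_density (FS G) A"
  define \<beta> where "\<beta> = np_density G B"
  have FS_means: "FS G \<subseteq> means G" and BM_means: "bebutov_means G B \<subseteq> means G"
    by (auto simp: FS_def bebutov_means_def)
  have \<alpha>: "\<alpha> > 0" using A(2) by (simp add: large_def \<alpha>_def)
  obtain \<eta>\<^sub>0 where \<eta>\<^sub>0: "\<eta>\<^sub>0 \<in> bebutov_means G B" "Re (\<eta>\<^sub>0 (indicator B)) > 0" using bebutov_mean[OF B]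
    by blast
  have \<beta>: "\<beta> > 0"
    using mean_le_upper_density[OF BM_means \<eta>\<^sub>0(1) B(1)] \<eta>\<^sub>0(2) by (simp add: \<beta>_def np_density_def)
  define N where "N = nat \<lfloor>1 / (\<alpha> * \<beta>)\<rfloor>"
  have N: "int N = \<lfloor>1 / (\<alpha> * \<beta>)\<rfloor>" using \<alpha> \<beta> by (simp add: N_def)
  have "1 / (\<alpha> * \<beta>) < real (Suc N)" using N by linarith
  then have N1: "1 < real (Suc N) * (\<alpha> * \<beta>)" using \<alpha> \<beta> by (simp add: divide_less_eq)
  \<comment> \<open>\<open>c < 1\<close> measures the slack in
    \<open>1 / (\<alpha> * \<beta>) < N + 1\<close>. The densities are suprema, so each mean is
    taken within a factor \<open>s\<close> of its density; the midpoint \<open>s\<close> of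
    \<open>c\<close> and \<open>1\<close> satisfies \<open>s * s > c\<close>.\<close>
  define c where "c = 1 / (real (Suc N) * (\<alpha> * \<beta>))"
  have c: "0 < c" "c < 1" using N1 \<alpha> \<beta> by (simp_all add: c_def)
  define s where "s = (1 + c) / 2"
  have s: "0 < s" "s < 1" "c < s * s"
  proof -
    have "0 < (1 - c) * (1 - c)" using c by (intro mult_pos_pos) auto
    then show "c < s * s" by (simp add: s_def field_simps)
  qed (use c in \<open>auto simp: s_def\<close>)
  obtain \<Lambda> where \<Lambda>: "\<Lambda> \<in> FS G" "\<alpha> * s < Re (\<Lambda> (indicator A))"
  proof (rule large_mean[OF FS_means FS_nonempty])
    show "\<alpha> * s < upper_density (FS G) A" using \<alpha> s by (simp flip: \<alpha>_def)
  qed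
  obtain \<eta> where eta: "\<eta> \<in> bebutov_means G B" "\<beta> * s < Re (\<eta> (indicator B))"
  proof (rule large_mean[OF BM_means])
    show "\<beta> * s < upper_density (bebutov_means G B) B" using \<beta> s by (simp flip: \<beta>_def np_density_def)
  qed (use \<eta>\<^sub>0(1) in auto)
  \<comment> \<open>An enumeration by all natural numbers requires \<open>A\<close> to be nonempty;
    for finite \<open>A\<close> it has repetitions, which do no harm.\<close>
  define a where "a = from_nat_into A"
  have "A \<noteq> {}"
  proof
    assume "A = {}"
    have "real_mean G \<Lambda> (indicator A) = real_mean G \<Lambda> (\<lambda>_. 0)"
      by (rule real_mean_cong) (simp add: \<open>A = {}\<close>)
    also have "\<dots> = 0" using real_mean_const[OF star_space_linf, of G \<Lambda> 0] \<Lambda>(1) FS_means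
      by (auto simp: means_def)
    finally have "real_mean G \<Lambda> (indicator A) = 0" .
    moreover have "real_mean G \<Lambda> (indicator A) = Re (\<Lambda> (indicator A))"
      using mean_indicator(3)[OF _ A(1)] \<Lambda>(1) FS_means by auto
    ultimately show False using \<Lambda>(2) mult_pos_pos[OF \<alpha> s(1)] by linarith
  qed
  then have a: "A = range a" unfolding a_def using countable_subset[OF A(1) cnt]
    by (simp add: range_from_nat_into)
  interpret product_setup G \<Lambda> A B \<eta> a by unfold_locales (use a A B \<Lambda> eta in auto)
  have L: "L (indicator A) = Re (\<Lambda> (indicator A))" using mean_indicator(3)[OF _ A(1)] \<Lambda>(1) FS_means
    by auto
  have E: "E (indicator B) = Re (\<eta> (indicator B))" using mean_indicator(3)[OF _ B(1)] eta(1) BM_means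
    by auto
  have pos: "0 < L (indicator A)" "0 < E (indicator B)"
    using mult_pos_pos[OF \<alpha> s(1)] mult_pos_pos[OF \<beta> s(1)] \<Lambda>(2) eta(2) unfolding L E by auto
  have big: "1 < real (Suc N) * (L (indicator A) * E (indicator B))"
  proof -
    have "1 = real (Suc N) * (\<alpha> * \<beta>) * c" using \<alpha> \<beta> by (simp add: c_def)
    also have "\<dots> \<le> real (Suc N) * (\<alpha> * \<beta>) * (s * s)" using \<alpha> \<beta> s(3) by (intro mult_left_mono) auto
    also have "\<dots> = real (Suc N) * ((\<alpha> * s) * (\<beta> * s))" by (simp add: ac_simps)
    also have "\<dots> < real (Suc N) * (L (indicator A) * E (indicator B))"
      unfolding L E using \<Lambda>(2) eta(2) \<alpha> \<beta> s(1) pos[unfolded L E] by (intro mult_strict_left_mono mult_strict_mono) auto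
    finally show ?thesis .
  qed
  obtain \<Delta> \<sigma> where met: "biinvariant_metric G \<Delta>" "\<sigma> > 0"
    and stages: "\<And>F. \<lbrakk>finite F; F \<subseteq> carrier G\<rbrakk> \<Longrightarrow> \<exists>h Y P. h \<in> carrier G \<and> finite Y \<and> Y \<subseteq> carrier G \<and> card Y \<le> N \<and>
       P \<subseteq> carrier G \<and> (\<forall>w\<in>carrier G. \<exists>y\<in>Y. \<exists>p\<in>P. w = y \<otimes> p) \<and>
       (\<forall>g\<in>F. \<forall>p\<in>P. \<Delta> g p < \<sigma> \<longrightarrow> g \<otimes> h \<in> A <#> B)"
    by (rule product_stages[OF big pos], rule that)
  interpret bm: biinvariant_metric G \<Delta> by (rule met(1))
  obtain Q Y T r where Q: "finite Q" "Q \<subseteq> carrier G" "finite Y" "Y \<subseteq> carrier G" "card Y \<le> N" "r > 0"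
    "right_thick G T" "\<And>w. w \<in> carrier G \<Longrightarrow> \<exists>y\<in>Y. \<exists>p\<in>Q. \<Delta> w (y \<otimes> p) \<le> r / 2"
    "\<And>g p. \<lbrakk>g \<in> T; p \<in> Q; \<Delta> g p < r\<rbrakk> \<Longrightarrow> g \<in> A <#> B"
    by (rule bm.stages_thick[OF cnt met(2) stages], assumption+, rule that)
  have T: "T \<subseteq> carrier G" using Q(7) by (simp add: right_thick_def)
  obtain V where V: "openin bm.profile_topology V" "V \<noteq> {}" "bm.profile -` V \<inter> T \<subseteq> A <#> B"
    "\<And>k. k \<in> carrier bm.profile_group \<Longrightarrow> \<exists>y\<in>Y. inv\<^bsub>bm.profile_group\<^esub> (bm.profile y) \<otimes>\<^bsub>bm.profile_group\<^esub> k \<in> V"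
    by (rule bm.thick_open_set[OF Q(1-4,6,8) T Q(9)], assumption+, rule that)
  show thesis
    by (rule that[OF bm.compact_hausdorff_profile_group bm.dense_hom_profile V(1,2) Q(7) V(3) Q(3,4) _ V(4)])
      (use Q(5) N in \<open>simp_all add: \<alpha>_def \<beta>_def\<close>)
qed

section \<open>Transfer to the Bohr compactification\<close>

lemma right_thick_mono: "\<lbrakk>right_thick G T; T \<subseteq> S; S \<subseteq> carrier G\<rbrakk> \<Longrightarrow> right_thick G S"
  unfolding right_thick_def by (meson subset_trans)

text \<open>The covering of \<open>K\<close> pulls back along the homomorphism with the same
  translating elements, which bounds the syndeticity index of the preimage. Surjectivity makes the
  preimage nonempty.\<close>

lemma syndetic_preimage:
  assumes bG: "group bG" "topspace X = carrier bG" and K: "group K" "topspace Z = carrier K"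
    and \<kappa>: "\<kappa> \<in> hom bG K" "continuous_map X Z \<kappa>" "\<kappa> ` carrier bG = carrier K"
    and V: "openin Z V" "V \<noteq> {}" and Y: "finite Y" "Y \<subseteq> carrier bG"
    and cover: "\<And>k. k \<in> carrier K \<Longrightarrow> \<exists>y\<in>Y. inv\<^bsub>K\<^esub> (\<kappa> y) \<otimes>\<^bsub>K\<^esub> k \<in> V"
  shows "openin X {z \<in> carrier bG. \<kappa> z \<in> V}" "{z \<in> carrier bG. \<kappa> z \<in> V} \<noteq> {}"
    "syndeticity_index bG {z \<in> carrier bG. \<kappa> z \<in> V} \<le> card Y"
proof -
  let ?U = "{z \<in> carrier bG. \<kappa> z \<in> V}"
  interpret bG: group bG by (rule bG)
  interpret h: group_hom bG K \<kappa> by (intro group_hom.intro group_hom_axioms.intro bG(1) K(1) \<kappa>(1))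
  show "openin X ?U" using openin_continuous_map_preimage[OF \<kappa>(2) V(1)] by (simp add: bG(2))
  obtain v where "v \<in> V" using V(2) by blast
  moreover from this have "v \<in> \<kappa> ` carrier bG" using openin_subset[OF V(1)] unfolding K(2) \<kappa>(3)
    by (rule subsetD[rotated])
  ultimately show "?U \<noteq> {}" by (auto elim!: imageE)
  have "Y <#>\<^bsub>bG\<^esub> ?U = carrier bG"
  proof
    show "Y <#>\<^bsub>bG\<^esub> ?U \<subseteq> carrier bG" using Y(2) by (intro bG.set_mult_closed) auto
    show "carrier bG \<subseteq> Y <#>\<^bsub>bG\<^esub> ?U"
    proof
      fix z assume z: "z \<in> carrier bG"
      then obtain y where y: "y \<in> Y" "inv\<^bsub>K\<^esub> (\<kappa> y) \<otimes>\<^bsub>K\<^esub> \<kappa> z \<in> V" using cover[of "\<kappa> z"] by auto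
      have yG: "y \<in> carrier bG" using y Y by auto
      have "inv\<^bsub>bG\<^esub> y \<otimes>\<^bsub>bG\<^esub> z \<in> ?U" using y(2) yG z by simp
      moreover have "z = y \<otimes>\<^bsub>bG\<^esub> (inv\<^bsub>bG\<^esub> y \<otimes>\<^bsub>bG\<^esub> z)" using yG z by (simp flip: bG.m_assoc)
      ultimately show "z \<in> Y <#>\<^bsub>bG\<^esub> ?U" unfolding set_mult_def using y(1) by blast
    qed
  qed
  then show "syndeticity_index bG ?U \<le> card Y"
    unfolding syndeticity_index_def using Y by (intro Least_le exI[of _ Y]) auto
qed

theorem theorem1p3:
  fixes G :: "('a, 'm) monoid_scheme"
  assumes "group G" and "countable (carrier G)"
  shows "(\<forall>(bG :: ('b, 'n) monoid_scheme) X \<iota>\<^sub>o A B.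
            bohr_compactification G bG X \<iota>\<^sub>o \<and>
            A \<subseteq> carrier G \<and> large (FS G) A \<and>
            B \<subseteq> carrier G \<and> strongly_non_paradoxical G B \<longrightarrow>
            (\<exists>U T. openin X U \<and> U \<noteq> {} \<and>
               int (syndeticity_index bG U) \<le> \<lfloor>1 / (upper_density (FS G) A * np_density G B)\<rfloor> \<and>
               right_thick G T \<and>
               \<iota>\<^sub>o -` U \<inter> carrier G \<inter> T \<subseteq> A <#>\<^bsub>G\<^esub> B)) \<and>
         (amenable G \<longrightarrow>
            (\<forall>A B. A \<subseteq> carrier G \<and> large (FS G) A \<and>
               B \<subseteq> carrier G \<and> large (left_invariant_means G) B \<longrightarrow>
               right_piecewise_bohr G (A <#>\<^bsub>G\<^esub> B)))"
proof (intro conjI allI impI; elim conjE)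
  interpret group G by (rule assms(1))
  fix bG :: "('b, 'n) monoid_scheme" and X \<iota>\<^sub>o A B
  assume bohr: "bohr_compactification G bG X \<iota>\<^sub>o"
    and A: "A \<subseteq> carrier G" "large (FS G) A" and B: "B \<subseteq> carrier G" "strongly_non_paradoxical G B"
  obtain K :: "('a \<Rightarrow> real) monoid" and Z \<tau> V T Y where K:
    "compact_hausdorff_group K Z" "dense_hom G K Z \<tau>" "openin Z V" "V \<noteq> {}"
    "right_thick G T" "\<tau> -` V \<inter> T \<subseteq> A <#>\<^bsub>G\<^esub> B" "finite Y" "Y \<subseteq> carrier G"
    "int (card Y) \<le> \<lfloor>1 / (upper_density (FS G) A * np_density G B)\<rfloor>"
    "\<And>k. k \<in> carrier K \<Longrightarrow> \<exists>y\<in>Y. inv\<^bsub>K\<^esub> (\<tau> y) \<otimes>\<^bsub>K\<^esub> k \<in> V"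
    by (rule product_open_set[OF assms(2) A B], rule that)
  obtain \<kappa> where \<kappa>: "\<kappa> \<in> hom bG K" "continuous_map X Z \<kappa>" "\<kappa> ` carrier bG = carrier K"
    "\<And>g. g \<in> carrier G \<Longrightarrow> \<kappa> (\<iota>\<^sub>o g) = \<tau> g"
    using bohr_compactification_universal[OF bohr K(1,2)] by blast
  have gr: "group bG" "topspace X = carrier bG" "group K" "topspace Z = carrier K"
    using bohr K(1) by (auto simp: bohr_compactification_def compact_hausdorff_group_def)
  have \<iota>: "\<iota>\<^sub>o g \<in> carrier bG" if "g \<in> carrier G" for g
    using bohr that by (auto simp: bohr_compactification_def dense_hom_def hom_def)
  have "\<exists>y\<in>\<iota>\<^sub>o ` Y. inv\<^bsub>K\<^esub> (\<kappa> y) \<otimes>\<^bsub>K\<^esub> k \<in> V" if k: "k \<in> carrier K" for k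
  proof -
    obtain y where y: "y \<in> Y" "inv\<^bsub>K\<^esub> (\<tau> y) \<otimes>\<^bsub>K\<^esub> k \<in> V" using K(10)[OF k] by blast
    then show ?thesis using \<kappa>(4)[of y] K(8) by (intro bexI[of _ "\<iota>\<^sub>o y"]) auto
  qed
  \<comment> \<open>The translating elements lie in \<open>G\<close>, so their images under
    \<open>\<iota>\<^sub>o\<close> do the same in \<open>bG\<close>, and there are at most as many
    of them.\<close>
  from syndetic_preimage[OF gr \<kappa>(1-3) K(3,4) _ _ this]
  have U: "openin X {z \<in> carrier bG. \<kappa> z \<in> V}" "{z \<in> carrier bG. \<kappa> z \<in> V} \<noteq> {}"
    "syndeticity_index bG {z \<in> carrier bG. \<kappa> z \<in> V} \<le> card (\<iota>\<^sub>o ` Y)"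
    using K(7,8) \<iota> by blast+
  have "int (syndeticity_index bG {z \<in> carrier bG. \<kappa> z \<in> V}) \<le> \<lfloor>1 / (upper_density (FS G) A * np_density G B)\<rfloor>"
    using U(3) card_image_le[OF K(7), of \<iota>\<^sub>o] K(9) by linarith
  moreover have "\<iota>\<^sub>o -` {z \<in> carrier bG. \<kappa> z \<in> V} \<inter> carrier G \<inter> T \<subseteq> A <#>\<^bsub>G\<^esub> B" using \<kappa>(4) K(6) by auto
  ultimately show "\<exists>U T. openin X U \<and> U \<noteq> {} \<and>
      int (syndeticity_index bG U) \<le> \<lfloor>1 / (upper_density (FS G) A * np_density G B)\<rfloor> \<and>
      right_thick G T \<and> \<iota>\<^sub>o -` U \<inter> carrier G \<inter> T \<subseteq> A <#>\<^bsub>G\<^esub> B"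
    using U(1,2) K(5) by blast
next
  interpret group G by (rule assms(1))
  fix A B
  assume am: "amenable G" and A: "A \<subseteq> carrier G" "large (FS G) A"
    and B: "B \<subseteq> carrier G" "large (left_invariant_means G) B"
  have "left_invariant_means G \<subseteq> means G" by (auto simp: left_invariant_means_def)
  from large_mean[OF this] obtain \<mu> where "\<mu> \<in> left_invariant_means G" "0 < Re (\<mu> (indicator B))"
    using am B(2) unfolding amenable_def large_def by blast
  then have snp: "strongly_non_paradoxical G B" by (rule strongly_non_paradoxicalI[OF B(1)])
  obtain K :: "('a \<Rightarrow> real) monoid" and Z \<tau> V T Y where K:
    "compact_hausdorff_group K Z" "dense_hom G K Z \<tau>" "openin Z V" "V \<noteq> {}"
    "right_thick G T" "\<tau> -` V \<inter> T \<subseteq> A <#>\<^bsub>G\<^esub> B" "finite Y" "Y \<subseteq> carrier G"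
    "int (card Y) \<le> \<lfloor>1 / (upper_density (FS G) A * np_density G B)\<rfloor>"
    "\<And>k. k \<in> carrier K \<Longrightarrow> \<exists>y\<in>Y. inv\<^bsub>K\<^esub> (\<tau> y) \<otimes>\<^bsub>K\<^esub> k \<in> V"
    by (rule product_open_set[OF assms(2) A B(1) snp], rule that)
  have AB: "A <#>\<^bsub>G\<^esub> B \<subseteq> carrier G" using A(1) B(1) by (rule set_mult_closed)
  \<comment> \<open>The definition asks for an exact intersection, not for a superset. Bohr sets and
    thick sets may be enlarged, and adding \<open>A B\<close> to both turns the intersection into
    \<open>A B\<close> itself.\<close>
  let ?W = "\<tau> -` V \<inter> carrier G"
  have "bohr_set G ((A <#>\<^bsub>G\<^esub> B) \<union> ?W)" by (rule bohr_setI[OF K(1-4)]) (use AB in auto)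
  moreover have "right_thick G ((A <#>\<^bsub>G\<^esub> B) \<union> T)"
    by (rule right_thick_mono[OF K(5)]) (use K(5) AB in \<open>auto simp: right_thick_def\<close>)
  moreover have "A <#>\<^bsub>G\<^esub> B = ((A <#>\<^bsub>G\<^esub> B) \<union> ?W) \<inter> ((A <#>\<^bsub>G\<^esub> B) \<union> T)" using K(6) by blast
  ultimately show "right_piecewise_bohr G (A <#>\<^bsub>G\<^esub> B)"
    unfolding right_piecewise_bohr_def by (intro exI conjI)
qed

end
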